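(* Let $d\ge 1$, $m\ge 0$, and let $\alpha_0,\alpha_1,\dots,\alpha_d\in\mathbb{C}^{n\times n}$ be Dirac matrices. Let $1\le p,q\le\infty$ and $r,s\in\mathbb{R}$, and let $X$ denote any of the spaces $M^{p,q}_{r,s}(\mathbb{R}^d,\mathbb{C}^n)$ or $W^{p,q}_{r,s}(\mathbb{R}^d,\mathbb{C}^n)$. For every $t\in\mathbb{R}$ there exists a constant $C_X(t)>0$ such that for every $\psi_0\in X$ the solution $\psi$ of the free Dirac equation $$i\partial_t\psi(t,x)=\mathcal{D}_m\psi(t,x),\qquad \psi(0,x)=\psi_0(x),\qquad (t,x)\in\mathbb{R}\times\mathbb{R}^d,$$ satisfies $$\|\psi(t,\cdot)\|_X\le C_X(t)\,\|\psi_0\|_X .$$ In particular, if $X=M^{p,q}_{0,s}(\mathbb{R}^d,\mathbb{C}^n)$, there exists a constant $C'>0$, independent of $t$, such that the estimate $\|\psi(t,\cdot)\|_X\le C_X(t)\,\|\psi_0\|_X$ holds with $$C_X(t)\le C'(1+|t|)^{d|1/2-1/p|}\qquad\text{for all } t\in\mathbb{R}.$$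
   Context: Dirac matrices: $n\times n$ Hermitian matrices with $\alpha_i\alpha_j+\alpha_j\alpha_i=2\delta_{ij}I_n$ for all $0\le i,j\le d$. The Dirac operator is $\mathcal{D}_m=2\pi m\,\alpha_0-i\sum_{j=1}^d\alpha_j\partial_j$, acting on $\mathbb{C}^n$-valued (generalized) functions on $\mathbb{R}^d$. Fourier transform: $\hat f(\xi)=\mathcal{F}f(\xi)=\int_{\mathbb{R}^d}e^{-2\pi i x\cdot\xi}f(x)\,dx$. The solution of the free equation is $\psi(t,\cdot)=e^{-it\mathcal{D}_m}\psi_0$, where $e^{-it\mathcal{D}_m}$ is the Fourier multiplier $f\mapsto\mathcal{F}^{-1}(\mu_t\hat f)$ with matrix symbol $\mu_t(\xi)=\exp[-2\pi i t(m\alpha_0+\sum_{j=1}^d\xi_j\alpha_j)]$. For a complex Banach space $E$ with norm $|\cdot|_E$, $\mathcal{S}'(\mathbb{R}^d,E)$ denotes the $E$-valued temperate distributions, i.e. continuous conjugate-linear maps $\mathcal{S}(\mathbb{R}^d)\to E$; functions act by $\langle f,g\rangle=\int f\,\overline g$. For $g\in\mathcal{S}(\mathbb{R}^d)\setminus\{0\}$ the short-time Fourier transform is $V_gf(x,\xi)=\langle f,M_\xi T_xg\rangle$, where $M_\xi g(y)=e^{2\pi i y\cdot\xi}g(y)$, $T_xg(y)=g(y-x)$; formally $V_gf(x,\xi)=\int e^{-2\pi i y\cdot\xi}f(y)\overline{g(y-x)}\,dy$. Write $\langle x\rangle=(1+|x|^2)^{1/2}$. For $1\le p,q\le\infty$,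 $r,s\in\mathbb{R}$: - $M^{p,q}_{r,s}(\mathbb{R}^d,E)$ is the space of $f\in\mathcal{S}'(\mathbb{R}^d,E)$ with $\|f\|_{M^{p,q}_{r,s}}=\big(\int(\int|V_gf(x,\xi)|_E^p\langle x\rangle^{rp}dx)^{q/p}\langle\xi\rangle^{sq}d\xi\big)^{1/q}<\infty$; - $W^{p,q}_{r,s}(\mathbb{R}^d,E)$ is the space of $f\in\mathcal{S}'(\mathbb{R}^d,E)$ with $\|f\|_{W^{p,q}_{r,s}}=\big(\int(\int|V_gf(x,\xi)|_E^p\langle \xi\rangle^{rp}d\xi)^{q/p}\langle x\rangle^{sq}dx\big)^{1/q}<\infty$; with the usual modifications when $p=\infty$ or $q=\infty$. Different windows $g$ give equivalent norms. *)

theory Defs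
  imports "HOL-Analysis.Analysis" "HOL-Probability.Essential_Supremum"
begin

section \<open>Schwartz functions and their topology\<close>

definition partial_deriv :: "'d \<Rightarrow> (real ^ 'd \<Rightarrow> complex) \<Rightarrow> real ^ 'd::finite \<Rightarrow> complex" where
  "partial_deriv j f = (\<lambda>x. frechet_derivative f (at x) (axis j 1))"

primrec partial_derivs :: "'d list \<Rightarrow> (real ^ 'd \<Rightarrow> complex) \<Rightarrow> real ^ 'd::finite \<Rightarrow> complex" where
  "partial_derivs [] f = f"
| "partial_derivs (j # js) f = partial_deriv j (partial_derivs js f)"

definition monomial :: "('d \<Rightarrow> nat) \<Rightarrow> real ^ 'd::finite \<Rightarrow> real" where
  "monomial a x = (\<Prod>j\<in>UNIV. (x $ j) ^ a j)"

text \<open>Smoothness is total differentiability of all iterated partial derivatives.  Derivative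
  multi-indices are given as lists of directions; the order is irrelevant for smooth functions.\<close>

definition schwartz :: "(real ^ 'd::finite \<Rightarrow> complex) set" where
  "schwartz = {\<phi>. (\<forall>js x. partial_derivs js \<phi> differentiable (at x)) \<and>
     (\<forall>a js. bounded (range (\<lambda>x. monomial a x *\<^sub>R partial_derivs js \<phi> x)))}"

definition schwartz_seminorm ::
    "('d \<Rightarrow> nat) \<Rightarrow> 'd list \<Rightarrow> (real ^ 'd::finite \<Rightarrow> complex) \<Rightarrow> real" where
  "schwartz_seminorm a js \<phi> = (SUP x. norm (monomial a x *\<^sub>R partial_derivs js \<phi> x))"

definition schwartz_topology :: "(real ^ 'd::finite \<Rightarrow> complex) topology" where
  "schwartz_topology = topology_generated_by
     {{\<psi> \<in> schwartz. schwartz_seminorm a js (\<lambda>x. \<psi> x - \<phi> x) < e} | a js \<phi> e.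
        \<phi> \<in> schwartz \<and> 0 < e}"

lemma topspace_schwartz_topology: "topspace schwartz_topology = schwartz"
proof (intro equalityI subsetI)
  fix \<phi> :: "real ^ 'd \<Rightarrow> complex"
  assume \<phi>: "\<phi> \<in> schwartz"
  let ?B = "{\<psi> \<in> schwartz. schwartz_seminorm (\<lambda>_. 0) [] (\<lambda>x. \<psi> x - \<phi> x) < 1}"
  have "\<phi> \<in> ?B"
    using \<phi> by (simp add: schwartz_seminorm_def)
  moreover have "?B \<in> {{\<psi> \<in> schwartz. schwartz_seminorm a js (\<lambda>x. \<psi> x - \<phi> x) < e} | a js \<phi> e.
        \<phi> \<in> schwartz \<and> 0 < e}"
    using \<phi> zero_less_one[where 'a = real] by blast
  ultimately show "\<phi> \<in> topspace schwartz_topology"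
    unfolding schwartz_topology_def topology_generated_by_topspace by (rule UnionI[rotated])
next
  fix \<phi> :: "real ^ 'd \<Rightarrow> complex"
  assume "\<phi> \<in> topspace schwartz_topology"
  then show "\<phi> \<in> schwartz"
    unfolding schwartz_topology_def topology_generated_by_topspace by blast
qed

section \<open>Temperate distributions with values in \<open>\<complex>\<^sup>n\<close>\<close>

text \<open>A distribution is represented by a function on all \<open>\<phi> :: real ^ 'd \<Rightarrow> complex\<close>; only its
  values on \<open>schwartz\<close> are meaningful.  The pairing is conjugate-linear, a function \<open>f\<close>
  acting by \<open>\<langle>f, \<phi>\<rangle> = \<integral> f \<cdot> cnj \<phi>\<close>.\<close>

type_synonym ('d, 'n) vdist = "(real ^ 'd \<Rightarrow> complex) \<Rightarrow> complex ^ 'n"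

definition temperate :: "('d::finite, 'n::finite) vdist set" where
  "temperate = {u. continuous_map schwartz_topology euclidean u \<and>
     (\<forall>\<phi>\<in>schwartz. \<forall>\<psi>\<in>schwartz. u (\<lambda>x. \<phi> x + \<psi> x) = u \<phi> + u \<psi>) \<and>
     (\<forall>c. \<forall>\<phi>\<in>schwartz. u (\<lambda>x. c * \<phi> x) = cnj c *s u \<phi>)}"

section \<open>Fourier transform and Fourier multipliers\<close>

definition fourier :: "(real ^ 'd::finite \<Rightarrow> complex) \<Rightarrow> real ^ 'd \<Rightarrow> complex" where
  "fourier \<phi> \<xi> = (LINT x|lborel. cis (- 2 * pi * (x \<bullet> \<xi>)) * \<phi> x)"

definition inv_fourier :: "(real ^ 'd::finite \<Rightarrow> complex) \<Rightarrow> real ^ 'd \<Rightarrow> complex" where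
  "inv_fourier \<phi> x = (LINT \<xi>|lborel. cis (2 * pi * (x \<bullet> \<xi>)) * \<phi> \<xi>)"

text \<open>Since the pairing is conjugate-linear, operations on distributions are the transposes, with
  respect to \<open>\<integral> f \<cdot> cnj \<phi>\<close>, of operations on test functions: for functions \<open>f\<close>,
  \<open>\<langle>\<F> f, \<phi>\<rangle> = \<langle>f, \<F>\<^sup>-\<^sup>1 \<phi>\<rangle>\<close>, and \<open>\<langle>(\<mu> f)\<^sub>k, \<phi>\<rangle> = \<Sum>\<^sub>l \<langle>f\<^sub>l, cnj \<mu>\<^sub>k\<^sub>l \<cdot> \<phi>\<rangle>\<close>.\<close>

definition dist_fourier :: "('d::finite, 'n) vdist \<Rightarrow> ('d, 'n) vdist" where
  "dist_fourier u = (\<lambda>\<phi>. u (inv_fourier \<phi>))"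

definition dist_inv_fourier :: "('d::finite, 'n) vdist \<Rightarrow> ('d, 'n) vdist" where
  "dist_inv_fourier u = (\<lambda>\<phi>. u (fourier \<phi>))"

definition dist_mult ::
    "(real ^ 'd \<Rightarrow> complex ^ 'n ^ 'n) \<Rightarrow> ('d::finite, 'n::finite) vdist \<Rightarrow> ('d, 'n) vdist" where
  "dist_mult \<mu> u = (\<lambda>\<phi>. \<chi> k. \<Sum>l\<in>UNIV. u (\<lambda>\<xi>. cnj (\<mu> \<xi> $ k $ l) * \<phi> \<xi>) $ l)"

definition fourier_multiplier ::
    "(real ^ 'd \<Rightarrow> complex ^ 'n ^ 'n) \<Rightarrow> ('d::finite, 'n::finite) vdist \<Rightarrow> ('d, 'n) vdist" where
  "fourier_multiplier \<mu> u = dist_inv_fourier (dist_mult \<mu> (dist_fourier u))"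

section \<open>The free Dirac evolution\<close>

definition hermitian :: "complex ^ 'n ^ 'n \<Rightarrow> bool" where
  "hermitian A \<longleftrightarrow> (\<forall>i j. A $ j $ i = cnj (A $ i $ j))"

text \<open>Matrix \<open>0\<close> is indexed by \<open>None\<close>, matrix \<open>j\<close> (for a coordinate \<open>j :: 'd\<close>) by \<open>Some j\<close>.
  Note that \<open>mat c\<close> is \<open>c\<close> times the identity.\<close>

definition dirac_matrices :: "('d option \<Rightarrow> complex ^ 'n ^ 'n::finite) \<Rightarrow> bool" where
  "dirac_matrices \<alpha> \<longleftrightarrow> (\<forall>i. hermitian (\<alpha> i)) \<and>
     (\<forall>i j. \<alpha> i ** \<alpha> j + \<alpha> j ** \<alpha> i = mat (if i = j then 2 else 0))"

text \<open>The library's multiplication and power on \<open>complex ^ 'n ^ 'n\<close> are componentwise, so powers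
  are formed here with the matrix product.\<close>

definition mat_exp :: "complex ^ 'n ^ 'n \<Rightarrow> complex ^ 'n ^ 'n::finite" where
  "mat_exp A = (\<Sum>k. (1 / fact k) *\<^sub>R (((**) A ^^ k) (mat 1)))"

definition dirac_symbol ::
    "('d::finite option \<Rightarrow> complex ^ 'n ^ 'n::finite) \<Rightarrow> real \<Rightarrow> real \<Rightarrow> real ^ 'd \<Rightarrow> complex ^ 'n ^ 'n" where
  "dirac_symbol \<alpha> m t \<xi> = mat_exp (mat (- 2 * pi * \<i> * t) **
     (m *\<^sub>R \<alpha> None + (\<Sum>j\<in>UNIV. (\<xi> $ j) *\<^sub>R \<alpha> (Some j))))"

text \<open>The value at time \<open>t\<close> of the solution of \<open>\<i> \<partial>\<^sub>t \<psi> = \<D>\<^sub>m \<psi>\<close>, \<open>\<psi>(0) = \<psi>\<^sub>0\<close>, where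
  \<open>\<D>\<^sub>m = 2\<pi>m \<alpha>\<^sub>0 - \<i> \<Sum>\<^sub>j \<alpha>\<^sub>j \<partial>\<^sub>j\<close>; that is, \<open>exp (-\<i> t \<D>\<^sub>m) \<psi>\<^sub>0\<close>, \<open>\<D>\<^sub>m\<close> having Fourier symbol
  \<open>2\<pi> (m \<alpha>\<^sub>0 + \<Sum>\<^sub>j \<xi>\<^sub>j \<alpha>\<^sub>j)\<close>.\<close>

definition dirac_solution ::
    "('d::finite option \<Rightarrow> complex ^ 'n ^ 'n::finite) \<Rightarrow> real \<Rightarrow> ('d, 'n) vdist \<Rightarrow> real \<Rightarrow> ('d, 'n) vdist" where
  "dirac_solution \<alpha> m \<psi>0 t = fourier_multiplier (dirac_symbol \<alpha> m t) \<psi>0"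

section \<open>Modulation and Wiener amalgam spaces\<close>

definition time_freq_shift ::
    "real ^ 'd \<Rightarrow> real ^ 'd \<Rightarrow> (real ^ 'd::finite \<Rightarrow> complex) \<Rightarrow> real ^ 'd \<Rightarrow> complex" where
  "time_freq_shift x \<xi> g = (\<lambda>y. cis (2 * pi * (y \<bullet> \<xi>)) * g (y - x))"

definition stft ::
    "(real ^ 'd \<Rightarrow> complex) \<Rightarrow> ('d::finite, 'n) vdist \<Rightarrow> real ^ 'd \<Rightarrow> real ^ 'd \<Rightarrow> complex ^ 'n" where
  "stft g u x \<xi> = u (time_freq_shift x \<xi> g)"

definition japanese_bracket :: "'a::real_normed_vector \<Rightarrow> real" where
  "japanese_bracket x = sqrt (1 + (norm x)\<^sup>2)"

text \<open>Powers of extended nonnegative reals, intended for exponents \<open>a > 0\<close>.\<close>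

definition ennreal_powr :: "ennreal \<Rightarrow> real \<Rightarrow> ennreal" where
  "ennreal_powr y a = (if y = \<infinity> then \<infinity> else ennreal (enn2real y powr a))"

definition lp_norm :: "ennreal \<Rightarrow> ('a::euclidean_space \<Rightarrow> ennreal) \<Rightarrow> ennreal" where
  "lp_norm p F =
     (if p = \<infinity> then esssup lborel F
      else ennreal_powr (\<integral>\<^sup>+ x. ennreal_powr (F x) (enn2real p) \<partial>lborel) (1 / enn2real p))"

definition modulation_norm ::
    "(real ^ 'd \<Rightarrow> complex) \<Rightarrow> ennreal \<Rightarrow> ennreal \<Rightarrow> real \<Rightarrow> real \<Rightarrow> ('d::finite, 'n::finite) vdist \<Rightarrow> ennreal" where
  "modulation_norm g p q r s u =
     lp_norm q (\<lambda>\<xi>. lp_norm p (\<lambda>x. ennreal (norm (stft g u x \<xi>) * japanese_bracket x powr r))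
                   * ennreal (japanese_bracket \<xi> powr s))"

definition modulation_space ::
    "(real ^ 'd \<Rightarrow> complex) \<Rightarrow> ennreal \<Rightarrow> ennreal \<Rightarrow> real \<Rightarrow> real \<Rightarrow> ('d::finite, 'n::finite) vdist set" where
  "modulation_space g p q r s = {u \<in> temperate. modulation_norm g p q r s u < \<infinity>}"

definition amalgam_norm ::
    "(real ^ 'd \<Rightarrow> complex) \<Rightarrow> ennreal \<Rightarrow> ennreal \<Rightarrow> real \<Rightarrow> real \<Rightarrow> ('d::finite, 'n::finite) vdist \<Rightarrow> ennreal" where
  "amalgam_norm g p q r s u =
     lp_norm q (\<lambda>x. lp_norm p (\<lambda>\<xi>. ennreal (norm (stft g u x \<xi>) * japanese_bracket \<xi> powr r))
                   * ennreal (japanese_bracket x powr s))"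

definition amalgam_space ::
    "(real ^ 'd \<Rightarrow> complex) \<Rightarrow> ennreal \<Rightarrow> ennreal \<Rightarrow> real \<Rightarrow> real \<Rightarrow> ('d::finite, 'n::finite) vdist set" where
  "amalgam_space g p q r s = {u \<in> temperate. amalgam_norm g p q r s u < \<infinity>}"

end

theory Submission
 imports Defs "HOL-Probability.Sinc_Integral"
begin

text \<open>Expanding a test function in the Gabor frame of \<open>g\<close> turns the multiplier into an operator on
 short-time Fourier transforms. For each frequency shift \<open>\<eta>\<close> it acts as a convolution in \<open>x\<close> whose symbol is
 the multiplier times \<open>\<F>g(\<zeta>) cnj (\<F>g(\<zeta> - \<eta>))\<close>, so everything decays rapidly in \<open>\<eta>\<close>.
 The Dirac symbol is smooth with bounded derivatives because \<open>(m\<alpha>\<^sub>0 + \<Sum>\<^sub>j \<xi>\<^sub>j\<alpha>\<^sub>j)\<^sup>2 = m\<^sup>2 + |\<xi>|\<^sup>2\<close> makes it a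
 combination of \<open>cos (2\<pi>t\<surd>(m\<^sup>2 + |\<xi>|\<^sup>2))\<close> and the corresponding sine quotient; hence the
 kernel also decays rapidly in \<open>x\<close>, and Minkowski's integral inequality gives the weighted estimates. For \<open>r = 0\<close>
 the convolutions have \<open>L\<^sup>1\<close> kernels of norm \<open>O((1 + |t|)\<^bsup>d/2\<^esup>)\<close> by Cauchy--Schwarz and Plancherel and
 bounded symbols; interpolating between \<open>L\<^sup>1\<close>, \<open>L\<^sup>2\<close> and \<open>L\<^sup>\<infinity>\<close> gives the exponent
 \<open>d |1/2 - 1/p|\<close>.\<close>

text \<open>Two kinds of estimate run through the same frame and differ in where absolute values are
  taken. With weights they go inside both integrals; this ignores the oscillation of the kernel and
  gives constants without control in \<open>t\<close>. For \<open>r = 0\<close> they are taken only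
  after the integral in \<open>y\<close>, so that each \<open>\<eta>\<close> keeps a genuine
  convolution operator whose \<open>L^2\<close> norm is governed by the size of its symbol. That
  norm does not grow in \<open>t\<close>, which is what interpolation exploits. The frequency
  \<open>\<xi>\<close> merely translates the multiplier, so all bounds are uniform in it.

  The constant of Fourier inversion is never evaluated: the nonzero window yields inversion up to a
  nonzero factor and Plancherel as an inequality, and both constants are divided out or absorbed.
  Interpolation is by level sets, with truncation heights proportional to the level and tuned to the
  \<open>L^1\<close> bound; this reproduces the exponent of complex interpolation up to a constant
  depending on \<open>p\<close>. Distributions enter through their scalar components, each bounded
  by one norm on Schwartz space.\<close>

type_synonym 'd cfun = "real ^ 'd \<Rightarrow> complex"

abbreviation borel_functions ("\<B>") where
 "\<B> \<equiv> borel_measurable borel"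

abbreviation nn_integral_lborel :: "('a::euclidean_space \<Rightarrow> ennreal) \<Rightarrow> ennreal" (binder "\<integral>\<^sub>+" 10) where
 "nn_integral_lborel f \<equiv> nn_integral lborel f"

abbreviation decay_weight :: "nat \<Rightarrow> 'a::real_normed_vector \<Rightarrow> ennreal" where
 "decay_weight K y \<equiv> ennreal (1 / (1 + norm y) ^ K)"

abbreviation integral_lborel :: "('a::euclidean_space \<Rightarrow> 'b::{banach, second_countable_topology}) \<Rightarrow> 'b" (binder "\<integral>\<^sub>L" 10) where
 "integral_lborel f \<equiv> integral\<^sup>L lborel f"

subsection \<open>Smooth functions and pointwise bounds on derivatives\<close>

lemma partial_deriv_eq:
 assumes "(f has_derivative f') (at x)"
 shows "partial_deriv j f x = f' (axis j 1)"
 unfolding partial_deriv_def using frechet_derivative_at[OF assms] by simp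

lemma partial_derivs_append: "partial_derivs (js @ ls) f = partial_derivs js (partial_derivs ls f)"
 by (induction js) auto

lemma partial_derivs_snoc: "partial_derivs (js @ [j]) f = partial_derivs js (partial_deriv j f)"
 by (simp add: partial_derivs_append)

text \<open>Half of the definition of \<open>schwartz\<close>, split off because characters,
  coordinates and the Dirac symbol are smooth without decaying.\<close>

definition smooth :: "('d::finite cfun) \<Rightarrow> bool" where
 "smooth f \<longleftrightarrow> (\<forall>js x. partial_derivs js f differentiable (at x))"

lemma smooth_differentiable: "smooth f \<Longrightarrow> f differentiable (at x)"
 unfolding smooth_def by (metis partial_derivs.simps(1))

lemma smooth_partial_deriv: "smooth f \<Longrightarrow> smooth (partial_deriv j f)"
 unfolding smooth_def by (metis partial_derivs_snoc)

lemma smooth_partial_derivs: "smooth f \<Longrightarrow> smooth (partial_derivs js f)"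
 unfolding smooth_def by (metis partial_derivs_append)

lemma smooth_has_derivative: "smooth f \<Longrightarrow> (f has_derivative frechet_derivative f (at x)) (at x)"
 by (simp add: smooth_differentiable frechet_derivative_works[THEN iffD1])

lemma smooth_continuous_on: "smooth f \<Longrightarrow> continuous_on A f"
 by (meson differentiable_imp_continuous_within smooth_differentiable continuous_at_imp_continuous_on)

lemma smooth_borel: "smooth f \<Longrightarrow> f \<in> \<B>"
 by (rule borel_measurable_continuous_onI) (rule smooth_continuous_on)

text \<open>The rule through which smoothness is mostly proved below: exhibiting an invariant class
  \<open>X\<close> replaces an induction over lists of directions, in which all intermediate
  derivatives would have to be computed.\<close>

lemma smooth_coinduct:
 assumes "X f"
  and diff: "\<And>f x. X f \<Longrightarrow> f differentiable (at x)"
  and step: "\<And>f j. X f \<Longrightarrow> X (partial_deriv j f)"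
 shows "smooth f"
proof -
 have "X (partial_derivs js f)" for js
  by (induction js) (auto intro: assms)
 then show ?thesis
  unfolding smooth_def using diff by blast
qed

lemma smooth_const: "smooth (\<lambda>x. c)" and partial_deriv_const: "partial_deriv j (\<lambda>x. c) = (\<lambda>x. 0)"
proof -
 show *: "partial_deriv j (\<lambda>x. c) = (\<lambda>x. 0)" for j and c :: complex
  by (rule ext, subst partial_deriv_eq[where f' = "\<lambda>_. 0"]) auto
 show "smooth (\<lambda>x. c)"
  by (rule smooth_coinduct[of "\<lambda>f. \<exists>c. f = (\<lambda>x. c)"]) (auto simp: *)
qed

lemma partial_deriv_add:
 assumes "f differentiable (at x)" "g differentiable (at x)"
 shows "partial_deriv j (\<lambda>x. f x + g x) x = partial_deriv j f x + partial_deriv j g x"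
 unfolding partial_deriv_def
 using assms[THEN frechet_derivative_works[THEN iffD1]]
 by (subst frechet_derivative_at[symmetric]) (auto intro!: derivative_eq_intros)

lemma partial_deriv_mult:
 assumes "f differentiable (at x)" "g differentiable (at x)"
 shows "partial_deriv j (\<lambda>x. f x * g x) x = partial_deriv j f x * g x + f x * partial_deriv j g x"
proof -
 have "((\<lambda>x. f x * g x) has_derivative
   (\<lambda>h. f x * frechet_derivative g (at x) h + frechet_derivative f (at x) h * g x)) (at x)"
  using assms[THEN frechet_derivative_works[THEN iffD1]] by (intro has_derivative_mult)
 from partial_deriv_eq[OF this] show ?thesis
  by (simp add: partial_deriv_def)
qed

lemma smooth_add:
 assumes "smooth f" "smooth g"
 shows "smooth (\<lambda>x. f x + g x)"
proof (rule smooth_coinduct[of "\<lambda>h. \<exists>f g. smooth f \<and> smooth g \<and> h = (\<lambda>x. f x + g x)"])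
 show "\<exists>f' g'. smooth f' \<and> smooth g' \<and> (\<lambda>x. f x + g x) = (\<lambda>x. f' x + g' x)"
  using assms by blast
next
 fix h :: "'a cfun" and x
 assume "\<exists>f g. smooth f \<and> smooth g \<and> h = (\<lambda>x. f x + g x)"
 then show "h differentiable at x"
  by (auto intro!: differentiable_add intro: smooth_differentiable)
next
 fix h :: "'a cfun" and j
 assume "\<exists>f g. smooth f \<and> smooth g \<and> h = (\<lambda>x. f x + g x)"
 then obtain f g where fg: "smooth f" "smooth g" "h = (\<lambda>x. f x + g x)"
  by blast
 then have "partial_deriv j h = (\<lambda>x. partial_deriv j f x + partial_deriv j g x)"
  by (auto simp: partial_deriv_add smooth_differentiable)
 then show "\<exists>f g. smooth f \<and> smooth g \<and> partial_deriv j h = (\<lambda>x. f x + g x)"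
  using fg smooth_partial_deriv by blast
qed

lemma partial_derivs_add:
 assumes "smooth f" "smooth g"
 shows "partial_derivs js (\<lambda>x. f x + g x) = (\<lambda>x. partial_derivs js f x + partial_derivs js g x)"
 by (induction js)
   (auto simp: partial_deriv_add smooth_differentiable smooth_partial_derivs assms)

text \<open>The point \<open>x\<close> stays fixed, so that growth or decay is expressed by letting
  \<open>a\<close> depend on \<open>x\<close>, and the product rule can be applied to such bounds
  point by point.\<close>

definition deriv_bound :: "nat \<Rightarrow> ('d::finite cfun) \<Rightarrow> real ^ 'd \<Rightarrow> real \<Rightarrow> bool" where
 "deriv_bound k f x a \<longleftrightarrow> (\<forall>js. length js \<le> k \<longrightarrow> norm (partial_derivs js f x) \<le> a)"

lemma deriv_boundD: "deriv_bound k f x a \<Longrightarrow> length js \<le> k \<Longrightarrow> norm (partial_derivs js f x) \<le> a"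
 by (simp add: deriv_bound_def)

lemma deriv_bound_mono: "deriv_bound k f x a \<Longrightarrow> l \<le> k \<Longrightarrow> a \<le> b \<Longrightarrow> deriv_bound l f x b"
 unfolding deriv_bound_def by (meson order_trans)

lemma deriv_bound_nonneg: "deriv_bound k f x a \<Longrightarrow> 0 \<le> a"
 unfolding deriv_bound_def by (metis le0 list.size(3) norm_ge_zero order_trans)

lemma deriv_bound_norm: "deriv_bound k f x a \<Longrightarrow> norm (f x) \<le> a"
 using deriv_boundD[of k f x a "[]"] by simp

lemma deriv_bound_partial_deriv: "deriv_bound (Suc k) f x a \<Longrightarrow> deriv_bound k (partial_deriv j f) x a"
 unfolding deriv_bound_def
proof (intro allI impI)
 fix js :: "'a list"
 assume "\<forall>js. length js \<le> Suc k \<longrightarrow> norm (partial_derivs js f x) \<le> a" "length js \<le> k"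
 from this(1)[rule_format, of "js @ [j]"] this(2)
 show "norm (partial_derivs js (partial_deriv j f) x) \<le> a"
  by (simp add: partial_derivs_snoc)
qed

lemma deriv_bound_add:
 assumes "smooth f" "smooth g" "deriv_bound k f x a" "deriv_bound k g x b"
 shows "deriv_bound k (\<lambda>x. f x + g x) x (a + b)"
 unfolding deriv_bound_def
 by (auto simp: partial_derivs_add assms intro!: norm_triangle_le add_mono deriv_boundD[OF assms(3)] deriv_boundD[OF assms(4)])

text \<open>Products are not closed under \<open>partial_deriv\<close>, which turns one of them into
  a sum of two. Coinduction is therefore replaced by an induction on the order, over all pairs of
  smooth functions at once, that peels off the derivative applied first.\<close>

lemma smooth_mult:
 fixes f g :: "'d::finite cfun"
 assumes "smooth f" "smooth g"
 shows "smooth (\<lambda>x. f x * g x)"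
proof -
 have "\<forall>f g :: 'd cfun. smooth f \<longrightarrow> smooth g \<longrightarrow>
   (\<forall>js x. length js \<le> n \<longrightarrow> partial_derivs js (\<lambda>x. f x * g x) differentiable at x)" for n
 proof (induction n)
  case 0
  then show ?case by (auto intro!: differentiable_mult intro: smooth_differentiable)
 next
  case (Suc n)
  show ?case
  proof (intro allI impI)
   fix f g :: "'d cfun" and js :: "'d list" and x
   assume fg: "smooth f" "smooth g" and js: "length js \<le> Suc n"
   show "partial_derivs js (\<lambda>x. f x * g x) differentiable at x"
   proof (cases js rule: rev_cases)
    case Nil
    then show ?thesis using fg by (auto intro!: differentiable_mult intro: smooth_differentiable)
   next
    case (snoc ls j)
    let ?F = "\<lambda>x. partial_deriv j f x * g x" and ?G = "\<lambda>x. f x * partial_deriv j g x"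
    have eq: "partial_deriv j (\<lambda>x. f x * g x) = (\<lambda>x. ?F x + ?G x)"
     using fg by (auto simp: partial_deriv_mult smooth_differentiable)
    have len: "length ls \<le> n" using js snoc by simp
    have IH: "partial_derivs ks ?F differentiable at y" "partial_derivs ks ?G differentiable at y"
     if "length ks \<le> n" for ks y
     using Suc.IH[rule_format, OF smooth_partial_deriv[OF fg(1)] fg(2) that]
      Suc.IH[rule_format, OF fg(1) smooth_partial_deriv[OF fg(2)] that] by simp_all
    \<comment> \<open>Additivity is redone here up to order \<open>n\<close> only:
      \<open>partial_derivs_add\<close> asks for smooth summands, and their smoothness is what is
      being proved.\<close>
    have "length ks \<le> n \<Longrightarrow>
     partial_derivs ks (\<lambda>x. ?F x + ?G x) = (\<lambda>x. partial_derivs ks ?F x + partial_derivs ks ?G x)" for ks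
     by (induction ks) (auto simp: partial_deriv_add IH)
    from this[OF len] show ?thesis
     using IH[OF len] by (simp add: snoc partial_derivs_snoc eq differentiable_add)
   qed
  qed
 qed
 from this[rule_format, OF assms order_refl] show ?thesis
  unfolding smooth_def[of "\<lambda>x. f x * g x"] by blast
qed

text \<open>Each use of the product rule doubles the number of terms, so \<open>k\<close>
  derivatives produce at most \<open>2 ^ k\<close> of them, each bounded by \<open>a * b\<close>.
  The order \<open>k\<close> is generalised in the induction because the bounds for the
  differentiated factor lose one order.\<close>

lemma deriv_bound_mult:
 assumes "smooth f" "smooth g" "deriv_bound k f x a" "deriv_bound k g x b"
 shows "deriv_bound k (\<lambda>x. f x * g x) x (2 ^ k * a * b)"
proof -
 have "norm (partial_derivs js (\<lambda>x. f x * g x) x) \<le> 2 ^ length js * a * b"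
  if "length js \<le> k" "smooth f" "smooth g" "deriv_bound k f x a" "deriv_bound k g x b" for js k f g a b
  using that
 proof (induction js arbitrary: f g k a b rule: rev_induct)
  case Nil
  then show ?case
   by (auto simp: norm_mult intro!: mult_mono deriv_bound_norm intro: deriv_bound_nonneg)
 next
  case (snoc j js)
  then obtain l where l: "k = Suc l" "length js \<le> l"
   by (cases k) auto
  let ?F = "\<lambda>x. partial_deriv j f x * g x" and ?G = "\<lambda>x. f x * partial_deriv j g x"
  have eq: "partial_deriv j (\<lambda>x. f x * g x) = (\<lambda>x. ?F x + ?G x)"
   using snoc.prems by (auto simp: partial_deriv_mult smooth_differentiable)
  have sm: "smooth ?F" "smooth ?G"
   using snoc.prems by (auto intro!: smooth_mult smooth_partial_deriv)
  have "norm (partial_derivs js ?F x) \<le> 2 ^ length js * a * b"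
   using snoc.prems l by (intro snoc.IH[of l]) (auto intro: smooth_partial_deriv deriv_bound_partial_deriv deriv_bound_mono)
  moreover have "norm (partial_derivs js ?G x) \<le> 2 ^ length js * a * b"
   using snoc.prems l by (intro snoc.IH[of l]) (auto intro: smooth_partial_deriv deriv_bound_partial_deriv deriv_bound_mono)
  ultimately show ?case
   using norm_triangle_ineq[of "partial_derivs js ?F x" "partial_derivs js ?G x"]
   by (simp add: partial_derivs_snoc eq partial_derivs_add sm)
 qed
 from this[OF _ assms] have *: "norm (partial_derivs js (\<lambda>x. f x * g x) x) \<le> 2 ^ length js * a * b"
  if "length js \<le> k" for js using that .
 show ?thesis
  unfolding deriv_bound_def
 proof (intro allI impI)
  fix js :: "'a list" assume "length js \<le> k"
  then have "2 ^ length js * a * b \<le> 2 ^ k * a * b"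
   using assms(3,4)[THEN deriv_bound_nonneg] by (intro mult_right_mono power_increasing) auto
  with *[OF \<open>length js \<le> k\<close>] show "norm (partial_derivs js (\<lambda>x. f x * g x) x) \<le> 2 ^ k * a * b"
   by linarith
 qed
qed

lemma smooth_cmult: "smooth f \<Longrightarrow> smooth (\<lambda>x. c * f x)"
 by (intro smooth_mult smooth_const)

lemma partial_derivs_cmult:
 assumes "smooth f"
 shows "partial_derivs js (\<lambda>x. c * f x) = (\<lambda>x. c * partial_derivs js f x)"
proof (induction js)
 case (Cons j js)
 then show ?case
  by (auto simp: partial_deriv_mult[OF differentiable_const smooth_differentiable] smooth_partial_derivs assms
    partial_deriv_const)
qed auto

lemma deriv_bound_cmult:
 assumes "smooth f" "deriv_bound k f x a"
 shows "deriv_bound k (\<lambda>x. c * f x) x (norm c * a)"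
 using assms unfolding deriv_bound_def
 by (auto simp: partial_derivs_cmult norm_mult intro!: mult_left_mono)

lemma smooth_sum:
 assumes "\<And>i. i \<in> I \<Longrightarrow> smooth (f i)"
 shows "smooth (\<lambda>x. \<Sum>i\<in>I. f i x)"
 using assms by (induction I rule: infinite_finite_induct) (auto intro: smooth_const smooth_add)

lemma partial_derivs_sum:
 assumes "finite I" "\<And>i. i \<in> I \<Longrightarrow> smooth (f i)"
 shows "partial_derivs js (\<lambda>x. \<Sum>i\<in>I. f i x) = (\<lambda>x. \<Sum>i\<in>I. partial_derivs js (f i) x)"
 using assms
proof (induction I rule: finite_induct)
 case empty
 have "partial_derivs js (\<lambda>x. 0) = (\<lambda>x. 0)"
  by (induction js) (auto simp: partial_deriv_const)
 then show ?case by simp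
next
 case (insert i I)
 then show ?case by (simp add: partial_derivs_add smooth_sum)
qed

lemma smooth_cnj:
 assumes "smooth f"
 shows "smooth (\<lambda>x. cnj (f x))"
  and partial_derivs_cnj: "partial_derivs js (\<lambda>x. cnj (f x)) = (\<lambda>x. cnj (partial_derivs js f x))"
proof -
 have d: "((\<lambda>x. cnj (f x)) has_derivative (\<lambda>h. cnj (frechet_derivative f (at x) h))) (at x)" if "smooth f" for f :: "'a cfun" and x
  using that by (intro bounded_linear.has_derivative[OF bounded_linear_cnj] smooth_has_derivative)
 have p: "partial_deriv j (\<lambda>x. cnj (f x)) = (\<lambda>x. cnj (partial_deriv j f x))" if "smooth f" for j and f :: "'a cfun"
  using partial_deriv_eq[OF d[OF that]] by (auto simp: partial_deriv_def)
 show "smooth (\<lambda>x. cnj (f x))"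
 proof (rule smooth_coinduct[of "\<lambda>h. \<exists>f. smooth f \<and> h = (\<lambda>x. cnj (f x))"])
  show "\<exists>f'. smooth f' \<and> (\<lambda>x. cnj (f x)) = (\<lambda>x. cnj (f' x))"
   using assms by blast
 next
  fix h :: "'a cfun" and x assume "\<exists>f. smooth f \<and> h = (\<lambda>x. cnj (f x))"
  then show "h differentiable at x"
   using differentiableI[OF d] by blast
 next
  fix h :: "'a cfun" and j assume "\<exists>f. smooth f \<and> h = (\<lambda>x. cnj (f x))"
  then obtain f where f: "smooth f" "h = (\<lambda>x. cnj (f x))" by blast
  then show "\<exists>f. smooth f \<and> partial_deriv j h = (\<lambda>x. cnj (f x))"
   using p[OF f(1), of j] smooth_partial_deriv[OF f(1), of j] by blast
 qed
 show "partial_derivs js (\<lambda>x. cnj (f x)) = (\<lambda>x. cnj (partial_derivs js f x))"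
  by (induction js) (auto simp: p smooth_partial_derivs assms)
qed

lemma deriv_bound_cnj: "smooth f \<Longrightarrow> deriv_bound k (\<lambda>x. cnj (f x)) x a \<longleftrightarrow> deriv_bound k f x a"
 unfolding deriv_bound_def by (simp add: partial_derivs_cnj)

lemma smooth_affine:
 assumes "smooth f"
 shows "smooth (\<lambda>x. f (c *\<^sub>R x + b))"
  and partial_derivs_affine: "partial_derivs js (\<lambda>x. f (c *\<^sub>R x + b)) =
   (\<lambda>x. c ^ length js *\<^sub>R partial_derivs js f (c *\<^sub>R x + b))"
proof -
 have d: "((\<lambda>x. f (c *\<^sub>R x + b)) has_derivative (\<lambda>h. frechet_derivative f (at (c *\<^sub>R x + b)) (c *\<^sub>R h))) (at x)"
  if "smooth f" for f :: "'a cfun" and x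
  by (rule has_derivative_compose[OF _ smooth_has_derivative[OF that]]) (auto intro!: derivative_eq_intros)
 have p: "partial_deriv j (\<lambda>x. f (c *\<^sub>R x + b)) = (\<lambda>x. c *\<^sub>R partial_deriv j f (c *\<^sub>R x + b))" if "smooth f" for j and f :: "'a cfun"
 proof
  fix x
  have "bounded_linear (frechet_derivative f (at (c *\<^sub>R x + b)))"
   using smooth_has_derivative[OF that] has_derivative_bounded_linear by blast
  then show "partial_deriv j (\<lambda>x. f (c *\<^sub>R x + b)) x = c *\<^sub>R partial_deriv j f (c *\<^sub>R x + b)"
   by (subst partial_deriv_eq[OF d[OF that]])
     (simp add: partial_deriv_def bounded_linear.linear linear_scale)
 qed
 have sm: "smooth (\<lambda>x. f (c *\<^sub>R x + b))" if "smooth f" for f :: "'a cfun"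
 \<comment> \<open>The scalar \<open>e\<close> belongs to the class because each derivative brings
   out a factor \<open>c\<close>.\<close>
 proof (rule smooth_coinduct[of "\<lambda>h. \<exists>f e. smooth f \<and> h = (\<lambda>x. e * f (c *\<^sub>R x + b))"])
  show "\<exists>f' e. smooth f' \<and> (\<lambda>x. f (c *\<^sub>R x + b)) = (\<lambda>x. e * f' (c *\<^sub>R x + b))"
   using that by (intro exI[of _ f] exI[of _ 1]) auto
 next
  fix h :: "'a cfun" and x assume "\<exists>f e. smooth f \<and> h = (\<lambda>x. e * f (c *\<^sub>R x + b))"
  then obtain f e where fe: "smooth f" "h = (\<lambda>x. e * f (c *\<^sub>R x + b))" by blast
  then show "h differentiable at x"
   using differentiableI[OF d[OF fe(1)]] by (auto intro!: differentiable_mult)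
 next
  fix h :: "'a cfun" and j assume "\<exists>f e. smooth f \<and> h = (\<lambda>x. e * f (c *\<^sub>R x + b))"
  then obtain f e where fe: "smooth f" "h = (\<lambda>x. e * f (c *\<^sub>R x + b))" by blast
  have "partial_deriv j h = (\<lambda>x. (e * of_real c) * partial_deriv j f (c *\<^sub>R x + b))"
   unfolding fe(2)
   by (rule ext, subst partial_deriv_mult)
     (use differentiableI[OF d[OF fe(1)]] p[OF fe(1)] in \<open>auto simp: partial_deriv_const scaleR_conv_of_real\<close>)
  then show "\<exists>f e. smooth f \<and> partial_deriv j h = (\<lambda>x. e * f (c *\<^sub>R x + b))"
   using smooth_partial_deriv[OF fe(1)] by blast
 qed
 show "smooth (\<lambda>x. f (c *\<^sub>R x + b))"
  by (rule sm[OF assms])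
 show "partial_derivs js (\<lambda>x. f (c *\<^sub>R x + b)) =
   (\<lambda>x. c ^ length js *\<^sub>R partial_derivs js f (c *\<^sub>R x + b))"
 proof (induction js)
  case (Cons j js)
  have s: "smooth (\<lambda>x. partial_derivs js f (c *\<^sub>R x + b))"
   using assms by (intro sm smooth_partial_derivs)
  have "partial_deriv j (\<lambda>x. of_real (c ^ length js) * partial_derivs js f (c *\<^sub>R x + b)) =
   (\<lambda>x. of_real (c ^ length js) * partial_deriv j (\<lambda>x. partial_derivs js f (c *\<^sub>R x + b)) x)"
   using partial_derivs_cmult[OF s, of "[j]"] by simp
  then show ?case
   using Cons p[OF smooth_partial_derivs[OF assms]] by (simp add: scaleR_conv_of_real mult_ac)
 qed simp
qed

text \<open>The chain rule gives the factor \<open>c ^ length js\<close>; passing to an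
  \<open>R\<close> with \<open>1 \<le> R\<close> makes it monotone in the order, so that
  \<open>R ^ k\<close> covers all orders up to \<open>k\<close>. With
  \<open>R = 1 + \<bar>t\<bar>\<close> this is the origin of the growth in \<open>t\<close> of the
  derivatives of the symbol.\<close>

lemma deriv_bound_affine:
 assumes "smooth f" "deriv_bound k f (c *\<^sub>R x + b) a" "\<bar>c\<bar> \<le> R" "1 \<le> R"
 shows "deriv_bound k (\<lambda>x. f (c *\<^sub>R x + b)) x (R ^ k * a)"
 unfolding deriv_bound_def
proof (intro allI impI)
 fix js :: "'a list" assume "length js \<le> k"
 have "\<bar>c\<bar> ^ length js \<le> R ^ length js"
  using assms by (intro power_mono) auto
 also have "\<dots> \<le> R ^ k"
  using assms \<open>length js \<le> k\<close> by (intro power_increasing) auto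
 finally show "norm (partial_derivs js (\<lambda>x. f (c *\<^sub>R x + b)) x) \<le> R ^ k * a"
  using assms deriv_boundD[OF assms(2) \<open>length js \<le> k\<close>]
  by (simp add: partial_derivs_affine[OF assms(1)] power_abs mult_mono)
qed

lemma smooth_translate: "smooth f \<Longrightarrow> smooth (\<lambda>x. f (x + b))"
 using smooth_affine(1)[of f 1 b] by simp

lemma partial_derivs_translate: "smooth f \<Longrightarrow> partial_derivs js (\<lambda>x. f (x + b)) = (\<lambda>x. partial_derivs js f (x + b))"
 using partial_derivs_affine[of f js 1 b] by simp

lemma deriv_bound_translate: "smooth f \<Longrightarrow> deriv_bound k (\<lambda>x. f (x + b)) x a \<longleftrightarrow> deriv_bound k f (x + b) a"
 unfolding deriv_bound_def by (simp add: partial_derivs_translate)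

section \<open>Coordinate functions and characters\<close>

definition coord :: "'d \<Rightarrow> 'd::finite cfun" where
 "coord j x = of_real (x $ j)"

lemma partial_deriv_coord: "partial_deriv i (coord j) = (\<lambda>x. if i = j then 1 else 0)"
 and smooth_coord: "smooth (coord j)"
proof -
 have d: "(coord j has_derivative (\<lambda>h. of_real (h $ j))) (at x)" for x
  unfolding coord_def[abs_def]
  by (intro has_derivative_of_real bounded_linear_imp_has_derivative bounded_linear_vec_nth)
 show p: "partial_deriv i (coord j) = (\<lambda>x. if i = j then 1 else 0)" for i
  by (rule ext, subst partial_deriv_eq[OF d]) (auto simp: axis_def)
 show "smooth (coord j)"
  by (rule smooth_coinduct[of "\<lambda>h. h = coord j \<or> (\<exists>c. h = (\<lambda>x. c))"])
    (use p differentiableI[OF d] in \<open>auto simp: partial_deriv_const\<close>)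
qed

lemma deriv_bound_coord: "deriv_bound k (coord j) x (1 + norm x)"
 unfolding deriv_bound_def
proof (intro allI impI)
 fix js :: "'a list"
 have z: "partial_derivs js (\<lambda>x. 0 :: complex) = (\<lambda>x. 0)" for js :: "'a list"
  by (induction js) (auto simp: partial_deriv_const)
 have o: "norm (partial_derivs js (\<lambda>x. c) x) \<le> norm c" for c :: complex and js :: "'a list"
  by (cases js rule: rev_cases) (auto simp: partial_derivs_snoc partial_deriv_const z)
 show "norm (partial_derivs js (coord j) x) \<le> 1 + norm x"
 proof (cases js rule: rev_cases)
  case Nil
  then show ?thesis
   using component_le_norm_cart[of x j] by (simp add: coord_def)
 next
  case (snoc ls i)
  then show ?thesis
   using o[of "ls" "if i = j then 1 else 0"] norm_ge_zero[of x]
   by (auto simp: partial_derivs_snoc partial_deriv_coord split: if_splits intro: order_trans)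
 qed
qed

definition expi :: "real ^ 'd::finite \<Rightarrow> 'd cfun" where
 "expi \<xi> x = cis (2 * pi * (x \<bullet> \<xi>))"

lemma norm_expi [simp]: "norm (expi \<xi> x) = 1"
 by (simp add: expi_def)

lemma partial_deriv_expi: "partial_deriv j (expi \<xi>) = (\<lambda>x. 2 * pi * \<i> * coord j \<xi> * expi \<xi> x)"
 and smooth_expi: "smooth (expi \<xi>)"
proof -
 have d: "(expi \<xi> has_derivative (\<lambda>h. \<i> * of_real (2 * pi * (h \<bullet> \<xi>)) * expi \<xi> x)) (at x)" for x
 proof -
  have "((\<lambda>x. \<i> * of_real (2 * pi * (x \<bullet> \<xi>))) has_derivative
    (\<lambda>h. \<i> * of_real (2 * pi * (h \<bullet> \<xi>)))) (at x)"
   by (intro has_derivative_mult_right has_derivative_of_real has_derivative_inner_left has_derivative_ident)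
  from has_derivative_compose[OF this DERIV_exp[unfolded has_field_derivative_def]]
  show ?thesis
   unfolding expi_def[abs_def] cis_conv_exp by (simp add: mult_ac)
 qed
 show p: "partial_deriv j (expi \<xi>) = (\<lambda>x. 2 * pi * \<i> * coord j \<xi> * expi \<xi> x)" for j
  by (rule ext, subst partial_deriv_eq[OF d]) (auto simp: coord_def inner_axis' mult_ac)
 show "smooth (expi \<xi>)"
 proof (rule smooth_coinduct[of "\<lambda>h. \<exists>c. h = (\<lambda>x. c * expi \<xi> x)"])
  show "\<exists>c. expi \<xi> = (\<lambda>x. c * expi \<xi> x)" by (intro exI[of _ 1]) auto
 next
  fix h :: "'a cfun" and x assume "\<exists>c. h = (\<lambda>x. c * expi \<xi> x)"
  then show "h differentiable at x"
   using differentiableI[OF d] by (auto intro!: differentiable_mult)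
 next
  fix h :: "'a cfun" and j assume "\<exists>c. h = (\<lambda>x. c * expi \<xi> x)"
  then obtain c where h: "h = (\<lambda>x. c * expi \<xi> x)" by blast
  have "partial_deriv j h = (\<lambda>x. c * (2 * pi * \<i> * coord j \<xi>) * expi \<xi> x)"
   unfolding h
   by (rule ext, subst partial_deriv_mult)
     (use differentiableI[OF d] in \<open>auto simp: partial_deriv_const p\<close>)
  then show "\<exists>c. partial_deriv j h = (\<lambda>x. c * expi \<xi> x)" by blast
 qed
qed

subsection \<open>Decay bounds\<close>

text \<open>An isotropic weight in place of the monomials of \<open>schwartz_seminorm\<close>. The
  two families control each other, and with \<open>k = N\<close> a single index measures smoothness
  and decay together.\<close>

definition decay_bound :: "nat \<Rightarrow> nat \<Rightarrow> real \<Rightarrow> ('d::finite cfun) \<Rightarrow> bool" where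
 "decay_bound k N B f \<longleftrightarrow> (\<forall>x. deriv_bound k f x (B / (1 + norm x) ^ N))"

lemma one_plus_norm_pos [simp]: "0 < 1 + norm x" "0 \<le> 1 + norm x" "1 + norm x \<noteq> 0"
 using norm_ge_zero[of x] by linarith+

lemma decay_bound_nonneg: "decay_bound k N B f \<Longrightarrow> 0 \<le> B"
 unfolding decay_bound_def using deriv_bound_nonneg[of k f 0 B] by (auto dest: spec[of _ 0])

lemma decay_bound_mono:
 assumes "decay_bound k N B f" "l \<le> k" "M \<le> N" "B \<le> C"
 shows "decay_bound l M C f"
 unfolding decay_bound_def
proof
 fix x :: "real ^ 'a"
 have "B / (1 + norm x) ^ N \<le> C / (1 + norm x) ^ M"
  using assms decay_bound_nonneg[OF assms(1)]
  by (intro frac_le power_increasing) auto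
 then show "deriv_bound l f x (C / (1 + norm x) ^ M)"
  using assms deriv_bound_mono unfolding decay_bound_def by blast
qed

lemma decay_bound_norm: "decay_bound k N B f \<Longrightarrow> norm (f x) \<le> B / (1 + norm x) ^ N"
 unfolding decay_bound_def using deriv_bound_norm by blast

lemma decay_bound_iff:
 "decay_bound k N B f \<longleftrightarrow> (\<forall>js x. length js \<le> k \<longrightarrow> (1 + norm x) ^ N * norm (partial_derivs js f x) \<le> B)"
 unfolding decay_bound_def deriv_bound_def
 by (auto simp: field_simps)

lemma finite_lists_length: "finite {js :: 'd::finite list. length js \<le> k}"
 using finite_lists_length_le[of "UNIV :: 'd set" k] by simp

lemma norm_le_sum_coord: "norm x \<le> (\<Sum>j\<in>UNIV. \<bar>x $ j\<bar>)" for x :: "real ^ 'd::finite"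
 by (rule norm_le_l1_cart)

text \<open>With \<open>M\<close> the largest of 1 and the \<open>\<bar>x $ j\<bar>\<close>, the
  left-hand side is at most \<open>(2 * CARD('d) * M) ^ N\<close>, and \<open>M ^ N\<close> is one
  of the summands on the right. Since only pure powers of single coordinates occur, decay can be
  tested with repeated derivatives in one direction.\<close>

lemma power_one_plus_norm_le:
 fixes x :: "real ^ 'd::finite"
 shows "(1 + norm x) ^ N \<le> (2 * real CARD('d)) ^ N * (1 + (\<Sum>j\<in>UNIV. \<bar>x $ j\<bar> ^ N))"
proof -
 let ?n = "real CARD('d)"
 have n: "1 \<le> ?n" by (simp add: Suc_leI)
 define M where "M = Max (insert 1 (range (\<lambda>j. \<bar>x $ j\<bar>)))"
 have M1: "1 \<le> M" and Mj: "\<bar>x $ j\<bar> \<le> M" for j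
  unfolding M_def by (rule Max_ge; simp)+
 have "1 + norm x \<le> M + (\<Sum>j\<in>(UNIV::'d set). M)"
  by (intro add_mono M1 order_trans[OF norm_le_sum_coord] sum_mono Mj)
 also have "\<dots> = M + ?n * M" by simp
 also have "M + ?n * M \<le> 2 * ?n * M"
  using mult_right_mono[OF n, of M] M1 by simp
 finally have "(1 + norm x) ^ N \<le> (2 * ?n * M) ^ N"
  by (intro power_mono) auto
 also have "\<dots> = (2 * ?n) ^ N * M ^ N" by (simp add: power_mult_distrib)
 also have "M ^ N \<le> 1 + (\<Sum>j\<in>UNIV. \<bar>x $ j\<bar> ^ N)"
 proof -
  have "M \<in> insert 1 (range (\<lambda>j. \<bar>x $ j\<bar>))"
   unfolding M_def by (rule Max_in) auto
  then consider "M = 1" | j where "M = \<bar>x $ j\<bar>" by auto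
  then show ?thesis
  proof cases
   case 1
   then show ?thesis by (simp add: sum_nonneg)
  next
   case (2 j)
   have "\<bar>x $ j\<bar> ^ N \<le> (\<Sum>j\<in>UNIV. \<bar>x $ j\<bar> ^ N)"
    by (rule member_le_sum) auto
   then show ?thesis using 2 by simp
  qed
 qed
 finally show ?thesis using n by (simp add: mult_left_mono)
qed

lemma abs_monomial_le:
 fixes x :: "real ^ 'd::finite"
 shows "\<bar>monomial a x\<bar> \<le> (1 + norm x) ^ (\<Sum>j\<in>UNIV. a j)"
proof -
 have "\<bar>monomial a x\<bar> = (\<Prod>j\<in>UNIV. \<bar>x $ j\<bar> ^ a j)"
  by (simp add: monomial_def abs_prod power_abs)
 also have "\<dots> \<le> (\<Prod>j\<in>UNIV. (1 + norm x) ^ a j)"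
 proof (intro prod_mono conjI power_mono)
  show "\<bar>x $ j\<bar> \<le> 1 + norm x" for j using component_le_norm_cart[of x j] by simp
 qed auto
 also have "\<dots> = (1 + norm x) ^ (\<Sum>j\<in>UNIV. a j)" by (simp add: power_sum)
 finally show ?thesis .
qed

lemma schwartz_seminorm_le:
 assumes "decay_bound k N B f" "length js \<le> k" "(\<Sum>j\<in>UNIV. a j) \<le> N"
 shows "norm (monomial a x *\<^sub>R partial_derivs js f x) \<le> B"
proof -
 have "\<bar>monomial a x\<bar> \<le> (1 + norm x) ^ N"
  using abs_monomial_le[of a x] power_increasing[OF assms(3), of "1 + norm x"] by simp
 then have "norm (monomial a x *\<^sub>R partial_derivs js f x) \<le> (1 + norm x) ^ N * norm (partial_derivs js f x)"
  by (simp add: mult_right_mono)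
 then show ?thesis
  using assms unfolding decay_bound_iff by (meson order_trans)
qed

lemma norm_le_schwartz_seminorm:
 assumes "f \<in> schwartz"
 shows "norm (monomial a x *\<^sub>R partial_derivs js f x) \<le> schwartz_seminorm a js f"
 unfolding schwartz_seminorm_def
proof (rule cSUP_upper)
 have "bounded (range (\<lambda>x. monomial a x *\<^sub>R partial_derivs js f x))"
  using assms by (simp add: schwartz_def)
 then show "bdd_above (range (\<lambda>x. norm (monomial a x *\<^sub>R partial_derivs js f x)))"
  unfolding bounded_iff bdd_above_def by auto
qed simp

lemma monomial_single: "monomial (\<lambda>i. if i = j then N else 0) x = (x $ j) ^ N"
proof -
 have "monomial (\<lambda>i. if i = j then N else 0) x = (\<Prod>i\<in>UNIV. if i = j then (x $ j) ^ N else 1)"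
  unfolding monomial_def by (intro prod.cong) auto
 then show ?thesis by simp
qed

text \<open>The converse of \<open>schwartz_seminorm_le\<close>. By
  \<open>power_one_plus_norm_le\<close> the weight is dominated by 1 and pure powers of the
  coordinates, so finitely many seminorms suffice, as a neighbourhood basis requires.\<close>

lemma decay_bound_from_seminorms:
 fixes f :: "'d::finite cfun"
 assumes "f \<in> schwartz"
  and "\<And>js a. length js \<le> k \<Longrightarrow> a \<in> insert (\<lambda>_. 0) (range (\<lambda>j i. if i = j then N else 0)) \<Longrightarrow>
   schwartz_seminorm a js f \<le> e"
 shows "decay_bound k N ((2 * real CARD('d)) ^ N * ((1 + real CARD('d)) * e)) f"
 unfolding decay_bound_iff
proof (intro allI impI)
 fix js :: "'d list" and x :: "real ^ 'd" assume js: "length js \<le> k"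
 let ?p = "norm (partial_derivs js f x)"
 have "(1 + norm x) ^ N * ?p \<le> (2 * real CARD('d)) ^ N * (1 + (\<Sum>j\<in>UNIV. \<bar>x $ j\<bar> ^ N)) * ?p"
  by (intro mult_right_mono power_one_plus_norm_le) auto
 also have "\<dots> = (2 * real CARD('d)) ^ N * (?p + (\<Sum>j\<in>UNIV. \<bar>x $ j\<bar> ^ N * ?p))"
  by (simp add: algebra_simps sum_distrib_left sum_distrib_right)
 also have "\<dots> \<le> (2 * real CARD('d)) ^ N * (e + (\<Sum>j\<in>(UNIV :: 'd set). e))"
 proof (intro mult_left_mono add_mono sum_mono)
  show "?p \<le> e"
   using norm_le_schwartz_seminorm[OF assms(1), of "\<lambda>_. 0" x js] assms(2)[OF js, of "\<lambda>_. 0"]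
   by (simp add: monomial_def)
  fix j
  show "\<bar>x $ j\<bar> ^ N * ?p \<le> e"
   using norm_le_schwartz_seminorm[OF assms(1), of "\<lambda>i. if i = j then N else 0" x js]
    assms(2)[OF js, of "\<lambda>i. if i = j then N else 0"]
   by (simp add: monomial_single power_abs)
 qed auto
 finally show "(1 + norm x) ^ N * ?p \<le> (2 * real CARD('d)) ^ N * ((1 + real CARD('d)) * e)"
  by (simp add: algebra_simps)
qed

lemma schwartz_iff: "f \<in> schwartz \<longleftrightarrow> smooth f \<and> (\<forall>k N. \<exists>B. decay_bound k N B f)"
 for f :: "'d::finite cfun"
proof (intro iffI conjI allI)
 assume f: "f \<in> schwartz"
 then show "smooth f" by (simp add: schwartz_def smooth_def)
 fix k N :: nat
 let ?I = "{js :: 'd list. length js \<le> k} \<times> insert (\<lambda>_. 0) (range (\<lambda>j i. if i = j then N else (0::nat)))"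
 have nonneg: "0 \<le> schwartz_seminorm a js f" for a js
  by (rule order_trans[OF norm_ge_zero norm_le_schwartz_seminorm[OF f, of a 0 js]])
 define e where "e = (\<Sum>(js, a)\<in>?I. schwartz_seminorm a js f)"
 have le: "schwartz_seminorm a js f \<le> e" if "length js \<le> k" "a \<in> insert (\<lambda>_. 0) (range (\<lambda>j i. if i = j then N else 0))" for js a
  unfolding e_def using member_le_sum[of "(js, a)" ?I "\<lambda>(js, a). schwartz_seminorm a js f"] that nonneg
  by (auto simp: finite_lists_length)
 show "\<exists>B. decay_bound k N B f"
  by (rule exI, rule decay_bound_from_seminorms[OF f le])
next
 assume f: "smooth f \<and> (\<forall>k N. \<exists>B. decay_bound k N B f)"
 have "bounded (range (\<lambda>x. monomial a x *\<^sub>R partial_derivs js f x))" for a js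
 proof -
  obtain B where "decay_bound (length js) (\<Sum>j\<in>UNIV. a j) B f" using f by blast
  from schwartz_seminorm_le[OF this order_refl order_refl] show ?thesis by (auto simp: bounded_iff)
 qed
 then show "f \<in> schwartz"
  using f by (simp add: schwartz_def smooth_def)
qed

lemma schwartz_smooth: "f \<in> schwartz \<Longrightarrow> smooth f"
 by (simp add: schwartz_iff)

lemma schwartz_decay: "f \<in> schwartz \<Longrightarrow> \<exists>B. decay_bound k N B f"
 by (simp add: schwartz_iff)

section \<open>Linear operations on Schwartz functions\<close>

lemma decay_bound_add:
 assumes "smooth f" "smooth g" "decay_bound k N A f" "decay_bound k N B g"
 shows "decay_bound k N (A + B) (\<lambda>x. f x + g x)"
 using assms deriv_bound_add[OF assms(1,2)] unfolding decay_bound_def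
 by (simp add: add_divide_distrib)

lemma decay_bound_cmult:
 assumes "smooth f" "decay_bound k N B f"
 shows "decay_bound k N (norm c * B) (\<lambda>x. c * f x)"
 using assms deriv_bound_cmult[OF assms(1)] unfolding decay_bound_def
 by (metis times_divide_eq_right)

lemma schwartz_add: "f \<in> schwartz \<Longrightarrow> g \<in> schwartz \<Longrightarrow> (\<lambda>x. f x + g x) \<in> schwartz"
 unfolding schwartz_iff using smooth_add decay_bound_add by metis

lemma schwartz_cmult: "f \<in> schwartz \<Longrightarrow> (\<lambda>x. c * f x) \<in> schwartz"
 unfolding schwartz_iff using smooth_cmult decay_bound_cmult by metis

lemma schwartz_diff: "f \<in> schwartz \<Longrightarrow> g \<in> schwartz \<Longrightarrow> (\<lambda>x. f x - g x) \<in> schwartz"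
 using schwartz_add[of f "\<lambda>x. (-1) * g x"] schwartz_cmult[of g "-1"] by simp

lemma partial_derivs_zero: "partial_derivs js (\<lambda>x. 0) = (\<lambda>x. 0)"
 by (induction js) (auto simp: partial_deriv_const)

lemma schwartz_zero: "(\<lambda>x. 0) \<in> schwartz"
 unfolding schwartz_iff decay_bound_iff by (auto simp: smooth_const partial_derivs_zero)

lemma schwartz_sum: "(\<And>i. i \<in> I \<Longrightarrow> f i \<in> schwartz) \<Longrightarrow> (\<lambda>x. \<Sum>i\<in>I. f i x) \<in> schwartz"
 by (induction I rule: infinite_finite_induct) (auto intro: schwartz_zero schwartz_add)

subsection \<open>Temperate distributions as bounded conjugate-linear forms\<close>

text \<open>The topology is generated by sets with arbitrary centres, so the claim is proved along
  the generation of \<open>U\<close>. For a generating set around another centre the triangle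
  inequality leaves the slack \<open>e - ?p\<close>, and half of it serves as radius.\<close>

lemma schwartz_open_contains_bound:
 assumes "openin schwartz_topology U" "\<phi> \<in> U"
 shows "\<exists>N \<delta>. 0 < \<delta> \<and> (\<forall>\<psi>\<in>schwartz. decay_bound N N \<delta> (\<lambda>x. \<psi> x - \<phi> x) \<longrightarrow> \<psi> \<in> U)"
proof -
 have "\<phi> \<in> schwartz"
  using assms openin_subset topspace_schwartz_topology by blast
 have "generate_topology_on {{\<psi> \<in> schwartz. schwartz_seminorm a js (\<lambda>x. \<psi> x - \<phi> x) < e} | a js \<phi> e.
    \<phi> \<in> schwartz \<and> 0 < e} U"
  using assms(1) unfolding schwartz_topology_def openin_topology_generated_by_iff .
 then show ?thesis using assms(2)
 proof (induction rule: generate_topology_on.induct)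
  case Empty
  then show ?case by simp
 next
  case (Int A B)
  then obtain N M d e where *: "0 < d" "0 < e"
   "\<forall>\<psi>\<in>schwartz. decay_bound N N d (\<lambda>x. \<psi> x - \<phi> x) \<longrightarrow> \<psi> \<in> A"
   "\<forall>\<psi>\<in>schwartz. decay_bound M M e (\<lambda>x. \<psi> x - \<phi> x) \<longrightarrow> \<psi> \<in> B"
   by blast
  have "\<psi> \<in> A \<inter> B" if "\<psi> \<in> schwartz" "decay_bound (max N M) (max N M) (min d e) (\<lambda>x. \<psi> x - \<phi> x)" for \<psi>
   using * that(1) decay_bound_mono[OF that(2)] by auto
  then show ?case
   using *(1,2) by (intro exI[of _ "max N M"] exI[of _ "min d e"]) auto
 next
  case (UN K)
  then show ?case by blast
 next
  case (Basis s)
  then obtain a js \<phi>' e where s: "s = {\<psi> \<in> schwartz. schwartz_seminorm a js (\<lambda>x. \<psi> x - \<phi>' x) < e}"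
   "\<phi>' \<in> schwartz" "0 < e" by blast
  define N where "N = max (length js) (\<Sum>j\<in>UNIV. a j)"
  let ?p = "schwartz_seminorm a js (\<lambda>x. \<phi> x - \<phi>' x)"
  define \<delta> where "\<delta> = (e - ?p) / 2"
  have pe: "?p < e" using Basis s by auto
  then have "0 < \<delta>" by (simp add: \<delta>_def)
  moreover have "\<psi> \<in> s" if \<psi>: "\<psi> \<in> schwartz" "decay_bound N N \<delta> (\<lambda>x. \<psi> x - \<phi> x)" for \<psi>
  proof -
   have "schwartz_seminorm a js (\<lambda>x. \<psi> x - \<phi>' x) \<le> \<delta> + ?p"
    unfolding schwartz_seminorm_def[of _ _ "\<lambda>x. \<psi> x - \<phi>' x"]
   proof (rule cSUP_least)
    fix x
    have "partial_derivs js (\<lambda>x. (\<psi> x - \<phi> x) + (\<phi> x - \<phi>' x)) =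
      (\<lambda>x. partial_derivs js (\<lambda>x. \<psi> x - \<phi> x) x + partial_derivs js (\<lambda>x. \<phi> x - \<phi>' x) x)"
     using \<psi> s \<open>\<phi> \<in> schwartz\<close> by (intro partial_derivs_add schwartz_smooth schwartz_diff)
    then have "monomial a x *\<^sub>R partial_derivs js (\<lambda>x. \<psi> x - \<phi>' x) x =
     monomial a x *\<^sub>R partial_derivs js (\<lambda>x. \<psi> x - \<phi> x) x + monomial a x *\<^sub>R partial_derivs js (\<lambda>x. \<phi> x - \<phi>' x) x"
     by (simp add: scaleR_right_distrib)
    moreover have "norm (monomial a x *\<^sub>R partial_derivs js (\<lambda>x. \<psi> x - \<phi> x) x) \<le> \<delta>"
     by (rule schwartz_seminorm_le[OF \<psi>(2)]) (auto simp: N_def)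
    moreover have "norm (monomial a x *\<^sub>R partial_derivs js (\<lambda>x. \<phi> x - \<phi>' x) x) \<le> ?p"
     using s \<open>\<phi> \<in> schwartz\<close> by (intro norm_le_schwartz_seminorm schwartz_diff)
    ultimately show "norm (monomial a x *\<^sub>R partial_derivs js (\<lambda>x. \<psi> x - \<phi>' x) x) \<le> \<delta> + ?p"
     by (simp only: norm_triangle_mono)
   qed simp
   also have "\<delta> + ?p < e" using pe by (simp add: \<delta>_def field_simps)
   finally show ?thesis using \<psi> s by simp
  qed
  ultimately show ?case by blast
 qed
qed

text \<open>Continuity of a conjugate-linear functional, expressed as an estimate by one norm. It is
  scalar-valued so that the components of a vector distribution can be treated separately, and so
  that evaluations of derivatives are forms of the same kind.\<close>

definition tempered_form :: "nat \<Rightarrow> real \<Rightarrow> (('d::finite cfun) \<Rightarrow> complex) \<Rightarrow> bool" where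
 "tempered_form N C v \<longleftrightarrow> 0 \<le> C \<and>
   (\<forall>\<phi>\<in>schwartz. \<forall>\<psi>\<in>schwartz. v (\<lambda>x. \<phi> x + \<psi> x) = v \<phi> + v \<psi>) \<and>
   (\<forall>c. \<forall>\<phi>\<in>schwartz. v (\<lambda>x. c * \<phi> x) = cnj c * v \<phi>) \<and>
   (\<forall>\<phi>\<in>schwartz. \<forall>B. decay_bound N N B \<phi> \<longrightarrow> norm (v \<phi>) \<le> C * B)"

lemma tempered_form_add: "tempered_form N C v \<Longrightarrow> \<phi> \<in> schwartz \<Longrightarrow> \<psi> \<in> schwartz \<Longrightarrow> v (\<lambda>x. \<phi> x + \<psi> x) = v \<phi> + v \<psi>"
 and tempered_form_cmult: "tempered_form N C v \<Longrightarrow> \<phi> \<in> schwartz \<Longrightarrow> v (\<lambda>x. c * \<phi> x) = cnj c * v \<phi>"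
 and tempered_form_bound: "tempered_form N C v \<Longrightarrow> \<phi> \<in> schwartz \<Longrightarrow> decay_bound N N B \<phi> \<Longrightarrow> norm (v \<phi>) \<le> C * B"
 and tempered_form_nonneg: "tempered_form N C v \<Longrightarrow> 0 \<le> C"
 unfolding tempered_form_def by blast+

lemma tempered_form_zero: "tempered_form N C v \<Longrightarrow> v (\<lambda>x. 0) = 0"
 using tempered_form_cmult[of N C v "\<lambda>x. 0" 0] schwartz_zero by simp

lemma tempered_form_diff:
 "tempered_form N C v \<Longrightarrow> \<phi> \<in> schwartz \<Longrightarrow> \<psi> \<in> schwartz \<Longrightarrow> v (\<lambda>x. \<phi> x - \<psi> x) = v \<phi> - v \<psi>"
 using tempered_form_add[of N C v \<phi> "\<lambda>x. (-1) * \<psi> x"] tempered_form_cmult[of N C v \<psi> "-1"] schwartz_cmult[of \<psi> "-1"]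
 by simp

lemma tempered_form_sum:
 assumes "tempered_form N C v"
 shows "(\<And>i. i \<in> I \<Longrightarrow> f i \<in> schwartz) \<Longrightarrow> v (\<lambda>x. \<Sum>i\<in>I. f i x) = (\<Sum>i\<in>I. v (f i))"
proof (induction I rule: infinite_finite_induct)
 case (insert i I)
 then show ?case
  using tempered_form_add[OF assms, of "f i" "\<lambda>x. \<Sum>i\<in>I. f i x"] schwartz_sum[of I f] by simp
qed (simp_all add: tempered_form_zero[OF assms])

lemma tempered_form_mono:
 assumes "tempered_form N C v" "N \<le> M" "C \<le> D"
 shows "tempered_form M D v"
 unfolding tempered_form_def
proof (intro conjI ballI allI impI)
 fix \<phi> :: "'a cfun" and B assume "\<phi> \<in> schwartz" and d: "decay_bound M M B \<phi>"
 then have "norm (v \<phi>) \<le> C * B"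
  using tempered_form_bound[OF assms(1)] decay_bound_mono assms(2) by blast
 also have "\<dots> \<le> D * B"
  using assms(3) decay_bound_nonneg[OF d] by (intro mult_right_mono)
 finally show "norm (v \<phi>) \<le> D * B" .
qed (use assms in \<open>auto simp: tempered_form_def\<close>)

text \<open>Continuity at the zero function gives a ball of radius \<open>\<delta>\<close> in some
  norm on which \<open>u\<close> stays below 1; homogeneity turns this into a bound with constant
  \<open>1 / \<delta>\<close>, common to all components.\<close>

lemma temperate_components:
 assumes "u \<in> temperate"
 shows "\<exists>N C. \<forall>l. tempered_form N C (\<lambda>\<phi>. u \<phi> $ l)"
proof -
 have cont: "continuous_map schwartz_topology euclidean u"
  and add: "\<And>\<phi> \<psi>. \<phi> \<in> schwartz \<Longrightarrow> \<psi> \<in> schwartz \<Longrightarrow> u (\<lambda>x. \<phi> x + \<psi> x) = u \<phi> + u \<psi>"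
  and cm: "\<And>c \<phi>. \<phi> \<in> schwartz \<Longrightarrow> u (\<lambda>x. c * \<phi> x) = cnj c *s u \<phi>"
  using assms by (auto simp: temperate_def)
 have u0: "u (\<lambda>x. 0) = 0"
  using cm[OF schwartz_zero, of 0] by simp
 have "openin schwartz_topology {\<phi> \<in> topspace schwartz_topology. u \<phi> \<in> ball 0 1}"
  using cont by (rule openin_continuous_map_preimage) simp
 from schwartz_open_contains_bound[OF this, of "\<lambda>x. 0"] u0
 obtain N \<delta> where \<delta>: "0 < \<delta>" and *: "\<And>\<psi>. \<psi> \<in> schwartz \<Longrightarrow> decay_bound N N \<delta> \<psi> \<Longrightarrow> norm (u \<psi>) < 1"
  by (auto simp: topspace_schwartz_topology schwartz_zero)
 have bd: "norm (u \<phi>) \<le> 1 / \<delta> * B" if \<phi>: "\<phi> \<in> schwartz" and B: "decay_bound N N B \<phi>" for \<phi> B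
 proof (rule dense_ge)
  \<comment> \<open>Rescaling by a \<open>y\<close> strictly above the claimed bound covers the case
    \<open>B = 0\<close> as well.\<close>
  fix y assume y: "1 / \<delta> * B < y"
  have "0 \<le> B" using decay_bound_nonneg[OF B] .
  then have "0 \<le> 1 / \<delta> * B" using \<delta> by simp
  then have y0: "0 < y" using y by linarith
  let ?\<psi> = "\<lambda>x. of_real (1 / y) * \<phi> x"
  have "norm (complex_of_real (1 / y)) * B \<le> \<delta>"
   using y y0 \<delta> by (simp add: field_simps norm_divide)
  then have "decay_bound N N \<delta> ?\<psi>"
   using decay_bound_cmult[OF schwartz_smooth[OF \<phi>] B, of "of_real (1 / y)"] decay_bound_mono by blast
  then have 1: "norm (u ?\<psi>) < 1" using * schwartz_cmult[OF \<phi>] by blast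
  have 2: "norm (u ?\<psi>) = norm (u \<phi>) / y"
  proof -
   have "u ?\<psi> = (1 / y) *\<^sub>R u \<phi>"
    unfolding cm[OF \<phi>] by (subst vec_eq_iff) (auto simp: field_simps scaleR_conv_of_real[where 'a = complex])
   then show ?thesis using y0 by simp
  qed
  from 1[unfolded 2] show "norm (u \<phi>) \<le> y" using y0 by (simp add: field_simps)
 qed
 have "tempered_form N (1 / \<delta>) (\<lambda>\<phi>. u \<phi> $ l)" for l
  unfolding tempered_form_def
  using \<delta> add cm bd by (auto intro: order_trans[OF Finite_Cartesian_Product.norm_nth_le])
 then show ?thesis by blast
qed

text \<open>By linearity the bounds are Lipschitz estimates for \<open>u \<psi> - u \<phi>\<close>,
  and a finite intersection of generating sets centred at \<open>\<phi>\<close> makes them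
  small.\<close>

lemma temperateI:
 fixes u :: "('d::finite, 'n::finite) vdist"
 assumes "\<And>l. \<exists>N C. tempered_form N C (\<lambda>\<phi>. u \<phi> $ l)"
 shows "u \<in> temperate"
proof -
 obtain N C where NC: "\<And>l. tempered_form (N l) (C l) (\<lambda>\<phi>. u \<phi> $ l)"
  using assms by metis
 define M where "M = Max (range N)"
 define D where "D = (\<Sum>l\<in>UNIV. C l)"
 have C0: "0 \<le> C l" for l using NC tempered_form_nonneg by blast
 have bd: "norm (u \<phi>) \<le> D * B" if "\<phi> \<in> schwartz" "decay_bound M M B \<phi>" for \<phi> B
 proof -
  have "norm (u \<phi>) \<le> (\<Sum>l\<in>UNIV. norm (u \<phi> $ l))"
   unfolding norm_vec_def by (rule L2_set_le_sum) simp
  also have "\<dots> \<le> (\<Sum>l\<in>UNIV. C l * B)"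
  proof (intro sum_mono tempered_form_bound[OF NC] that(1))
   show "decay_bound (N l) (N l) B \<phi>" for l
    by (rule decay_bound_mono[OF that(2)]) (auto simp: M_def)
  qed
  finally show ?thesis by (simp add: D_def sum_distrib_right)
 qed
 have D0: "0 \<le> D" unfolding D_def by (intro sum_nonneg C0)
 have diff: "u (\<lambda>x. \<phi> x - \<psi> x) = u \<phi> - u \<psi>" if "\<phi> \<in> schwartz" "\<psi> \<in> schwartz" for \<phi> \<psi>
  using tempered_form_diff[OF NC that] by (simp add: vec_eq_iff)
 have "continuous_map schwartz_topology euclidean u"
  unfolding continuous_map_def
 proof (intro conjI allI impI)
  fix V :: "(complex ^ 'n) set" assume "openin euclidean V"
  then have V: "open V" by simp
  show "openin schwartz_topology {\<phi> \<in> topspace schwartz_topology. u \<phi> \<in> V}"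
  proof (subst openin_subopen, intro ballI)
   fix \<phi> assume "\<phi> \<in> {\<phi> \<in> topspace schwartz_topology. u \<phi> \<in> V}"
   then have \<phi>: "\<phi> \<in> schwartz" "u \<phi> \<in> V" by (auto simp: topspace_schwartz_topology)
   obtain r where r: "0 < r" "ball (u \<phi>) r \<subseteq> V"
    using V \<phi>(2) openE by blast
   define K where "K = (2 * real CARD('d)) ^ M * (1 + real CARD('d))"
   have K: "0 < K" unfolding K_def by (simp add: add_pos_nonneg)
   \<comment> \<open>\<open>K\<close> converts seminorms into a \<open>decay_bound\<close>, so this
     radius yields \<open>D * (K * e) \<le> r / 2\<close>; the \<open>+ 1\<close> keeps the quotient
     meaningful for \<open>D = 0\<close>.\<close>
   define e where "e = r / (2 * K * (D + 1))"
   have e: "0 < e" using r K D0 by (simp add: e_def)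
   let ?A = "insert (\<lambda>_. 0) (range (\<lambda>(j::'d) i. if i = j then M else 0)) \<times> {js :: 'd list. length js \<le> M}"
   let ?N = "\<lambda>(a, js). {\<psi> \<in> schwartz. schwartz_seminorm a js (\<lambda>x. \<psi> x - \<phi> x) < e}"
   let ?T = "\<Inter> (?N ` ?A)"
   have "openin schwartz_topology ?T"
   proof (rule openin_Inter)
    show "finite (?N ` ?A)" by (intro finite_imageI finite_cartesian_product finite_lists_length) auto
    show "?N ` ?A \<noteq> {}" by (auto intro: exI[of _ "[]"])
    fix X assume "X \<in> ?N ` ?A"
    then obtain a js where "X = {\<psi> \<in> schwartz. schwartz_seminorm a js (\<lambda>x. \<psi> x - \<phi> x) < e}" by auto
    then show "openin schwartz_topology X"
     unfolding schwartz_topology_def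
     by (intro topology_generated_by_Basis CollectI exI conjI) (assumption | rule \<phi> e)+
   qed
   moreover have "\<phi> \<in> ?T"
    using \<phi> e by (auto simp: schwartz_seminorm_def partial_derivs_zero)
   moreover have "?T \<subseteq> {\<phi> \<in> topspace schwartz_topology. u \<phi> \<in> V}"
   proof
    fix \<psi> assume T: "\<psi> \<in> ?T"
    have "(\<lambda>_. 0, []) \<in> ?A" by simp
    then have "\<psi> \<in> ?N (\<lambda>_. 0, [])" using T by blast
    then have \<psi>: "\<psi> \<in> schwartz" by simp
    have "schwartz_seminorm a js (\<lambda>x. \<psi> x - \<phi> x) \<le> e" if "length js \<le> M"
     "a \<in> insert (\<lambda>_. 0) (range (\<lambda>j i. if i = j then M else 0))" for a js
    proof -
     have "(a, js) \<in> ?A" using that by simp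
     then have "\<psi> \<in> ?N (a, js)" using T by blast
     then show ?thesis by simp
    qed
    from decay_bound_from_seminorms[OF schwartz_diff[OF \<psi> \<phi>(1)] this]
    have "decay_bound M M (K * e) (\<lambda>x. \<psi> x - \<phi> x)"
     by (simp add: K_def mult_ac)
    from bd[OF schwartz_diff[OF \<psi> \<phi>(1)] this]
    have "norm (u \<psi> - u \<phi>) \<le> D * (K * e)" by (simp add: diff \<psi> \<phi>)
    also have "\<dots> < r"
    proof -
     have "D * (K * e) = r / 2 * (D / (D + 1))" using K by (simp add: e_def)
     also have "\<dots> \<le> r / 2 * 1" using D0 r by (intro mult_left_mono) auto
     finally show ?thesis using r by simp
    qed
    finally have "u \<psi> \<in> ball (u \<phi>) r" by (simp add: dist_norm norm_minus_commute)
    then show "\<psi> \<in> {\<phi> \<in> topspace schwartz_topology. u \<phi> \<in> V}"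
     using r \<psi> by (auto simp: topspace_schwartz_topology)
   qed
   ultimately show "\<exists>T. openin schwartz_topology T \<and> \<phi> \<in> T \<and> T \<subseteq> {\<phi> \<in> topspace schwartz_topology. u \<phi> \<in> V}"
    by blast
  qed
 qed auto
 moreover have "u (\<lambda>x. \<phi> x + \<psi> x) = u \<phi> + u \<psi>" if "\<phi> \<in> schwartz" "\<psi> \<in> schwartz" for \<phi> \<psi>
  using tempered_form_add[OF NC that] by (simp add: vec_eq_iff)
 moreover have "u (\<lambda>x. c * \<phi> x) = cnj c *s u \<phi>" if "\<phi> \<in> schwartz" for \<phi> c
  using tempered_form_cmult[OF NC that] by (simp add: vec_eq_iff)
 ultimately show ?thesis unfolding temperate_def by blast
qed

subsection \<open>Integrals over Euclidean space\<close>

lemma nn_integral_lborel_affine: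
 fixes f :: "'a::euclidean_space \<Rightarrow> ennreal"
 assumes [measurable]: "f \<in> \<B>" and "c \<noteq> 0"
 shows "(\<integral>\<^sub>+x. f x) = ennreal (\<bar>c\<bar> ^ DIM('a)) * (\<integral>\<^sub>+x. f (t + c *\<^sub>R x))"
 by (subst lborel_affine[OF \<open>c \<noteq> 0\<close>, of t])
   (simp add: nn_integral_density nn_integral_distr nn_integral_cmult ennreal_power)

lemma integral_lborel_affine:
 fixes f :: "'a::euclidean_space \<Rightarrow> complex"
 assumes [measurable]: "f \<in> \<B>" and "c \<noteq> 0"
 shows "(\<integral>\<^sub>Lx. f x) = \<bar>c\<bar> ^ DIM('a) *\<^sub>R (\<integral>\<^sub>Lx. f (t + c *\<^sub>R x))"
 by (subst lborel_affine[OF \<open>c \<noteq> 0\<close>, of t])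
   (simp add: integral_density integral_distr)

lemma nn_integral_lborel_translate:
 fixes f :: "'a::euclidean_space \<Rightarrow> ennreal"
 assumes "f \<in> \<B>"
 shows "(\<integral>\<^sub>+x. f (t + x)) = (\<integral>\<^sub>+x. f x)"
 using nn_integral_lborel_affine[OF assms, of 1 t] by simp

lemma integral_lborel_translate:
 fixes f :: "'a::euclidean_space \<Rightarrow> complex"
 assumes "f \<in> \<B>"
 shows "(\<integral>\<^sub>Lx. f (t + x)) = (\<integral>\<^sub>Lx. f x)"
 using integral_lborel_affine[OF assms, of 1 t] by simp

lemma integrable_lborel_affine:
 fixes f :: "'a::euclidean_space \<Rightarrow> 'b::{banach, second_countable_topology}"
 assumes f: "integrable lborel f" and c: "c \<noteq> 0"
 shows "integrable lborel (\<lambda>x. f (t + c *\<^sub>R x))"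
proof -
 have [measurable]: "f \<in> \<B>"
  using borel_measurable_integrable[OF f] by simp
 have "(\<integral>\<^sub>+x. norm (f x)) < \<infinity>"
  using f unfolding integrable_iff_bounded by simp
 then have "ennreal (\<bar>c\<bar> ^ DIM('a)) * (\<integral>\<^sub>+x. norm (f (t + c *\<^sub>R x))) < \<infinity>"
  by (subst (asm) nn_integral_lborel_affine[OF _ c, of _ t]) simp_all
 then have "(\<integral>\<^sub>+x. norm (f (t + c *\<^sub>R x))) < \<infinity>"
  using c by (auto simp: ennreal_mult_less_top)
 then show ?thesis
  unfolding integrable_iff_bounded by simp
qed

lemma integrable_inverse_one_plus_abs_square: "integrable lborel (\<lambda>t::real. 1 / (1 + \<bar>t\<bar>) ^ 2)"
proof (rule Bochner_Integration.integrable_bound)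
 have "set_integrable lborel (einterval (-\<infinity>) \<infinity>) (\<lambda>x. inverse (1 + x ^ 2 :: real))"
  by (rule integrable_inverse_1_plus_square)
 then show "integrable lborel (\<lambda>x. inverse (1 + x ^ 2 :: real))"
  by (simp add: set_integrable_def)
 show "AE t in lborel. norm (1 / (1 + \<bar>t\<bar>) ^ 2) \<le> norm (inverse (1 + t ^ 2 :: real))"
 proof (rule AE_I2)
  fix t :: real
  have "1 + t ^ 2 \<le> (1 + \<bar>t\<bar>) ^ 2" by (simp add: power2_sum)
  moreover have "0 < 1 + t ^ 2" by (simp add: add_pos_nonneg)
  ultimately show "norm (1 / (1 + \<bar>t\<bar>) ^ 2) \<le> norm (inverse (1 + t ^ 2))"
   by (simp add: divide_simps)
 qed
qed simp

text \<open>The exponent comes from comparison with a product: coordinates are at most the norm, so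
  the weight dominates the product of the \<open>(1 + \<bar>x \<bullet> b\<bar>) ^ 2\<close>, whose
  reciprocal has a finite integral that factorises over the basis.\<close>

lemma integrable_inverse_one_plus_norm:
 assumes "2 * DIM('a) \<le> N"
 shows "integrable lborel (\<lambda>x::'a::euclidean_space. 1 / (1 + norm x) ^ N)"
proof -
 let ?f = "\<lambda>t::real. 1 / (1 + \<bar>t\<bar>) ^ 2"
 have "(\<integral>\<^sub>+(x::'a). ennreal (norm (1 / (1 + norm x) ^ N))) \<le>
   (\<integral>\<^sub>+(x::'a). (\<Prod>b\<in>Basis. ennreal (?f (x \<bullet> b))))"
 proof (rule nn_integral_mono)
  fix x :: 'a
  have "(\<Prod>b\<in>(Basis::'a set). (1 + \<bar>x \<bullet> b\<bar>) ^ 2) \<le> (\<Prod>b\<in>(Basis::'a set). (1 + norm x) ^ 2)"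
   by (intro prod_mono conjI power_mono add_left_mono Basis_le_norm) auto
  also have "\<dots> = (1 + norm x) ^ (2 * DIM('a))"
   by (simp add: power_mult)
  also have "\<dots> \<le> (1 + norm x) ^ N"
   using assms by (intro power_increasing) auto
  finally have "1 / (1 + norm x) ^ N \<le> 1 / (\<Prod>b\<in>(Basis::'a set). (1 + \<bar>x \<bullet> b\<bar>) ^ 2)"
   by (intro divide_left_mono mult_pos_pos prod_pos) (auto intro!: zero_less_power add_pos_nonneg)
  also have "\<dots> = (\<Prod>b\<in>(Basis::'a set). ?f (x \<bullet> b))"
   by (simp add: prod_dividef)
  finally show "ennreal (norm (1 / (1 + norm x) ^ N)) \<le> (\<Prod>b\<in>Basis. ennreal (?f (x \<bullet> b)))"
   by (simp add: prod_ennreal ennreal_leI)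
 qed
 also have "\<dots> = (\<Prod>b\<in>(Basis::'a set). (\<integral>\<^sub>+t. ennreal (?f t)))"
  by (rule nn_integral_lborel_prod) auto
 also have "\<dots> < \<infinity>"
 proof -
  have "(\<integral>\<^sub>+t. ennreal (?f t)) = ennreal (\<integral>\<^sub>Lt. ?f t)"
   by (rule nn_integral_eq_integral[OF integrable_inverse_one_plus_abs_square]) auto
  then show ?thesis by (simp add: power_less_top_ennreal)
 qed
 finally show ?thesis
  unfolding integrable_iff_bounded by simp
qed

text \<open>Differentiation under the integral for total derivatives, by dominated convergence along
  sequences. Convexity of \<open>S\<close> serves the mean value inequality, and a local
  \<open>S\<close> admits integrands that are dominated only near \<open>x\<close>.\<close>

lemma has_derivative_integral:
 fixes F :: "'a::euclidean_space \<Rightarrow> 'b \<Rightarrow> complex"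
 assumes S: "open S" "convex S" "x \<in> S"
  and int: "\<And>x. x \<in> S \<Longrightarrow> integrable M (F x)"
  and der: "\<And>x y. x \<in> S \<Longrightarrow> ((\<lambda>x. F x y) has_derivative F' x y) (at x)"
  and bd: "\<And>x y v. x \<in> S \<Longrightarrow> norm (F' x y v) \<le> G y * norm v"
  and G: "integrable M G"
  and meas: "\<And>v. (\<lambda>y. F' x y v) \<in> borel_measurable M"
 shows "((\<lambda>x. \<integral>y. F x y \<partial>M) has_derivative (\<lambda>v. \<integral>y. F' x y v \<partial>M)) (at x)"
proof -
 have int': "integrable M (\<lambda>y. F' x y v)" for v
  by (rule Bochner_Integration.integrable_bound[OF integrable_mult_left[OF G, of "norm v"] meas])
    (use bd[OF S(3)] in \<open>auto intro: order_trans[OF _ abs_ge_self]\<close>)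
 have lin: "linear (F' x y)" for y
  using der[OF S(3)] has_derivative_linear by blast
 have bl: "bounded_linear (\<lambda>v. \<integral>y. F' x y v \<partial>M)"
  unfolding linear_conv_bounded_linear[symmetric]
  by (rule linearI) (simp_all add: linear_add[OF lin] linear_scale[OF lin] int')
 have "((\<lambda>z. ((\<integral>y. F z y \<partial>M) - (\<integral>y. F x y \<partial>M) - (\<integral>y. F' x y (z - x) \<partial>M)) /\<^sub>R norm (z - x)) \<longlongrightarrow> 0) (at x)"
  unfolding tendsto_at_iff_sequentially comp_def
 proof (intro allI impI)
  fix X assume X: "\<forall>i. X i \<in> UNIV - {x}" "X \<longlonglongrightarrow> x"
  have "\<forall>\<^sub>F i in sequentially. X i \<in> S"
   using X(2) S(1,3) topological_tendstoD by blast
  then obtain n0 where n0: "\<And>n. n0 \<le> n \<Longrightarrow> X n \<in> S"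
   unfolding eventually_sequentially by blast
  define Y where "Y n = X (n + n0)" for n
  have Y: "Y n \<in> S" "Y n \<noteq> x" for n using n0 X(1) by (auto simp: Y_def)
  have Ylim: "Y \<longlonglongrightarrow> x" unfolding Y_def by (rule LIMSEQ_ignore_initial_segment[OF X(2)])
  let ?s = "\<lambda>z y. (F z y - F x y - F' x y (z - x)) /\<^sub>R norm (z - x)"
  have eq: "((\<integral>y. F z y \<partial>M) - (\<integral>y. F x y \<partial>M) - (\<integral>y. F' x y (z - x) \<partial>M)) /\<^sub>R norm (z - x) = (\<integral>y. ?s z y \<partial>M)"
   if "z \<in> S" for z
   using int[OF that] int[OF S(3)] int' by simp
  have "(\<lambda>n. \<integral>y. ?s (Y n) y \<partial>M) \<longlonglongrightarrow> (\<integral>y. 0 \<partial>M)"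
  \<comment> \<open>One \<open>G\<close> bounds the difference quotient, the other the linear
    term.\<close>
  proof (rule integral_dominated_convergence[where w = "\<lambda>y. 2 * G y"])
   show "AE y in M. (\<lambda>n. ?s (Y n) y) \<longlonglongrightarrow> 0"
   proof (rule AE_I2)
    fix y
    have "((\<lambda>z. ?s z y) \<longlongrightarrow> 0) (at x)"
     using der[OF S(3), of y] unfolding has_derivative_at_within by simp
    then show "(\<lambda>n. ?s (Y n) y) \<longlonglongrightarrow> 0"
     unfolding tendsto_at_iff_sequentially comp_def using Y(2) Ylim by auto
   qed
   show "AE y in M. norm (?s (Y n) y) \<le> 2 * G y" for n
   proof (rule AE_I2)
    fix y
    have "norm (F (Y n) y - F x y) \<le> G y * norm (Y n - x)"
    proof (rule differentiable_bound[OF S(2)])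
     show "((\<lambda>x. F x y) has_derivative F' z y) (at z within S)" if "z \<in> S" for z
      using der[OF that] has_derivative_at_withinI by blast
     show "onorm (F' z y) \<le> G y" if "z \<in> S" for z
      by (rule onorm_le) (use bd[OF that] in auto)
    qed (use Y S in auto)
    moreover have "norm (F' x y (Y n - x)) \<le> G y * norm (Y n - x)"
     by (rule bd[OF S(3)])
    ultimately have "norm (F (Y n) y - F x y - F' x y (Y n - x)) \<le> 2 * G y * norm (Y n - x)"
     using norm_triangle_ineq4[of "F (Y n) y - F x y" "F' x y (Y n - x)"] by linarith
    then show "norm (?s (Y n) y) \<le> 2 * G y"
     using Y(2)[of n] unfolding norm_scaleR norm_inverse by (simp add: field_simps)
   qed
   show "(\<lambda>y. ?s (Y n) y) \<in> borel_measurable M" for n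
    using int[OF Y(1)] int[OF S(3)] meas by (auto dest!: borel_measurable_integrable)
  qed (use G in auto)
  then have "(\<lambda>n. ((\<integral>y. F (Y n) y \<partial>M) - (\<integral>y. F x y \<partial>M) - (\<integral>y. F' x y (Y n - x) \<partial>M)) /\<^sub>R norm (Y n - x)) \<longlonglongrightarrow> 0"
   by (simp add: eq[OF Y(1)])
  then show "(\<lambda>n. ((\<integral>y. F (X n) y \<partial>M) - (\<integral>y. F x y \<partial>M) - (\<integral>y. F' x y (X n - x) \<partial>M)) /\<^sub>R norm (X n - x)) \<longlonglongrightarrow> 0"
   unfolding Y_def by (rule LIMSEQ_offset)
 qed
 with bl show ?thesis unfolding has_derivative_at_within by blast
qed

lemma integrable_pair_bound:
 fixes F :: "'a::euclidean_space \<times> 'b::euclidean_space \<Rightarrow> complex"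
 assumes [measurable]: "F \<in> \<B>"
  and AB: "integrable lborel A" "integrable lborel B"
  and bd: "\<And>x y. norm (F (x, y)) \<le> A x * B y"
 shows "integrable (lborel \<Otimes>\<^sub>M lborel) F"
proof (rule Bochner_Integration.integrable_bound)
 have [measurable]: "A \<in> \<B>" "B \<in> \<B>"
  using AB[THEN borel_measurable_integrable] by auto
 show "integrable (lborel \<Otimes>\<^sub>M lborel) (\<lambda>(x, y). A x * B y)"
 proof (rule lborel_pair.Fubini_integrable)
  show "integrable lborel (\<lambda>x. \<integral>\<^sub>Ly. norm (case (x, y) of (x, y) \<Rightarrow> A x * B y))"
   using AB by (simp add: abs_mult)
  show "AE x in lborel. integrable lborel (\<lambda>y. case (x, y) of (x, y) \<Rightarrow> A x * B y)"
   using AB by auto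
 qed simp
 show "AE z in lborel \<Otimes>\<^sub>M lborel. norm (F z) \<le> norm (case z of (x, y) \<Rightarrow> A x * B y)"
 proof (rule AE_I2)
  fix z :: "'a \<times> 'b"
  show "norm (F z) \<le> norm (case z of (x, y) \<Rightarrow> A x * B y)"
   using order_trans[OF bd[of "fst z" "snd z"] abs_ge_self] by (simp add: split_beta)
 qed
 show "F \<in> borel_measurable (lborel \<Otimes>\<^sub>M lborel)" by (simp add: lborel_prod)
qed

lemma Fubini_bound:
 fixes F :: "'a::euclidean_space \<times> 'b::euclidean_space \<Rightarrow> complex"
 assumes "F \<in> \<B>"
  and "integrable lborel A" "integrable lborel B"
  and "\<And>x y. norm (F (x, y)) \<le> A x * B y"
 shows "(\<integral>\<^sub>Ly. (\<integral>\<^sub>Lx. F (x, y))) = (\<integral>\<^sub>Lx. (\<integral>\<^sub>Ly. F (x, y)))"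
 using lborel_pair.Fubini_integral[of "\<lambda>x y. F (x, y)"] integrable_pair_bound[OF assms] by simp

subsection \<open>The Fourier transform on Schwartz functions\<close>

lemma expi_commute: "expi \<xi> x = expi x \<xi>"
 by (simp add: expi_def inner_commute)

lemma expi_add: "expi (a + b) x = expi a x * expi b x" "expi a (x + y) = expi a x * expi a y"
 by (simp_all add: expi_def cis_mult inner_add_left inner_add_right algebra_simps)

lemma expi_zero [simp]: "expi 0 x = 1" "expi a 0 = 1"
 by (simp_all add: expi_def)

lemma cnj_expi: "cnj (expi a x) = expi (- a) x"
 by (simp add: expi_def cis_cnj)

lemma expi_minus: "expi (- a) x = expi a (- x)"
 by (simp add: expi_def)

lemma expi_scaleR: "expi (c *\<^sub>R a) x = expi a (c *\<^sub>R x)"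
 by (simp add: expi_def)

lemma fourier_eq: "fourier f \<xi> = (\<integral>\<^sub>Lx. expi (- \<xi>) x * f x)"
 by (simp add: fourier_def expi_def)

lemma inv_fourier_eq: "inv_fourier f x = fourier f (- x)"
 by (simp add: fourier_eq inv_fourier_def expi_def inner_commute)

lemma expi_continuous: "continuous_on UNIV (\<lambda>p. expi (f p) (g p))"
 if "continuous_on UNIV f" "continuous_on UNIV g"
 unfolding expi_def cis_conv_exp by (intro continuous_intros that)

lemma expi_measurable [measurable (raw)]:
 assumes "f \<in> borel_measurable M" "g \<in> borel_measurable M"
 shows "(\<lambda>x. expi (f x) (g x)) \<in> borel_measurable M"
proof -
 have "(\<lambda>p. expi (fst p) (snd p)) \<in> \<B>"
  by (intro borel_measurable_continuous_onI expi_continuous continuous_intros)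
 from measurable_compose[OF borel_measurable_Pair[OF assms] this] show ?thesis by simp
qed

definition bracket_integral :: "'d::finite itself \<Rightarrow> real" where
 "bracket_integral _ = (\<integral>\<^sub>L(x::real ^ 'd). 1 / (1 + norm x) ^ (2 * CARD('d)))"

lemma bracket_integral_nonneg: "0 \<le> bracket_integral t"
 unfolding bracket_integral_def by (intro integral_nonneg_AE) auto

lemma integrable_decay:
 fixes f :: "'d::finite cfun"
 assumes [measurable]: "f \<in> \<B>"
  and "\<And>x. norm (f x) \<le> B / (1 + norm x) ^ (2 * CARD('d))"
 shows "integrable lborel f" and "(\<integral>\<^sub>Lx. norm (f x)) \<le> B * bracket_integral TYPE('d)"
proof -
 have i: "integrable lborel (\<lambda>x::real ^ 'd. B * (1 / (1 + norm x) ^ (2 * CARD('d))))"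
  by (intro integrable_mult_right integrable_inverse_one_plus_norm) simp
 show f: "integrable lborel f"
  by (rule Bochner_Integration.integrable_bound[OF i])
    (use order_trans[OF assms(2) abs_ge_self] in simp_all)
 have "(\<integral>\<^sub>Lx. norm (f x)) \<le> (\<integral>\<^sub>L(x::real ^ 'd). B * (1 / (1 + norm x) ^ (2 * CARD('d))))"
  by (rule integral_mono[OF integrable_norm[OF f] i]) (use assms in auto)
 then show "(\<integral>\<^sub>Lx. norm (f x)) \<le> B * bracket_integral TYPE('d)"
  unfolding bracket_integral_def by (simp only: integral_mult_right_zero)
qed

lemma schwartz_integrable: "f \<in> schwartz \<Longrightarrow> integrable lborel f" for f :: "'d::finite cfun"
proof -
 assume f: "f \<in> schwartz"
 obtain B where "decay_bound 0 (2 * CARD('d)) B f" using schwartz_decay[OF f] by blast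
 from decay_bound_norm[OF this] show "integrable lborel f"
  by (intro integrable_decay(1)) (auto intro: smooth_borel schwartz_smooth f)
qed

lemma integrable_expi_mult:
 assumes "integrable lborel f"
 shows "integrable lborel (\<lambda>x. expi a x * f x)"
proof (rule Bochner_Integration.integrable_bound[OF assms])
 have [measurable]: "f \<in> \<B>"
  using borel_measurable_integrable[OF assms] by simp
 show "(\<lambda>x. expi a x * f x) \<in> borel_measurable lborel" by measurable
qed (auto simp: norm_mult)

lemma norm_fourier_le: "norm (fourier f \<xi>) \<le> (\<integral>\<^sub>Lx. norm (f x))"
proof -
 have "norm (fourier f \<xi>) \<le> (\<integral>\<^sub>Lx. norm (expi (- \<xi>) x * f x))"
  unfolding fourier_eq by (rule integral_norm_bound)
 then show ?thesis by (simp add: norm_mult)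
qed

lemma fourier_measurable [measurable]:
 assumes "integrable lborel f"
 shows "fourier f \<in> \<B>"
proof -
 have [measurable]: "f \<in> \<B>"
  using borel_measurable_integrable[OF assms] by simp
 have "(\<lambda>\<xi>. \<integral>\<^sub>Lx. expi (- \<xi>) x * f x) \<in> \<B>"
  by measurable
 then show ?thesis by (simp add: fourier_eq[abs_def])
qed

text \<open>Continuity in quantitative form. It composes, so that the continuity of a multiplier is
  assembled from Fourier transforms and multiplications, and it transports the bound of a
  \<open>tempered_form\<close> through a transpose.\<close>

definition schwartz_map :: "(('d::finite cfun) \<Rightarrow> ('d cfun)) \<Rightarrow> bool" where
 "schwartz_map L \<longleftrightarrow> (\<forall>\<phi>\<in>schwartz. smooth (L \<phi>)) \<and>
   (\<forall>N. \<exists>M C. 0 \<le> C \<and> (\<forall>\<phi>\<in>schwartz. \<forall>B. decay_bound M M B \<phi> \<longrightarrow> decay_bound N N (C * B) (L \<phi>)))"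

lemma schwartz_mapI:
 assumes "\<And>\<phi>. \<phi> \<in> schwartz \<Longrightarrow> smooth (L \<phi>)"
  and "\<And>N. \<exists>M C. 0 \<le> C \<and> (\<forall>\<phi>\<in>schwartz. \<forall>B. decay_bound M M B \<phi> \<longrightarrow> decay_bound N N (C * B) (L \<phi>))"
 shows "schwartz_map L"
 using assms unfolding schwartz_map_def by blast

lemma schwartz_mapD:
 assumes "schwartz_map L"
 obtains M C where "0 \<le> C" "\<And>\<phi> B. \<phi> \<in> schwartz \<Longrightarrow> decay_bound M M B \<phi> \<Longrightarrow> decay_bound N N (C * B) (L \<phi>)"
 using assms unfolding schwartz_map_def by blast

lemma schwartz_map_schwartz:
 assumes "schwartz_map L" "\<phi> \<in> schwartz"
 shows "L \<phi> \<in> schwartz"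
 unfolding schwartz_iff
proof (intro conjI allI)
 show "smooth (L \<phi>)" using assms by (auto simp: schwartz_map_def)
 fix k N
 obtain M C where MC: "\<And>\<phi> B. \<phi> \<in> schwartz \<Longrightarrow> decay_bound M M B \<phi> \<Longrightarrow> decay_bound (max k N) (max k N) (C * B) (L \<phi>)"
  using schwartz_mapD[OF assms(1)] by metis
 obtain B where "decay_bound M M B \<phi>" using schwartz_decay[OF assms(2)] by blast
 from MC[OF assms(2) this] have "decay_bound k N (C * B) (L \<phi>)"
  by (rule decay_bound_mono) auto
 then show "\<exists>B. decay_bound k N B (L \<phi>)" ..
qed

lemma schwartz_map_compose:
 assumes "schwartz_map K" "schwartz_map L"
 shows "schwartz_map (\<lambda>\<phi>. K (L \<phi>))"
proof (rule schwartz_mapI)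
 show "smooth (K (L \<phi>))" if "\<phi> \<in> schwartz" for \<phi>
  using schwartz_map_schwartz[OF assms(1) schwartz_map_schwartz[OF assms(2) that]] schwartz_smooth by blast
 fix N
 obtain M C where MC: "0 \<le> C" "\<And>\<phi> B. \<phi> \<in> schwartz \<Longrightarrow> decay_bound M M B \<phi> \<Longrightarrow> decay_bound N N (C * B) (K \<phi>)"
  using schwartz_mapD[OF assms(1)] by metis
 obtain M' C' where MC': "0 \<le> C'" "\<And>\<phi> B. \<phi> \<in> schwartz \<Longrightarrow> decay_bound M' M' B \<phi> \<Longrightarrow> decay_bound M M (C' * B) (L \<phi>)"
  using schwartz_mapD[OF assms(2)] by metis
 have "decay_bound N N (C * C' * B) (K (L \<phi>))" if "\<phi> \<in> schwartz" "decay_bound M' M' B \<phi>" for \<phi> B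
  using MC(2)[OF schwartz_map_schwartz[OF assms(2) that(1)] MC'(2)[OF that]] by (simp add: mult.assoc)
 then show "\<exists>M C. 0 \<le> C \<and> (\<forall>\<phi>\<in>schwartz. \<forall>B. decay_bound M M B \<phi> \<longrightarrow> decay_bound N N (C * B) (K (L \<phi>)))"
  using MC(1) MC'(1) by (intro exI[of _ M'] exI[of _ "C * C'"]) auto
qed

lemma schwartz_map_id: "schwartz_map (\<lambda>\<phi>. \<phi>)"
proof (rule schwartz_mapI)
 show "\<exists>M C. 0 \<le> C \<and> (\<forall>\<phi>\<in>schwartz. \<forall>B. decay_bound M M B \<phi> \<longrightarrow> decay_bound N N (C * B) \<phi>)" for N
  by (intro exI[of _ N] exI[of _ 1]) auto
qed (rule schwartz_smooth)

lemma schwartz_map_partial_deriv: "schwartz_map (partial_deriv j)"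
proof (rule schwartz_mapI)
 fix N
 have "decay_bound N N (1 * B) (partial_deriv j \<phi>)" if "decay_bound (Suc N) (Suc N) B \<phi>" for \<phi> :: "'a cfun" and B
 proof -
  have "decay_bound (Suc N) N B \<phi>" by (rule decay_bound_mono[OF that]) auto
  then show ?thesis unfolding decay_bound_def by (auto intro!: deriv_bound_partial_deriv)
 qed
 then show "\<exists>M C. 0 \<le> C \<and> (\<forall>\<phi>\<in>schwartz. \<forall>B. decay_bound M M B \<phi> \<longrightarrow> decay_bound N N (C * B) (partial_deriv j \<phi>))"
  by (intro exI[of _ "Suc N"] exI[of _ 1]) auto
qed (intro smooth_partial_deriv schwartz_smooth)

text \<open>The derivatives of \<open>\<nu>\<close> may grow polynomially: \<open>n\<close>
  additional powers of decay of \<open>\<phi>\<close> absorb the growth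
  \<open>(1 + norm x) ^ n\<close>.\<close>

lemma schwartz_map_mult:
 assumes "smooth \<nu>" and "\<And>k. \<exists>A n. \<forall>x. deriv_bound k \<nu> x (A * (1 + norm x) ^ n)"
 shows "schwartz_map (\<lambda>\<phi> x. \<nu> x * \<phi> x)"
proof (rule schwartz_mapI)
 show "smooth (\<lambda>x. \<nu> x * \<phi> x)" if "\<phi> \<in> schwartz" for \<phi>
  by (intro smooth_mult schwartz_smooth assms(1) that)
 fix N
 obtain A n where A: "\<And>x. deriv_bound N \<nu> x (A * (1 + norm x) ^ n)" using assms(2) by blast
 have A0: "0 \<le> A" using deriv_bound_nonneg[OF A[of 0]] by simp
 have "decay_bound N N (2 ^ N * A * B) (\<lambda>x. \<nu> x * \<phi> x)" if \<phi>: "\<phi> \<in> schwartz" "decay_bound (N + n) (N + n) B \<phi>" for \<phi> B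
  unfolding decay_bound_def
 proof
  fix x
  have "deriv_bound N \<phi> x (B / (1 + norm x) ^ (N + n))"
   using decay_bound_mono[OF \<phi>(2), of N "N + n" B] unfolding decay_bound_def by auto
  from deriv_bound_mult[OF assms(1) schwartz_smooth[OF \<phi>(1)] A this]
  show "deriv_bound N (\<lambda>x. \<nu> x * \<phi> x) x (2 ^ N * A * B / (1 + norm x) ^ N)"
   by (simp add: power_add field_simps)
 qed
 then show "\<exists>M C. 0 \<le> C \<and> (\<forall>\<phi>\<in>schwartz. \<forall>B. decay_bound M M B \<phi> \<longrightarrow> decay_bound N N (C * B) (\<lambda>x. \<nu> x * \<phi> x))"
  using A0 by (intro exI[of _ "N + n"] exI[of _ "2 ^ N * A"]) auto
qed

lemma schwartz_map_cmult: "schwartz_map (\<lambda>\<phi> (x :: real ^ 'd::finite). c * \<phi> x)"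
proof (rule schwartz_map_mult[OF smooth_const])
 fix k
 have "deriv_bound k (\<lambda>x. c) x (norm c * (1 + norm x) ^ 0)" for x :: "real ^ 'd"
  unfolding deriv_bound_def
 proof (intro allI impI)
  fix js :: "'d list"
  show "norm (partial_derivs js (\<lambda>x. c) x) \<le> norm c * (1 + norm x) ^ 0"
   by (cases js rule: rev_cases) (auto simp: partial_derivs_snoc partial_deriv_const partial_derivs_zero)
 qed
 then show "\<exists>A n. \<forall>x :: real ^ 'd. deriv_bound k (\<lambda>x. c) x (A * (1 + norm x) ^ n)" by blast
qed

lemma schwartz_map_coord: "schwartz_map (\<lambda>\<phi> x. coord j x * \<phi> x)"
 using deriv_bound_coord by (intro schwartz_map_mult smooth_coord exI[of _ 1] allI) auto

text \<open>Differentiation under the integral. The derivative of the character costs a factor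
  \<open>norm x\<close>, paid for by the exponent \<open>2 * CARD('d) + 1\<close> in the decay of
  \<open>\<phi>\<close>.\<close>

lemma partial_deriv_fourier:
 fixes \<phi> :: "'d::finite cfun"
 assumes "\<phi> \<in> schwartz"
 shows "fourier \<phi> differentiable (at \<xi>)"
  and "partial_deriv j (fourier \<phi>) \<xi> = fourier (\<lambda>x. - 2 * pi * \<i> * (coord j x * \<phi> x)) \<xi>"
proof -
 let ?F' = "\<lambda>\<xi> x v. - 2 * pi * \<i> * of_real (x \<bullet> v) * (expi (- \<xi>) x * \<phi> x)"
 obtain B where "decay_bound 0 (2 * CARD('d) + 1) B \<phi>" using schwartz_decay[OF assms] by blast
 from decay_bound_norm[OF this] have B: "norm (\<phi> x) \<le> B / (1 + norm x) ^ (2 * CARD('d) + 1)" for x .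
 have [measurable]: "\<phi> \<in> \<B>" by (intro smooth_borel schwartz_smooth assms)
 have d: "((\<lambda>\<xi>. \<integral>\<^sub>Lx. expi (- \<xi>) x * \<phi> x) has_derivative (\<lambda>v. \<integral>\<^sub>Lx. ?F' \<xi> x v)) (at \<xi>)"
 proof (rule has_derivative_integral[where S = UNIV and G = "\<lambda>x. 2 * pi * (norm x * norm (\<phi> x))"])
  show "integrable lborel (\<lambda>x. expi (- z) x * \<phi> x)" for z
   by (intro integrable_expi_mult schwartz_integrable assms)
  show "((\<lambda>\<xi>. expi (- \<xi>) x * \<phi> x) has_derivative ?F' z x) (at z)" for z x
  proof -
   have "((\<lambda>\<xi>. - (\<i> * of_real (2 * pi * (x \<bullet> \<xi>)))) has_derivative (\<lambda>v. - (\<i> * of_real (2 * pi * (x \<bullet> v))))) (at z)"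
    by (intro has_derivative_mult_right has_derivative_of_real has_derivative_inner_right
      has_derivative_ident has_derivative_minus)
   from has_derivative_mult_left[OF has_derivative_compose[OF this DERIV_exp[unfolded has_field_derivative_def]], of "\<phi> x"]
   show ?thesis
    unfolding expi_def cis_conv_exp by (simp add: mult_ac)
  qed
  show "norm (?F' z x v) \<le> 2 * pi * (norm x * norm (\<phi> x)) * norm v" for z x v
  proof -
   have "norm (?F' z x v) = 2 * pi * \<bar>x \<bullet> v\<bar> * norm (\<phi> x)"
    by (simp add: norm_mult)
   also have "\<dots> \<le> 2 * pi * (norm x * norm v) * norm (\<phi> x)"
    by (intro mult_right_mono mult_left_mono Cauchy_Schwarz_ineq2) auto
   finally show ?thesis by (simp add: mult_ac)
  qed
  have "integrable lborel (\<lambda>x. of_real (norm x) * \<phi> x)"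
  proof (rule integrable_decay(1))
   fix x
   have "norm x * norm (\<phi> x) \<le> (1 + norm x) * (B / (1 + norm x) ^ (2 * CARD('d) + 1))"
    by (intro mult_mono B) auto
   then show "norm (of_real (norm x) * \<phi> x) \<le> B / (1 + norm x) ^ (2 * CARD('d))"
    by (simp add: norm_mult)
  qed measurable
  from integrable_norm[OF this] show "integrable lborel (\<lambda>x. 2 * pi * (norm x * norm (\<phi> x)))"
   by (simp add: norm_mult)
  show "(\<lambda>x. ?F' \<xi> x v) \<in> borel_measurable lborel" for v by measurable
 qed auto
 then show "fourier \<phi> differentiable (at \<xi>)"
  unfolding fourier_eq[abs_def] using differentiableI by blast
 show "partial_deriv j (fourier \<phi>) \<xi> = fourier (\<lambda>x. - 2 * pi * \<i> * (coord j x * \<phi> x)) \<xi>"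
  unfolding fourier_eq[abs_def] partial_deriv_eq[OF d]
  by (simp add: inner_axis coord_def mult_ac)
qed

lemma smooth_fourier:
 assumes "\<phi> \<in> schwartz"
 shows "smooth (fourier \<phi>)"
proof (rule smooth_coinduct[of "\<lambda>f. \<exists>\<phi>\<in>schwartz. f = fourier \<phi>"])
 show "\<exists>\<phi>'\<in>schwartz. fourier \<phi> = fourier \<phi>'" using assms by blast
next
 fix f :: "'a cfun" and x assume "\<exists>\<phi>\<in>schwartz. f = fourier \<phi>"
 then show "f differentiable at x" using partial_deriv_fourier(1) by blast
next
 fix f :: "'a cfun" and j assume "\<exists>\<phi>\<in>schwartz. f = fourier \<phi>"
 then obtain \<phi> where \<phi>: "\<phi> \<in> schwartz" "f = fourier \<phi>" by blast
 have "(\<lambda>x. - 2 * pi * \<i> * (coord j x * \<phi> x)) \<in> schwartz"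
  by (intro schwartz_cmult schwartz_map_schwartz[OF schwartz_map_coord] \<phi>)
 moreover have "partial_deriv j f = fourier (\<lambda>x. - 2 * pi * \<i> * (coord j x * \<phi> x))"
  using \<phi> partial_deriv_fourier(2) by blast
 ultimately show "\<exists>\<phi>\<in>schwartz. partial_deriv j f = fourier \<phi>" by blast
qed

text \<open>By translation invariance the integral of \<open>f\<close> shifted by \<open>h\<close>
  along the axis \<open>j\<close> does not depend on \<open>h\<close>; differentiating it at
  \<open>h = 0\<close> under the integral gives the claim. This takes the place of integration by
  parts.\<close>

lemma integral_partial_deriv_eq_0:
 fixes f :: "'d::finite cfun"
 assumes f: "f \<in> schwartz"
 shows "(\<integral>\<^sub>Lx. partial_deriv j f x) = 0"
proof -
 let ?e = "axis j 1 :: real ^ 'd"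
 have sm: "smooth f" using f schwartz_smooth by blast
 have [measurable]: "f \<in> \<B>" by (rule smooth_borel[OF sm])
 obtain B where B: "decay_bound 1 (2 * CARD('d)) B f" using schwartz_decay[OF f] by blast
 have B0: "0 \<le> B" using decay_bound_nonneg[OF B] .
 have pd: "norm (partial_deriv j f x) \<le> B / (1 + norm x) ^ (2 * CARD('d))" for x
  using B deriv_bound_partial_deriv deriv_bound_norm unfolding decay_bound_def One_nat_def by blast
 have "((\<lambda>h. \<integral>\<^sub>Lx. f (x + h *\<^sub>R ?e)) has_derivative (\<lambda>v. \<integral>\<^sub>Lx. v *\<^sub>R partial_deriv j f (x + 0 *\<^sub>R ?e))) (at 0)"
 proof (rule has_derivative_integral[where S = "ball 0 1" and F' = "\<lambda>h x v. v *\<^sub>R partial_deriv j f (x + h *\<^sub>R ?e)"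
    and G = "\<lambda>x. B * 2 ^ (2 * CARD('d)) * (1 / (1 + norm x) ^ (2 * CARD('d)))"])
  show "integrable lborel (\<lambda>x. f (x + h *\<^sub>R ?e))" for h
   using integrable_lborel_affine[OF schwartz_integrable[OF f], of 1 "h *\<^sub>R ?e"] by (simp add: add.commute)
  show "((\<lambda>h. f (x + h *\<^sub>R ?e)) has_derivative (\<lambda>v. v *\<^sub>R partial_deriv j f (x + h *\<^sub>R ?e))) (at h)" for h x
  proof -
   have "((\<lambda>h. x + h *\<^sub>R ?e) has_derivative (\<lambda>v. v *\<^sub>R ?e)) (at h)"
    by (auto intro!: derivative_eq_intros)
   from has_derivative_compose[OF this smooth_has_derivative[OF sm]]
   have "((\<lambda>h. f (x + h *\<^sub>R ?e)) has_derivative (\<lambda>v. frechet_derivative f (at (x + h *\<^sub>R ?e)) (v *\<^sub>R ?e))) (at h)" .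
   moreover have "linear (frechet_derivative f (at (x + h *\<^sub>R ?e)))"
    using smooth_has_derivative[OF sm] has_derivative_linear by blast
   ultimately show ?thesis by (simp add: linear_scale partial_deriv_def)
  qed
  show "norm (v *\<^sub>R partial_deriv j f (x + h *\<^sub>R ?e)) \<le> B * 2 ^ (2 * CARD('d)) * (1 / (1 + norm x) ^ (2 * CARD('d))) * norm v"
   if "h \<in> ball 0 1" for h x v
  proof -
   have a: "norm x \<le> norm (x + h *\<^sub>R ?e) + norm (h *\<^sub>R ?e)"
    using norm_triangle_ineq4[of "x + h *\<^sub>R ?e" "h *\<^sub>R ?e"] by simp
   have b: "norm (h *\<^sub>R ?e) \<le> 1" using that by simp
   \<comment> \<open>A shift by at most 1 changes the weight by at most a factor 2; this is the
     \<open>2 ^ (2 * CARD('d))\<close> in the dominating function.\<close>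
   have "1 + norm x \<le> 2 * (1 + norm (x + h *\<^sub>R ?e))"
    using add_mono[OF order_trans[OF a add_left_mono[OF b]] norm_ge_zero[of "x + h *\<^sub>R ?e"]] by (simp add: algebra_simps)
   from power_mono[OF this, of "2 * CARD('d)"]
   have "(1 + norm x) ^ (2 * CARD('d)) \<le> 2 ^ (2 * CARD('d)) * (1 + norm (x + h *\<^sub>R ?e)) ^ (2 * CARD('d))"
    by (simp only: power_mult_distrib one_plus_norm_pos)
   from mult_left_mono[OF this B0]
   have "B / (1 + norm (x + h *\<^sub>R ?e)) ^ (2 * CARD('d)) \<le> B * 2 ^ (2 * CARD('d)) * (1 / (1 + norm x) ^ (2 * CARD('d)))"
    by (simp add: divide_simps mult_ac)
   then have "norm (partial_deriv j f (x + h *\<^sub>R ?e)) \<le> B * 2 ^ (2 * CARD('d)) * (1 / (1 + norm x) ^ (2 * CARD('d)))"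
    using pd order_trans by blast
   from mult_right_mono[OF this, of "\<bar>v\<bar>"] show ?thesis by (simp add: mult_ac)
  qed
  show "integrable lborel (\<lambda>x::real ^ 'd. B * 2 ^ (2 * CARD('d)) * (1 / (1 + norm x) ^ (2 * CARD('d))))"
   by (intro integrable_mult_right integrable_inverse_one_plus_norm) simp
  have [measurable]: "partial_deriv j f \<in> \<B>"
   by (intro smooth_borel smooth_partial_deriv sm)
  show "(\<lambda>x. v *\<^sub>R partial_deriv j f (x + 0 *\<^sub>R ?e)) \<in> borel_measurable lborel" for v by simp
 qed auto
 moreover have "(\<lambda>h. \<integral>\<^sub>Lx. f (x + h *\<^sub>R ?e)) = (\<lambda>h. \<integral>\<^sub>Lx. f x)"
 proof
  fix h
  have "(\<integral>\<^sub>Lx. f (h *\<^sub>R ?e + x)) = (\<integral>\<^sub>Lx. f x)"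
   by (rule integral_lborel_translate) simp
  then show "(\<integral>\<^sub>Lx. f (x + h *\<^sub>R ?e)) = (\<integral>\<^sub>Lx. f x)"
   by (subst add.commute)
 qed
 ultimately have "((\<lambda>h. \<integral>\<^sub>Lx. f x) has_derivative (\<lambda>v. v *\<^sub>R (\<integral>\<^sub>Lx. partial_deriv j f x))) (at (0::real))"
  by simp
 from has_derivative_unique[OF this has_derivative_const] show ?thesis
  by (metis scaleR_one)
qed

text \<open>The scalar is generalised in the induction: a derivative of
  \<open>c * expi \<xi>\<close> has the same form, with \<open>c\<close> multiplied by
  \<open>2 * pi * \<i> * coord j \<xi>\<close>.\<close>

lemma deriv_bound_cmult_expi:
 "deriv_bound k (\<lambda>x. c * expi \<xi> x) y ((1 + 2 * pi * norm \<xi>) ^ k * norm c)"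
proof -
 have "norm (partial_derivs js (\<lambda>x. c * expi \<xi> x) y) \<le> (1 + 2 * pi * norm \<xi>) ^ length js * norm c" for js c
 proof (induction js arbitrary: c rule: rev_induct)
  case Nil
  then show ?case by (simp add: norm_mult)
 next
  case (snoc j js)
  have "partial_deriv j (\<lambda>x. c * expi \<xi> x) = (\<lambda>x. (c * (2 * pi * \<i> * coord j \<xi>)) * expi \<xi> x)"
   using partial_derivs_cmult[OF smooth_expi, of "[j]" c \<xi>] by (auto simp: partial_deriv_expi mult_ac)
  then have "norm (partial_derivs (js @ [j]) (\<lambda>x. c * expi \<xi> x) y) \<le>
    (1 + 2 * pi * norm \<xi>) ^ length js * norm (c * (2 * pi * \<i> * coord j \<xi>))"
   using snoc.IH[of "c * (2 * pi * \<i> * coord j \<xi>)"] by (simp add: partial_derivs_snoc)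
  also have "\<dots> \<le> (1 + 2 * pi * norm \<xi>) ^ length js * ((1 + 2 * pi * norm \<xi>) * norm c)"
  proof (rule mult_left_mono)
   have "2 * pi * \<bar>\<xi> $ j\<bar> \<le> 2 * pi * norm \<xi>"
    by (intro mult_left_mono component_le_norm_cart) auto
   then have "norm c * (2 * pi * \<bar>\<xi> $ j\<bar>) \<le> norm c * (1 + 2 * pi * norm \<xi>)"
    by (intro mult_left_mono) (linarith, simp)
   then show "norm (c * (2 * pi * \<i> * coord j \<xi>)) \<le> (1 + 2 * pi * norm \<xi>) * norm c"
    by (simp add: norm_mult coord_def mult_ac)
  qed simp
  finally show ?case by (simp add: mult_ac)
 qed
 moreover have "(1 + 2 * pi * norm \<xi>) ^ length js * norm c \<le> (1 + 2 * pi * norm \<xi>) ^ k * norm c"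
  if "length js \<le> k" for js :: "'a list"
  using that by (intro mult_right_mono power_increasing) auto
 ultimately show ?thesis
  unfolding deriv_bound_def by (meson order_trans)
qed

lemma schwartz_map_expi: "schwartz_map (\<lambda>\<phi> x. expi \<xi> x * \<phi> x)" for \<xi> :: "real ^ 'd::finite"
proof (rule schwartz_map_mult[OF smooth_expi])
 fix k
 have "deriv_bound k (expi \<xi>) x ((1 + 2 * pi * norm \<xi>) ^ k * (1 + norm x) ^ 0)" for x
  using deriv_bound_cmult_expi[of k 1 \<xi> x] by simp
 then show "\<exists>A n. \<forall>x. deriv_bound k (expi \<xi>) x (A * (1 + norm x) ^ n)" by blast
qed

lemma fourier_partial_deriv:
 assumes \<phi>: "\<phi> \<in> schwartz"
 shows "fourier (partial_deriv j \<phi>) \<xi> = 2 * pi * \<i> * coord j \<xi> * fourier \<phi> \<xi>"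
proof -
 let ?e = "expi (- \<xi>)"
 have sm: "smooth \<phi>" using \<phi> schwartz_smooth by blast
 have i1: "integrable lborel (\<lambda>x. ?e x * \<phi> x)"
  and i2: "integrable lborel (\<lambda>x. ?e x * partial_deriv j \<phi> x)"
  by (intro integrable_expi_mult schwartz_integrable \<phi> schwartz_map_schwartz[OF schwartz_map_partial_deriv])+
 have "0 = (\<integral>\<^sub>Lx. partial_deriv j (\<lambda>x. ?e x * \<phi> x) x)"
  by (rule integral_partial_deriv_eq_0[symmetric]) (rule schwartz_map_schwartz[OF schwartz_map_expi \<phi>])
 also have "\<dots> = (\<integral>\<^sub>Lx. - (2 * pi * \<i> * coord j \<xi>) * (?e x * \<phi> x) + ?e x * partial_deriv j \<phi> x)"
  by (intro Bochner_Integration.integral_cong refl)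
    (simp add: partial_deriv_mult smooth_differentiable smooth_expi sm partial_deriv_expi coord_def)
 also have "\<dots> = - (2 * pi * \<i> * coord j \<xi>) * fourier \<phi> \<xi> + fourier (partial_deriv j \<phi>) \<xi>"
  unfolding fourier_eq
  by (subst Bochner_Integration.integral_add[OF integrable_mult_right[OF i1] i2]) (simp only: integral_mult_right_zero)
 finally show ?thesis by (simp add: algebra_simps)
qed

text \<open>The operation on \<open>\<phi>\<close> that corresponds to applying
  \<open>partial_derivs js\<close> to \<open>fourier \<phi>\<close>.\<close>

primrec mult_coords :: "'d list \<Rightarrow> ('d::finite cfun) \<Rightarrow> 'd cfun" where
 "mult_coords [] \<phi> = \<phi>"
| "mult_coords (j # js) \<phi> = (\<lambda>x. - 2 * pi * \<i> * (coord j x * mult_coords js \<phi> x))"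

lemma schwartz_map_mult_coords: "schwartz_map (mult_coords js)"
proof (induction js)
 case Nil
 have "mult_coords [] = (\<lambda>\<phi> :: 'a cfun. \<phi>)" by auto
 then show ?case using schwartz_map_id by simp
next
 case (Cons j js)
 from schwartz_map_compose[OF schwartz_map_cmult schwartz_map_compose[OF schwartz_map_coord Cons], of "- 2 * pi * \<i>" j]
 show ?case by simp
qed

lemma schwartz_map_partial_derivs: "schwartz_map (partial_derivs js)"
proof (induction js)
 case Nil
 have "partial_derivs [] = (\<lambda>\<phi> :: 'a cfun. \<phi>)" by auto
 then show ?case using schwartz_map_id by simp
next
 case (Cons j js)
 from schwartz_map_compose[OF schwartz_map_partial_deriv Cons, of j]
 show ?case by simp
qed

lemma partial_derivs_fourier:
 assumes "\<phi> \<in> schwartz"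
 shows "partial_derivs js (fourier \<phi>) = fourier (mult_coords js \<phi>)"
proof (induction js)
 case (Cons j js)
 then show ?case
  using partial_deriv_fourier(2)[OF schwartz_map_schwartz[OF schwartz_map_mult_coords assms]] by auto
qed simp

lemma fourier_partial_derivs_replicate:
 assumes "\<phi> \<in> schwartz"
 shows "fourier (partial_derivs (replicate n j) \<phi>) \<xi> = (2 * pi * \<i> * coord j \<xi>) ^ n * fourier \<phi> \<xi>"
proof (induction n)
 case (Suc n)
 then show ?case
  using fourier_partial_deriv[OF schwartz_map_schwartz[OF schwartz_map_partial_derivs assms]] by simp
qed simp

text \<open>Decay of order \<open>N\<close> is tested on the transforms of
  \<open>partial_derivs (replicate N j) \<phi>\<close>, each of which is bounded by an
  \<open>L^1\<close> norm; the weight \<open>2 * CARD('d)\<close> in the hypothesis makes these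
  norms finite. The factor \<open>2 * pi\<close> exceeds 1 and is dropped.\<close>

lemma fourier_decay:
 fixes \<phi> :: "'d::finite cfun"
 assumes "\<phi> \<in> schwartz" "decay_bound N (2 * CARD('d)) B \<phi>"
 shows "(1 + norm \<xi>) ^ N * norm (fourier \<phi> \<xi>) \<le>
  (2 * real CARD('d)) ^ N * (1 + real CARD('d)) * bracket_integral TYPE('d) * B"
proof -
 let ?I = "bracket_integral TYPE('d)"
 have est: "norm (fourier (partial_derivs js \<phi>) \<xi>) \<le> B * ?I" if "length js \<le> N" for js
 proof (rule order_trans[OF norm_fourier_le integrable_decay(2)])
  show "partial_derivs js \<phi> \<in> \<B>"
   using assms(1) by (intro smooth_borel smooth_partial_derivs schwartz_smooth)
  show "norm (partial_derivs js \<phi> x) \<le> B / (1 + norm x) ^ (2 * CARD('d))" for x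
   using assms(2) that unfolding decay_bound_def deriv_bound_def by blast
 qed
 let ?p = "norm (fourier \<phi> \<xi>)"
 have "(1 + norm \<xi>) ^ N * ?p \<le> (2 * real CARD('d)) ^ N * (1 + (\<Sum>j\<in>UNIV. \<bar>\<xi> $ j\<bar> ^ N)) * ?p"
  by (intro mult_right_mono power_one_plus_norm_le) auto
 also have "\<dots> = (2 * real CARD('d)) ^ N * (?p + (\<Sum>j\<in>UNIV. \<bar>\<xi> $ j\<bar> ^ N * ?p))"
  by (simp add: algebra_simps sum_distrib_left sum_distrib_right)
 also have "\<dots> \<le> (2 * real CARD('d)) ^ N * (B * ?I + (\<Sum>j\<in>(UNIV :: 'd set). B * ?I))"
 proof (intro mult_left_mono add_mono sum_mono)
  show "?p \<le> B * ?I" using est[of "[]"] by simp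
  fix j
  have "\<bar>\<xi> $ j\<bar> ^ N * ?p \<le> (2 * pi * \<bar>\<xi> $ j\<bar>) ^ N * ?p"
  proof (intro mult_right_mono power_mono)
   show "\<bar>\<xi> $ j\<bar> \<le> 2 * pi * \<bar>\<xi> $ j\<bar>"
    using mult_right_mono[of 1 "2 * pi" "\<bar>\<xi> $ j\<bar>"] pi_gt3 by simp
  qed auto
  also have "\<dots> = norm (fourier (partial_derivs (replicate N j) \<phi>) \<xi>)"
   by (simp add: fourier_partial_derivs_replicate[OF assms(1)] norm_mult norm_power coord_def)
  also have "\<dots> \<le> B * ?I" by (rule est) simp
  finally show "\<bar>\<xi> $ j\<bar> ^ N * ?p \<le> B * ?I" .
 qed auto
 finally show ?thesis by (simp add: algebra_simps)
qed

lemma schwartz_map_fourier: "schwartz_map (fourier :: ('d::finite cfun) \<Rightarrow> _)"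
proof (rule schwartz_mapI)
 show "smooth (fourier \<phi>)" if "\<phi> \<in> schwartz" for \<phi> :: "'d cfun"
  by (rule smooth_fourier[OF that])
 fix N
 define L where "L = max N (2 * CARD('d))"
 define K where "K = (2 * real CARD('d)) ^ N * (1 + real CARD('d)) * bracket_integral TYPE('d)"
 have K0: "0 \<le> K" unfolding K_def by (intro mult_nonneg_nonneg bracket_integral_nonneg) auto
 have "\<forall>js :: 'd list. \<exists>M C. 0 \<le> C \<and> (\<forall>\<phi>\<in>schwartz. \<forall>B. decay_bound M M B \<phi> \<longrightarrow> decay_bound L L (C * B) (mult_coords js \<phi>))"
  using schwartz_map_mult_coords unfolding schwartz_map_def by blast
 then obtain M C where MC: "\<And>js :: 'd list. 0 \<le> C js"
  "\<And>js \<phi> B. \<phi> \<in> schwartz \<Longrightarrow> decay_bound (M js) (M js) B \<phi> \<Longrightarrow> decay_bound L L (C js * B) (mult_coords js \<phi>)"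
  by metis
 let ?J = "{js :: 'd list. length js \<le> N}"
 \<comment> \<open>Sums over the finitely many lists of length at most \<open>N\<close> serve as
   common upper bounds for the orders and constants.\<close>
 define M' where "M' = (\<Sum>js\<in>?J. M js)"
 define C' where "C' = (\<Sum>js\<in>?J. C js)"
 have MC': "M js \<le> M'" "C js \<le> C'" if "js \<in> ?J" for js
  unfolding M'_def C'_def using that MC(1) by (auto intro!: member_le_sum finite_lists_length)
 have "decay_bound N N (K * C' * B) (fourier \<phi>)" if \<phi>: "\<phi> \<in> schwartz" and B: "decay_bound M' M' B \<phi>" for \<phi> :: "'d cfun" and B
  unfolding decay_bound_iff
 proof (intro allI impI)
  fix js :: "'d list" and \<xi> :: "real ^ 'd" assume js: "length js \<le> N"
  have "decay_bound (M js) (M js) B \<phi>"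
   using decay_bound_mono[OF B MC'(1) MC'(1)] js by auto
  from MC(2)[OF \<phi> this] have "decay_bound N (2 * CARD('d)) (C js * B) (mult_coords js \<phi>)"
   by (rule decay_bound_mono) (auto simp: L_def)
  from fourier_decay[OF schwartz_map_schwartz[OF schwartz_map_mult_coords \<phi>] this, of \<xi>]
  have "(1 + norm \<xi>) ^ N * norm (fourier (mult_coords js \<phi>) \<xi>) \<le> K * (C js * B)"
   by (simp add: K_def)
  also have "\<dots> \<le> K * (C' * B)"
   using js MC'(2) K0 decay_bound_nonneg[OF B] by (intro mult_left_mono mult_right_mono) auto
  finally show "(1 + norm \<xi>) ^ N * norm (partial_derivs js (fourier \<phi>) \<xi>) \<le> K * C' * B"
   by (simp add: partial_derivs_fourier[OF \<phi>] mult.assoc)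
 qed
 moreover have "0 \<le> K * C'" using K0 MC(1) unfolding C'_def by (intro mult_nonneg_nonneg sum_nonneg)
 ultimately show "\<exists>M C. 0 \<le> C \<and> (\<forall>\<phi>::'d cfun\<in>schwartz. \<forall>B. decay_bound M M B \<phi> \<longrightarrow> decay_bound N N (C * B) (fourier \<phi>))"
  by blast
qed

lemma schwartz_map_reflect: "schwartz_map (\<lambda>\<phi> x. \<phi> (- x))"
proof (rule schwartz_mapI)
 show "smooth (\<lambda>x. \<phi> (- x))" if "\<phi> \<in> schwartz" for \<phi> :: "'a cfun"
  using smooth_affine(1)[OF schwartz_smooth[OF that], of "-1" 0] by simp
 fix N
 have "decay_bound N N (1 * B) (\<lambda>x. \<phi> (- x))" if "\<phi> \<in> schwartz" "decay_bound N N B \<phi>" for \<phi> :: "'a cfun" and B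
  unfolding decay_bound_def
 proof
  fix x
  have "deriv_bound N \<phi> (- x) (B / (1 + norm (- x)) ^ N)" using that(2) unfolding decay_bound_def by blast
  then show "deriv_bound N (\<lambda>x. \<phi> (- x)) x (1 * B / (1 + norm x) ^ N)"
   using deriv_bound_affine[OF schwartz_smooth[OF that(1)], of N "-1" x 0 "B / (1 + norm x) ^ N" 1] by simp
 qed
 then show "\<exists>M C. 0 \<le> C \<and> (\<forall>\<phi>\<in>schwartz. \<forall>B. decay_bound M M B \<phi> \<longrightarrow> decay_bound N N (C * B) (\<lambda>x :: real ^ 'a. \<phi> (- x)))"
  by (intro exI[of _ N] exI[of _ 1]) auto
qed

lemma schwartz_map_inv_fourier: "schwartz_map (inv_fourier :: ('d::finite cfun) \<Rightarrow> _)"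
proof -
 have eq: "inv_fourier = (\<lambda>(\<phi> :: 'd cfun) x. fourier \<phi> (- x))" by (intro ext) (rule inv_fourier_eq)
 show ?thesis
  unfolding eq by (rule schwartz_map_compose[OF schwartz_map_reflect schwartz_map_fourier])
qed

section \<open>Conjugates, products and translates of Schwartz functions\<close>

lemma schwartz_cnj:
 assumes "f \<in> schwartz"
 shows "(\<lambda>x. cnj (f x)) \<in> schwartz"
 using assms unfolding schwartz_iff decay_bound_def by (simp add: smooth_cnj deriv_bound_cnj)

lemma schwartz_mult:
 assumes "f \<in> schwartz" "g \<in> schwartz"
 shows "(\<lambda>x. f x * g x) \<in> schwartz"
proof -
 have "schwartz_map (\<lambda>\<phi> x. f x * \<phi> x)"
 proof (rule schwartz_map_mult)
  fix k
  obtain A where "decay_bound k 0 A f" using schwartz_decay[OF assms(1)] by blast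
  then show "\<exists>A n. \<forall>x. deriv_bound k f x (A * (1 + norm x) ^ n)"
   unfolding decay_bound_def by (intro exI[of _ A] exI[of _ 0]) simp
 qed (rule schwartz_smooth[OF assms(1)])
 from schwartz_map_schwartz[OF this assms(2)] show ?thesis .
qed

text \<open>Peetre's inequality, in the form of submultiplicativity of the weight; the estimates for
  shifted functions below rest on it.\<close>

lemma one_plus_norm_shift: "1 + norm x \<le> (1 + norm b) * (1 + norm (x + b))" for x b :: "'a::real_normed_vector"
proof -
 have "norm x \<le> norm (x + b) + norm b" using norm_triangle_ineq4[of "x + b" b] by simp
 moreover have "0 \<le> norm b * norm (x + b)" by simp
 moreover have "(1 + norm b) * (1 + norm (x + b)) = 1 + norm b + norm (x + b) + norm b * norm (x + b)"
  by (simp add: algebra_simps)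
 ultimately show ?thesis by linarith
qed

lemma decay_bound_translate:
 assumes "smooth f" "decay_bound k N B f"
 shows "decay_bound k N ((1 + norm b) ^ N * B) (\<lambda>x. f (x + b))"
 unfolding decay_bound_def
proof
 fix x
 have "deriv_bound k f (x + b) (B / (1 + norm (x + b)) ^ N)" using assms(2) unfolding decay_bound_def by blast
 moreover have "B / (1 + norm (x + b)) ^ N \<le> (1 + norm b) ^ N * B / (1 + norm x) ^ N"
 proof -
  have "(1 + norm x) ^ N \<le> (1 + norm b) ^ N * (1 + norm (x + b)) ^ N"
   unfolding power_mult_distrib[symmetric] by (intro power_mono one_plus_norm_shift) auto
  from mult_left_mono[OF this decay_bound_nonneg[OF assms(2)]]
  show ?thesis by (simp add: divide_simps mult_ac)
 qed
 ultimately have "deriv_bound k f (x + b) ((1 + norm b) ^ N * B / (1 + norm x) ^ N)"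
  using deriv_bound_mono by blast
 then show "deriv_bound k (\<lambda>x. f (x + b)) x ((1 + norm b) ^ N * B / (1 + norm x) ^ N)"
  using deriv_bound_translate[OF assms(1)] by blast
qed

lemma schwartz_translate:
 assumes "f \<in> schwartz"
 shows "(\<lambda>x. f (x + b)) \<in> schwartz"
 using assms decay_bound_translate smooth_translate unfolding schwartz_iff by blast

subsection \<open>Inversion and the Plancherel inequality\<close>

lemma fourier_multiplication_formula:
 fixes f h :: "'d::finite cfun"
 assumes f: "integrable lborel f" and h: "integrable lborel h"
 shows "(\<integral>\<^sub>L\<xi>. fourier f \<xi> * h \<xi>) = (\<integral>\<^sub>Lx. f x * fourier h x)"
proof -
 have [measurable]: "f \<in> \<B>" "h \<in> \<B>"
  using f h by (auto dest: borel_measurable_integrable)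
 let ?F = "\<lambda>(x, \<xi>). expi (- \<xi>) x * f x * h \<xi>"
 have m: "?F \<in> \<B>"
  unfolding borel_prod[symmetric] by measurable
 have "(\<integral>\<^sub>L\<xi>. fourier f \<xi> * h \<xi>) = (\<integral>\<^sub>L\<xi>. (\<integral>\<^sub>Lx. ?F (x, \<xi>)))"
  by (simp add: fourier_eq)
 also have "\<dots> = (\<integral>\<^sub>Lx. (\<integral>\<^sub>L\<xi>. ?F (x, \<xi>)))"
  by (rule Fubini_bound[OF m integrable_norm[OF f] integrable_norm[OF h]]) (simp add: norm_mult)
 also have "(\<lambda>x. (\<integral>\<^sub>L\<xi>. ?F (x, \<xi>))) = (\<lambda>x. f x * fourier h x)"
 proof
  fix x
  have "(\<integral>\<^sub>L\<xi>. ?F (x, \<xi>)) = (\<integral>\<^sub>L\<xi>. f x * (expi (- x) \<xi> * h \<xi>))"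
   by (intro Bochner_Integration.integral_cong refl) (simp add: expi_def inner_commute)
  then show "(\<integral>\<^sub>L\<xi>. ?F (x, \<xi>)) = f x * fourier h x"
   unfolding fourier_eq by (simp only: integral_mult_right_zero)
 qed
 finally show ?thesis .
qed

lemma fourier_dilation:
 assumes [measurable]: "h \<in> \<B>" and e: "0 < \<epsilon>"
 shows "fourier (\<lambda>\<xi>. h (\<epsilon> *\<^sub>R \<xi>)) (\<epsilon> *\<^sub>R z) = (1 / \<epsilon> ^ CARD('d)) *\<^sub>R fourier h (z :: real ^ 'd::finite)"
proof -
 have "fourier h z = \<epsilon> ^ CARD('d) *\<^sub>R (\<integral>\<^sub>L\<xi>. expi (- z) (\<epsilon> *\<^sub>R \<xi>) * h (\<epsilon> *\<^sub>R \<xi>))"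
  unfolding fourier_eq
  using e by (subst integral_lborel_affine[of _ \<epsilon> 0]) auto
 also have "(\<integral>\<^sub>L\<xi>. expi (- z) (\<epsilon> *\<^sub>R \<xi>) * h (\<epsilon> *\<^sub>R \<xi>)) = fourier (\<lambda>\<xi>. h (\<epsilon> *\<^sub>R \<xi>)) (\<epsilon> *\<^sub>R z)"
  unfolding fourier_eq
  by (intro Bochner_Integration.integral_cong refl) (simp add: expi_scaleR[symmetric])
 finally show ?thesis using e by simp
qed

lemma integrable_dilation:
 fixes h :: "'a::euclidean_space \<Rightarrow> complex"
 assumes "integrable lborel h" "0 < \<epsilon>"
 shows "integrable lborel (\<lambda>x. h (\<epsilon> *\<^sub>R x))"
 using integrable_lborel_affine[OF assms(1), of \<epsilon> 0] assms(2) by simp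

lemma fourier_modulation: "fourier (\<lambda>\<xi>. expi a \<xi> * h \<xi>) y = fourier h (y - a)"
 unfolding fourier_eq
 by (intro Bochner_Integration.integral_cong refl) (simp add: expi_add(1)[symmetric] mult.assoc[symmetric] add.commute)

text \<open>The factor \<open>h (\<epsilon> *\<^sub>R \<xi>)\<close> regularises the inversion
  integral. The multiplication formula moves the transform onto this factor, and the substitution
  \<open>y = x + \<epsilon> *\<^sub>R z\<close> absorbs its concentration at \<open>x\<close>,
  leaving a right-hand side that converges as \<open>\<epsilon>\<close> tends to 0.\<close>

lemma fourier_inversion_dilation:
 fixes f h :: "'d::finite cfun"
 assumes f: "integrable lborel f" and h: "integrable lborel h" and e: "0 < \<epsilon>"
 shows "(\<integral>\<^sub>L\<xi>. fourier f \<xi> * (expi x \<xi> * h (\<epsilon> *\<^sub>R \<xi>))) = (\<integral>\<^sub>Lz. f (x + \<epsilon> *\<^sub>R z) * fourier h z)"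
proof -
 have [measurable]: "f \<in> \<B>" "h \<in> \<B>"
  using f h by (auto dest: borel_measurable_integrable)
 have [measurable]: "fourier (\<lambda>\<xi>. expi x \<xi> * h (\<epsilon> *\<^sub>R \<xi>)) \<in> \<B>"
  by (intro fourier_measurable integrable_expi_mult integrable_dilation h e)
 have "(\<integral>\<^sub>L\<xi>. fourier f \<xi> * (expi x \<xi> * h (\<epsilon> *\<^sub>R \<xi>))) = (\<integral>\<^sub>Ly. f y * fourier (\<lambda>\<xi>. expi x \<xi> * h (\<epsilon> *\<^sub>R \<xi>)) y)"
  by (intro fourier_multiplication_formula f integrable_expi_mult integrable_dilation h e)
 also have "\<dots> = \<epsilon> ^ CARD('d) *\<^sub>R (\<integral>\<^sub>Lz. f (x + \<epsilon> *\<^sub>R z) * fourier (\<lambda>\<xi>. expi x \<xi> * h (\<epsilon> *\<^sub>R \<xi>)) (x + \<epsilon> *\<^sub>R z))"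
  using e by (subst integral_lborel_affine[of _ \<epsilon> x]) auto
 also have "(\<lambda>z. f (x + \<epsilon> *\<^sub>R z) * fourier (\<lambda>\<xi>. expi x \<xi> * h (\<epsilon> *\<^sub>R \<xi>)) (x + \<epsilon> *\<^sub>R z)) =
   (\<lambda>z. (1 / \<epsilon> ^ CARD('d)) *\<^sub>R (f (x + \<epsilon> *\<^sub>R z) * fourier h z))"
  by (simp add: fourier_modulation fourier_dilation[OF _ e])
 also have "(\<integral>\<^sub>Lz. (1 / \<epsilon> ^ CARD('d)) *\<^sub>R (f (x + \<epsilon> *\<^sub>R z) * fourier h z)) = (1 / \<epsilon> ^ CARD('d)) *\<^sub>R (\<integral>\<^sub>Lz. f (x + \<epsilon> *\<^sub>R z) * fourier h z)"
  by (rule integral_scaleR_right)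
 finally show ?thesis using e by simp
qed

lemma tendsto_dilation:
 fixes f :: "'a::real_normed_vector \<Rightarrow> complex"
 assumes "continuous_on UNIV f"
 shows "(\<lambda>n. f (x + (1 / real (Suc n)) *\<^sub>R z)) \<longlonglongrightarrow> f x"
proof -
 have "(\<lambda>n. x + (1 / real (Suc n)) *\<^sub>R z) \<longlonglongrightarrow> x + 0 *\<^sub>R z"
  by (intro tendsto_intros LIMSEQ_Suc lim_1_over_n)
 then show ?thesis
  using assms by (auto simp: continuous_on_eq_continuous_at intro: isCont_tendsto_compose)
qed

text \<open>The limit of the regularised identity on both sides, by dominated convergence. An
  arbitrary Schwartz function \<open>h\<close> plays the role of the usual Gaussian; the conclusion
  is inversion up to a factor that depends neither on \<open>f\<close> nor on \<open>x\<close>,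
  provided \<open>h 0\<close> is nonzero.\<close>

lemma fourier_inversion_weighted:
 fixes f h :: "'d::finite cfun"
 assumes f: "f \<in> schwartz" and h: "h \<in> schwartz"
 shows "h 0 * inv_fourier (fourier f) x = f x * (\<integral>\<^sub>Lz. fourier h z)"
proof -
 have Ff: "fourier f \<in> schwartz" and Fh: "fourier h \<in> schwartz"
  using schwartz_map_schwartz[OF schwartz_map_fourier] f h by auto
 obtain A where "decay_bound 0 0 A h" using schwartz_decay[OF h] by blast
 from decay_bound_norm[OF this] have A: "norm (h x) \<le> A" for x by simp
 obtain A' where "decay_bound 0 0 A' f" using schwartz_decay[OF f] by blast
 from decay_bound_norm[OF this] have A': "norm (f x) \<le> A'" for x by simp
 have [measurable]: "f \<in> \<B>" "h \<in> \<B>"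
  "fourier f \<in> \<B>" "fourier h \<in> \<B>"
  using f h Ff Fh by (auto intro: smooth_borel schwartz_smooth)
 have c: "continuous_on UNIV f" "continuous_on UNIV h"
  using f h by (auto intro: smooth_continuous_on schwartz_smooth)
 let ?e = "\<lambda>n. 1 / real (Suc n)"
 have "(\<lambda>n. \<integral>\<^sub>L\<xi>. fourier f \<xi> * (expi x \<xi> * h (?e n *\<^sub>R \<xi>))) \<longlonglongrightarrow> (\<integral>\<^sub>L\<xi>. fourier f \<xi> * (expi x \<xi> * h 0))"
 proof (rule integral_dominated_convergence[where w = "\<lambda>\<xi>. norm (fourier f \<xi>) * A"])
  show "AE \<xi> in lborel. (\<lambda>n. fourier f \<xi> * (expi x \<xi> * h (?e n *\<^sub>R \<xi>))) \<longlonglongrightarrow> fourier f \<xi> * (expi x \<xi> * h 0)"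
   using tendsto_dilation[OF c(2), of 0] by (intro AE_I2 tendsto_intros) simp
  show "AE \<xi> in lborel. norm (fourier f \<xi> * (expi x \<xi> * h (?e n *\<^sub>R \<xi>))) \<le> norm (fourier f \<xi>) * A" for n
   using A by (intro AE_I2) (simp add: norm_mult mult_left_mono)
  show "integrable lborel (\<lambda>\<xi>. norm (fourier f \<xi>) * A)"
   by (intro integrable_mult_left integrable_norm schwartz_integrable Ff)
 qed measurable
 moreover have "(\<lambda>n. \<integral>\<^sub>Lz. f (x + ?e n *\<^sub>R z) * fourier h z) \<longlonglongrightarrow> (\<integral>\<^sub>Lz. f x * fourier h z)"
 proof (rule integral_dominated_convergence[where w = "\<lambda>z. A' * norm (fourier h z)"])
  show "AE z in lborel. (\<lambda>n. f (x + ?e n *\<^sub>R z) * fourier h z) \<longlonglongrightarrow> f x * fourier h z"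
   using tendsto_dilation[OF c(1)] by (intro AE_I2 tendsto_intros) simp
  show "AE z in lborel. norm (f (x + ?e n *\<^sub>R z) * fourier h z) \<le> A' * norm (fourier h z)" for n
   using A' by (intro AE_I2) (simp add: norm_mult mult_right_mono)
  show "integrable lborel (\<lambda>z. A' * norm (fourier h z))"
   by (intro integrable_mult_right integrable_norm schwartz_integrable Fh)
 qed measurable
 moreover have "(\<integral>\<^sub>L\<xi>. fourier f \<xi> * (expi x \<xi> * h (?e n *\<^sub>R \<xi>))) = (\<integral>\<^sub>Lz. f (x + ?e n *\<^sub>R z) * fourier h z)" for n
  by (intro fourier_inversion_dilation schwartz_integrable f h) simp
 ultimately have "(\<integral>\<^sub>L\<xi>. fourier f \<xi> * (expi x \<xi> * h 0)) = (\<integral>\<^sub>Lz. f x * fourier h z)"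
  by (simp add: LIMSEQ_unique)
 moreover have "(\<integral>\<^sub>L\<xi>. fourier f \<xi> * (expi x \<xi> * h 0)) = (\<integral>\<^sub>L\<xi>. h 0 * (expi x \<xi> * fourier f \<xi>))"
  by (simp add: mult_ac)
 moreover have "(\<integral>\<^sub>L\<xi>. h 0 * (expi x \<xi> * fourier f \<xi>)) = h 0 * inv_fourier (fourier f) x"
  by (simp add: inv_fourier_eq fourier_eq[of "fourier f"])
 ultimately show ?thesis by simp
qed

lemma borel_measurable_cnj [measurable]: "cnj \<in> \<B>"
 by (intro borel_measurable_continuous_onI continuous_intros)

lemma open_AE_not_mem_empty:
 fixes S :: "'a::euclidean_space set"
 assumes "open S" "AE x in lborel. x \<notin> S"
 shows "S = {}"
proof -
 have "S \<in> null_sets lborel"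
  using assms by (subst AE_iff_null_sets) auto
 then have "negligible S"
  by (simp add: negligible_iff_null_sets null_sets_completionI)
 then show ?thesis using assms(1) open_not_negligible by blast
qed

lemma schwartz_integrable_norm_square:
 assumes "f \<in> schwartz"
 shows "integrable lborel (\<lambda>x. (norm (f x))\<^sup>2)"
 using integrable_norm[OF schwartz_integrable[OF schwartz_mult[OF assms assms]]]
 by (simp add: norm_mult power2_eq_square)

lemma schwartz_integral_norm_square_eq_0:
 assumes f: "f \<in> schwartz" and 0: "(\<integral>\<^sub>Lx. (norm (f x))\<^sup>2) = 0"
 shows "f x = 0"
proof -
 have "AE x in lborel. (norm (f x))\<^sup>2 = 0"
  using 0 integral_nonneg_eq_0_iff_AE[OF schwartz_integrable_norm_square[OF f]] by simp
 then have "AE x in lborel. x \<notin> {x. f x \<noteq> 0}"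
  by simp
 moreover have "open {x. f x \<noteq> 0}"
  using smooth_continuous_on[OF schwartz_smooth[OF f], of UNIV]
  by (intro open_Collect_neq continuous_intros) auto
 ultimately show ?thesis using open_AE_not_mem_empty by blast
qed

text \<open>The factor is the integral of \<open>fourier h\<close> divided by \<open>h 0\<close>,
  with \<open>h\<close> a translate of \<open>g\<close> that is nonzero at the origin. It cannot
  vanish: otherwise the multiplication formula would force \<open>fourier f = 0\<close> for
  \<open>f = h * cnj h\<close>, whereas \<open>fourier f 0\<close> is the square integral of
  \<open>h\<close>.\<close>

lemma fourier_inversion:
 fixes g :: "'d::finite cfun"
 assumes g: "g \<in> schwartz" "g \<noteq> (\<lambda>x. 0)"
 shows "\<exists>c. c \<noteq> 0 \<and> (\<forall>f::'d cfun\<in>schwartz. \<forall>x. inv_fourier (fourier f) x = c * f x)"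
proof -
 obtain x0 where x0: "g x0 \<noteq> 0" using g(2) by auto
 define h where "h x = g (x + x0)" for x
 have h: "h \<in> schwartz" unfolding h_def by (rule schwartz_translate[OF g(1)])
 have h0: "h 0 \<noteq> 0" using x0 by (simp add: h_def)
 define c where "c = (\<integral>\<^sub>Lz. fourier h z) / h 0"
 have inv: "inv_fourier (fourier f) x = c * f x" if "f \<in> schwartz" for f :: "'d cfun" and x
  using fourier_inversion_weighted[OF that h, of x] h0 by (simp add: c_def field_simps)
 have "c \<noteq> 0"
 proof
  assume c: "c = 0"
  define f where "f x = h x * cnj (h x)" for x
  have f: "f \<in> schwartz" unfolding f_def by (intro schwartz_mult schwartz_cnj h)
  have Ff: "fourier f \<in> schwartz" by (rule schwartz_map_schwartz[OF schwartz_map_fourier f])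
  have "(\<integral>\<^sub>L\<xi>. of_real ((norm (fourier f \<xi>))\<^sup>2)) = (\<integral>\<^sub>L\<xi>. fourier f \<xi> * cnj (fourier f \<xi>))"
   by (simp only: complex_norm_square)
  also have "\<dots> = (\<integral>\<^sub>Lx. f x * fourier (\<lambda>\<xi>. cnj (fourier f \<xi>)) x)"
   by (intro fourier_multiplication_formula schwartz_integrable f schwartz_cnj Ff)
  also have "(\<lambda>x. fourier (\<lambda>\<xi>. cnj (fourier f \<xi>)) x) = (\<lambda>x. cnj (inv_fourier (fourier f) x))"
   unfolding inv_fourier_eq fourier_eq[of "\<lambda>\<xi>. cnj (fourier f \<xi>)"] fourier_eq[of "fourier f"]
   by (rule ext, subst Bochner_Integration.integral_cnj[symmetric]) (simp add: cnj_expi)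
  also have "(\<integral>\<^sub>Lx. f x * cnj (inv_fourier (fourier f) x)) = 0"
   by (simp add: inv[OF f] c)
  finally have "(\<integral>\<^sub>L\<xi>. (norm (fourier f \<xi>))\<^sup>2) = 0"
   by (simp only: integral_complex_of_real of_real_eq_0_iff)
  from schwartz_integral_norm_square_eq_0[OF Ff this] have "fourier f 0 = 0" .
  moreover have "fourier f 0 = of_real (\<integral>\<^sub>Lx. (norm (h x))\<^sup>2)"
   unfolding fourier_eq f_def
   by (subst integral_complex_of_real[symmetric]) (simp only: complex_norm_square minus_zero expi_zero mult_1)
  ultimately have "(\<integral>\<^sub>Lx. (norm (h x))\<^sup>2) = 0" by simp
  from schwartz_integral_norm_square_eq_0[OF h this] h0 show False by blast
 qed
 with inv show ?thesis by blast
qed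

text \<open>Stated for merely integrable \<open>f\<close>, since it will be applied to truncations
  that are not smooth; the right-hand side may be infinite. Regularised by
  \<open>h (\<epsilon> *\<^sub>R \<xi>)\<close>, the square integral of the transform becomes a
  double integral that is bounded uniformly in \<open>\<epsilon>\<close>, and Fatou's lemma removes
  the regularisation.\<close>

lemma plancherel_inequality:
 fixes g :: "'d::finite cfun"
 assumes g: "g \<in> schwartz" "g \<noteq> (\<lambda>x. 0)"
 shows "\<exists>C\<ge>0. \<forall>f::'d cfun. integrable lborel f \<longrightarrow>
  (\<integral>\<^sub>+\<xi>. ennreal ((norm (fourier f \<xi>))\<^sup>2)) \<le> ennreal C * (\<integral>\<^sub>+x. ennreal ((norm (f x))\<^sup>2))"
proof -
 obtain x0 where x0: "g x0 \<noteq> 0" using g(2) by auto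
 define h0 where "h0 x = g (x + x0)" for x
 have h0: "h0 \<in> schwartz" unfolding h0_def by (rule schwartz_translate[OF g(1)])
 \<comment> \<open>A square is nonnegative, so the regularised integrand equals its absolute value,
   and \<open>h\<close> is positive at 0.\<close>
 define h where "h x = h0 x * cnj (h0 x)" for x
 have h: "h \<in> schwartz" unfolding h_def by (intro schwartz_mult schwartz_cnj h0)
 have hreal: "h x = of_real (norm (h x))" for x
  by (simp add: h_def norm_mult complex_norm_square[symmetric] power2_eq_square)
 have hc: "cnj (h x) = h x" for x
  by (simp add: h_def mult.commute)
 have hpos: "0 < norm (h 0)" using x0 by (simp add: h_def h0_def)
 have hint: "integrable lborel h" by (rule schwartz_integrable[OF h])
 have Fh: "fourier h \<in> schwartz" by (rule schwartz_map_schwartz[OF schwartz_map_fourier h])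
 have [measurable]: "h \<in> \<B>" "fourier h \<in> \<B>"
  by (intro smooth_borel schwartz_smooth h Fh)+
 define K where "K = (\<integral>\<^sub>Lz. norm (fourier h z))"
 have K0: "0 \<le> K" unfolding K_def by simp
 have Keq: "(\<integral>\<^sub>+z. ennreal (norm (fourier h z))) = ennreal K"
  unfolding K_def by (rule nn_integral_eq_integral[OF integrable_norm[OF schwartz_integrable[OF Fh]]]) simp
 have main: "(\<integral>\<^sub>+\<xi>. ennreal ((norm (fourier f \<xi>))\<^sup>2)) \<le> ennreal (K / norm (h 0)) * (\<integral>\<^sub>+x. ennreal ((norm (f x))\<^sup>2))"
  if f: "integrable lborel f" for f :: "'d cfun"
 proof -
  have [measurable]: "f \<in> \<B>"
   using borel_measurable_integrable[OF f] by simp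
  have [measurable]: "fourier f \<in> \<B>" by (rule fourier_measurable[OF f])
  let ?N = "\<integral>\<^sub>+x. ennreal ((norm (f x))\<^sup>2)"
  have eps: "(\<integral>\<^sub>+\<xi>. ennreal ((norm (fourier f \<xi>))\<^sup>2 * norm (h (\<epsilon> *\<^sub>R \<xi>)))) \<le> ennreal K * ?N" if e: "0 < \<epsilon>" for \<epsilon>
  proof -
   define G where "G \<xi> = cnj (fourier f \<xi>) * h (\<epsilon> *\<^sub>R \<xi>)" for \<xi>
   have hd: "integrable lborel (\<lambda>\<xi>. h (\<epsilon> *\<^sub>R \<xi>))" by (rule integrable_dilation[OF hint e])
   define F0 where "F0 = (\<integral>\<^sub>Lx. norm (f x))"
   have G: "integrable lborel G"
   proof (rule Bochner_Integration.integrable_bound)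
    show "integrable lborel (\<lambda>\<xi>. of_real F0 * h (\<epsilon> *\<^sub>R \<xi>))" using hd by simp
    show "G \<in> borel_measurable lborel" unfolding G_def by measurable
    show "AE \<xi> in lborel. norm (G \<xi>) \<le> norm (of_real F0 * h (\<epsilon> *\<^sub>R \<xi>))"
     using norm_fourier_le[of f] unfolding F0_def G_def
     by (intro AE_I2) (auto simp: norm_mult intro!: mult_right_mono order_trans[OF _ abs_ge_self])
   qed
   have FG: "ennreal (norm (fourier G y)) \<le> (\<integral>\<^sub>+z. ennreal (norm (f (y + \<epsilon> *\<^sub>R z)) * norm (fourier h z)))" for y
   proof -
    have "cnj (fourier G y) = (\<integral>\<^sub>L\<xi>. fourier f \<xi> * (expi y \<xi> * h (\<epsilon> *\<^sub>R \<xi>)))"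
     unfolding fourier_eq[of G] G_def
     by (subst Bochner_Integration.integral_cnj[symmetric]) (simp add: cnj_expi hc mult_ac)
    also have "\<dots> = (\<integral>\<^sub>Lz. f (y + \<epsilon> *\<^sub>R z) * fourier h z)"
     by (rule fourier_inversion_dilation[OF f hint e])
    finally have "norm (fourier G y) = norm (\<integral>\<^sub>Lz. f (y + \<epsilon> *\<^sub>R z) * fourier h z)"
     by (metis complex_mod_cnj)
    also have "ennreal \<dots> \<le> (\<integral>\<^sub>+z. ennreal (norm (f (y + \<epsilon> *\<^sub>R z)) * norm (fourier h z)))"
    proof (cases "integrable lborel (\<lambda>z. f (y + \<epsilon> *\<^sub>R z) * fourier h z)")
     case True
     from integral_norm_bound_ennreal[OF this] show ?thesis by (simp add: norm_mult)
    qed (simp add: not_integrable_integral_eq)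
    finally show ?thesis .
   qed
   have "(\<integral>\<^sub>+\<xi>. ennreal ((norm (fourier f \<xi>))\<^sup>2 * norm (h (\<epsilon> *\<^sub>R \<xi>)))) =
     ennreal (norm (\<integral>\<^sub>L\<xi>. fourier f \<xi> * G \<xi>))"
   proof -
    have eq: "fourier f \<xi> * G \<xi> = of_real ((norm (fourier f \<xi>))\<^sup>2 * norm (h (\<epsilon> *\<^sub>R \<xi>)))" for \<xi>
     unfolding G_def by (subst hreal) (simp only: of_real_mult complex_norm_square mult.assoc)
    have "integrable lborel (\<lambda>\<xi>. fourier f \<xi> * G \<xi>)"
    proof (rule Bochner_Integration.integrable_bound)
     show "integrable lborel (\<lambda>\<xi>. of_real F0 * G \<xi>)" using G by simp
     show "AE \<xi> in lborel. norm (fourier f \<xi> * G \<xi>) \<le> norm (of_real F0 * G \<xi>)"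
      using norm_fourier_le[of f] unfolding F0_def
      by (intro AE_I2) (auto simp: norm_mult intro!: mult_right_mono order_trans[OF _ abs_ge_self])
    qed (use G in \<open>auto dest: borel_measurable_integrable\<close>)
    then have i: "integrable lborel (\<lambda>\<xi>. (norm (fourier f \<xi>))\<^sup>2 * norm (h (\<epsilon> *\<^sub>R \<xi>)))"
     unfolding eq by (simp only: complex_of_real_integrable_eq)
    have n: "0 \<le> (\<integral>\<^sub>L\<xi>. (norm (fourier f \<xi>))\<^sup>2 * norm (h (\<epsilon> *\<^sub>R \<xi>)))"
     by (intro integral_nonneg_AE) auto
    have "(\<integral>\<^sub>L\<xi>. fourier f \<xi> * G \<xi>) = of_real (\<integral>\<^sub>L\<xi>. (norm (fourier f \<xi>))\<^sup>2 * norm (h (\<epsilon> *\<^sub>R \<xi>)))"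
     unfolding eq by (rule integral_complex_of_real)
    then have "norm (\<integral>\<^sub>L\<xi>. fourier f \<xi> * G \<xi>) = (\<integral>\<^sub>L\<xi>. (norm (fourier f \<xi>))\<^sup>2 * norm (h (\<epsilon> *\<^sub>R \<xi>)))"
     using n by (simp only: norm_of_real abs_of_nonneg)
    with nn_integral_eq_integral[OF i] show ?thesis by simp
   qed
   also have "\<dots> = ennreal (norm (\<integral>\<^sub>Ly. f y * fourier G y))"
    by (subst fourier_multiplication_formula[OF f G]) simp
   also have "\<dots> \<le> (\<integral>\<^sub>+y. ennreal (norm (f y) * norm (fourier G y)))"
   proof (cases "integrable lborel (\<lambda>y. f y * fourier G y)")
    case True
    from integral_norm_bound_ennreal[OF this] show ?thesis by (simp add: norm_mult)
   qed (simp add: not_integrable_integral_eq)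
   also have "\<dots> \<le> (\<integral>\<^sub>+y. (\<integral>\<^sub>+z. ennreal (norm (f y)) * ennreal (norm (f (y + \<epsilon> *\<^sub>R z)) * norm (fourier h z))))"
    by (intro nn_integral_mono) (simp add: nn_integral_cmult ennreal_mult mult_left_mono FG[unfolded ennreal_mult[OF norm_ge_zero norm_ge_zero]])
   \<comment> \<open>By \<open>2ab \<le> a^2 + b^2\<close> each half involves a single translate of
     \<open>f\<close>, so \<open>\<epsilon>\<close> disappears when the integral in \<open>y\<close>
     is carried out.\<close>
   also have "\<dots> \<le> (\<integral>\<^sub>+y. (\<integral>\<^sub>+z. ennreal (norm (fourier h z)) * (ennreal ((norm (f y))\<^sup>2 / 2) + ennreal ((norm (f (y + \<epsilon> *\<^sub>R z)))\<^sup>2 / 2))))"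
   proof (intro nn_integral_mono)
    fix y z
    have "norm (f y) * norm (f (y + \<epsilon> *\<^sub>R z)) \<le> (norm (f y))\<^sup>2 / 2 + (norm (f (y + \<epsilon> *\<^sub>R z)))\<^sup>2 / 2"
     using sum_squares_bound[of "norm (f y)" "norm (f (y + \<epsilon> *\<^sub>R z))"] by simp
    then have "norm (fourier h z) * (norm (f y) * norm (f (y + \<epsilon> *\<^sub>R z))) \<le> norm (fourier h z) * ((norm (f y))\<^sup>2 / 2 + (norm (f (y + \<epsilon> *\<^sub>R z)))\<^sup>2 / 2)"
     by (intro mult_left_mono) auto
    then show "ennreal (norm (f y)) * ennreal (norm (f (y + \<epsilon> *\<^sub>R z)) * norm (fourier h z)) \<le>
     ennreal (norm (fourier h z)) * (ennreal ((norm (f y))\<^sup>2 / 2) + ennreal ((norm (f (y + \<epsilon> *\<^sub>R z)))\<^sup>2 / 2))"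
     by (simp add: ennreal_mult[symmetric] ennreal_plus[symmetric] mult_ac ennreal_leI del: ennreal_plus)
   qed
   also have "\<dots> = (\<integral>\<^sub>+z. (\<integral>\<^sub>+y. ennreal (norm (fourier h z)) * (ennreal ((norm (f y))\<^sup>2 / 2) + ennreal ((norm (f (y + \<epsilon> *\<^sub>R z)))\<^sup>2 / 2))))"
    by (rule lborel_pair.Fubini'[symmetric]) measurable
   also have "\<dots> = (\<integral>\<^sub>+z. ennreal (norm (fourier h z)) * ?N)"
   proof (intro nn_integral_cong)
    fix z :: "real ^ 'd"
    have 1: "(\<integral>\<^sub>+y. ennreal ((norm (f (y + \<epsilon> *\<^sub>R z)))\<^sup>2 / 2)) = (\<integral>\<^sub>+y. ennreal ((norm (f y))\<^sup>2 / 2))"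
     using nn_integral_lborel_translate[of "\<lambda>y. ennreal ((norm (f y))\<^sup>2 / 2)" "\<epsilon> *\<^sub>R z"] by (simp add: add.commute)
    have 2: "(\<integral>\<^sub>+y. ennreal ((norm (f y))\<^sup>2 / 2)) + (\<integral>\<^sub>+y. ennreal ((norm (f y))\<^sup>2 / 2)) = ?N"
     by (subst nn_integral_add[symmetric]) (auto simp flip: ennreal_plus)
    have "(\<integral>\<^sub>+y. ennreal (norm (fourier h z)) * (ennreal ((norm (f y))\<^sup>2 / 2) + ennreal ((norm (f (y + \<epsilon> *\<^sub>R z)))\<^sup>2 / 2))) =
     ennreal (norm (fourier h z)) * ((\<integral>\<^sub>+y. ennreal ((norm (f y))\<^sup>2 / 2)) + (\<integral>\<^sub>+y. ennreal ((norm (f (y + \<epsilon> *\<^sub>R z)))\<^sup>2 / 2)))"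
     by (subst nn_integral_cmult, measurable, subst nn_integral_add) auto
    then show "(\<integral>\<^sub>+y. ennreal (norm (fourier h z)) * (ennreal ((norm (f y))\<^sup>2 / 2) + ennreal ((norm (f (y + \<epsilon> *\<^sub>R z)))\<^sup>2 / 2))) =
     ennreal (norm (fourier h z)) * ?N"
     by (simp only: 1 2)
   qed
   also have "\<dots> = ennreal K * ?N"
    by (subst nn_integral_multc) (simp_all add: Keq)
   finally show ?thesis .
  qed
  have "(\<integral>\<^sub>+\<xi>. ennreal ((norm (fourier f \<xi>))\<^sup>2 * norm (h 0))) =
   (\<integral>\<^sub>+\<xi>. liminf (\<lambda>n. ennreal ((norm (fourier f \<xi>))\<^sup>2 * norm (h ((1 / real (Suc n)) *\<^sub>R \<xi>)))))"
  proof (intro nn_integral_cong)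
   fix \<xi>
   have "(\<lambda>n. h (0 + (1 / real (Suc n)) *\<^sub>R \<xi>)) \<longlonglongrightarrow> h 0"
    by (rule tendsto_dilation[OF smooth_continuous_on[OF schwartz_smooth[OF h]]])
   then have "(\<lambda>n. ennreal ((norm (fourier f \<xi>))\<^sup>2 * norm (h ((1 / real (Suc n)) *\<^sub>R \<xi>)))) \<longlonglongrightarrow> ennreal ((norm (fourier f \<xi>))\<^sup>2 * norm (h 0))"
    by (intro tendsto_ennrealI tendsto_intros) simp
   then show "ennreal ((norm (fourier f \<xi>))\<^sup>2 * norm (h 0)) = liminf (\<lambda>n. ennreal ((norm (fourier f \<xi>))\<^sup>2 * norm (h ((1 / real (Suc n)) *\<^sub>R \<xi>))))"
    by (rule lim_imp_Liminf[OF trivial_limit_sequentially, symmetric])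
  qed
  also have "\<dots> \<le> liminf (\<lambda>n. \<integral>\<^sub>+\<xi>. ennreal ((norm (fourier f \<xi>))\<^sup>2 * norm (h ((1 / real (Suc n)) *\<^sub>R \<xi>))))"
   by (rule nn_integral_liminf) measurable
  also have "\<dots> \<le> liminf (\<lambda>n::nat. ennreal K * ?N)"
   by (intro Liminf_mono always_eventually allI eps) simp
  also have "\<dots> = ennreal K * ?N" by (simp add: Liminf_const)
  finally have fin: "(\<integral>\<^sub>+\<xi>. ennreal ((norm (fourier f \<xi>))\<^sup>2 * norm (h 0))) \<le> ennreal K * ?N" .
  have "(\<integral>\<^sub>+\<xi>. ennreal ((norm (fourier f \<xi>))\<^sup>2)) = (\<integral>\<^sub>+\<xi>. ennreal (1 / norm (h 0)) * ennreal ((norm (fourier f \<xi>))\<^sup>2 * norm (h 0)))"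
   using hpos by (intro nn_integral_cong) (simp add: ennreal_mult'[symmetric])
  also have "\<dots> = ennreal (1 / norm (h 0)) * (\<integral>\<^sub>+\<xi>. ennreal ((norm (fourier f \<xi>))\<^sup>2 * norm (h 0)))"
   by (rule nn_integral_cmult) measurable
  also have "\<dots> \<le> ennreal (1 / norm (h 0)) * (ennreal K * ?N)"
   by (intro mult_left_mono fin) simp
  also have "\<dots> = ennreal (K / norm (h 0)) * ?N"
   using hpos K0 by (simp add: mult.assoc[symmetric] ennreal_mult'[symmetric])
  finally show ?thesis .
 qed
 show ?thesis
  by (intro exI[of _ "K / norm (h 0)"] conjI allI impI main) (use K0 in auto)
qed

lemma nn_integral_reflect:
 fixes f :: "'a::euclidean_space \<Rightarrow> ennreal"
 assumes "f \<in> \<B>"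
 shows "(\<integral>\<^sub>+x. f (- x)) = (\<integral>\<^sub>+x. f x)"
 using nn_integral_lborel_affine[OF assms, of "-1" 0] by simp

subsection \<open>Time-frequency shifts\<close>

lemma time_freq_shift_eq: "time_freq_shift x \<xi> g = (\<lambda>y. expi \<xi> y * g (y + - x))"
 by (simp add: time_freq_shift_def expi_def)

lemma time_freq_shift_schwartz: "g \<in> schwartz \<Longrightarrow> time_freq_shift x \<xi> g \<in> schwartz"
 unfolding time_freq_shift_eq
 by (rule schwartz_map_schwartz[OF schwartz_map_expi]) (rule schwartz_translate)

lemma norm_cis_minus_1_le: "norm (cis t - 1) \<le> \<bar>t\<bar>"
proof (rule power2_le_imp_le)
 have c: "cos t = 1 - 2 * (sin (t / 2))\<^sup>2" and s: "sin t = 2 * sin (t / 2) * cos (t / 2)"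
  using cos_double_sin[of "t / 2"] sin_double[of "t / 2"] by simp_all
 have "(norm (cis t - 1))\<^sup>2 = (cos t - 1)\<^sup>2 + (sin t)\<^sup>2"
  by (simp add: cmod_power2)
 also have "\<dots> = 4 * (sin (t / 2))\<^sup>2 * ((sin (t / 2))\<^sup>2 + (cos (t / 2))\<^sup>2)"
  unfolding c s by (simp only: power2_eq_square) algebra
 also have "\<dots> = (2 * \<bar>sin (t / 2)\<bar>)\<^sup>2" by (simp add: power_mult_distrib)
 also have "\<dots> \<le> (2 * \<bar>t / 2\<bar>)\<^sup>2"
  by (intro power_mono mult_left_mono abs_sin_x_le_abs_x) auto
 finally show "(norm (cis t - 1))\<^sup>2 \<le> \<bar>t\<bar>\<^sup>2" by simp
qed simp

text \<open>The bound is linear in \<open>norm \<eta>\<close>, as Lipschitz continuity of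
  modulations requires. At order 0 this costs a power of \<open>1 + norm y\<close>; at higher orders
  a component of \<open>\<eta>\<close> comes out of the derivative itself.\<close>

lemma deriv_bound_expi_minus_1:
 "deriv_bound k (\<lambda>y. expi \<eta> y + - 1) y (2 * pi * norm \<eta> * (1 + 2 * pi * norm \<eta>) ^ k * (1 + norm y))"
 unfolding deriv_bound_def
proof (intro allI impI)
 fix js :: "'a list" assume js: "length js \<le> k"
 have p1: "1 \<le> (1 + 2 * pi * norm \<eta>) ^ k" by (rule one_le_power) simp
 show "norm (partial_derivs js (\<lambda>y. expi \<eta> y + - 1) y) \<le> 2 * pi * norm \<eta> * (1 + 2 * pi * norm \<eta>) ^ k * (1 + norm y)"
 proof (cases js rule: rev_cases)
  case Nil
  have "norm (expi \<eta> y + - 1) \<le> \<bar>2 * pi * (y \<bullet> \<eta>)\<bar>"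
   using norm_cis_minus_1_le[of "2 * pi * (y \<bullet> \<eta>)"] by (simp add: expi_def)
  also have "\<dots> = 2 * pi * \<bar>y \<bullet> \<eta>\<bar>" by (simp add: abs_mult)
  also have "\<dots> \<le> 2 * pi * (norm y * norm \<eta>)"
   by (intro mult_left_mono Cauchy_Schwarz_ineq2) simp
  also have "\<dots> = 2 * pi * norm \<eta> * 1 * norm y" by simp
  also have "\<dots> \<le> 2 * pi * norm \<eta> * (1 + 2 * pi * norm \<eta>) ^ k * (1 + norm y)"
   by (intro mult_mono p1) auto
  finally show ?thesis using Nil by simp
 next
  case (snoc ls j)
  have eq: "partial_deriv j (\<lambda>y. expi \<eta> y + - 1) = (\<lambda>y. (2 * pi * \<i> * coord j \<eta>) * expi \<eta> y)"
   by (rule ext, subst partial_deriv_add)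
     (auto simp: partial_deriv_const partial_deriv_expi intro: smooth_differentiable[OF smooth_expi])
  have "length ls \<le> k" using js snoc by simp
  from deriv_boundD[OF deriv_bound_cmult_expi this, of "2 * pi * \<i> * coord j \<eta>" \<eta> y]
  have "norm (partial_derivs js (\<lambda>y. expi \<eta> y + - 1) y) \<le> (1 + 2 * pi * norm \<eta>) ^ k * (2 * pi * \<bar>\<eta> $ j\<bar>)"
   unfolding snoc partial_derivs_snoc eq by (simp add: norm_mult coord_def mult_ac)
  also have "\<dots> \<le> (1 + 2 * pi * norm \<eta>) ^ k * (2 * pi * norm \<eta>)"
   by (intro mult_left_mono component_le_norm_cart) auto
  also have "\<dots> = 2 * pi * norm \<eta> * (1 + 2 * pi * norm \<eta>) ^ k * 1" by simp
  also have "\<dots> \<le> 2 * pi * norm \<eta> * (1 + 2 * pi * norm \<eta>) ^ k * (1 + norm y)"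
   by (intro mult_left_mono) auto
  finally show ?thesis .
 qed
qed

lemma frechet_derivative_eq_sum:
 assumes "f differentiable (at x)"
 shows "frechet_derivative f (at x) v = (\<Sum>j\<in>UNIV. (v $ j) *\<^sub>R partial_deriv j f x)"
proof -
 have lin: "linear (frechet_derivative f (at x))"
  using assms linear_frechet_derivative by blast
 have "v = (\<Sum>j\<in>UNIV. (v $ j) *\<^sub>R axis j 1)"
  using basis_expansion[of v] by (simp add: scalar_mult_eq_scaleR)
 then have "frechet_derivative f (at x) v = frechet_derivative f (at x) (\<Sum>j\<in>UNIV. (v $ j) *\<^sub>R axis j 1)"
  by simp
 also have "\<dots> = (\<Sum>j\<in>UNIV. (v $ j) *\<^sub>R frechet_derivative f (at x) (axis j 1))"
  by (simp add: linear_sum[OF lin] linear_scale[OF lin])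
 finally show ?thesis by (simp add: partial_deriv_def)
qed

lemma norm_frechet_derivative_le:
 fixes f :: "'d::finite cfun"
 assumes "f differentiable (at x)" "\<And>j. norm (partial_deriv j f x) \<le> B"
 shows "norm (frechet_derivative f (at x) v) \<le> real CARD('d) * B * norm v"
proof -
 have "norm (frechet_derivative f (at x) v) \<le> (\<Sum>j\<in>(UNIV::'d set). norm v * B)"
  unfolding frechet_derivative_eq_sum[OF assms(1)]
  by (rule sum_norm_le) (auto intro!: mult_mono assms(2) component_le_norm_cart)
 then show ?thesis by (simp add: mult_ac)
qed

text \<open>The mean value inequality on the segment from \<open>y - x\<close> to
  \<open>y - x'\<close>, applied to every derivative of \<open>g\<close>; hence the order
  \<open>Suc k\<close> in the hypothesis. The points of the segment are \<open>y - p\<close> with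
  \<open>p\<close> between \<open>x\<close> and \<open>x'\<close>, which limits the loss in the
  weight.\<close>

lemma decay_bound_translate_diff:
 fixes g :: "'d::finite cfun"
 assumes g: "g \<in> schwartz" and B: "decay_bound (Suc k) N B g"
 shows "decay_bound k N (real CARD('d) * B * (1 + norm x + norm x') ^ N * norm (x - x')) (\<lambda>y. g (y + - x) - g (y + - x'))"
 unfolding decay_bound_iff
proof (intro allI impI)
 fix js :: "'d list" and y :: "real ^ 'd" assume js: "length js \<le> k"
 have B0: "0 \<le> B" using decay_bound_nonneg[OF B] .
 let ?h = "partial_derivs js g"
 have sm: "smooth ?h" using g by (intro smooth_partial_derivs schwartz_smooth)
 have eq: "partial_derivs js (\<lambda>y. g (y + - x) - g (y + - x')) y = ?h (y + - x) - ?h (y + - x')"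
 proof -
  have s: "smooth (\<lambda>y. g (y + - x))" "smooth (\<lambda>y. - 1 * g (y + - x'))"
   by (intro smooth_cmult smooth_translate schwartz_smooth g)+
  have "partial_derivs js (\<lambda>y. g (y + - x) + - 1 * g (y + - x')) y = ?h (y + - x) + - 1 * ?h (y + - x')"
   by (simp only: partial_derivs_add[OF s] partial_derivs_cmult[OF smooth_translate[OF schwartz_smooth[OF g]]]
     partial_derivs_translate[OF schwartz_smooth[OF g]])
  then show ?thesis by simp
 qed
 let ?D = "real CARD('d) * (B * (1 + norm x + norm x') ^ N / (1 + norm y) ^ N)"
 have "norm (?h (y + - x) - ?h (y + - x')) \<le> ?D * norm ((y + - x) - (y + - x'))"
 proof (rule differentiable_bound[where S = "closed_segment (y + - x) (y + - x')"])
  show "(?h has_derivative frechet_derivative ?h (at z)) (at z within closed_segment (y + - x) (y + - x'))" for z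
   using smooth_has_derivative[OF sm] has_derivative_at_withinI by blast
  fix z assume "z \<in> closed_segment (y + - x) (y + - x')"
  then obtain u where u: "0 \<le> u" "u \<le> 1" "z = (1 - u) *\<^sub>R (y + - x) + u *\<^sub>R (y + - x')"
   by (auto simp: closed_segment_def)
  define p where "p = (1 - u) *\<^sub>R x + u *\<^sub>R x'"
  have z: "z = y + - p" unfolding u(3) p_def by (simp add: algebra_simps)
  have "norm p \<le> (1 - u) * norm x + u * norm x'"
   unfolding p_def using u norm_triangle_ineq[of "(1 - u) *\<^sub>R x" "u *\<^sub>R x'"] by simp
  also have "\<dots> \<le> 1 * norm x + 1 * norm x'"
   using u by (intro add_mono mult_right_mono) auto
  finally have p: "1 + norm p \<le> 1 + norm x + norm x'" by simp
  have "1 + norm y \<le> (1 + norm x + norm x') * (1 + norm z)"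
   using order_trans[OF one_plus_norm_shift[of y "- p"] mult_right_mono[of "1 + norm (- p)" "1 + norm x + norm x'" "1 + norm (y + - p)"]]
    p by (simp add: z)
  from power_mono[OF this, of N] have "(1 + norm y) ^ N \<le> (1 + norm x + norm x') ^ N * (1 + norm z) ^ N"
   by (simp only: power_mult_distrib one_plus_norm_pos)
  from mult_left_mono[OF this B0]
  have *: "B / (1 + norm z) ^ N \<le> B * (1 + norm x + norm x') ^ N / (1 + norm y) ^ N"
   by (simp add: divide_simps mult_ac)
  show "onorm (frechet_derivative ?h (at z)) \<le> ?D"
  proof (rule onorm_le)
   fix v
   have "norm (partial_deriv j ?h z) \<le> B * (1 + norm x + norm x') ^ N / (1 + norm y) ^ N" for j
    using B js * deriv_boundD[of "Suc k" g z "B / (1 + norm z) ^ N" "j # js"] order_trans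
    unfolding decay_bound_def by fastforce
   from norm_frechet_derivative_le[OF smooth_differentiable[OF sm] this]
   show "norm (frechet_derivative ?h (at z) v) \<le> ?D * norm v" .
  qed
 qed auto
 also have "norm ((y + - x) - (y + - x')) = norm (x - x')" by (simp add: norm_minus_commute)
 finally show "(1 + norm y) ^ N * norm (partial_derivs js (\<lambda>y. g (y + - x) - g (y + - x')) y) \<le>
   real CARD('d) * B * (1 + norm x + norm x') ^ N * norm (x - x')"
  unfolding eq by (simp add: field_simps)
qed

lemma time_freq_shift_bound:
 fixes g :: "'d::finite cfun"
 assumes g: "g \<in> schwartz"
 shows "\<exists>C\<ge>0. \<forall>x \<xi>. decay_bound k N (C * (1 + norm \<xi>) ^ k * (1 + norm x) ^ N) (time_freq_shift x \<xi> g)"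
proof -
 obtain B where B: "decay_bound k N B g" using schwartz_decay[OF g] by blast
 have B0: "0 \<le> B" using decay_bound_nonneg[OF B] .
 have "decay_bound k N (2 ^ k * (1 + 2 * pi) ^ k * B * (1 + norm \<xi>) ^ k * (1 + norm x) ^ N) (time_freq_shift x \<xi> g)" for x \<xi>
  unfolding decay_bound_def
 proof
  fix y
  have 1: "deriv_bound k (expi \<xi>) y ((1 + 2 * pi * norm \<xi>) ^ k)"
   using deriv_bound_cmult_expi[of k 1 \<xi> y] by simp
  have 2: "deriv_bound k (\<lambda>y. g (y + - x)) y ((1 + norm x) ^ N * B / (1 + norm y) ^ N)"
   using decay_bound_translate[OF schwartz_smooth[OF g] B, of "- x"] unfolding decay_bound_def by simp
  have "(1 + 2 * pi * norm \<xi>) ^ k \<le> ((1 + 2 * pi) * (1 + norm \<xi>)) ^ k"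
   by (intro power_mono) (simp_all add: algebra_simps)
  then have 3: "(1 + 2 * pi * norm \<xi>) ^ k \<le> (1 + 2 * pi) ^ k * (1 + norm \<xi>) ^ k"
   by (simp only: power_mult_distrib)
  have "2 ^ k * (1 + 2 * pi * norm \<xi>) ^ k * ((1 + norm x) ^ N * B / (1 + norm y) ^ N) \<le>
   2 ^ k * ((1 + 2 * pi) ^ k * (1 + norm \<xi>) ^ k) * ((1 + norm x) ^ N * B / (1 + norm y) ^ N)"
   using B0 by (intro mult_right_mono mult_left_mono 3) auto
  also have "\<dots> = 2 ^ k * (1 + 2 * pi) ^ k * B * (1 + norm \<xi>) ^ k * (1 + norm x) ^ N / (1 + norm y) ^ N"
   by simp
  finally show "deriv_bound k (time_freq_shift x \<xi> g) y (2 ^ k * (1 + 2 * pi) ^ k * B * (1 + norm \<xi>) ^ k * (1 + norm x) ^ N / (1 + norm y) ^ N)"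
   unfolding time_freq_shift_eq
   using deriv_bound_mult[OF smooth_expi smooth_translate[OF schwartz_smooth[OF g]] 1 2] deriv_bound_mono by blast
 qed
 then show ?thesis using B0 by (intro exI[of _ "2 ^ k * (1 + 2 * pi) ^ k * B"]) auto
qed

text \<open>The difference is split into a modulation part
  \<open>expi \<xi>' * (expi (\<xi> - \<xi>') - 1) * T_x g\<close> and a translation part
  \<open>expi \<xi>' * (T_x g - T_x' g)\<close>. The exponent collects \<open>k\<close> from each of
  two characters and \<open>N + 1\<close> from the translate, the extra power paying for the factor
  \<open>1 + norm y\<close> in the modulation part.\<close>

lemma time_freq_shift_diff_bound:
 fixes g :: "'d::finite cfun"
 assumes g: "g \<in> schwartz"
 shows "\<exists>C\<ge>0. \<forall>x \<xi> x' \<xi>'. decay_bound k N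
  (C * (norm (x - x') + norm (\<xi> - \<xi>')) * (1 + norm x + norm x' + norm \<xi> + norm \<xi>') ^ (N + 1 + 2 * k))
  (\<lambda>y. time_freq_shift x \<xi> g y - time_freq_shift x' \<xi>' g y)"
proof -
 \<comment> \<open>Order and weight are one higher than in the claim: the translation part uses the
   derivative, the modulation part the weight.\<close>
 obtain B where B: "decay_bound (Suc k) (Suc N) B g" using schwartz_decay[OF g] by blast
 have B0: "0 \<le> B" using decay_bound_nonneg[OF B] .
 have sm: "smooth g" using g schwartz_smooth by blast
 define P where "P = (1 + 2 * pi) ^ k"
 have P1: "1 \<le> P" unfolding P_def by (rule one_le_power) simp
 have ex: "deriv_bound k (expi \<eta>) y (P * W ^ k)" if "1 + norm \<eta> \<le> W" for \<eta> y :: "real ^ 'd" and W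
 proof -
  have W: "1 \<le> W" using that norm_ge_zero[of \<eta>] by linarith
  have "2 * pi * norm \<eta> \<le> 2 * pi * W" by (intro mult_left_mono) (use that in auto)
  then have "1 + 2 * pi * norm \<eta> \<le> (1 + 2 * pi) * W"
   using W unfolding distrib_right by linarith
  from power_mono[OF this, of k] have "(1 + 2 * pi * norm \<eta>) ^ k \<le> P * W ^ k"
   by (simp add: P_def power_mult_distrib)
  then show ?thesis
   using deriv_bound_cmult_expi[of k 1 \<eta> y] deriv_bound_mono by fastforce
 qed
 define C where "C = 2 ^ k * (2 ^ k * P * (2 * pi * P)) * B + 2 ^ k * P * (real CARD('d) * B)"
 have C0: "0 \<le> C" unfolding C_def using B0 P1 by (intro add_nonneg_nonneg mult_nonneg_nonneg) auto
 have "decay_bound k N (C * (norm (x - x') + norm (\<xi> - \<xi>')) * (1 + norm x + norm x' + norm \<xi> + norm \<xi>') ^ (N + 1 + 2 * k))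
  (\<lambda>y. time_freq_shift x \<xi> g y - time_freq_shift x' \<xi>' g y)" for x \<xi> x' \<xi>' :: "real ^ 'd"
  unfolding decay_bound_def
 proof
  fix y :: "real ^ 'd"
  define W where "W = 1 + norm x + norm x' + norm \<xi> + norm \<xi>'"
  define \<delta> where "\<delta> = norm (x - x') + norm (\<xi> - \<xi>')"
  have W1: "1 \<le> W" unfolding W_def by simp
  have d0: "0 \<le> \<delta>" unfolding \<delta>_def by simp
  have n0: "0 < 1 + norm y" by simp
  have e1: "deriv_bound k (expi \<xi>') y (P * W ^ k)" by (rule ex) (simp add: W_def)
  have e2: "deriv_bound k (\<lambda>y. expi (\<xi> - \<xi>') y + - 1) y (2 * pi * norm (\<xi> - \<xi>') * (P * W ^ k) * (1 + norm y))"
  proof (rule deriv_bound_mono[OF deriv_bound_expi_minus_1])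
   have "norm (\<xi> - \<xi>') \<le> W" using norm_triangle_ineq4[of \<xi> \<xi>'] norm_ge_zero[of x] norm_ge_zero[of x'] unfolding W_def by linarith
   then have "2 * pi * norm (\<xi> - \<xi>') \<le> 2 * pi * W" by (intro mult_left_mono) auto
   then have "1 + 2 * pi * norm (\<xi> - \<xi>') \<le> (1 + 2 * pi) * W" using W1 unfolding distrib_right by linarith
   from power_mono[OF this, of k] have "(1 + 2 * pi * norm (\<xi> - \<xi>')) ^ k \<le> P * W ^ k"
    by (simp add: P_def power_mult_distrib)
   then show "2 * pi * norm (\<xi> - \<xi>') * (1 + 2 * pi * norm (\<xi> - \<xi>')) ^ k * (1 + norm y) \<le> 2 * pi * norm (\<xi> - \<xi>') * (P * W ^ k) * (1 + norm y)"
    by (intro mult_right_mono mult_left_mono) auto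
  qed simp
  have se: "smooth (\<lambda>y. expi (\<xi> - \<xi>') y + - 1)"
   by (rule smooth_add[OF smooth_expi smooth_const])
  have t: "deriv_bound k (\<lambda>y. g (y + - x)) y (W ^ Suc N * B / (1 + norm y) ^ Suc N)"
  proof -
   have "deriv_bound k (\<lambda>y. g (y + - x)) y ((1 + norm x) ^ Suc N * B / (1 + norm y) ^ Suc N)"
    using decay_bound_translate[OF sm decay_bound_mono[OF B, of k "Suc N" B], of "- x"] unfolding decay_bound_def by simp
   moreover have "(1 + norm x) ^ Suc N * B / (1 + norm y) ^ Suc N \<le> W ^ Suc N * B / (1 + norm y) ^ Suc N"
    using B0 by (intro divide_right_mono mult_right_mono power_mono) (auto simp: W_def)
   ultimately show ?thesis using deriv_bound_mono by blast
  qed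
  have "decay_bound (Suc k) N B g" by (rule decay_bound_mono[OF B]) auto
  from decay_bound_translate_diff[OF g this, of x x']
  have "deriv_bound k (\<lambda>y. g (y + - x) - g (y + - x')) y (real CARD('d) * B * (1 + norm x + norm x') ^ N * norm (x - x') / (1 + norm y) ^ N)"
   unfolding decay_bound_def by blast
  moreover have "real CARD('d) * B * (1 + norm x + norm x') ^ N * norm (x - x') / (1 + norm y) ^ N \<le> real CARD('d) * B * W ^ N * \<delta> / (1 + norm y) ^ N"
   using B0 by (intro divide_right_mono mult_mono power_mono) (auto simp: W_def \<delta>_def)
  ultimately have td: "deriv_bound k (\<lambda>y. g (y + - x) - g (y + - x')) y (real CARD('d) * B * W ^ N * \<delta> / (1 + norm y) ^ N)"
   using deriv_bound_mono by blast
  have std: "smooth (\<lambda>y. g (y + - x) - g (y + - x'))"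
   using schwartz_diff[OF schwartz_translate[OF g] schwartz_translate[OF g]] schwartz_smooth by blast
  have sA: "smooth (\<lambda>y. expi \<xi>' y * (expi (\<xi> - \<xi>') y + - 1))" by (intro smooth_mult smooth_expi se)
  have A: "deriv_bound k (\<lambda>y. (expi \<xi>' y * (expi (\<xi> - \<xi>') y + - 1)) * g (y + - x)) y
   (2 ^ k * (2 ^ k * (P * W ^ k) * (2 * pi * norm (\<xi> - \<xi>') * (P * W ^ k) * (1 + norm y))) * (W ^ Suc N * B / (1 + norm y) ^ Suc N))"
   by (intro deriv_bound_mult sA smooth_translate sm smooth_expi se e1 e2 t)
  have Bd: "deriv_bound k (\<lambda>y. expi \<xi>' y * (g (y + - x) - g (y + - x'))) y
   (2 ^ k * (P * W ^ k) * (real CARD('d) * B * W ^ N * \<delta> / (1 + norm y) ^ N))"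
   by (intro deriv_bound_mult smooth_expi std e1 td)
  have "2 ^ k * (2 ^ k * (P * W ^ k) * (2 * pi * norm (\<xi> - \<xi>') * (P * W ^ k) * (1 + norm y))) * (W ^ Suc N * B / (1 + norm y) ^ Suc N)
    = 2 ^ k * (2 ^ k * P * (2 * pi * P)) * B * norm (\<xi> - \<xi>') * W ^ (N + 1 + 2 * k) / (1 + norm y) ^ N"
  proof -
   have w: "W ^ k * W ^ k * W ^ Suc N = W ^ (N + 1 + 2 * k)" by (simp add: power_add mult_2)
   have u: "(1 + norm y) / (1 + norm y) ^ Suc N = 1 / (1 + norm y) ^ N" using n0 by simp
   have "2 ^ k * (2 ^ k * (P * W ^ k) * (2 * pi * norm (\<xi> - \<xi>') * (P * W ^ k) * (1 + norm y))) * (W ^ Suc N * B / (1 + norm y) ^ Suc N)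
    = 2 ^ k * (2 ^ k * P * (2 * pi * P)) * B * norm (\<xi> - \<xi>') * (W ^ k * W ^ k * W ^ Suc N) * ((1 + norm y) / (1 + norm y) ^ Suc N)"
    by (simp only: divide_inverse mult_ac)
   then show ?thesis unfolding w u by simp
  qed
  also have "\<dots> \<le> 2 ^ k * (2 ^ k * P * (2 * pi * P)) * B * \<delta> * W ^ (N + 1 + 2 * k) / (1 + norm y) ^ N"
   using B0 P1 W1 by (intro divide_right_mono mult_right_mono mult_left_mono) (auto simp: \<delta>_def)
  finally have A': "2 ^ k * (2 ^ k * (P * W ^ k) * (2 * pi * norm (\<xi> - \<xi>') * (P * W ^ k) * (1 + norm y))) * (W ^ Suc N * B / (1 + norm y) ^ Suc N)
   \<le> 2 ^ k * (2 ^ k * P * (2 * pi * P)) * B * \<delta> * W ^ (N + 1 + 2 * k) / (1 + norm y) ^ N" .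
  have "2 ^ k * (P * W ^ k) * (real CARD('d) * B * W ^ N * \<delta> / (1 + norm y) ^ N) =
    2 ^ k * P * (real CARD('d) * B) * \<delta> * W ^ (N + k) / (1 + norm y) ^ N"
   by (simp add: power_add mult_ac)
  also have "\<dots> \<le> 2 ^ k * P * (real CARD('d) * B) * \<delta> * W ^ (N + 1 + 2 * k) / (1 + norm y) ^ N"
   using B0 P1 W1 d0 by (intro divide_right_mono mult_left_mono power_increasing) auto
  finally have B': "2 ^ k * (P * W ^ k) * (real CARD('d) * B * W ^ N * \<delta> / (1 + norm y) ^ N)
   \<le> 2 ^ k * P * (real CARD('d) * B) * \<delta> * W ^ (N + 1 + 2 * k) / (1 + norm y) ^ N" .
  have eq: "(\<lambda>y. time_freq_shift x \<xi> g y - time_freq_shift x' \<xi>' g y) =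
   (\<lambda>y. (expi \<xi>' y * (expi (\<xi> - \<xi>') y + - 1)) * g (y + - x) + expi \<xi>' y * (g (y + - x) - g (y + - x')))"
  proof
   fix y
   have "expi \<xi> y = expi \<xi>' y * expi (\<xi> - \<xi>') y" by (simp add: expi_add(1)[symmetric])
   then show "time_freq_shift x \<xi> g y - time_freq_shift x' \<xi>' g y =
    (expi \<xi>' y * (expi (\<xi> - \<xi>') y + - 1)) * g (y + - x) + expi \<xi>' y * (g (y + - x) - g (y + - x'))"
    unfolding time_freq_shift_eq by (simp add: algebra_simps)
  qed
  have "deriv_bound k (\<lambda>y. time_freq_shift x \<xi> g y - time_freq_shift x' \<xi>' g y) y
   (2 ^ k * (2 ^ k * P * (2 * pi * P)) * B * \<delta> * W ^ (N + 1 + 2 * k) / (1 + norm y) ^ N +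
    2 ^ k * P * (real CARD('d) * B) * \<delta> * W ^ (N + 1 + 2 * k) / (1 + norm y) ^ N)"
   unfolding eq
   by (intro deriv_bound_add smooth_mult sA smooth_expi std smooth_translate sm
     deriv_bound_mono[OF A order_refl A'] deriv_bound_mono[OF Bd order_refl B'])
  also have "2 ^ k * (2 ^ k * P * (2 * pi * P)) * B * \<delta> * W ^ (N + 1 + 2 * k) / (1 + norm y) ^ N +
    2 ^ k * P * (real CARD('d) * B) * \<delta> * W ^ (N + 1 + 2 * k) / (1 + norm y) ^ N = C * \<delta> * W ^ (N + 1 + 2 * k) / (1 + norm y) ^ N"
   by (simp only: C_def add_divide_distrib[symmetric] distrib_right)
  finally show "deriv_bound k (\<lambda>y. time_freq_shift x \<xi> g y - time_freq_shift x' \<xi>' g y) y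
   (C * (norm (x - x') + norm (\<xi> - \<xi>')) * (1 + norm x + norm x' + norm \<xi> + norm \<xi>') ^ (N + 1 + 2 * k) / (1 + norm y) ^ N)"
   unfolding W_def \<delta>_def .
 qed
 then show ?thesis using C0 by blast
qed

subsection \<open>The reproducing formula\<close>

text \<open>The short-time Fourier transform of the function \<open>\<phi>\<close>. Time and
  frequency form one argument, so that integrals over phase space are integrals over a single
  Euclidean space.\<close>

definition gabor_coeff :: "('d::finite cfun) \<Rightarrow> ('d cfun) \<Rightarrow> (real ^ 'd) \<times> (real ^ 'd) \<Rightarrow> complex" where
 "gabor_coeff g \<phi> w = fourier (\<lambda>z. \<phi> z * cnj (g (z + - fst w))) (snd w)"

abbreviation gabor_atom :: "('d::finite cfun) \<Rightarrow> (real ^ 'd) \<times> (real ^ 'd) \<Rightarrow> 'd cfun" where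
 "gabor_atom g w \<equiv> time_freq_shift (fst w) (snd w) g"

text \<open>Of the \<open>M + N\<close> powers of decay of \<open>\<phi>\<close>, \<open>N\<close>
  are combined with those of the shifted factor: \<open>1 + norm y\<close> is at most the product of
  the two weights at \<open>z\<close>, so the product decays in the shift as well.\<close>

lemma decay_bound_mult_translate:
 assumes "smooth \<phi>" "smooth \<psi>" "decay_bound k (M + N) A \<phi>" "decay_bound k N B \<psi>"
 shows "decay_bound k M (2 ^ k * A * B / (1 + norm y) ^ N) (\<lambda>z. \<phi> z * \<psi> (z + - y))"
 unfolding decay_bound_def
proof
 fix z
 have A: "deriv_bound k \<phi> z (A / (1 + norm z) ^ (M + N))"
  using assms(3) unfolding decay_bound_def by blast
 have B: "deriv_bound k (\<lambda>z. \<psi> (z + - y)) z (B / (1 + norm (z + - y)) ^ N)"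
  using assms(4) unfolding decay_bound_def deriv_bound_translate[OF assms(2)] by blast
 have AB: "0 \<le> 2 ^ k * A * B" using decay_bound_nonneg[OF assms(3)] decay_bound_nonneg[OF assms(4)] by simp
 have "1 + norm y \<le> (1 + norm z) * (1 + norm (z + - y))"
  using one_plus_norm_shift[of y "- z"] norm_minus_commute[of y z] by simp
 from power_mono[OF this, of N] have "(1 + norm y) ^ N \<le> (1 + norm z) ^ N * (1 + norm (z + - y)) ^ N"
  by (simp only: power_mult_distrib one_plus_norm_pos)
 from mult_left_mono[OF this AB] have "2 ^ k * (A / (1 + norm z) ^ (M + N)) * (B / (1 + norm (z + - y)) ^ N) \<le> 2 ^ k * A * B / (1 + norm y) ^ N / (1 + norm z) ^ M"
  by (simp add: power_add divide_simps mult_ac)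
 then show "deriv_bound k (\<lambda>z. \<phi> z * \<psi> (z + - y)) z (2 ^ k * A * B / (1 + norm y) ^ N / (1 + norm z) ^ M)"
  using deriv_bound_mult[OF assms(1) smooth_translate[OF assms(2)] A B] deriv_bound_mono by blast
qed

lemma gabor_coeff_window_schwartz:
 "\<phi> \<in> schwartz \<Longrightarrow> g \<in> schwartz \<Longrightarrow> (\<lambda>z. \<phi> z * cnj (g (z + - y))) \<in> schwartz"
 by (intro schwartz_mult schwartz_cnj schwartz_translate)

text \<open>Decay in \<open>y\<close> comes from the small overlap of \<open>\<phi>\<close> with the
  shifted window, decay in \<open>\<eta>\<close> from the continuity of the Fourier transform
  applied to that product.\<close>

lemma gabor_coeff_decay:
 fixes g \<phi> :: "'d::finite cfun"
 assumes g: "g \<in> schwartz" and \<phi>: "\<phi> \<in> schwartz"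
 shows "\<exists>K\<ge>0. \<forall>y \<eta>. norm (gabor_coeff g \<phi> (y, \<eta>)) \<le> K / ((1 + norm y) ^ N * (1 + norm \<eta>) ^ N)"
proof -
 obtain M C where C: "0 \<le> C" "\<And>\<phi> B. \<phi> \<in> schwartz \<Longrightarrow> decay_bound M M B \<phi> \<Longrightarrow> decay_bound N N (C * B) (fourier \<phi> :: 'd cfun)"
  using schwartz_mapD[OF schwartz_map_fourier] by metis
 obtain A where A: "decay_bound M (M + N) A \<phi>" using schwartz_decay[OF \<phi>] by blast
 obtain B where B: "decay_bound M N B (\<lambda>z. cnj (g z))" using schwartz_decay[OF schwartz_cnj[OF g]] by blast
 have "norm (gabor_coeff g \<phi> (y, \<eta>)) \<le> C * (2 ^ M * A * B) / ((1 + norm y) ^ N * (1 + norm \<eta>) ^ N)" for y \<eta>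
 proof -
  have "decay_bound M M (2 ^ M * A * B / (1 + norm y) ^ N) (\<lambda>z. \<phi> z * cnj (g (z + - y)))"
   by (rule decay_bound_mult_translate[OF _ _ A B]) (intro schwartz_smooth \<phi> schwartz_cnj g)+
  from decay_bound_norm[OF C(2)[OF gabor_coeff_window_schwartz[OF \<phi> g] this], of \<eta>]
  show ?thesis by (simp add: gabor_coeff_def)
 qed
 moreover have "0 \<le> C * (2 ^ M * A * B)"
  using C(1) decay_bound_nonneg[OF A] decay_bound_nonneg[OF B] by simp
 ultimately show ?thesis by blast
qed

lemma gabor_coeff_decay_norm:
 fixes g \<phi> :: "'d::finite cfun"
 assumes g: "g \<in> schwartz" and \<phi>: "\<phi> \<in> schwartz"
 shows "\<exists>K\<ge>0. \<forall>w. norm (gabor_coeff g \<phi> w) \<le> K / (1 + norm w) ^ N"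
proof -
 obtain K where K: "0 \<le> K" "\<And>y \<eta>. norm (gabor_coeff g \<phi> (y, \<eta>)) \<le> K / ((1 + norm y) ^ N * (1 + norm \<eta>) ^ N)"
  using gabor_coeff_decay[OF assms] by blast
 have "norm (gabor_coeff g \<phi> w) \<le> K / (1 + norm w) ^ N" for w
 proof -
  obtain y \<eta> where w: "w = (y, \<eta>)" by (cases w)
  have "norm w \<le> norm y + norm \<eta>" unfolding w by (rule norm_Pair_le)
  moreover have "0 \<le> norm y * norm \<eta>" by simp
  moreover have "(1 + norm y) * (1 + norm \<eta>) = 1 + norm y + norm \<eta> + norm y * norm \<eta>" by (simp add: algebra_simps)
  ultimately have "1 + norm w \<le> (1 + norm y) * (1 + norm \<eta>)" by linarith
  from power_mono[OF this, of N] have "(1 + norm w) ^ N \<le> (1 + norm y) ^ N * (1 + norm \<eta>) ^ N"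
   by (simp only: power_mult_distrib one_plus_norm_pos)
  then have "K / ((1 + norm y) ^ N * (1 + norm \<eta>) ^ N) \<le> K / (1 + norm w) ^ N"
   using K(1) by (intro divide_left_mono) auto
  then show ?thesis using K(2)[of y \<eta>] unfolding w by linarith
 qed
 then show ?thesis using K(1) by blast
qed

lemma gabor_coeff_measurable [measurable]:
 assumes "g \<in> schwartz" "\<phi> \<in> schwartz"
 shows "gabor_coeff g \<phi> \<in> \<B>"
proof -
 have [measurable]: "g \<in> \<B>" "\<phi> \<in> \<B>"
  using assms by (auto intro: smooth_borel schwartz_smooth)
 have "(\<lambda>w. \<integral>\<^sub>Lz. expi (- snd w) z * (\<phi> z * cnj (g (z + - fst w)))) \<in> borel_measurable (borel \<Otimes>\<^sub>M borel)"
  by measurable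
 then show ?thesis
  by (simp add: gabor_coeff_def[abs_def] fourier_eq borel_prod)
qed

lemma integrable_gabor_coeff_mult:
 fixes g \<phi> :: "'d::finite cfun"
 assumes g: "g \<in> schwartz" and \<phi>: "\<phi> \<in> schwartz"
  and [measurable]: "q \<in> \<B>" and q: "\<And>w. norm (q w :: complex) \<le> D * (1 + norm w) ^ k"
 shows "integrable lborel (\<lambda>w. gabor_coeff g \<phi> w * q w)"
proof -
 let ?n = "2 * DIM((real ^ 'd) \<times> (real ^ 'd))"
 obtain K where K: "0 \<le> K" "\<And>w. norm (gabor_coeff g \<phi> w) \<le> K / (1 + norm w) ^ (?n + k)"
  using gabor_coeff_decay_norm[OF g \<phi>] by blast
 note gabor_coeff_measurable[OF g \<phi>, measurable]
 have D: "0 \<le> D" using q[of 0] order_trans[OF norm_ge_zero q[of 0]] by simp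
 show ?thesis
 proof (rule Bochner_Integration.integrable_bound)
  show "integrable lborel (\<lambda>w::(real ^ 'd) \<times> (real ^ 'd). (K * D) * (1 / (1 + norm w) ^ ?n))"
   by (intro integrable_mult_right integrable_inverse_one_plus_norm) simp
  show "AE w in lborel. norm (gabor_coeff g \<phi> w * q w) \<le> norm ((K * D) * (1 / (1 + norm w) ^ ?n))"
  proof (rule AE_I2)
   fix w
   have "norm (gabor_coeff g \<phi> w * q w) \<le> (K / (1 + norm w) ^ (?n + k)) * (D * (1 + norm w) ^ k)"
    unfolding norm_mult by (intro mult_mono K q) (use K in auto)
   also have "\<dots> = (K * D) * (1 / (1 + norm w) ^ ?n)" by (simp add: power_add)
   finally have F: "norm (gabor_coeff g \<phi> w * q w) \<le> (K * D) * (1 / (1 + norm w) ^ ?n)" .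
   show "norm (gabor_coeff g \<phi> w * q w) \<le> norm ((K * D) * (1 / (1 + norm w) ^ ?n))"
    using order_trans[OF F abs_ge_self] by (simp only: real_norm_def)
  qed
 qed measurable
qed

text \<open>Evaluation of a derivative, conjugated to be conjugate-linear, is treated as a
  distribution. Measurability of the derivatives of the atoms in \<open>w\<close> then becomes an
  instance of the corresponding statement for \<open>v\<close>.\<close>

lemma tempered_form_eval: "tempered_form (length js) 1 (\<lambda>\<phi>. cnj (partial_derivs js \<phi> z))"
 unfolding tempered_form_def
proof (intro conjI ballI allI impI)
 fix \<phi> :: "'a cfun" and B assume \<phi>: "\<phi> \<in> schwartz" "decay_bound (length js) (length js) B \<phi>"
 from \<phi>(2) have "(1 + norm z) ^ length js * norm (partial_derivs js \<phi> z) \<le> B"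
  unfolding decay_bound_iff by blast
 moreover have "1 * norm (partial_derivs js \<phi> z) \<le> (1 + norm z) ^ length js * norm (partial_derivs js \<phi> z)"
  by (intro mult_right_mono one_le_power) auto
 ultimately show "norm (cnj (partial_derivs js \<phi> z)) \<le> 1 * B" by simp
qed (simp_all add: partial_derivs_add partial_derivs_cmult schwartz_smooth)

lemma tempered_form_gabor_diff:
 fixes g :: "'d::finite cfun"
 assumes v: "tempered_form N C v" and g: "g \<in> schwartz"
 shows "\<exists>D\<ge>0. \<forall>w w'. norm (v (gabor_atom g w) - v (gabor_atom g w')) \<le> D * norm (w - w') * (1 + norm w + norm w') ^ (3 * N + 1)"
proof -
 obtain D where D: "0 \<le> D" "\<And>x \<xi> x' \<xi>'. decay_bound N N
  (D * (norm (x - x') + norm (\<xi> - \<xi>')) * (1 + norm x + norm x' + norm \<xi> + norm \<xi>') ^ (N + 1 + 2 * N))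
  (\<lambda>y. time_freq_shift x \<xi> g y - time_freq_shift x' \<xi>' g y)"
  using time_freq_shift_diff_bound[OF g, of N N] by blast
 have "norm (v (gabor_atom g w) - v (gabor_atom g w')) \<le> C * D * 2 * 2 ^ (3 * N + 1) * norm (w - w') * (1 + norm w + norm w') ^ (3 * N + 1)" for w w'
 proof -
  obtain x \<xi> x' \<xi>' where w: "w = (x, \<xi>)" "w' = (x', \<xi>')" by (cases w, cases w')
  have "v (gabor_atom g w) - v (gabor_atom g w') = v (\<lambda>y. gabor_atom g w y - gabor_atom g w' y)"
   by (rule tempered_form_diff[OF v, symmetric]) (intro time_freq_shift_schwartz g)+
  then have 1: "norm (v (gabor_atom g w) - v (gabor_atom g w')) \<le> C * (D * (norm (x - x') + norm (\<xi> - \<xi>')) * (1 + norm x + norm x' + norm \<xi> + norm \<xi>') ^ (N + 1 + 2 * N))"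
   using tempered_form_bound[OF v schwartz_diff[OF time_freq_shift_schwartz[OF g] time_freq_shift_schwartz[OF g]] D(2)[of x x' \<xi> \<xi>']]
   unfolding w by simp
  have n: "norm (x - x') \<le> norm (w - w')" "norm (\<xi> - \<xi>') \<le> norm (w - w')" "norm x \<le> norm w" "norm \<xi> \<le> norm w" "norm x' \<le> norm w'" "norm \<xi>' \<le> norm w'"
   unfolding w by (auto simp: norm_Pair real_le_rsqrt)
  have 2: "norm (x - x') + norm (\<xi> - \<xi>') \<le> 2 * norm (w - w')" using n by linarith
  have 3: "(1 + norm x + norm x' + norm \<xi> + norm \<xi>') ^ (N + 1 + 2 * N) \<le> (2 * (1 + norm w + norm w')) ^ (3 * N + 1)"
  proof -
   have "1 + norm x + norm x' + norm \<xi> + norm \<xi>' \<le> 2 + 2 * norm w + 2 * norm w'" using n by linarith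
   also have "\<dots> = 2 * (1 + norm w + norm w')" by simp
   finally have "1 + norm x + norm x' + norm \<xi> + norm \<xi>' \<le> 2 * (1 + norm w + norm w')" .
   from power_mono[OF this, of "3 * N + 1"] show ?thesis by (simp add: mult.commute)
  qed
  have "C * (D * (norm (x - x') + norm (\<xi> - \<xi>')) * (1 + norm x + norm x' + norm \<xi> + norm \<xi>') ^ (N + 1 + 2 * N))
   \<le> C * (D * (2 * norm (w - w')) * (2 * (1 + norm w + norm w')) ^ (3 * N + 1))"
   using tempered_form_nonneg[OF v] D(1) by (intro mult_left_mono mult_mono 2 3) auto
  also have "\<dots> = C * D * 2 * 2 ^ (3 * N + 1) * norm (w - w') * (1 + norm w + norm w') ^ (3 * N + 1)"
   by (simp only: power_mult_distrib mult_ac)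
  finally show ?thesis using 1 by linarith
 qed
 moreover have "0 \<le> C * D * 2 * 2 ^ (3 * N + 1)" using tempered_form_nonneg[OF v] D(1) by simp
 ultimately show ?thesis by blast
qed

lemma continuous_on_tempered_gabor:
 fixes g :: "'d::finite cfun"
 assumes v: "tempered_form N C v" and g: "g \<in> schwartz"
 shows "continuous_on UNIV (\<lambda>w. v (gabor_atom g w))"
proof -
 obtain D where D: "\<And>w w'. norm (v (gabor_atom g w) - v (gabor_atom g w')) \<le> D * norm (w - w') * (1 + norm w + norm w') ^ (3 * N + 1)"
  using tempered_form_gabor_diff[OF assms] by blast
 have "isCont (\<lambda>w. v (gabor_atom g w)) w'" for w'
  unfolding isCont_def
 proof (rule LIM_zero_cancel, rule Lim_null_comparison)
  show "\<forall>\<^sub>F w in at w'. norm (v (gabor_atom g w) - v (gabor_atom g w')) \<le> D * norm (w - w') * (1 + norm w + norm w') ^ (3 * N + 1)"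
   using D by simp
  have "((\<lambda>w. D * norm (w - w') * (1 + norm w + norm w') ^ (3 * N + 1)) \<longlongrightarrow> D * norm (w' - w') * (1 + norm w' + norm w') ^ (3 * N + 1)) (at w')"
   by (intro tendsto_intros)
  then show "((\<lambda>w. D * norm (w - w') * (1 + norm w + norm w') ^ (3 * N + 1)) \<longlongrightarrow> 0) (at w')" by simp
 qed
 then show ?thesis by (simp add: continuous_on_eq_continuous_at)
qed

lemma tempered_gabor_measurable:
 "tempered_form N C v \<Longrightarrow> g \<in> schwartz \<Longrightarrow> (\<lambda>w. v (gabor_atom g w)) \<in> \<B>"
 by (intro borel_measurable_continuous_onI continuous_on_tempered_gabor)

lemma tempered_gabor_growth:
 fixes g :: "'d::finite cfun"
 assumes v: "tempered_form N C v" and g: "g \<in> schwartz"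
 shows "\<exists>D\<ge>0. \<forall>w. norm (v (gabor_atom g w)) \<le> D * (1 + norm w) ^ (2 * N)"
proof -
 obtain D where D: "0 \<le> D" "\<And>x \<xi>. decay_bound N N (D * (1 + norm \<xi>) ^ N * (1 + norm x) ^ N) (time_freq_shift x \<xi> g)"
  using time_freq_shift_bound[OF g] by blast
 have "norm (v (gabor_atom g w)) \<le> C * D * (1 + norm w) ^ (2 * N)" for w
 proof -
  obtain x \<xi> where w: "w = (x, \<xi>)" by (cases w)
  have "norm (v (gabor_atom g w)) \<le> C * (D * (1 + norm \<xi>) ^ N * (1 + norm x) ^ N)"
   using tempered_form_bound[OF v time_freq_shift_schwartz[OF g] D(2)] unfolding w by simp
  also have "\<dots> \<le> C * (D * (1 + norm w) ^ N * (1 + norm w) ^ N)"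
   using tempered_form_nonneg[OF v] D(1) unfolding w
   by (intro mult_left_mono mult_mono power_mono) (auto simp: norm_Pair real_le_rsqrt)
  also have "\<dots> = C * D * (1 + norm w) ^ (2 * N)" by (simp add: mult_2 power_add)
  finally show ?thesis .
 qed
 then show ?thesis using tempered_form_nonneg[OF v] D(1) by (intro exI[of _ "C * D"]) auto
qed

lemma gabor_atom_deriv_measurable:
 fixes g :: "'d::finite cfun"
 assumes g: "g \<in> schwartz"
 shows "(\<lambda>w. partial_derivs js (gabor_atom g w) z) \<in> \<B>"
proof -
 have [measurable]: "(\<lambda>w. cnj (partial_derivs js (gabor_atom g w) z)) \<in> \<B>"
  using tempered_gabor_measurable[OF tempered_form_eval g] .
 have "(\<lambda>w. cnj (cnj (partial_derivs js (gabor_atom g w) z))) \<in> \<B>" by measurable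
 then show ?thesis by simp
qed

lemma gabor_atom_deriv_bound:
 fixes g :: "'d::finite cfun"
 assumes g: "g \<in> schwartz"
 shows "\<exists>D\<ge>0. \<forall>w js z. length js \<le> k \<longrightarrow> norm (partial_derivs js (gabor_atom g w) z) \<le> D * (1 + norm w) ^ k"
proof -
 obtain D where D: "0 \<le> D" "\<And>x \<xi>. decay_bound k 0 (D * (1 + norm \<xi>) ^ k * (1 + norm x) ^ 0) (time_freq_shift x \<xi> g)"
  using time_freq_shift_bound[OF g] by blast
 have "norm (partial_derivs js (gabor_atom g w) z) \<le> D * (1 + norm w) ^ k" if "length js \<le> k" for w js z
 proof -
  have "norm (partial_derivs js (gabor_atom g w) z) \<le> D * (1 + norm (snd w)) ^ k"
   using D(2)[of "snd w" "fst w"] that unfolding decay_bound_iff by simp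
  also have "\<dots> \<le> D * (1 + norm w) ^ k"
   using D(1) by (intro mult_left_mono power_mono) (use norm_snd_le[of "snd w" "fst w"] in auto)
  finally show ?thesis .
 qed
 then show ?thesis using D(1) by blast
qed

text \<open>For fixed \<open>y\<close> the integral in frequency is Fourier inversion for
  \<open>\<phi> z * cnj (g (z - y))\<close>; the integral in \<open>y\<close> that remains is the
  square integral of \<open>g\<close>.\<close>

lemma gabor_reproducing:
 fixes g \<phi> :: "'d::finite cfun"
 assumes g: "g \<in> schwartz" and \<phi>: "\<phi> \<in> schwartz"
  and c: "\<And>f x. f \<in> schwartz \<Longrightarrow> inv_fourier (fourier f) x = c * f (x :: real ^ 'd)"
 shows "(\<integral>\<^sub>Lw. gabor_coeff g \<phi> w * gabor_atom g w z) = c * of_real (\<integral>\<^sub>Ly. (norm (g y))\<^sup>2) * \<phi> z"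
proof -
 note gabor_coeff_measurable[OF g \<phi>, measurable]
 have [measurable]: "g \<in> \<B>" using g by (intro smooth_borel schwartz_smooth)
 have [measurable]: "(\<lambda>w. gabor_atom g w z) \<in> \<B>"
  using gabor_atom_deriv_measurable[OF g, of "[]"] by simp
 obtain K where K: "0 \<le> K" "\<And>y \<eta>. norm (gabor_coeff g \<phi> (y, \<eta>)) \<le> K / ((1 + norm y) ^ (2 * CARD('d)) * (1 + norm \<eta>) ^ (2 * CARD('d)))"
  using gabor_coeff_decay[OF g \<phi>] by blast
 obtain B where "decay_bound 0 0 B g" using schwartz_decay[OF g] by blast
 from decay_bound_norm[OF this] have B: "norm (g x) \<le> B" for x by simp
 let ?i = "\<lambda>y::real ^ 'd. 1 / (1 + norm y) ^ (2 * CARD('d))"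
 have i: "integrable lborel ?i" by (intro integrable_inverse_one_plus_norm) simp
 let ?F = "\<lambda>w. gabor_coeff g \<phi> w * gabor_atom g w z"
 have int: "integrable (lborel \<Otimes>\<^sub>M lborel) ?F"
 proof (rule integrable_pair_bound)
  show "integrable lborel (\<lambda>y. K * B * ?i y)" using i by (rule integrable_mult_right)
  show "norm (?F (y, \<eta>)) \<le> K * B * ?i y * ?i \<eta>" for y \<eta>
  proof -
   have "norm (?F (y, \<eta>)) \<le> K / ((1 + norm y) ^ (2 * CARD('d)) * (1 + norm \<eta>) ^ (2 * CARD('d))) * B"
    unfolding norm_mult by (intro mult_mono K) (use K B in \<open>auto simp: time_freq_shift_eq norm_mult\<close>)
   then show ?thesis by (simp add: mult_ac)
  qed
 qed (use i in auto)
 have "(\<integral>\<^sub>Lw. ?F w) = (\<integral>w. ?F w \<partial>(lborel \<Otimes>\<^sub>M lborel))" by (simp add: lborel_prod)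
 also have "\<dots> = (\<integral>\<^sub>Ly. (\<integral>\<^sub>L\<eta>. ?F (y, \<eta>)))"
  by (rule lborel_pair.integral_fst'[OF int, symmetric])
 also have "(\<lambda>y. (\<integral>\<^sub>L\<eta>. ?F (y, \<eta>))) = (\<lambda>y. c * \<phi> z * of_real ((norm (g (z + -1 *\<^sub>R y)))\<^sup>2))"
 proof
  fix y
  let ?\<psi> = "\<lambda>z. \<phi> z * cnj (g (z + - y))"
  have "(\<integral>\<^sub>L\<eta>. ?F (y, \<eta>)) = (\<integral>\<^sub>L\<eta>. g (z + - y) * (cis (2 * pi * (z \<bullet> \<eta>)) * fourier ?\<psi> \<eta>))"
   by (intro Bochner_Integration.integral_cong refl) (simp add: gabor_coeff_def time_freq_shift_eq expi_def mult_ac)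
  also have "\<dots> = g (z + - y) * inv_fourier (fourier ?\<psi>) z"
   unfolding inv_fourier_def by (rule integral_mult_right_zero)
  also have "\<dots> = c * \<phi> z * (g (z + - y) * cnj (g (z + - y)))"
   unfolding c[OF gabor_coeff_window_schwartz[OF \<phi> g]] by (simp only: mult_ac)
  finally show "(\<integral>\<^sub>L\<eta>. ?F (y, \<eta>)) = c * \<phi> z * of_real ((norm (g (z + -1 *\<^sub>R y)))\<^sup>2)"
   unfolding complex_norm_square by simp
 qed
 also have "(\<integral>\<^sub>Ly. c * \<phi> z * of_real ((norm (g (z + -1 *\<^sub>R y)))\<^sup>2)) = c * \<phi> z * (\<integral>\<^sub>Ly. of_real ((norm (g (z + -1 *\<^sub>R y)))\<^sup>2))"
  by (rule integral_mult_right_zero)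
 also have "(\<integral>\<^sub>Ly. complex_of_real ((norm (g (z + -1 *\<^sub>R y)))\<^sup>2)) = (\<integral>\<^sub>Ly. complex_of_real ((norm (g y))\<^sup>2))"
  by (subst (2) integral_lborel_affine[of _ "-1" z]) simp_all
 also have "\<dots> = of_real (\<integral>\<^sub>Ly. (norm (g y))\<^sup>2)" by (rule integral_complex_of_real)
 finally show ?thesis by (simp add: mult_ac)
qed

text \<open>Differentiation of the reproducing formula under the integral, one direction at a time:
  derivatives of the atoms grow polynomially in \<open>w\<close>, and the rapid decay of the
  coefficients dominates them. This prepares convergence in the Schwartz seminorms instead of
  pointwise.\<close>

lemma gabor_reproducing_deriv:
 fixes g \<phi> :: "'d::finite cfun"
 assumes g: "g \<in> schwartz" and \<phi>: "\<phi> \<in> schwartz"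
  and c: "\<And>f x. f \<in> schwartz \<Longrightarrow> inv_fourier (fourier f) x = c * f (x :: real ^ 'd)"
 shows "(\<integral>\<^sub>Lw. gabor_coeff g \<phi> w * partial_derivs js (gabor_atom g w) z) =
  c * of_real (\<integral>\<^sub>Ly. (norm (g y))\<^sup>2) * partial_derivs js \<phi> z"
proof (induction js arbitrary: z)
 case Nil
 show ?case using gabor_reproducing[OF assms] by simp
next
 case (Cons j js)
 let ?a = "gabor_coeff g \<phi>" and ?k = "c * of_real (\<integral>\<^sub>Ly. (norm (g y))\<^sup>2)"
 let ?f = "\<lambda>w. partial_derivs js (gabor_atom g w)"
 note gabor_coeff_measurable[OF g \<phi>, measurable]
 have sm: "smooth (gabor_atom g w)" for w by (intro schwartz_smooth time_freq_shift_schwartz g)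
 note [measurable] = gabor_atom_deriv_measurable[OF g]
 obtain D where D: "0 \<le> D" "\<And>w ls z. length ls \<le> Suc (length js) \<Longrightarrow> norm (partial_derivs ls (gabor_atom g w) z) \<le> D * (1 + norm w) ^ Suc (length js)"
  using gabor_atom_deriv_bound[OF g] by metis
 have n: "norm (complex_of_real (D * (1 + norm w) ^ Suc (length js))) = D * (1 + norm w) ^ Suc (length js)" for w :: "(real ^ 'd) \<times> (real ^ 'd)"
  unfolding norm_of_real by (rule abs_of_nonneg) (simp add: D(1))
 have int: "integrable lborel (\<lambda>w. ?a w * partial_derivs ls (gabor_atom g w) z)" if "length ls \<le> Suc (length js)" for ls z
  by (rule integrable_gabor_coeff_mult[OF g \<phi> gabor_atom_deriv_measurable[OF g] D(2)[OF that]])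
 have d: "((\<lambda>z. \<integral>\<^sub>Lw. ?a w * ?f w z) has_derivative (\<lambda>v. \<integral>\<^sub>Lw. ?a w * frechet_derivative (?f w) (at z) v)) (at z)"
 proof (rule has_derivative_integral[where S = UNIV and G = "\<lambda>w. norm (?a w * of_real (D * (1 + norm w) ^ Suc (length js))) * real CARD('d)"])
  show "integrable lborel (\<lambda>w. ?a w * ?f w z)" for z by (rule int) simp
  show "((\<lambda>z. ?a w * ?f w z) has_derivative (\<lambda>v. ?a w * frechet_derivative (?f w) (at z) v)) (at z)" for z w
   by (intro has_derivative_mult_right smooth_has_derivative smooth_partial_derivs sm)
  show "norm (?a w * frechet_derivative (?f w) (at z) v) \<le> norm (?a w * of_real (D * (1 + norm w) ^ Suc (length js))) * real CARD('d) * norm v" for z w v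
  proof -
   have "norm (frechet_derivative (?f w) (at z) v) \<le> real CARD('d) * (D * (1 + norm w) ^ Suc (length js)) * norm v"
    by (rule norm_frechet_derivative_le)
      (use D(2)[of "_ # js" w z] in \<open>auto intro!: smooth_differentiable smooth_partial_derivs sm\<close>)
   from mult_left_mono[OF this, of "norm (?a w)"] show ?thesis
    unfolding norm_mult[of "?a w"] n by (simp add: mult_ac)
  qed
  have "integrable lborel (\<lambda>w. ?a w * of_real (D * (1 + norm w) ^ Suc (length js)))"
   by (rule integrable_gabor_coeff_mult[OF g \<phi>, where D = D and k = "Suc (length js)"])
     (simp_all only: n order_refl, measurable)
  then show "integrable lborel (\<lambda>w. norm (?a w * of_real (D * (1 + norm w) ^ Suc (length js))) * real CARD('d))"
   by (intro integrable_mult_left integrable_norm)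
  have e: "frechet_derivative (?f w) (at z) v = (\<Sum>i\<in>UNIV. (v $ i) *\<^sub>R partial_derivs (i # js) (gabor_atom g w) z)" for w v
   by (subst frechet_derivative_eq_sum) (auto intro: smooth_differentiable smooth_partial_derivs sm)
  show "(\<lambda>w. ?a w * frechet_derivative (?f w) (at z) v) \<in> borel_measurable lborel" for v
   unfolding e by measurable
 qed auto
 have "(\<integral>\<^sub>Lw. ?a w * partial_derivs (j # js) (gabor_atom g w) z) = partial_deriv j (\<lambda>z. \<integral>\<^sub>Lw. ?a w * ?f w z) z"
  unfolding partial_deriv_eq[OF d] by (simp add: partial_deriv_def)
 also have "\<dots> = partial_deriv j (\<lambda>z. ?k * partial_derivs js \<phi> z) z"
  by (simp only: Cons.IH)
 also have "\<dots> = ?k * partial_derivs (j # js) \<phi> z"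
  using fun_cong[OF partial_derivs_cmult[OF smooth_partial_derivs[OF schwartz_smooth[OF \<phi>]], of "[j]" ?k js], of z] by simp
 finally show ?case .
qed

text \<open>Along a simple function the integral is a finite sum whose coefficients do not depend on
  \<open>q\<close>. The same kind of sum can thus be formed with the derivatives of the atoms and
  with the values of \<open>v\<close> on them.\<close>

lemma integral_comp_simple_function:
 fixes a :: "'a::euclidean_space \<Rightarrow> complex"
 assumes a: "integrable lborel a" and s: "simple_function lborel s"
 shows "(\<integral>\<^sub>Lw. a w * q (s w)) = (\<Sum>v\<in>range s. (\<integral>\<^sub>Lw. indicator (s -` {v}) w *\<^sub>R a w) * q v)"
proof -
 have fin: "finite (range s)" using simple_functionD(1)[OF s] by simp
 have set: "s -` {v} \<in> sets lborel" for v using simple_functionD(2)[OF s, of "{v}"] by simp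
 have int: "integrable lborel (\<lambda>w. indicator (s -` {v}) w *\<^sub>R a w)" for v
  by (rule integrable_mult_indicator[OF set a])
 have "(\<lambda>w. a w * q (s w)) = (\<lambda>w. \<Sum>v\<in>range s. (indicator (s -` {v}) w *\<^sub>R a w) * q v)"
 proof
  fix w
  have "(\<Sum>v\<in>range s. (indicator (s -` {v}) w *\<^sub>R a w) * q v) = (\<Sum>v\<in>range s. if v = s w then a w * q v else 0)"
   by (intro sum.cong) (auto simp: indicator_def)
  also have "\<dots> = a w * q (s w)" using fin by simp
  finally show "a w * q (s w) = (\<Sum>v\<in>range s. (indicator (s -` {v}) w *\<^sub>R a w) * q v)" ..
 qed
 then have "(\<integral>\<^sub>Lw. a w * q (s w)) = (\<integral>\<^sub>Lw. (\<Sum>v\<in>range s. (indicator (s -` {v}) w *\<^sub>R a w) * q v))"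
  by simp
 also have "\<dots> = (\<Sum>v\<in>range s. \<integral>\<^sub>Lw. (indicator (s -` {v}) w *\<^sub>R a w) * q v)"
  by (rule Bochner_Integration.integral_sum) (intro integrable_mult_left int)
 also have "\<dots> = (\<Sum>v\<in>range s. (\<integral>\<^sub>Lw. indicator (s -` {v}) w *\<^sub>R a w) * q v)"
  by (simp only: integral_mult_left_zero)
 finally show ?thesis .
qed

text \<open>The integral of the Gabor atoms converges in the Schwartz topology: replacing the index \<open>w\<close>
 by simple functions \<open>s\<^sub>n w \<longlongrightarrow> w\<close> turns it into finite sums, to which \<open>v\<close> can be applied.\<close>

lemma tempered_form_reproducing:
 fixes g \<phi> :: "'d::finite cfun"
 assumes v: "tempered_form N C v" and g: "g \<in> schwartz" and \<phi>: "\<phi> \<in> schwartz"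
  and c: "\<And>f x. f \<in> schwartz \<Longrightarrow> inv_fourier (fourier f) x = c * f (x :: real ^ 'd)"
 shows "(\<integral>\<^sub>Lw. cnj (gabor_coeff g \<phi> w) * v (gabor_atom g w)) =
  cnj (c * of_real (\<integral>\<^sub>Ly. (norm (g y))\<^sup>2)) * v \<phi>"
proof -
 let ?a = "gabor_coeff g \<phi>" and ?k = "c * of_real (\<integral>\<^sub>Ly. (norm (g y))\<^sup>2)"
 let ?E = "gabor_atom g"
 note gabor_coeff_measurable[OF g \<phi>, measurable]
 have a: "integrable lborel ?a"
  using integrable_gabor_coeff_mult[OF g \<phi>, of "\<lambda>_. 1" 1 0] by simp
 note [measurable] = tempered_gabor_measurable[OF v g] gabor_atom_deriv_measurable[OF g]
 have Es: "?E w \<in> schwartz" for w by (rule time_freq_shift_schwartz[OF g])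
 from borel_measurable_implies_sequence_metric[of "\<lambda>w::(real ^ 'd) \<times> (real ^ 'd). w" lborel 0]
 obtain s :: "nat \<Rightarrow> (real ^ 'd) \<times> (real ^ 'd) \<Rightarrow> (real ^ 'd) \<times> (real ^ 'd)" where s:
  "\<And>i. simple_function lborel (s i)" "\<And>w. (\<lambda>i. s i w) \<longlonglongrightarrow> w" "\<And>i w. norm (s i w) \<le> 2 * norm w"
  by auto
 have [measurable]: "s i \<in> \<B>" for i
  using borel_measurable_simple_function[OF s(1)] by simp
 obtain D where D: "0 \<le> D" "\<And>x \<xi> x' \<xi>'. decay_bound N N
  (D * (norm (x - x') + norm (\<xi> - \<xi>')) * (1 + norm x + norm x' + norm \<xi> + norm \<xi>') ^ (N + 1 + 2 * N))
  (\<lambda>y. time_freq_shift x \<xi> g y - time_freq_shift x' \<xi>' g y)"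
  using time_freq_shift_diff_bound[OF g, of N N] by blast
 define M where "M = 3 * N + 1"
 let ?b = "\<lambda>i w. D * (2 * norm (s i w - w)) * (6 * (1 + norm w)) ^ M" and ?B = "\<lambda>w. D * (6 * norm w) * (6 * (1 + norm w)) ^ M"
  and ?G = "\<lambda>G w. G * (2 ^ (2 * N) * (1 + norm w) ^ (2 * N))"
 \<comment> \<open>Because of \<open>norm (s i w) \<le> 2 * norm w\<close>, all norms together are
   at most \<open>6 * (1 + norm w)\<close>; the bound grows polynomially in \<open>w\<close> and,
   for each \<open>w\<close>, tends to 0 with \<open>i\<close>.\<close>
 have lip: "decay_bound N N (?b i w) (\<lambda>y. ?E w y - ?E (s i w) y)" for i w
 proof (rule decay_bound_mono[OF D(2)[of "fst w" "fst (s i w)" "snd w" "snd (s i w)"] order_refl order_refl])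
  have n: "norm (fst w - fst (s i w)) \<le> norm (s i w - w)" "norm (snd w - snd (s i w)) \<le> norm (s i w - w)"
  proof -
   have "norm (fst (w - s i w)) \<le> norm (w - s i w)" "norm (snd (w - s i w)) \<le> norm (w - s i w)"
    by (metis norm_fst_le norm_snd_le prod.collapse)+
   then show "norm (fst w - fst (s i w)) \<le> norm (s i w - w)" "norm (snd w - snd (s i w)) \<le> norm (s i w - w)"
    by (simp_all only: fst_diff snd_diff norm_minus_commute[of w])
  qed
  have m: "norm (fst w) \<le> norm w" "norm (snd w) \<le> norm w" "norm (fst (s i w)) \<le> 2 * norm w" "norm (snd (s i w)) \<le> 2 * norm w"
   using norm_fst_le[of "fst w" "snd w"] norm_snd_le[of "snd w" "fst w"] norm_fst_le[of "fst (s i w)" "snd (s i w)"]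
    norm_snd_le[of "snd (s i w)" "fst (s i w)"] s(3)[of i w] by auto
  have "1 + norm (fst w) + norm (fst (s i w)) + norm (snd w) + norm (snd (s i w)) \<le> 6 + 6 * norm w" using m by linarith
  also have "\<dots> = 6 * (1 + norm w)" by simp
  finally have 1: "1 + norm (fst w) + norm (fst (s i w)) + norm (snd w) + norm (snd (s i w)) \<le> 6 * (1 + norm w)" .
  have 2: "norm (fst w - fst (s i w)) + norm (snd w - snd (s i w)) \<le> 2 * norm (s i w - w)" using n by linarith
  have 3: "N + 1 + 2 * N = M" by (simp add: M_def)
  show "D * (norm (fst w - fst (s i w)) + norm (snd w - snd (s i w))) *
   (1 + norm (fst w) + norm (fst (s i w)) + norm (snd w) + norm (snd (s i w))) ^ (N + 1 + 2 * N)
   \<le> ?b i w"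
   unfolding 3 using D(1) by (intro mult_mono power_mono 1 2 order_refl) auto
 qed
 \<comment> \<open>A bound for the approximation error in the very norm that controls
   \<open>v\<close>.\<close>
 define \<epsilon> where "\<epsilon> i = (\<integral>\<^sub>Lw. norm (?a w) * (?b i w))" for i
 have domint: "integrable lborel (\<lambda>w. norm (?a w * of_real (?B w)))"
 proof (rule integrable_norm, rule integrable_gabor_coeff_mult[OF g \<phi>])
  fix w :: "(real ^ 'd) \<times> (real ^ 'd)"
  have "norm (complex_of_real (?B w)) = ?B w"
   unfolding norm_of_real by (rule abs_of_nonneg) (simp add: D(1))
  also have "\<dots> \<le> D * (6 * (1 + norm w)) * (6 * (1 + norm w)) ^ M"
   using D(1) by (intro mult_right_mono mult_left_mono) auto
  also have "\<dots> = (D * 6 ^ Suc M) * (1 + norm w) ^ Suc M" by (simp only: power_mult_distrib power_Suc mult_ac)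
  finally show "norm (complex_of_real (?B w)) \<le> (D * 6 ^ Suc M) * (1 + norm w) ^ Suc M" .
 qed measurable
 have dom: "norm (?a w) * (?b i w) \<le> norm (?a w * of_real (?B w))" for i w
 proof -
  have "norm (s i w - w) \<le> 3 * norm w" using norm_triangle_ineq4[of "s i w" w] s(3)[of i w] by linarith
  then have "norm (?a w) * (?b i w) \<le> norm (?a w) * (D * (2 * (3 * norm w)) * (6 * (1 + norm w)) ^ M)"
   using D(1) by (intro mult_left_mono mult_right_mono) auto
  also have "\<dots> = norm (?a w) * \<bar>?B w\<bar>"
   using D(1) by (subst abs_of_nonneg) auto
  finally show ?thesis unfolding norm_mult norm_of_real .
 qed
 have \<epsilon>int: "integrable lborel (\<lambda>w. norm (?a w) * (?b i w))" for i
 proof (rule Bochner_Integration.integrable_bound[OF domint])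
  show "AE w in lborel. norm (norm (?a w) * (?b i w)) \<le> norm (norm (?a w * of_real (?B w)))"
   using dom[of _ i] D(1) by (intro AE_I2) simp
 qed measurable
 have \<epsilon>lim: "\<epsilon> \<longlonglongrightarrow> 0"
 proof -
  have "(\<lambda>i. \<integral>\<^sub>Lw. norm (?a w) * (?b i w)) \<longlonglongrightarrow> (\<integral>\<^sub>L(w::(real ^ 'd) \<times> (real ^ 'd)). 0)"
  proof (rule integral_dominated_convergence[OF _ _ domint])
   show "AE w in lborel. (\<lambda>i. norm (?a w) * (?b i w)) \<longlonglongrightarrow> 0"
   proof (rule AE_I2)
    fix w
    have "(\<lambda>i. norm (?a w) * (?b i w)) \<longlonglongrightarrow> norm (?a w) * (D * (2 * norm (w - w)) * (6 * (1 + norm w)) ^ M)"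
     by (intro tendsto_intros s(2))
    then show "(\<lambda>i. norm (?a w) * (?b i w)) \<longlonglongrightarrow> 0" by simp
   qed
   show "AE w in lborel. norm (norm (?a w) * (?b i w)) \<le> norm (?a w * of_real (?B w))" for i
    using dom[of _ i] D(1) by (intro AE_I2) simp
  qed measurable
  then show ?thesis by (simp add: \<epsilon>_def[abs_def])
 qed
 \<comment> \<open>Riemann-type sums: the mass of the coefficients on each level set of
   \<open>s i\<close>, times the atom at the value taken there.\<close>
 define A where "A i x = (\<integral>\<^sub>Lw. indicator (s i -` {x}) w *\<^sub>R ?a w)" for i x
 define S where "S i = (\<lambda>y. \<Sum>x\<in>range (s i). A i x * ?E x y)" for i
 have fin: "finite (range (s i))" for i using simple_functionD(1)[OF s(1)[of i]] by simp
 have S: "S i \<in> schwartz" for i unfolding S_def by (intro schwartz_sum schwartz_cmult Es)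
 have S_deriv: "partial_derivs js (S i) z = (\<integral>\<^sub>Lw. ?a w * partial_derivs js (?E (s i w)) z)" for js i z
  unfolding integral_comp_simple_function[OF a s(1), of "\<lambda>x. partial_derivs js (?E x) z" i] A_def[symmetric] S_def
  using fin by (subst partial_derivs_sum) (auto simp: partial_derivs_cmult schwartz_smooth Es smooth_cmult)
 obtain D' where D': "0 \<le> D'" "\<And>w js z. length js \<le> N \<Longrightarrow> norm (partial_derivs js (?E w) z) \<le> D' * (1 + norm w) ^ N"
  using gabor_atom_deriv_bound[OF g] by metis
 have int1: "integrable lborel (\<lambda>w. ?a w * partial_derivs js (?E w) z)" if "length js \<le> N" for js z
  by (rule integrable_gabor_coeff_mult[OF g \<phi> _ D'(2)[OF that]]) measurable
 have sgrow: "(1 + norm (s i w)) ^ K \<le> 2 ^ K * (1 + norm w) ^ K" for i w K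
 proof -
  have "1 + norm (s i w) \<le> 2 * (1 + norm w)" using s(3)[of i w] by simp
  from power_mono[OF this, of K] show ?thesis by (simp only: power_mult_distrib one_plus_norm_pos)
 qed
 have int2: "integrable lborel (\<lambda>w. ?a w * partial_derivs js (?E (s i w)) z)" if "length js \<le> N" for js z i
 proof (rule integrable_gabor_coeff_mult[OF g \<phi>])
  show "(\<lambda>w. partial_derivs js (?E (s i w)) z) \<in> \<B>"
   by (rule measurable_compose[OF _ gabor_atom_deriv_measurable[OF g]]) simp
  show "norm (partial_derivs js (?E (s i w)) z) \<le> (D' * 2 ^ N) * (1 + norm w) ^ N" for w
   using order_trans[OF D'(2)[OF that, of "s i w" z] mult_left_mono[OF sgrow D'(1)]] by (simp add: mult.assoc)
 qed
 have diff: "decay_bound N N (\<epsilon> i) (\<lambda>y. ?k * \<phi> y - S i y)" for i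
  unfolding decay_bound_iff
 proof (intro allI impI)
  fix js :: "'d list" and z :: "real ^ 'd" assume js: "length js \<le> N"
  have s1: "smooth (\<lambda>y. ?k * \<phi> y)" and s2: "smooth (\<lambda>y. - 1 * S i y)"
   by (intro smooth_cmult schwartz_smooth \<phi> S)+
  have r: "(\<integral>\<^sub>Lw. ?a w * partial_derivs js (?E w) z) = ?k * partial_derivs js \<phi> z"
   by (rule gabor_reproducing_deriv[OF g \<phi> c])
  have "partial_derivs js (\<lambda>y. ?k * \<phi> y - S i y) z = partial_derivs js (\<lambda>y. ?k * \<phi> y + - 1 * S i y) z"
   by simp
  also have "\<dots> = ?k * partial_derivs js \<phi> z - partial_derivs js (S i) z"
   by (simp only: partial_derivs_add[OF s1 s2] partial_derivs_cmult[OF schwartz_smooth[OF \<phi>]] partial_derivs_cmult[OF schwartz_smooth[OF S]]) simp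
  also have "\<dots> = (\<integral>\<^sub>Lw. ?a w * partial_derivs js (?E w) z) - (\<integral>\<^sub>Lw. ?a w * partial_derivs js (?E (s i w)) z)"
   by (simp only: S_deriv r)
  also have "\<dots> = (\<integral>\<^sub>Lw. ?a w * partial_derivs js (?E w) z - ?a w * partial_derivs js (?E (s i w)) z)"
   by (rule Bochner_Integration.integral_diff[symmetric]) (intro int1 int2 js)+
  finally have eq: "partial_derivs js (\<lambda>y. ?k * \<phi> y - S i y) z =
   (\<integral>\<^sub>Lw. ?a w * partial_derivs js (?E w) z - ?a w * partial_derivs js (?E (s i w)) z)" .
  have "(1 + norm z) ^ N * norm (partial_derivs js (\<lambda>y. ?k * \<phi> y - S i y) z) =
   norm (\<integral>\<^sub>Lw. of_real ((1 + norm z) ^ N) * (?a w * partial_derivs js (?E w) z - ?a w * partial_derivs js (?E (s i w)) z))"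
   unfolding eq integral_mult_right_zero norm_mult norm_of_real by simp
  also have "\<dots> \<le> \<epsilon> i"
   unfolding \<epsilon>_def
  proof (rule Bochner_Integration.integral_norm_bound_integral[OF _ \<epsilon>int])
   show "integrable lborel (\<lambda>w. of_real ((1 + norm z) ^ N) * (?a w * partial_derivs js (?E w) z - ?a w * partial_derivs js (?E (s i w)) z))"
    by (intro integrable_mult_right Bochner_Integration.integrable_diff int1 int2 js)
   fix w
   have pd: "partial_derivs js (\<lambda>y. ?E w y - ?E (s i w) y) z = partial_derivs js (?E w) z - partial_derivs js (?E (s i w)) z"
   proof -
    have s2: "smooth (\<lambda>y. - 1 * ?E (s i w) y)" by (intro smooth_cmult schwartz_smooth Es)
    have "partial_derivs js (\<lambda>y. ?E w y + - 1 * ?E (s i w) y) z = partial_derivs js (?E w) z - partial_derivs js (?E (s i w)) z"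
     by (simp only: partial_derivs_add[OF schwartz_smooth[OF Es] s2] partial_derivs_cmult[OF schwartz_smooth[OF Es]]) simp
    then show ?thesis by simp
   qed
   have "(1 + norm z) ^ N * norm (partial_derivs js (\<lambda>y. ?E w y - ?E (s i w) y) z) \<le> ?b i w"
    using lip[of i w] js unfolding decay_bound_iff by blast
   from mult_left_mono[OF this[unfolded pd], of "norm (?a w)"]
   show "norm (of_real ((1 + norm z) ^ N) * (?a w * partial_derivs js (?E w) z - ?a w * partial_derivs js (?E (s i w)) z))
    \<le> norm (?a w) * (?b i w)"
    unfolding right_diff_distrib[symmetric] norm_mult norm_of_real by (simp add: mult_ac)
  qed
  finally show "(1 + norm z) ^ N * norm (partial_derivs js (\<lambda>y. ?k * \<phi> y - S i y) z) \<le> \<epsilon> i" .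
 qed
 have vS: "v (S i) = (\<integral>\<^sub>Lw. cnj (?a w) * v (?E (s i w)))" for i
 proof -
  have "integrable lborel (\<lambda>w. cnj (?a w))" using a by simp
  from integral_comp_simple_function[OF this s(1), of "\<lambda>x. v (?E x)" i]
  have "(\<integral>\<^sub>Lw. cnj (?a w) * v (?E (s i w))) = (\<Sum>x\<in>range (s i). cnj (A i x) * v (?E x))"
   unfolding A_def by (simp flip: Bochner_Integration.integral_cnj)
  also have "\<dots> = v (S i)"
   unfolding S_def by (subst tempered_form_sum[OF v]) (auto simp: tempered_form_cmult[OF v] Es schwartz_cmult)
  finally show ?thesis ..
 qed
 have "(\<lambda>i. v (S i)) \<longlonglongrightarrow> v (\<lambda>y. ?k * \<phi> y)"
 proof (rule LIM_zero_cancel, rule Lim_null_comparison)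
  show "\<forall>\<^sub>F i in sequentially. norm (v (S i) - v (\<lambda>y. ?k * \<phi> y)) \<le> C * \<epsilon> i"
  proof (intro always_eventually allI)
   fix i
   have "norm (v (\<lambda>y. ?k * \<phi> y - S i y)) \<le> C * \<epsilon> i"
    by (rule tempered_form_bound[OF v schwartz_diff[OF schwartz_cmult[OF \<phi>] S] diff])
   then show "norm (v (S i) - v (\<lambda>y. ?k * \<phi> y)) \<le> C * \<epsilon> i"
    by (simp add: tempered_form_diff[OF v schwartz_cmult[OF \<phi>] S] norm_minus_commute)
  qed
  show "(\<lambda>i. C * \<epsilon> i) \<longlonglongrightarrow> 0" using tendsto_mult[OF tendsto_const \<epsilon>lim, of C] by simp
 qed
 \<comment> \<open>A second limit of the same sequence, by dominated convergence with the polynomial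
   growth of \<open>v\<close> on atoms. Equating the two limits is the formula.\<close>
 moreover have "(\<lambda>i. v (S i)) \<longlonglongrightarrow> (\<integral>\<^sub>Lw. cnj (?a w) * v (?E w))"
  unfolding vS
 proof -
  obtain G where G: "0 \<le> G" "\<And>w. norm (v (?E w)) \<le> G * (1 + norm w) ^ (2 * N)"
   using tempered_gabor_growth[OF v g] by blast
  show "(\<lambda>i. \<integral>\<^sub>Lw. cnj (?a w) * v (?E (s i w))) \<longlonglongrightarrow> (\<integral>\<^sub>Lw. cnj (?a w) * v (?E w))"
  proof (rule integral_dominated_convergence)
   have nn: "norm (complex_of_real (?G G w)) = ?G G w" for w :: "(real ^ 'd) \<times> (real ^ 'd)"
    unfolding norm_of_real by (rule abs_of_nonneg) (simp add: G(1))
   have "integrable lborel (\<lambda>w. ?a w * of_real (?G G w))"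
   proof (rule integrable_gabor_coeff_mult[OF g \<phi>])
    show "norm (complex_of_real (?G G w)) \<le> (G * 2 ^ (2 * N)) * (1 + norm w) ^ (2 * N)" for w :: "(real ^ 'd) \<times> (real ^ 'd)"
     unfolding nn by (simp add: mult.assoc)
   qed measurable
   then show "integrable lborel (\<lambda>w. norm (?a w * of_real (?G G w)))" by (rule integrable_norm)
   show "AE w in lborel. norm (cnj (?a w) * v (?E (s i w))) \<le> norm (?a w * of_real (?G G w))" for i
   proof (rule AE_I2)
    fix w
    have "norm (v (?E (s i w))) \<le> ?G G w"
     using order_trans[OF G(2)[of "s i w"] mult_left_mono[OF sgrow G(1)]] .
    then show "norm (cnj (?a w) * v (?E (s i w))) \<le> norm (?a w * of_real (?G G w))"
     unfolding norm_mult[of "?a w"] norm_mult[of "cnj (?a w)"] nn complex_mod_cnj by (intro mult_left_mono) auto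
   qed
   show "AE w in lborel. (\<lambda>i. cnj (?a w) * v (?E (s i w))) \<longlonglongrightarrow> cnj (?a w) * v (?E w)"
   proof (intro AE_I2 tendsto_mult tendsto_const)
    fix w
    show "(\<lambda>i. v (?E (s i w))) \<longlonglongrightarrow> v (?E w)"
     by (rule isCont_tendsto_compose[OF
       continuous_on_tempered_gabor[OF v g, unfolded continuous_on_eq_continuous_at[OF open_UNIV], rule_format, OF UNIV_I] s(2)])
   qed
   show "(\<lambda>w. cnj (?a w) * v (?E (s i w))) \<in> borel_measurable lborel" for i
   proof -
    have [measurable]: "(\<lambda>w. v (?E (s i w))) \<in> \<B>"
     by (rule measurable_compose[OF _ tempered_gabor_measurable[OF v g]]) simp
    show ?thesis by measurable
   qed
  qed measurable
 qed
 ultimately have "(\<integral>\<^sub>Lw. cnj (?a w) * v (?E w)) = v (\<lambda>y. ?k * \<phi> y)"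
  using LIMSEQ_unique by blast
 then show ?thesis by (simp only: tempered_form_cmult[OF v \<phi>])
qed

subsection \<open>Mixed Lebesgue norms\<close>

lemma ennreal_powr_ennreal: "0 \<le> r \<Longrightarrow> ennreal_powr (ennreal r) a = ennreal (r powr a)"
 by (simp add: ennreal_powr_def)

lemma ennreal_powr_top [simp]: "ennreal_powr top a = top"
 by (simp add: ennreal_powr_def)

lemma ennreal_powr_0 [simp]: "ennreal_powr 0 a = 0"
 by (simp add: ennreal_powr_def)

lemma ennreal_powr_mono: "0 \<le> a \<Longrightarrow> x \<le> y \<Longrightarrow> ennreal_powr x a \<le> ennreal_powr y a"
 by (cases x; cases y) (auto simp: ennreal_powr_ennreal powr_mono2 ennreal_leI top_unique)

text \<open>Infinite factors are included: \<open>ennreal_powr z a\<close> vanishes only for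
  \<open>z = 0\<close>, so the convention \<open>0 * top = 0\<close> is respected on both
  sides.\<close>

lemma ennreal_powr_mult: "ennreal_powr (x * y) a = ennreal_powr x a * ennreal_powr y a"
proof (cases "x = top \<or> y = top")
 case True
 have z: "ennreal_powr z a = 0 \<longleftrightarrow> z = 0" for z
  by (cases z) (auto simp: ennreal_powr_ennreal ennreal_eq_0_iff)
 have t: "ennreal_powr (top * z) a = ennreal_powr top a * ennreal_powr z a" for z
  using z[of z] by (cases "z = 0") (simp_all add: ennreal_top_mult)
 from True show ?thesis
 proof
  assume "x = top"
  then show ?thesis using t[of y] by (simp only:)
 next
  assume "y = top"
  then show ?thesis using t[of x] by (simp only: mult.commute)
 qed
next
 case False
 then obtain r s where "x = ennreal r" "y = ennreal s" "0 \<le> r" "0 \<le> s"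
  by (cases x; cases y) auto
 then show ?thesis
  by (simp add: ennreal_powr_ennreal ennreal_mult[symmetric] powr_mult)
qed

lemma ennreal_powr_powr: "ennreal_powr (ennreal_powr x a) b = ennreal_powr x (a * b)"
 by (cases x) (auto simp: ennreal_powr_ennreal powr_powr)

lemma ennreal_powr_one [simp]: "ennreal_powr x 1 = x"
 by (cases x) (auto simp: ennreal_powr_ennreal)

lemma ennreal_powr_measurable [measurable (raw)]:
 assumes [measurable]: "f \<in> borel_measurable M"
 shows "(\<lambda>x. ennreal_powr (f x) a) \<in> borel_measurable M"
 unfolding ennreal_powr_def by measurable

lemma ennreal_powr_inverse: "0 < a \<Longrightarrow> ennreal_powr (ennreal_powr x a) (1 / a) = x"
 by (simp add: ennreal_powr_powr)

section \<open>Monotonicity, homogeneity and translation invariance of the Lebesgue norms\<close>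

lemma lp_norm_finite:
 assumes "p \<noteq> top"
 shows "lp_norm p F = ennreal_powr (\<integral>\<^sub>+x. ennreal_powr (F x) (enn2real p)) (1 / enn2real p)"
 using assms by (simp add: lp_norm_def)

lemma lp_norm_top: "lp_norm top F = esssup lborel F"
 by (simp add: lp_norm_def)

lemma enn2real_ge_1: "1 \<le> p \<Longrightarrow> p \<noteq> top \<Longrightarrow> 1 \<le> enn2real p"
 by (cases p) auto

lemma lp_norm_mono:
 assumes [measurable]: "F \<in> \<B>" "G \<in> \<B>"
  and "1 \<le> p" and le: "\<And>x. F x \<le> G x"
 shows "lp_norm p F \<le> lp_norm p G"
proof (cases "p = top")
 case True
 then show ?thesis using le by (auto simp: lp_norm_top intro!: esssup_mono)
next
 case False
 then show ?thesis
  unfolding lp_norm_finite[OF False] using le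
  by (intro ennreal_powr_mono nn_integral_mono) auto
qed

lemma lp_norm_cmult_le:
 assumes [measurable]: "F \<in> \<B>" and p: "1 \<le> p"
 shows "lp_norm p (\<lambda>x. ennreal c * F x) \<le> ennreal c * lp_norm p F"
proof (cases "p = top")
 case True
 have "AE x in lborel. F x \<le> esssup lborel F" by (rule esssup_AE)
 then have "AE x in lborel. ennreal c * F x \<le> ennreal c * esssup lborel F"
  by eventually_elim (rule mult_left_mono, auto)
 then show ?thesis
  unfolding True lp_norm_top by (intro esssup_I) auto
next
 case False
 have "0 < enn2real p" using enn2real_ge_1[OF p False] by simp
 then show ?thesis
  unfolding lp_norm_finite[OF False]
  by (simp add: ennreal_powr_mult nn_integral_cmult ennreal_powr_inverse)
qed

lemma lp_norm_translate:
 fixes F :: "'a::euclidean_space \<Rightarrow> ennreal"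
 assumes [measurable]: "F \<in> \<B>"
 shows "lp_norm p (\<lambda>x. F (x + y)) = lp_norm p F"
proof (cases "p = top")
 case True
 have *: "lborel = distr lborel borel ((+) y)" by (rule lborel_distr_plus[symmetric])
 have "(AE x in lborel. F (x + y) \<le> z) \<longleftrightarrow> (AE x in lborel. F x \<le> z)" for z
  by (subst (2) *, subst AE_distr_iff) (auto simp: add.commute)
 then show ?thesis
  unfolding True lp_norm_top by (simp add: esssup_eq_AE)
next
 case False
 show ?thesis
  unfolding lp_norm_finite[OF False]
  using nn_integral_lborel_translate[of "\<lambda>x. ennreal_powr (F x) (enn2real p)" y] by (simp add: add.commute)
qed

text \<open>The tangent line of \<open>u powr p\<close> at \<open>c\<close>, in the form
  \<open>young\<close>, is integrated against the density \<open>\<rho>\<close>; the best choice of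
  \<open>c\<close> is the mean \<open>T\<close> itself. Total mass below 1 is harmless since the
  constant term of the tangent inequality is nonnegative.\<close>

lemma jensen_ennreal_powr:
 assumes [measurable]: "\<rho> \<in> borel_measurable M" "h \<in> borel_measurable M"
  and \<rho>: "(\<integral>\<^sup>+x. \<rho> x \<partial>M) \<le> 1" and p: "1 \<le> p"
 shows "ennreal_powr (\<integral>\<^sup>+x. \<rho> x * h x \<partial>M) p \<le> (\<integral>\<^sup>+x. \<rho> x * ennreal_powr (h x) p \<partial>M)"
proof (cases "(\<integral>\<^sup>+x. \<rho> x * ennreal_powr (h x) p \<partial>M) = top")
 case False
 define J where "J = (\<integral>\<^sup>+x. \<rho> x * ennreal_powr (h x) p \<partial>M)"
 define T where "T = (\<integral>\<^sup>+x. \<rho> x * h x \<partial>M)"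
 have young: "u \<le> c powr (1 - p) / p * u powr p + (1 - 1 / p) * c" if "0 < c" "0 \<le> u" for u c :: real
 proof (cases "u = 0")
  case True
  then show ?thesis using that p by (simp add: field_simps)
 next
  case u: False
  then have u0: "0 < u" using that by simp
  have "(u powr p) powr (1 / p) * (c powr p) powr (1 - 1 / p) \<le> 1 / p * u powr p + (1 - 1 / p) * c powr p"
   using p u0 that by (intro Youngs_inequality_0) auto
  then have "u * c powr (p - 1) \<le> 1 / p * u powr p + (1 - 1 / p) * c powr p"
   using u0 p that by (simp add: powr_powr right_diff_distrib)
  from mult_left_mono[OF this, of "c powr (1 - p)"]
  have "u * (c powr (p - 1) * c powr (1 - p)) \<le> c powr (1 - p) / p * u powr p + (1 - 1 / p) * (c powr (1 - p) * c powr p)"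
   by (simp add: algebra_simps)
  moreover have "c powr (p - 1) * c powr (1 - p) = 1" "c powr (1 - p) * c powr p = c"
   using that by (simp_all add: powr_add[symmetric])
  ultimately show ?thesis by simp
 qed
 have int: "T \<le> ennreal (c powr (1 - p) / p) * J + ennreal ((1 - 1 / p) * c)" if l: "0 < c" for c
 proof -
  have pw: "h x \<le> ennreal (c powr (1 - p) / p) * ennreal_powr (h x) p + ennreal ((1 - 1 / p) * c)" for x
  proof (cases "h x")
   case (real u)
   have "0 \<le> (1 - 1 / p) * c" using p l by simp
   then show ?thesis
    using young[OF l real(1)] p real
    by (simp add: ennreal_powr_ennreal ennreal_mult'[symmetric] ennreal_plus[symmetric] ennreal_leI del: ennreal_plus)
  next
   case top
   then show ?thesis using l p by (simp add: ennreal_mult_top)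
  qed
  have "T \<le> (\<integral>\<^sup>+x. ennreal (c powr (1 - p) / p) * (\<rho> x * ennreal_powr (h x) p) + ennreal ((1 - 1 / p) * c) * \<rho> x \<partial>M)"
   unfolding T_def
  proof (rule nn_integral_mono)
   fix x
   show "\<rho> x * h x \<le> ennreal (c powr (1 - p) / p) * (\<rho> x * ennreal_powr (h x) p) + ennreal ((1 - 1 / p) * c) * \<rho> x"
    using mult_left_mono[OF pw[of x], of "\<rho> x"] by (simp add: distrib_left mult_ac)
  qed
  also have "\<dots> = ennreal (c powr (1 - p) / p) * J + ennreal ((1 - 1 / p) * c) * (\<integral>\<^sup>+x. \<rho> x \<partial>M)"
   unfolding J_def by (simp add: nn_integral_add nn_integral_cmult)
  also have "\<dots> \<le> ennreal (c powr (1 - p) / p) * J + ennreal ((1 - 1 / p) * c) * 1"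
   by (intro add_left_mono mult_left_mono \<rho>) simp
  finally show ?thesis by simp
 qed
 have J: "J \<noteq> top" using False by (simp add: J_def)
 then obtain j where j: "J = ennreal j" "0 \<le> j" by (cases J) auto
 \<comment> \<open>The choice \<open>c = 1\<close> shows that \<open>T\<close> is finite, so that
   \<open>T\<close> may itself be inserted for \<open>c\<close> below.\<close>
 have "ennreal (1 powr (1 - p) / p) * J + ennreal ((1 - 1 / p) * 1) < top"
  unfolding j by (simp add: ennreal_mult_less_top)
 then have "T < top" using int[of 1] by (auto intro: le_less_trans)
 then obtain t where t: "T = ennreal t" "0 \<le> t" by (cases T) auto
 have "t powr p \<le> j"
 proof (cases "t = 0")
  case True
  then show ?thesis using j by simp
 next
  case False
  then have t0: "0 < t" using t by simp
  have "0 \<le> (1 - 1 / p) * t" "0 \<le> t powr (1 - p) / p * j" using p t0 j by simp_all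
  then have "t \<le> t powr (1 - p) / p * j + (1 - 1 / p) * t"
   using int[OF t0] unfolding t j using p j t0
   by (simp add: ennreal_mult'[symmetric] ennreal_plus[symmetric] del: ennreal_plus)
  then have "t / p \<le> t powr (1 - p) / p * j" by (simp add: algebra_simps)
  from mult_left_mono[OF this, of "p * t powr (p - 1)"] have "t powr (p - 1) * t \<le> (t powr (p - 1) * t powr (1 - p)) * j"
   using p by (simp add: mult_ac)
  moreover have "t powr (p - 1) * t powr (1 - p) = 1" using t0 by (simp add: powr_add[symmetric])
  moreover have "t powr (p - 1) * t = t powr p" using t0 by (simp add: powr_diff)
  ultimately show ?thesis by simp
 qed
 then show ?thesis
  using t j unfolding T_def J_def by (simp add: ennreal_powr_ennreal ennreal_leI)
qed (simp add: top_unique)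

text \<open>The integrand is written as \<open>\<rho> * h\<close> with \<open>\<rho>\<close>
  proportional to the majorant and of total mass 1, and Jensen's inequality is applied in
  \<open>\<eta>\<close> for every \<open>x\<close>. A measurable majorant \<open>m\<close> stands
  for the norms of the slices, so that their measurability in \<open>\<eta>\<close> is settled
  separately.\<close>

lemma minkowski_integral:
 fixes B :: "'a::euclidean_space \<times> 'b \<Rightarrow> ennreal"
 assumes N: "sigma_finite_measure N"
  and [measurable]: "B \<in> borel_measurable (lborel \<Otimes>\<^sub>M N)" "m \<in> borel_measurable N"
  and p: "1 \<le> p" and le: "\<And>\<eta>. \<eta> \<in> space N \<Longrightarrow> lp_norm p (\<lambda>x. B (x, \<eta>)) \<le> m \<eta>"
 shows "lp_norm p (\<lambda>x. \<integral>\<^sup>+\<eta>. B (x, \<eta>) \<partial>N) \<le> (\<integral>\<^sup>+\<eta>. m \<eta> \<partial>N)"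
proof -
 interpret N: sigma_finite_measure N by fact
 interpret P: pair_sigma_finite "lborel :: 'a measure" N ..
 show ?thesis
 proof (cases "p = top")
  case True
  \<comment> \<open>The exceptional null set in \<open>x\<close> depends on \<open>\<eta>\<close>;
    measurability of the exceptional set in the product lets Fubini exchange the
    quantifiers.\<close>
  have "AE \<eta> in N. AE x in lborel. B (x, \<eta>) \<le> m \<eta>"
  proof (rule AE_I2)
   fix \<eta> assume \<eta>: "\<eta> \<in> space N"
   have "AE x in lborel. B (x, \<eta>) \<le> esssup lborel (\<lambda>x. B (x, \<eta>))" by (rule esssup_AE)
   then show "AE x in lborel. B (x, \<eta>) \<le> m \<eta>"
    by (rule eventually_mono) (use le[OF \<eta>] in \<open>simp add: True lp_norm_top\<close>)
  qed
  moreover have "{z \<in> space (lborel \<Otimes>\<^sub>M N). B (fst z, snd z) \<le> m (snd z)} \<in> sets (lborel \<Otimes>\<^sub>M N)"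
   unfolding prod.collapse by measurable
  ultimately have "AE x in lborel. AE \<eta> in N. B (x, \<eta>) \<le> m \<eta>"
   by (subst P.AE_commute)
  then have "AE x in lborel. (\<integral>\<^sup>+\<eta>. B (x, \<eta>) \<partial>N) \<le> (\<integral>\<^sup>+\<eta>. m \<eta> \<partial>N)"
   by eventually_elim (rule nn_integral_mono_AE)
  then show ?thesis
   unfolding True lp_norm_top by (intro esssup_I) auto
 next
  case False
  define P where "P = enn2real p"
  have P: "1 \<le> P" unfolding P_def by (rule enn2real_ge_1[OF p False])
  obtain w where w [measurable]: "w \<in> borel_measurable N" and wi: "(\<integral>\<^sup>+x. w x \<partial>N) \<noteq> top"
   and wp: "\<And>x. x \<in> space N \<Longrightarrow> 0 < w x \<and> w x < top"
   using N.Ex_finite_integrable_function by (auto simp: top_unique)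
  show ?thesis
  proof (cases "(\<integral>\<^sup>+\<eta>. m \<eta> \<partial>N) = top")
   case mfin: False
   show ?thesis
   proof (rule ennreal_le_epsilon)
    fix e :: real assume e: "0 < e"
    define \<epsilon> where "\<epsilon> = e / (1 + enn2real (\<integral>\<^sup>+x. w x \<partial>N))"
    have \<epsilon>: "0 < \<epsilon>" unfolding \<epsilon>_def using e by (simp add: add_pos_nonneg)
    \<comment> \<open>The majorant becomes a density and is divided by, so a small multiple of the
      strictly positive integrable \<open>w\<close> is added; \<open>\<epsilon>\<close> is scaled
      such that the added mass is at most \<open>e\<close>.\<close>
    define m' where "m' \<eta> = m \<eta> + ennreal \<epsilon> * w \<eta>" for \<eta>
    have [measurable]: "m' \<in> borel_measurable N" unfolding m'_def by measurable
    define I where "I = (\<integral>\<^sup>+\<eta>. m' \<eta> \<partial>N)"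
    have Ieq: "I = (\<integral>\<^sup>+\<eta>. m \<eta> \<partial>N) + ennreal \<epsilon> * (\<integral>\<^sup>+\<eta>. w \<eta> \<partial>N)"
     unfolding I_def m'_def by (simp add: nn_integral_add nn_integral_cmult)
    have Ifin: "I \<noteq> top" unfolding Ieq using mfin wi by (simp add: ennreal_mult_eq_top_iff)
    have Ile: "I \<le> (\<integral>\<^sup>+\<eta>. m \<eta> \<partial>N) + ennreal e"
    proof -
     obtain r where r: "(\<integral>\<^sup>+x. w x \<partial>N) = ennreal r" "0 \<le> r" using wi by (cases "(\<integral>\<^sup>+x. w x \<partial>N)") auto
     have "\<epsilon> * r = e * (r / (1 + r))" unfolding \<epsilon>_def r by (simp add: r)
     also have "\<dots> \<le> e * 1" using e r by (intro mult_left_mono) auto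
     finally show ?thesis
      unfolding Ieq r using \<epsilon> r by (intro add_left_mono) (simp add: ennreal_mult[symmetric] ennreal_leI)
    qed
    have m'pos: "0 < m' \<eta>" if "\<eta> \<in> space N" for \<eta>
     using wp[OF that] \<epsilon> unfolding m'_def by (simp add: ennreal_zero_less_mult_iff add_pos_nonneg add_nonneg_pos)
    have m'fin: "AE \<eta> in N. m' \<eta> \<noteq> top"
     using nn_integral_PInf_AE[of m' N] Ifin unfolding I_def by simp
    show "lp_norm p (\<lambda>x. \<integral>\<^sup>+\<eta>. B (x, \<eta>) \<partial>N) \<le> (\<integral>\<^sup>+\<eta>. m \<eta> \<partial>N) + ennreal e"
    proof (cases "I = 0")
     \<comment> \<open>Since \<open>m'\<close> is positive, a vanishing integral means that
       \<open>N\<close> is the null measure.\<close>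
     case I0: True
     have "AE \<eta> in N. m' \<eta> = 0" using I0 unfolding I_def by (simp add: nn_integral_0_iff_AE)
     then have "AE \<eta> in N. False"
      using AE_space by eventually_elim (use m'pos in force)
     have "(\<integral>\<^sup>+\<eta>. B (x, \<eta>) \<partial>N) = 0" for x
     proof -
      have "(\<integral>\<^sup>+\<eta>. B (x, \<eta>) \<partial>N) = (\<integral>\<^sup>+\<eta>. 0 \<partial>N)"
       using \<open>AE \<eta> in N. False\<close> by (intro nn_integral_cong_AE) (auto elim: eventually_mono)
      then show ?thesis by simp
     qed
     then show ?thesis by (simp add: lp_norm_finite[OF False])
    next
     case I0: False
     define \<rho> where "\<rho> \<eta> = m' \<eta> / I" for \<eta>
     define h where "h x \<eta> = I * B (x, \<eta>) / m' \<eta>" for x \<eta>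
     have [measurable]: "\<rho> \<in> borel_measurable N" unfolding \<rho>_def by measurable
     have hm [measurable]: "(\<lambda>z. h (fst z) (snd z)) \<in> borel_measurable (lborel \<Otimes>\<^sub>M N)" unfolding h_def by measurable
     have hx [measurable]: "h x \<in> borel_measurable N" for x unfolding h_def by measurable
     have \<rho>1: "(\<integral>\<^sup>+\<eta>. \<rho> \<eta> \<partial>N) \<le> 1"
      unfolding \<rho>_def using I0 Ifin by (simp add: nn_integral_divide I_def[symmetric] ennreal_divide_self less_top)
     have eq: "(\<integral>\<^sup>+\<eta>. B (x, \<eta>) \<partial>N) = (\<integral>\<^sup>+\<eta>. \<rho> \<eta> * h x \<eta> \<partial>N)" for x
     proof (rule nn_integral_cong_AE)
      show "AE \<eta> in N. B (x, \<eta>) = \<rho> \<eta> * h x \<eta>"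
       using m'fin AE_space
      proof eventually_elim
       case (elim \<eta>)
       have "\<rho> \<eta> * h x \<eta> = (m' \<eta> / m' \<eta>) * (I / I) * B (x, \<eta>)"
        unfolding \<rho>_def h_def by (simp add: divide_ennreal_def mult_ac)
       also have "\<dots> = B (x, \<eta>)"
        using elim m'pos[of \<eta>] I0 Ifin by (simp add: ennreal_divide_self less_top zero_less_iff_neq_zero)
       finally show ?case by simp
      qed
     qed
     have "(\<integral>\<^sub>+x. ennreal_powr (\<integral>\<^sup>+\<eta>. B (x, \<eta>) \<partial>N) P) \<le> (\<integral>\<^sub>+x. (\<integral>\<^sup>+\<eta>. \<rho> \<eta> * ennreal_powr (h x \<eta>) P \<partial>N))"
      unfolding eq by (intro nn_integral_mono jensen_ennreal_powr \<rho>1 P) measurable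
     also have "\<dots> = (\<integral>\<^sup>+\<eta>. (\<integral>\<^sub>+x. \<rho> \<eta> * ennreal_powr (h x \<eta>) P) \<partial>N)"
      by (rule P.Fubini'[symmetric]) (simp add: split_beta')
     also have "\<dots> \<le> (\<integral>\<^sup>+\<eta>. \<rho> \<eta> * ennreal_powr I P \<partial>N)"
     proof (rule nn_integral_mono_AE)
      show "AE \<eta> in N. (\<integral>\<^sub>+x. \<rho> \<eta> * ennreal_powr (h x \<eta>) P) \<le> \<rho> \<eta> * ennreal_powr I P"
       using m'fin AE_space
      proof eventually_elim
       case (elim \<eta>)
       have [measurable]: "(\<lambda>x. B (x, \<eta>)) \<in> \<B>"
        using measurable_compose[OF measurable_Pair2'[OF elim(2), of lborel] assms(2)] by simp
       have hxe: "h x \<eta> = (I / m' \<eta>) * B (x, \<eta>)" for x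
        unfolding h_def by (simp add: divide_ennreal_def mult_ac)
       have "(\<integral>\<^sub>+x. ennreal_powr (B (x, \<eta>)) P) = ennreal_powr (lp_norm p (\<lambda>x. B (x, \<eta>))) P"
        using P unfolding lp_norm_finite[OF False] P_def[symmetric] by (simp add: ennreal_powr_powr)
       also have "\<dots> \<le> ennreal_powr (m' \<eta>) P"
        using P le[OF elim(2)] unfolding m'_def by (intro ennreal_powr_mono) (auto intro: order_trans)
       finally have b: "(\<integral>\<^sub>+x. ennreal_powr (B (x, \<eta>)) P) \<le> ennreal_powr (m' \<eta>) P" .
       have "(\<integral>\<^sub>+x. \<rho> \<eta> * ennreal_powr (h x \<eta>) P) = \<rho> \<eta> * (ennreal_powr (I / m' \<eta>) P * (\<integral>\<^sub>+x. ennreal_powr (B (x, \<eta>)) P))"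
        unfolding hxe ennreal_powr_mult by (simp add: nn_integral_cmult)
       also have "\<dots> \<le> \<rho> \<eta> * (ennreal_powr (I / m' \<eta>) P * ennreal_powr (m' \<eta>) P)"
        by (intro mult_left_mono b) auto
       also have "ennreal_powr (I / m' \<eta>) P * ennreal_powr (m' \<eta>) P = ennreal_powr (I / m' \<eta> * m' \<eta>) P"
        by (simp add: ennreal_powr_mult)
       also have "I / m' \<eta> * m' \<eta> = I * (m' \<eta> / m' \<eta>)" by (simp add: divide_ennreal_def mult_ac)
       also have "\<dots> = I" using elim m'pos[of \<eta>] by (simp add: ennreal_divide_self less_top zero_less_iff_neq_zero)
       finally show ?case .
      qed
     qed
     also have "\<dots> = (\<integral>\<^sup>+\<eta>. \<rho> \<eta> \<partial>N) * ennreal_powr I P" by (simp add: nn_integral_multc)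
     also have "\<dots> \<le> 1 * ennreal_powr I P" by (intro mult_right_mono \<rho>1) simp
     finally have "ennreal_powr (\<integral>\<^sub>+x. ennreal_powr (\<integral>\<^sup>+\<eta>. B (x, \<eta>) \<partial>N) P) (1 / P) \<le> ennreal_powr (ennreal_powr I P) (1 / P)"
      using P by (intro ennreal_powr_mono) auto
     also have "\<dots> = I" using P by (intro ennreal_powr_inverse) simp
     also note Ile
     finally show ?thesis unfolding lp_norm_finite[OF False] P_def[symmetric] .
    qed
   qed
  qed simp
 qed
qed

text \<open>Minkowski's integral inequality for the counting measure on the index type.\<close>

lemma lp_norm_sum_le:
 fixes F :: "'n::finite \<Rightarrow> 'a::euclidean_space \<Rightarrow> ennreal"
 assumes F: "\<And>l. F l \<in> \<B>" and p: "1 \<le> p"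
 shows "lp_norm p (\<lambda>x. \<Sum>l\<in>UNIV. F l x) \<le> (\<Sum>l\<in>UNIV. lp_norm p (F l))"
proof -
 have "(\<lambda>z. F (snd z) (fst z)) \<in> borel_measurable (lborel \<Otimes>\<^sub>M count_space UNIV)"
 proof (rule measurable_compose_countable[of "\<lambda>l z. F l (fst z)"])
  show "(\<lambda>z. F l (fst z)) \<in> borel_measurable (lborel \<Otimes>\<^sub>M count_space UNIV)" for l
   using F[of l] by measurable
 qed measurable
 from minkowski_integral[OF sigma_finite_measure_count_space_finite[of UNIV] this, of "\<lambda>l. lp_norm p (F l)" p] p
 show ?thesis by (simp add: nn_integral_count_space_finite)
qed

section \<open>Polynomial weights\<close>

lemma japanese_bracket_ge_1: "1 \<le> japanese_bracket x"
 by (simp add: japanese_bracket_def)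

lemma japanese_bracket_le: "japanese_bracket x \<le> 1 + norm x"
 unfolding japanese_bracket_def by (rule real_le_lsqrt) (auto simp: power2_sum)

lemma japanese_bracket_ge: "1 + norm x \<le> 2 * japanese_bracket x"
proof -
 have "norm x \<le> japanese_bracket x" unfolding japanese_bracket_def by (rule real_le_rsqrt) simp
 then show ?thesis using japanese_bracket_ge_1[of x] by linarith
qed

lemma japanese_bracket_shift: "japanese_bracket x \<le> 4 * (japanese_bracket y * japanese_bracket (x + y))"
proof -
 have "japanese_bracket x \<le> 1 + norm x" by (rule japanese_bracket_le)
 also have "\<dots> \<le> (1 + norm y) * (1 + norm (x + y))" by (rule one_plus_norm_shift)
 also have "\<dots> \<le> (2 * japanese_bracket y) * (2 * japanese_bracket (x + y))"
  using japanese_bracket_ge_1[of y] by (intro mult_mono japanese_bracket_ge) auto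
 finally show ?thesis by simp
qed

lemma japanese_bracket_minus: "japanese_bracket (- y) = japanese_bracket y"
 by (simp add: japanese_bracket_def)

text \<open>For negative \<open>r\<close> the roles of \<open>x\<close> and \<open>x + y\<close> are
  exchanged, so either sign costs the same factor with exponent
  \<open>\<bar>r\<bar>\<close>.\<close>

lemma japanese_bracket_powr_shift:
 "japanese_bracket x powr r \<le> 4 powr \<bar>r\<bar> * (japanese_bracket y powr \<bar>r\<bar> * japanese_bracket (x + y) powr r)"
proof (cases "0 \<le> r")
 case True
 have "japanese_bracket x powr r \<le> (4 * (japanese_bracket y * japanese_bracket (x + y))) powr r"
  using True japanese_bracket_ge_1[of x] by (intro powr_mono2 japanese_bracket_shift) auto
 then show ?thesis
  using True japanese_bracket_ge_1[of y] japanese_bracket_ge_1[of "x + y"] by (simp add: powr_mult)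
next
 case False
 then have r: "\<bar>r\<bar> = - r" "0 < - r" by auto
 have j: "0 < japanese_bracket x" "0 < japanese_bracket y" "0 < japanese_bracket (x + y)"
  using japanese_bracket_ge_1[of x] japanese_bracket_ge_1[of y] japanese_bracket_ge_1[of "x + y"] by linarith+
 have "japanese_bracket (x + y) \<le> 4 * (japanese_bracket y * japanese_bracket x)"
  using japanese_bracket_shift[of "x + y" "- y"] by (simp add: japanese_bracket_minus)
 then have "japanese_bracket (x + y) powr (- r) \<le> (4 * (japanese_bracket y * japanese_bracket x)) powr (- r)"
  using r j by (intro powr_mono2) auto
 also have "\<dots> = 4 powr (- r) * (japanese_bracket y powr (- r) * japanese_bracket x powr (- r))"
  using j by (simp add: powr_mult)
 finally show ?thesis
  unfolding r(1) using j by (simp add: powr_minus field_simps)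
qed

lemma japanese_bracket_continuous [continuous_intros]:
 "continuous_on A f \<Longrightarrow> continuous_on A (\<lambda>x. japanese_bracket (f x))"
 unfolding japanese_bracket_def by (intro continuous_intros)

lemma japanese_bracket_powr_measurable [measurable]:
 "(\<lambda>x::'a::euclidean_space. japanese_bracket x powr r) \<in> \<B>"
 unfolding japanese_bracket_def by measurable

text \<open>Moving the weight under the convolution costs
  \<open>japanese_bracket y powr \<bar>r\<bar>\<close>; the bound on \<open>K\<close> leaves
  \<open>2 * DIM('a)\<close> powers of decay, enough for an integrable kernel. Minkowski's
  inequality and translation invariance give one \<open>C\<close> for all \<open>p\<close> and
  \<open>B\<close>.\<close>

lemma lp_norm_convolution_weight:
 assumes K: "2 * real DIM('a) + \<bar>r\<bar> \<le> real K"
 shows "\<exists>C\<ge>0. \<forall>p B. 1 \<le> p \<longrightarrow> (B :: 'a::euclidean_space \<Rightarrow> ennreal) \<in> \<B> \<longrightarrow>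
  lp_norm p (\<lambda>x. (\<integral>\<^sub>+y. decay_weight K y * B (x + y)) * ennreal (japanese_bracket x powr r))
  \<le> ennreal C * lp_norm p (\<lambda>x. B x * ennreal (japanese_bracket x powr r))"
proof -
 let ?w = "\<lambda>x::'a. ennreal (japanese_bracket x powr r)"
 define k where "k y = 4 powr \<bar>r\<bar> * (1 / (1 + norm y) ^ (2 * DIM('a)))" for y :: 'a
 have [measurable]: "k \<in> \<B>" unfolding k_def by measurable
 have ki: "integrable lborel k"
  unfolding k_def by (intro integrable_mult_right integrable_inverse_one_plus_norm) simp
 have k0: "0 \<le> k y" for y by (simp add: k_def)
 have kint: "(\<integral>\<^sub>+y. ennreal (k y)) = ennreal (\<integral>\<^sub>Ly. k y)"
  by (rule nn_integral_eq_integral[OF ki]) (simp add: k0)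
 have kle: "1 / (1 + norm y) ^ K * (4 powr \<bar>r\<bar> * japanese_bracket y powr \<bar>r\<bar>) \<le> k y" for y :: 'a
 proof -
  have "japanese_bracket y powr \<bar>r\<bar> \<le> (1 + norm y) powr \<bar>r\<bar>"
   using japanese_bracket_ge_1[of y] by (intro powr_mono2 japanese_bracket_le) auto
  also have "\<dots> \<le> (1 + norm y) powr (real K - 2 * real DIM('a))"
   using K by (intro powr_mono) auto
  also have "\<dots> = (1 + norm y) ^ K / (1 + norm y) ^ (2 * DIM('a))"
   using powr_realpow[of "1 + norm y" "2 * DIM('a)"] by (simp add: powr_diff powr_realpow)
  finally have "1 / (1 + norm y) ^ K * (4 powr \<bar>r\<bar> * japanese_bracket y powr \<bar>r\<bar>) \<le> 1 / (1 + norm y) ^ K * (4 powr \<bar>r\<bar> * ((1 + norm y) ^ K / (1 + norm y) ^ (2 * DIM('a))))"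
   by (intro mult_left_mono) auto
  then show ?thesis by (simp add: k_def)
 qed
 have main: "lp_norm p (\<lambda>x. (\<integral>\<^sub>+y. decay_weight K y * B (x + y)) * ?w x)
  \<le> ennreal (\<integral>\<^sub>Ly. k y) * lp_norm p (\<lambda>x. B x * ?w x)"
  if p: "1 \<le> p" and [measurable]: "B \<in> \<B>" for p and B :: "'a \<Rightarrow> ennreal"
 proof -
  have "lp_norm p (\<lambda>x. (\<integral>\<^sub>+y. decay_weight K y * B (x + y)) * ?w x)
   \<le> lp_norm p (\<lambda>x. \<integral>\<^sub>+y. ennreal (k y) * (B (x + y) * ?w (x + y)))"
  proof (rule lp_norm_mono[OF _ _ p])
   fix x
   have "(\<integral>\<^sub>+y. decay_weight K y * B (x + y)) * ?w x =
    (\<integral>\<^sub>+y. decay_weight K y * B (x + y) * ?w x)"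
    by (rule nn_integral_multc[symmetric]) measurable
   also have "\<dots> \<le> (\<integral>\<^sub>+y. ennreal (k y) * (B (x + y) * ?w (x + y)))"
   proof (rule nn_integral_mono)
    fix y
    have "1 / (1 + norm y) ^ K * japanese_bracket x powr r \<le> 1 / (1 + norm y) ^ K * (4 powr \<bar>r\<bar> * (japanese_bracket y powr \<bar>r\<bar> * japanese_bracket (x + y) powr r))"
     by (intro mult_left_mono japanese_bracket_powr_shift) simp
    also have "\<dots> \<le> k y * japanese_bracket (x + y) powr r"
     using mult_right_mono[OF kle[of y], of "japanese_bracket (x + y) powr r"] by (simp add: mult_ac)
    finally have "decay_weight K y * ?w x \<le> ennreal (k y) * ?w (x + y)"
     by (simp add: ennreal_mult[symmetric] k0 ennreal_leI)
    from mult_left_mono[OF this, of "B (x + y)"]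
    show "decay_weight K y * B (x + y) * ?w x \<le> ennreal (k y) * (B (x + y) * ?w (x + y))"
     by (simp add: mult_ac)
   qed
   finally show "(\<integral>\<^sub>+y. decay_weight K y * B (x + y)) * ?w x \<le> (\<integral>\<^sub>+y. ennreal (k y) * (B (x + y) * ?w (x + y)))" .
  qed measurable
  also have "\<dots> \<le> (\<integral>\<^sub>+y. ennreal (k y) * lp_norm p (\<lambda>x. B x * ?w x))"
  proof -
   have m: "(\<lambda>z. ennreal (k (snd z)) * (B (fst z + snd z) * ?w (fst z + snd z))) \<in> borel_measurable (lborel \<Otimes>\<^sub>M lborel)"
    by measurable
   have "lp_norm p (\<lambda>x. ennreal (k y) * (B (x + y) * ?w (x + y))) \<le> ennreal (k y) * lp_norm p (\<lambda>x. B x * ?w x)" for y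
    using order_trans[OF lp_norm_cmult_le[of "\<lambda>x. B (x + y) * ?w (x + y)" p "k y"] eq_refl]
     lp_norm_translate[of "\<lambda>x. B x * ?w x" p y] p by simp
   with minkowski_integral[OF sigma_finite_lborel m, of "\<lambda>y. ennreal (k y) * lp_norm p (\<lambda>x. B x * ?w x)" p] p
   show ?thesis by simp
  qed
  also have "\<dots> = ennreal (\<integral>\<^sub>Ly. k y) * lp_norm p (\<lambda>x. B x * ?w x)"
   by (subst nn_integral_multc) (simp_all add: kint)
  finally show ?thesis .
 qed
 have "0 \<le> (\<integral>\<^sub>Ly. k y)" by (intro integral_nonneg_AE) (simp add: k0)
 with main show ?thesis by blast
qed

text \<open>The superlevel sets of a continuous function are open, and a nonempty open set has
  positive measure. The purpose is the measurability of mixed norms with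
  \<open>p = top\<close>.\<close>

lemma continuous_esssup_less_iff:
 fixes f :: "'a::euclidean_space \<Rightarrow> real"
 assumes f: "continuous_on UNIV f"
 shows "c < esssup lborel (\<lambda>x. ennreal (f x)) \<longleftrightarrow> (\<exists>x. c < ennreal (f x))"
proof -
 have m: "(\<lambda>x. ennreal (f x)) \<in> borel_measurable lborel"
  using borel_measurable_continuous_onI[OF f] by measurable
 show ?thesis
 proof
  assume "c < esssup lborel (\<lambda>x. ennreal (f x))"
  then show "\<exists>x. c < ennreal (f x)"
   using esssup_I[OF m, of c] by (meson AE_I2 leD not_le_imp_less)
 next
  assume "\<exists>x. c < ennreal (f x)"
  then obtain x where x: "c < ennreal (f x)" ..
  show "c < esssup lborel (\<lambda>x. ennreal (f x))"
  proof (rule ccontr)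
   assume "\<not> ?thesis"
   then have le: "esssup lborel (\<lambda>x. ennreal (f x)) \<le> c" by simp
   have "AE x in lborel. ennreal (f x) \<le> esssup lborel (\<lambda>x. ennreal (f x))" by (rule esssup_AE)
   then have "AE x in lborel. x \<notin> {x. c < ennreal (f x)}"
    by (rule eventually_mono) (use le in \<open>auto simp: not_less intro: order_trans\<close>)
   moreover have "open {x. c < ennreal (f x)}"
    by (intro open_Collect_less continuous_intros continuous_on_ennreal f)
   ultimately show False using open_AE_not_mem_empty x by blast
  qed
 qed
qed

text \<open>For \<open>p = top\<close> the norm is a supremum over uncountably many
  \<open>x\<close>; continuity of \<open>W\<close> makes its superlevel sets open. For finite
  \<open>p\<close> it is an integral depending measurably on the parameter.\<close>

lemma lp_norm_measurable_parameter:
 fixes W :: "'a::euclidean_space \<times> 'b::euclidean_space \<Rightarrow> real"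
 assumes W: "continuous_on UNIV W"
 shows "(\<lambda>\<xi>. lp_norm p (\<lambda>x. ennreal (W (x, \<xi>)))) \<in> \<B>"
proof (cases "p = top")
 case True
 have sec: "continuous_on UNIV (\<lambda>x. W (x, \<xi>))" "continuous_on UNIV (\<lambda>\<xi>. W (x, \<xi>))" for x \<xi>
  by (auto intro!: continuous_on_compose2[OF W] continuous_intros)
 show ?thesis
  unfolding True lp_norm_top
 proof (rule borel_measurableI_greater)
  fix c :: ennreal
  have "{\<xi>. c < esssup lborel (\<lambda>x. ennreal (W (x, \<xi>)))} = (\<Union>x. {\<xi>. c < ennreal (W (x, \<xi>))})"
   unfolding continuous_esssup_less_iff[OF sec(1)] by auto
  moreover have "open (\<Union>x. {\<xi>. c < ennreal (W (x, \<xi>))})"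
   by (intro open_UN ballI open_Collect_less continuous_intros continuous_on_ennreal sec)
  ultimately show "{\<xi> \<in> space borel. c < esssup lborel (\<lambda>x. ennreal (W (x, \<xi>)))} \<in> sets borel"
   by simp
 qed
next
 case False
 have [measurable]: "W \<in> borel_measurable (borel \<Otimes>\<^sub>M borel)"
  using borel_measurable_continuous_onI[OF W] by (simp add: borel_prod)
 show ?thesis
  unfolding lp_norm_finite[OF False] by measurable
qed

subsection \<open>Real interpolation\<close>

lemma nn_integral_powr_from_0:
 assumes "-1 < a" "0 \<le> v"
 shows "(\<integral>\<^sub>+l. ennreal (l powr a) * indicator {0..v} l) = ennreal (v powr (a + 1) / (a + 1))"
 by (rule nn_integral_has_integral_lebesgue'[OF _ has_integral_powr_from_0]) (use assms in auto)

lemma nn_integral_powr_to_infinity: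
 assumes "a < -1" "0 < v"
 shows "(\<integral>\<^sub>+l. ennreal (l powr a) * indicator {v..} l) = ennreal (- (v powr (a + 1)) / (a + 1))"
 by (rule nn_integral_has_integral_lebesgue'[OF _ has_integral_powr_to_inf]) (use assms in auto)

lemma layer_cake:
 fixes G :: "'a::euclidean_space \<Rightarrow> real"
 assumes [measurable]: "G \<in> \<B>" and G: "\<And>x. 0 \<le> G x" and p: "1 \<le> p"
 shows "(\<integral>\<^sub>+x. ennreal (G x powr p)) \<le>
  (\<integral>\<^sub>+l. ennreal (p * l powr (p - 1)) * indicator {0<..} l * (\<integral>\<^sub>+x. indicator {x. l < G x} x))"
proof -
 have "ennreal (G x powr p) = (\<integral>\<^sub>+l. ennreal (p * l powr (p - 1)) * indicator {0<..} l * indicator {x. l < G x} x)" for x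
 proof -
  have "(\<integral>\<^sub>+l. ennreal (p * l powr (p - 1)) * indicator {0<..} l * indicator {x. l < G x} x) =
   (\<integral>\<^sub>+l. ennreal p * (ennreal (l powr (p - 1)) * indicator {0..G x} l))"
  proof (rule nn_integral_cong_AE)
   \<comment> \<open>The open and closed ranges of \<open>l\<close> differ only in the two
     endpoints.\<close>
   have "AE l in lborel. l \<noteq> 0 \<and> l \<noteq> G x"
    using AE_lborel_singleton[of 0] AE_lborel_singleton[of "G x"] by eventually_elim auto
   then show "AE l in lborel. ennreal (p * l powr (p - 1)) * indicator {0<..} l * indicator {x. l < G x} x =
    ennreal p * (ennreal (l powr (p - 1)) * indicator {0..G x} l)"
    by eventually_elim (use p in \<open>auto simp: indicator_def ennreal_mult\<close>)
  qed
  also have "\<dots> = ennreal p * ennreal (G x powr p / p)"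
   using p G by (simp add: nn_integral_cmult nn_integral_powr_from_0)
  also have "\<dots> = ennreal (G x powr p)"
   using p by (simp add: ennreal_mult[symmetric])
  finally show ?thesis ..
 qed
 then have "(\<integral>\<^sub>+x. ennreal (G x powr p)) =
   (\<integral>\<^sub>+x. (\<integral>\<^sub>+l. ennreal (p * l powr (p - 1)) * indicator {0<..} l * indicator {x. l < G x} x))"
  by simp
 also have "\<dots> = (\<integral>\<^sub>+l. (\<integral>\<^sub>+x. ennreal (p * l powr (p - 1)) * indicator {0<..} l * indicator {x. l < G x} x))"
  by (rule lborel_pair.Fubini'[symmetric]) (simp add: indicator_def)
 also have "\<dots> \<le> (\<integral>\<^sub>+l. ennreal (p * l powr (p - 1)) * indicator {0<..} l * (\<integral>\<^sub>+x. indicator {x. l < G x} x))"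
  by (intro nn_integral_mono eq_refl nn_integral_cmult) measurable
 finally show ?thesis .
qed

text \<open>The test class for interpolation: closed under truncation by size and contained in every
  Lebesgue space.\<close>

definition bounded_support_fun :: "('a::euclidean_space \<Rightarrow> complex) \<Rightarrow> bool" where
 "bounded_support_fun f \<longleftrightarrow> f \<in> \<B> \<and> (\<exists>s. \<forall>x. norm (f x) \<le> s) \<and> (\<exists>R. \<forall>x. R < norm x \<longrightarrow> f x = 0)"

lemma bounded_support_fun_restrict:
 assumes "bounded_support_fun f" "Measurable.pred borel P"
 shows "bounded_support_fun (\<lambda>x. if P x then f x else 0)"
proof -
 obtain s R where "\<forall>x. norm (f x) \<le> s" "\<forall>x. R < norm x \<longrightarrow> f x = 0" and [measurable]: "f \<in> \<B>"
  using assms(1) unfolding bounded_support_fun_def by blast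
 moreover from this have "0 \<le> s" by (meson norm_ge_zero order_trans)
 moreover have "(\<lambda>x. if P x then f x else 0) \<in> \<B>"
  using assms(2) by measurable
 ultimately show ?thesis
  unfolding bounded_support_fun_def by (intro conjI exI[of _ s] exI[of _ R]) auto
qed

text \<open>The operator is normalised to norm 1 on \<open>L^2\<close>, and the bounds for
  integrable and for bounded functions share the constant \<open>A\<close>, so that interpolation
  yields a power of \<open>A\<close> times a constant depending on \<open>p\<close>.
  \<open>T_Linf\<close> is pointwise: it refers to a bound for \<open>f\<close> everywhere, not
  almost everywhere.\<close>

locale interpolation_operator =
 fixes T :: "('a::euclidean_space \<Rightarrow> complex) \<Rightarrow> 'a \<Rightarrow> complex" and A :: real
 assumes A_pos: "0 < A"
  and T_add: "\<And>f h x. bounded_support_fun f \<Longrightarrow> bounded_support_fun h \<Longrightarrow> T (\<lambda>x. f x + h x) x = T f x + T h x"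
  and T_meas: "\<And>f. bounded_support_fun f \<Longrightarrow> T f \<in> \<B>"
  and T_L1: "\<And>f. bounded_support_fun f \<Longrightarrow> (\<integral>\<^sub>+x. ennreal (norm (T f x))) \<le> ennreal A * (\<integral>\<^sub>+x. ennreal (norm (f x)))"
  and T_L2: "\<And>f. bounded_support_fun f \<Longrightarrow> (\<integral>\<^sub>+x. ennreal ((norm (T f x))\<^sup>2)) \<le> (\<integral>\<^sub>+x. ennreal ((norm (f x))\<^sup>2))"
  and T_Linf: "\<And>f s x. bounded_support_fun f \<Longrightarrow> (\<And>x. norm (f x) \<le> s) \<Longrightarrow> norm (T f x) \<le> A * s"
begin

lemma T_split:
 assumes f: "bounded_support_fun f"
 shows "T f x = T (\<lambda>x. if c < norm (f x) then f x else 0) x + T (\<lambda>x. if norm (f x) \<le> c then f x else 0) x"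
  and "bounded_support_fun (\<lambda>x. if c < norm (f x) then f x else 0)"
  and "bounded_support_fun (\<lambda>x. if norm (f x) \<le> c then f x else 0)"
proof -
 have [measurable]: "f \<in> \<B>" using f by (simp add: bounded_support_fun_def)
 show 1: "bounded_support_fun (\<lambda>x. if c < norm (f x) then f x else 0)"
  by (rule bounded_support_fun_restrict[OF f]) measurable
 show 2: "bounded_support_fun (\<lambda>x. if norm (f x) \<le> c then f x else 0)"
  by (rule bounded_support_fun_restrict[OF f]) measurable
 have "f = (\<lambda>x. (if c < norm (f x) then f x else 0) + (if norm (f x) \<le> c then f x else 0))"
  by auto
 then show "T f x = T (\<lambda>x. if c < norm (f x) then f x else 0) x + T (\<lambda>x. if norm (f x) \<le> c then f x else 0) x"
  using T_add[OF 1 2, of x] by simp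
qed

lemma L2_weak:
 assumes h: "bounded_support_fun h" and l: "0 < l"
 shows "(\<integral>\<^sub>+x. ennreal (4 / l\<^sup>2) * ennreal ((norm (T h x))\<^sup>2)) \<le> ennreal (4 / l\<^sup>2) * (\<integral>\<^sub>+x. ennreal ((norm (h x))\<^sup>2))"
proof -
 have [measurable]: "T h \<in> \<B>" by (rule T_meas[OF h])
 show ?thesis by (subst nn_integral_cmult) (auto intro!: mult_left_mono T_L2[OF h])
qed

text \<open>\<open>f\<close> is cut at height \<open>l / (2 * A)\<close>: the small part is mapped
  below \<open>l / 2\<close> everywhere, so only the large part, through its \<open>L^2\<close>
  bound, contributes to the level set at \<open>l\<close>. A cut proportional to \<open>l\<close>
  produces the factor \<open>(2 * A) powr (p - 2)\<close>.\<close>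

lemma interpolation_above_2:
 assumes f: "bounded_support_fun f" and p: "2 < p"
 shows "(\<integral>\<^sub>+x. ennreal (norm (T f x) powr p)) \<le>
  ennreal (4 * p / (p - 2) * (2 * A) powr (p - 2)) * (\<integral>\<^sub>+x. ennreal (norm (f x) powr p))"
proof -
 have [measurable]: "f \<in> \<B>" using f by (simp add: bounded_support_fun_def)
 have [measurable]: "T f \<in> \<B>" by (rule T_meas[OF f])
 let ?big = "\<lambda>l x. if l / (2 * A) < norm (f x) then f x else 0"
 let ?small = "\<lambda>l x. if norm (f x) \<le> l / (2 * A) then f x else 0"
 \<comment> \<open>The integrand after Chebyshev's inequality. For fixed \<open>x\<close> the
   truncation becomes an upper limit for \<open>l\<close>, and \<open>l powr (p - 3)\<close> is
   integrable at 0 because \<open>2 < p\<close>.\<close>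
 let ?g = "\<lambda>x l. ennreal (4 * p) * (ennreal ((norm (f x))\<^sup>2) * (ennreal (l powr (p - 3)) * indicator {0..2 * A * norm (f x)} l))"
 have weak: "(\<integral>\<^sub>+x. indicator {x. l < norm (T f x)} x) \<le> ennreal (4 / l\<^sup>2) * (\<integral>\<^sub>+x. ennreal ((norm (?big l x))\<^sup>2))"
  if l: "0 < l" for l
 proof -
  note sp = T_split[OF f, where c = "l / (2 * A)"]
  have "(\<integral>\<^sub>+x. indicator {x. l < norm (T f x)} x) \<le> (\<integral>\<^sub>+x. ennreal (4 / l\<^sup>2) * ennreal ((norm (T (?big l) x))\<^sup>2))"
  proof (rule nn_integral_mono)
   fix x
   have "norm (T (?small l) x) \<le> A * (l / (2 * A))"
    by (rule T_Linf[OF sp(3)]) (use l A_pos in auto)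
   then have s: "norm (T (?small l) x) \<le> l / 2" using A_pos by simp
   show "indicator {x. l < norm (T f x)} x \<le> ennreal (4 / l\<^sup>2) * ennreal ((norm (T (?big l) x))\<^sup>2)"
   proof (cases "l < norm (T f x)")
    case True
    then have "l / 2 \<le> norm (T (?big l) x)"
     using s norm_triangle_ineq[of "T (?big l) x" "T (?small l) x"] unfolding sp(1)[of x] by linarith
    then have "(l / 2)\<^sup>2 \<le> (norm (T (?big l) x))\<^sup>2" using l by (intro power_mono) auto
    then have "1 \<le> 4 / l\<^sup>2 * (norm (T (?big l) x))\<^sup>2" using l by (simp add: field_simps power_divide)
    then show ?thesis using True by (simp add: ennreal_mult[symmetric])
   qed simp
  qed
  also have "\<dots> \<le> ennreal (4 / l\<^sup>2) * (\<integral>\<^sub>+x. ennreal ((norm (?big l x))\<^sup>2))"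
   by (rule L2_weak[OF sp(2) l])
  finally show ?thesis .
 qed
 have "(\<integral>\<^sub>+x. ennreal (norm (T f x) powr p)) \<le>
  (\<integral>\<^sub>+l. ennreal (p * l powr (p - 1)) * indicator {0<..} l * (\<integral>\<^sub>+x. indicator {x. l < norm (T f x)} x))"
  using p by (intro layer_cake) auto
 also have "\<dots> \<le> (\<integral>\<^sub>+l. (\<integral>\<^sub>+x. ?g x l))"
 proof (rule nn_integral_mono)
  fix l :: real
  show "ennreal (p * l powr (p - 1)) * indicator {0<..} l * (\<integral>\<^sub>+x. indicator {x. l < norm (T f x)} x) \<le>
   (\<integral>\<^sub>+x. ?g x l)"
  proof (cases "0 < l")
   case True
   have "ennreal (p * l powr (p - 1)) * indicator {0<..} l * (\<integral>\<^sub>+x. indicator {x. l < norm (T f x)} x) \<le>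
     ennreal (p * l powr (p - 1)) * (ennreal (4 / l\<^sup>2) * (\<integral>\<^sub>+x. ennreal ((norm (?big l x))\<^sup>2)))"
    using True weak[OF True] by (simp add: mult_left_mono)
   also have "\<dots> = (\<integral>\<^sub>+x. ennreal (p * l powr (p - 1)) * (ennreal (4 / l\<^sup>2) * ennreal ((norm (?big l x))\<^sup>2)))"
    by (simp add: nn_integral_cmult)
   also have "\<dots> \<le> (\<integral>\<^sub>+x. ?g x l)"
   proof (rule nn_integral_mono)
    fix x
    have "l powr (p - 1) = l powr (p - 3) * l powr 2" unfolding powr_add[symmetric] by simp
    then have e: "l powr (p - 1) * (4 / l\<^sup>2) = 4 * l powr (p - 3)" using True by (simp add: powr_numeral)
    show "ennreal (p * l powr (p - 1)) * (ennreal (4 / l\<^sup>2) * ennreal ((norm (?big l x))\<^sup>2)) \<le>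
     ?g x l"
    proof (cases "l / (2 * A) < norm (f x)")
     case big: True
     then have "l \<in> {0..2 * A * norm (f x)}" using True A_pos by (simp add: field_simps)
     moreover have "p * l powr (p - 1) * (4 / l\<^sup>2 * (norm (f x))\<^sup>2) = 4 * p * ((norm (f x))\<^sup>2 * l powr (p - 3))"
      using e by (simp add: mult_ac) (metis mult.assoc mult.commute times_divide_eq_right)
     ultimately show ?thesis using big p by (simp add: ennreal_mult[symmetric])
    qed simp
   qed
   finally show ?thesis .
  qed simp
 qed
 also have "\<dots> = (\<integral>\<^sub>+x. (\<integral>\<^sub>+l. ?g x l))"
  by (rule lborel_pair.Fubini') (simp add: indicator_def)
 also have "\<dots> = (\<integral>\<^sub>+x. ennreal (4 * p / (p - 2) * (2 * A) powr (p - 2)) * ennreal (norm (f x) powr p))"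
 proof (rule nn_integral_cong)
  fix x
  have "(\<integral>\<^sub>+l. ?g x l) =
   ennreal (4 * p) * (ennreal ((norm (f x))\<^sup>2) * ennreal ((2 * A * norm (f x)) powr (p - 3 + 1) / (p - 3 + 1)))"
   using p A_pos by (simp add: nn_integral_cmult nn_integral_powr_from_0)
  also have "\<dots> = ennreal (4 * p * ((norm (f x))\<^sup>2 * ((2 * A * norm (f x)) powr (p - 2) / (p - 2))))"
   using p by (simp add: ennreal_mult[symmetric])
  also have "4 * p * ((norm (f x))\<^sup>2 * ((2 * A * norm (f x)) powr (p - 2) / (p - 2))) = 4 * p / (p - 2) * (2 * A) powr (p - 2) * norm (f x) powr p"
  proof -
   have "(2 * A * norm (f x)) powr (p - 2) = (2 * A) powr (p - 2) * norm (f x) powr (p - 2)"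
    using A_pos by (simp add: powr_mult)
   moreover have "norm (f x) powr p = (norm (f x))\<^sup>2 * norm (f x) powr (p - 2)"
   proof (cases "f x = 0")
    case False
    then show ?thesis using powr_add[of "norm (f x)" 2 "p - 2"] by (simp add: powr_numeral)
   qed simp
   ultimately show ?thesis by simp
  qed
  finally show "(\<integral>\<^sub>+l. ?g x l) =
   ennreal (4 * p / (p - 2) * (2 * A) powr (p - 2)) * ennreal (norm (f x) powr p)"
   using p by (subst ennreal_mult[symmetric]) auto
 qed
 also have "\<dots> = ennreal (4 * p / (p - 2) * (2 * A) powr (p - 2)) * (\<integral>\<^sub>+x. ennreal (norm (f x) powr p))"
  by (rule nn_integral_cmult) measurable
 finally show ?thesis .
qed

text \<open>The cut is at height \<open>A * l\<close>; the large part is estimated in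
  \<open>L^1\<close>, the small part in \<open>L^2\<close>. With this height both contributions
  scale like \<open>A powr (2 - p)\<close>. Their integrals in \<open>l\<close> converge at 0
  because \<open>1 < p\<close> and at infinity because \<open>p < 2\<close>.\<close>

lemma interpolation_below_2:
 assumes f: "bounded_support_fun f" and p: "1 < p" "p < 2"
 shows "(\<integral>\<^sub>+x. ennreal (norm (T f x) powr p)) \<le>
  ennreal ((2 * p / (p - 1) + 4 * p / (2 - p)) * A powr (2 - p)) * (\<integral>\<^sub>+x. ennreal (norm (f x) powr p))"
proof -
 have [measurable]: "f \<in> \<B>" using f by (simp add: bounded_support_fun_def)
 have [measurable]: "T f \<in> \<B>" by (rule T_meas[OF f])
 let ?big = "\<lambda>l x. if A * l < norm (f x) then f x else 0"
 let ?small = "\<lambda>l x. if norm (f x) \<le> A * l then f x else 0"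
 have weak: "(\<integral>\<^sub>+x. indicator {x. l < norm (T f x)} x) \<le>
   ennreal (2 / l) * (ennreal A * (\<integral>\<^sub>+x. ennreal (norm (?big l x)))) + ennreal (4 / l\<^sup>2) * (\<integral>\<^sub>+x. ennreal ((norm (?small l x))\<^sup>2))"
  if l: "0 < l" for l
 proof -
  note sp = T_split[OF f, where c = "A * l"]
  have [measurable]: "T (?big l) \<in> \<B>" "T (?small l) \<in> \<B>"
   by (intro T_meas sp)+
  have "(\<integral>\<^sub>+x. indicator {x. l < norm (T f x)} x) \<le>
   (\<integral>\<^sub>+x. ennreal (2 / l) * ennreal (norm (T (?big l) x)) + ennreal (4 / l\<^sup>2) * ennreal ((norm (T (?small l) x))\<^sup>2))"
  proof (rule nn_integral_mono)
   fix x
   show "indicator {x. l < norm (T f x)} x \<le> ennreal (2 / l) * ennreal (norm (T (?big l) x)) + ennreal (4 / l\<^sup>2) * ennreal ((norm (T (?small l) x))\<^sup>2)"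
   proof (cases "l < norm (T f x)")
    case True
    then have "l / 2 \<le> norm (T (?big l) x) \<or> l / 2 \<le> norm (T (?small l) x)"
     using norm_triangle_ineq[of "T (?big l) x" "T (?small l) x"] unfolding sp(1)[of x] by linarith
    then have "1 \<le> 2 / l * norm (T (?big l) x) + 4 / l\<^sup>2 * (norm (T (?small l) x))\<^sup>2"
    proof
     assume "l / 2 \<le> norm (T (?big l) x)"
     then have "1 \<le> 2 / l * norm (T (?big l) x)" using l by (simp add: field_simps)
     moreover have "0 \<le> 4 / l\<^sup>2 * (norm (T (?small l) x))\<^sup>2" by simp
     ultimately show ?thesis by linarith
    next
     assume "l / 2 \<le> norm (T (?small l) x)"
     then have "(l / 2)\<^sup>2 \<le> (norm (T (?small l) x))\<^sup>2" using l by (intro power_mono) auto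
     then have "1 \<le> 4 / l\<^sup>2 * (norm (T (?small l) x))\<^sup>2" using l by (simp add: field_simps power_divide)
     moreover have "0 \<le> 2 / l * norm (T (?big l) x)" using l by simp
     ultimately show ?thesis by linarith
    qed
    then have "ennreal 1 \<le> ennreal (2 / l * norm (T (?big l) x) + 4 / l\<^sup>2 * (norm (T (?small l) x))\<^sup>2)"
     by (rule ennreal_leI)
    also have "\<dots> = ennreal (2 / l) * ennreal (norm (T (?big l) x)) + ennreal (4 / l\<^sup>2) * ennreal ((norm (T (?small l) x))\<^sup>2)"
     using l by (subst ennreal_plus) (auto simp: ennreal_mult[symmetric])
    finally show ?thesis using True by simp
   qed simp
  qed
  also have "\<dots> = ennreal (2 / l) * (\<integral>\<^sub>+x. ennreal (norm (T (?big l) x))) + (\<integral>\<^sub>+x. ennreal (4 / l\<^sup>2) * ennreal ((norm (T (?small l) x))\<^sup>2))"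
   by (simp add: nn_integral_add nn_integral_cmult)
  also have "\<dots> \<le> ennreal (2 / l) * (ennreal A * (\<integral>\<^sub>+x. ennreal (norm (?big l x)))) + ennreal (4 / l\<^sup>2) * (\<integral>\<^sub>+x. ennreal ((norm (?small l x))\<^sup>2))"
   by (intro add_mono mult_left_mono T_L1 L2_weak sp l) simp
  finally show ?thesis .
 qed
 let ?u = "\<lambda>l x. ennreal (2 * p * A) * (ennreal (norm (f x)) * (ennreal (l powr (p - 2)) * indicator {0..norm (f x) / A} l))"
 let ?v = "\<lambda>l x. ennreal (4 * p) * (ennreal ((norm (f x))\<^sup>2) * (ennreal (l powr (p - 3)) * indicator {norm (f x) / A..} l))"
 have "(\<integral>\<^sub>+x. ennreal (norm (T f x) powr p)) \<le>
  (\<integral>\<^sub>+l. ennreal (p * l powr (p - 1)) * indicator {0<..} l * (\<integral>\<^sub>+x. indicator {x. l < norm (T f x)} x))"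
  using p by (intro layer_cake) auto
 also have "\<dots> \<le> (\<integral>\<^sub>+l. (\<integral>\<^sub>+x. ?u l x + ?v l x))"
 proof (rule nn_integral_mono)
  fix l :: real
  show "ennreal (p * l powr (p - 1)) * indicator {0<..} l * (\<integral>\<^sub>+x. indicator {x. l < norm (T f x)} x) \<le> (\<integral>\<^sub>+x. ?u l x + ?v l x)"
  proof (cases "0 < l")
   case True
   let ?c = "p * l powr (p - 1)"
   have e3: "l powr (p - 1) * (4 / l\<^sup>2) = 4 * l powr (p - 3)"
   proof -
    have "l powr (p - 1) = l powr (p - 3) * l powr 2" unfolding powr_add[symmetric] by simp
    then show ?thesis using True by (simp add: powr_numeral)
   qed
   have e2: "l powr (p - 1) * (2 / l) = 2 * l powr (p - 2)"
   proof -
    have "l powr (p - 1) = l powr (p - 2) * l powr 1" unfolding powr_add[symmetric] by simp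
    then show ?thesis using True by simp
   qed
   have "ennreal ?c * indicator {0<..} l * (\<integral>\<^sub>+x. indicator {x. l < norm (T f x)} x) \<le>
     ennreal ?c * (ennreal (2 / l) * (ennreal A * (\<integral>\<^sub>+x. ennreal (norm (?big l x)))) + ennreal (4 / l\<^sup>2) * (\<integral>\<^sub>+x. ennreal ((norm (?small l x))\<^sup>2)))"
    using True weak[OF True] by (simp add: mult_left_mono)
   also have "\<dots> = (\<integral>\<^sub>+x. ennreal ?c * (ennreal (2 / l) * (ennreal A * ennreal (norm (?big l x))) + ennreal (4 / l\<^sup>2) * ennreal ((norm (?small l x))\<^sup>2)))"
    by (simp add: nn_integral_cmult nn_integral_add)
   also have "\<dots> \<le> (\<integral>\<^sub>+x. ?u l x + ?v l x)"
   proof (rule nn_integral_mono)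
    fix x
    have 1: "ennreal ?c * (ennreal (2 / l) * (ennreal A * ennreal (norm (?big l x)))) \<le> ?u l x"
    proof (cases "A * l < norm (f x)")
     case big: True
     then have "l \<in> {0..norm (f x) / A}" using True A_pos by (simp add: field_simps)
     moreover have "?c * (2 / l * (A * norm (f x))) = 2 * p * A * (norm (f x) * l powr (p - 2))"
     proof -
      have "?c * (2 / l * (A * norm (f x))) = p * (l powr (p - 1) * (2 / l)) * (A * norm (f x))" by simp
      then show ?thesis unfolding e2 by simp
     qed
     ultimately show ?thesis using big p True A_pos by (simp add: ennreal_mult[symmetric])
    qed simp
    have 2: "ennreal ?c * (ennreal (4 / l\<^sup>2) * ennreal ((norm (?small l x))\<^sup>2)) \<le> ?v l x"
    proof (cases "norm (f x) \<le> A * l")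
     case small: True
     then have "l \<in> {norm (f x) / A..}" using A_pos by (simp add: field_simps)
     moreover have "?c * (4 / l\<^sup>2 * (norm (f x))\<^sup>2) = 4 * p * ((norm (f x))\<^sup>2 * l powr (p - 3))"
     proof -
      have "?c * (4 / l\<^sup>2 * (norm (f x))\<^sup>2) = p * (l powr (p - 1) * (4 / l\<^sup>2)) * (norm (f x))\<^sup>2" by simp
      then show ?thesis unfolding e3 by simp
     qed
     ultimately show ?thesis using small p by (simp add: ennreal_mult[symmetric])
    qed simp
    show "ennreal ?c * (ennreal (2 / l) * (ennreal A * ennreal (norm (?big l x))) + ennreal (4 / l\<^sup>2) * ennreal ((norm (?small l x))\<^sup>2)) \<le> ?u l x + ?v l x"
     unfolding distrib_left by (intro add_mono 1 2)
   qed
   finally show ?thesis .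
  qed simp
 qed
 also have "\<dots> = (\<integral>\<^sub>+x. (\<integral>\<^sub>+l. ?u l x + ?v l x))"
  by (rule lborel_pair.Fubini') (simp add: indicator_def)
 also have "\<dots> = (\<integral>\<^sub>+x. ennreal ((2 * p / (p - 1) + 4 * p / (2 - p)) * A powr (2 - p)) * ennreal (norm (f x) powr p))"
 proof (rule nn_integral_cong)
  fix x
  show "(\<integral>\<^sub>+l. ?u l x + ?v l x) = ennreal ((2 * p / (p - 1) + 4 * p / (2 - p)) * A powr (2 - p)) * ennreal (norm (f x) powr p)"
  proof (cases "f x = 0")
   case False
   define n where "n = norm (f x)"
   have n: "0 < n" using False by (simp add: n_def)
   have "(\<integral>\<^sub>+l. ?u l x) = ennreal (2 * p * A) * (ennreal n * ennreal ((n / A) powr (p - 2 + 1) / (p - 2 + 1)))"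
    using p A_pos n unfolding n_def[symmetric] by (simp add: nn_integral_cmult nn_integral_powr_from_0)
   also have "\<dots> = ennreal (2 * p * A * (n * ((n / A) powr (p - 1) / (p - 1))))"
    using p A_pos n by (simp add: ennreal_mult[symmetric])
   also have "2 * p * A * (n * ((n / A) powr (p - 1) / (p - 1))) = 2 * p / (p - 1) * A powr (2 - p) * n powr p"
   proof -
    have a: "n * (n / A) powr (p - 1) = n powr p / A powr (p - 1)"
     using n A_pos powr_add[of n 1 "p - 1"] by (simp add: powr_divide)
    have b: "A / A powr (p - 1) = A powr (2 - p)"
     using A_pos powr_diff[of A 1 "p - 1"] by simp
    have "2 * p * A * (n * ((n / A) powr (p - 1) / (p - 1))) = 2 * p / (p - 1) * (A * (n * (n / A) powr (p - 1)))"
     by simp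
    also have "A * (n * (n / A) powr (p - 1)) = A / A powr (p - 1) * n powr p"
     unfolding a by simp
    finally show ?thesis unfolding b by simp
   qed
   finally have 1: "(\<integral>\<^sub>+l. ?u l x) = ennreal (2 * p / (p - 1) * A powr (2 - p) * n powr p)" .
   have "(\<integral>\<^sub>+l. ?v l x) = ennreal (4 * p) * (ennreal (n\<^sup>2) * ennreal (- ((n / A) powr (p - 3 + 1)) / (p - 3 + 1)))"
    using p A_pos n unfolding n_def[symmetric] by (simp add: nn_integral_cmult nn_integral_powr_to_infinity)
   also have "- ((n / A) powr (p - 3 + 1)) / (p - 3 + 1) = (n / A) powr (p - 2) / (2 - p)"
    using p by (simp add: divide_simps) (simp add: algebra_simps)
   also have "ennreal (4 * p) * (ennreal (n\<^sup>2) * ennreal ((n / A) powr (p - 2) / (2 - p))) = ennreal (4 * p * (n\<^sup>2 * ((n / A) powr (p - 2) / (2 - p))))"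
    using p by (simp add: ennreal_mult[symmetric])
   also have "4 * p * (n\<^sup>2 * ((n / A) powr (p - 2) / (2 - p))) = 4 * p / (2 - p) * A powr (2 - p) * n powr p"
   proof -
    have "n\<^sup>2 * (n / A) powr (p - 2) = n powr p / A powr (p - 2)"
     using n A_pos powr_add[of n 2 "p - 2"] by (simp add: powr_divide powr_numeral)
    moreover have "1 / A powr (p - 2) = A powr (2 - p)"
     using A_pos powr_minus[of A "p - 2"] by (simp add: field_simps)
    ultimately have "n\<^sup>2 * (n / A) powr (p - 2) = n powr p * A powr (2 - p)" by (metis mult.right_neutral times_divide_eq_right)
    then show ?thesis by (simp add: mult_ac)
   qed
   finally have 2: "(\<integral>\<^sub>+l. ?v l x) = ennreal (4 * p / (2 - p) * A powr (2 - p) * n powr p)" .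
   have "(\<integral>\<^sub>+l. ?u l x + ?v l x) = (\<integral>\<^sub>+l. ?u l x) + (\<integral>\<^sub>+l. ?v l x)"
    by (rule nn_integral_add) measurable
   also have "\<dots> = ennreal (2 * p / (p - 1) * A powr (2 - p) * n powr p + 4 * p / (2 - p) * A powr (2 - p) * n powr p)"
    unfolding 1 2 using p by (subst ennreal_plus) auto
   also have "\<dots> = ennreal ((2 * p / (p - 1) + 4 * p / (2 - p)) * A powr (2 - p) * n powr p)"
    by (simp only: distrib_right)
   also have "\<dots> = ennreal ((2 * p / (p - 1) + 4 * p / (2 - p)) * A powr (2 - p)) * ennreal (n powr p)"
    using p by (intro ennreal_mult mult_nonneg_nonneg add_nonneg_nonneg) auto
   finally show ?thesis unfolding n_def .
  qed simp
 qed
 also have "\<dots> = ennreal ((2 * p / (p - 1) + 4 * p / (2 - p)) * A powr (2 - p)) * (\<integral>\<^sub>+x. ennreal (norm (f x) powr p))"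
  by (rule nn_integral_cmult) measurable
 finally show ?thesis .
qed

end

text \<open>Roots of the constants from the two interpolation bounds. At 1, 2 and
  \<open>top\<close>, where these formulas break down, the assumed bounds apply directly with
  constant 1.\<close>

definition interpolation_constant :: "ennreal \<Rightarrow> real" where
 "interpolation_constant p = (let q = enn2real p in
  if p = top \<or> q = 1 \<or> q = 2 then 1
  else if q < 2 then (2 * q / (q - 1) + 4 * q / (2 - q)) powr (1 / q)
  else (4 * q / (q - 2) * 2 powr (q - 2)) powr (1 / q))"

lemma interpolation_constant_nonneg: "0 \<le> interpolation_constant p"
 by (simp add: interpolation_constant_def Let_def)

text \<open>Taking the root turns the powers \<open>\<bar>p - 2\<bar>\<close> of \<open>A\<close>
  into the exponent \<open>\<bar>1 - 2 / p\<bar>\<close>; the endpoints 1, 2 and \<open>top\<close>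
  fit the same formula.\<close>

lemma (in interpolation_operator) lp_norm_bound:
 assumes f: "bounded_support_fun f" and p: "1 \<le> p"
 shows "lp_norm p (\<lambda>x. ennreal (norm (T f x))) \<le>
  ennreal (interpolation_constant p * A powr \<bar>1 - 2 * enn2real (1 / p)\<bar>) * lp_norm p (\<lambda>x. ennreal (norm (f x)))"
proof (cases "p = top")
 case True
 have [measurable]: "f \<in> \<B>" using f by (simp add: bounded_support_fun_def)
 have [measurable]: "T f \<in> \<B>" by (rule T_meas[OF f])
 let ?s = "esssup lborel (\<lambda>x. ennreal (norm (f x)))"
 obtain b where b: "\<And>x. norm (f x) \<le> b" using f by (auto simp: bounded_support_fun_def)
 have "?s \<le> ennreal b" by (rule esssup_I) (auto intro: b ennreal_leI)
 then obtain s where s: "?s = ennreal s" "0 \<le> s" by (cases ?s) (auto simp: top_unique)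
 \<comment> \<open>\<open>T_Linf\<close> asks for a bound at every point, while \<open>s\<close>
   bounds \<open>f\<close> only almost everywhere. The part of \<open>f\<close> above
   \<open>s\<close> is null, and \<open>T_L1\<close> shows that its image vanishes almost
   everywhere.\<close>
 let ?g = "\<lambda>x. if norm (f x) \<le> s then f x else 0"
 note sp = T_split[OF f, where c = s]
 have ae: "AE x in lborel. norm (f x) \<le> s"
  using esssup_AE[of "\<lambda>x. ennreal (norm (f x))" lborel] unfolding s(1) by (rule eventually_mono) (simp add: s)
 have "(\<integral>\<^sub>+x. ennreal (norm (T (\<lambda>x. if s < norm (f x) then f x else 0) x))) \<le> ennreal A * (\<integral>\<^sub>+x. ennreal (norm (if s < norm (f x) then f x else 0)))"
  by (rule T_L1[OF sp(2)])
 also have "(\<integral>\<^sub>+x. ennreal (norm (if s < norm (f x) then f x else 0))) = (\<integral>\<^sub>+(x::'a). 0)"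
  using ae by (intro nn_integral_cong_AE) (auto elim!: eventually_mono)
 finally have z: "(\<integral>\<^sub>+x. ennreal (norm (T (\<lambda>x. if s < norm (f x) then f x else 0) x))) = 0" by simp
 have [measurable]: "T (\<lambda>x. if s < norm (f x) then f x else 0) \<in> \<B>" by (rule T_meas[OF sp(2)])
 have "AE x in lborel. T (\<lambda>x. if s < norm (f x) then f x else 0) x = 0"
  using z by (simp add: nn_integral_0_iff_AE)
 then have "AE x in lborel. ennreal (norm (T f x)) \<le> ennreal (A * s)"
 proof (rule eventually_mono)
  fix x assume "T (\<lambda>x. if s < norm (f x) then f x else 0) x = 0"
  then have "T f x = T ?g x" using sp(1)[of x] by simp
  also have "norm (T ?g x) \<le> A * s" by (rule T_Linf[OF sp(3)]) (use s in auto)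
  finally show "ennreal (norm (T f x)) \<le> ennreal (A * s)" by (rule ennreal_leI)
 qed
 then have "esssup lborel (\<lambda>x. ennreal (norm (T f x))) \<le> ennreal (A * s)"
  by (intro esssup_I) measurable
 then show ?thesis
  unfolding True lp_norm_top s(1) using A_pos s(2)
  by (simp add: interpolation_constant_def ennreal_mult[symmetric])
next
 case False
 define q where "q = enn2real p"
 have q: "1 \<le> q" "p = ennreal q" using enn2real_ge_1[OF p False] False by (simp_all add: q_def ennreal_enn2real less_top)
 have [measurable]: "f \<in> \<B>" using f by (simp add: bounded_support_fun_def)
 have ip: "enn2real (1 / p) = 1 / q"
  using q by (simp add: divide_ennreal ennreal_1[symmetric] del: ennreal_1)
 define c where "c = interpolation_constant p * A powr \<bar>1 - 2 * (1 / q)\<bar>"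
 have c0: "0 \<le> c" unfolding c_def by (intro mult_nonneg_nonneg interpolation_constant_nonneg) simp
 have "(\<integral>\<^sub>+x. ennreal (norm (T f x) powr q)) \<le> ennreal (c powr q) * (\<integral>\<^sub>+x. ennreal (norm (f x) powr q))"
 proof -
  consider "q = 1" | "q = 2" | "1 < q" "q < 2" | "2 < q" using q by linarith
  then show ?thesis
  proof cases
   case 1
   then have "c powr q = A" using A_pos by (simp add: c_def interpolation_constant_def q_def[symmetric])
   then show ?thesis using T_L1[OF f] 1 by simp
  next
   case 2
   then have "c powr q = 1" using A_pos by (simp add: c_def interpolation_constant_def q_def[symmetric])
   then show ?thesis using T_L2[OF f] 2 by (simp add: powr_numeral)
  next
   case 3
   have "\<bar>1 - 2 * (1 / q)\<bar> = (2 - q) / q" using 3 by (simp add: abs_if field_simps)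
   then have "c powr q = (2 * q / (q - 1) + 4 * q / (2 - q)) * A powr (2 - q)"
    using 3 A_pos False by (simp add: c_def interpolation_constant_def q_def[symmetric] powr_mult powr_powr add_pos_pos)
   then show ?thesis using interpolation_below_2[OF f 3] by simp
  next
   case 4
   have "\<bar>1 - 2 * (1 / q)\<bar> = (q - 2) / q" using 4 by (simp add: abs_if field_simps)
   then have "c powr q = (4 * q / (q - 2) * 2 powr (q - 2)) * A powr (q - 2)"
    using 4 A_pos False by (simp add: c_def interpolation_constant_def q_def[symmetric] powr_mult powr_powr)
   also have "\<dots> = 4 * q / (q - 2) * (2 * A) powr (q - 2)"
    using A_pos by (simp add: powr_mult)
   finally show ?thesis using interpolation_above_2[OF f 4] by simp
  qed
 qed
 then have "ennreal_powr (\<integral>\<^sub>+x. ennreal (norm (T f x) powr q)) (1 / q) \<le>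
  ennreal_powr (ennreal (c powr q) * (\<integral>\<^sub>+x. ennreal (norm (f x) powr q))) (1 / q)"
  using q by (intro ennreal_powr_mono) auto
 also have "\<dots> = ennreal c * ennreal_powr (\<integral>\<^sub>+x. ennreal (norm (f x) powr q)) (1 / q)"
  using c0 q by (simp add: ennreal_powr_mult ennreal_powr_ennreal powr_powr)
 finally show ?thesis
  unfolding lp_norm_finite[OF False] ip c_def q_def[symmetric] by (simp add: ennreal_powr_ennreal)
qed

subsection \<open>The Dirac symbol\<close>

text \<open>\<open>cos_sqrt 0\<close> is the entire function \<open>s \<mapsto> cos (2\<pi>\<surd>s)\<close>, and \<open>cos_sqrt k\<close> its \<open>k\<close>-th derivative.\<close>

definition cos_sqrt_coeff :: "nat \<Rightarrow> real" where
 "cos_sqrt_coeff n = (- (4 * pi\<^sup>2)) ^ n / fact (2 * n)"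

definition cos_sqrt :: "nat \<Rightarrow> real \<Rightarrow> real" where
 "cos_sqrt k s = (\<Sum>n. (diffs ^^ k) cos_sqrt_coeff n * s ^ n)"

lemma summable_cos_sqrt: "summable (\<lambda>n. (diffs ^^ k) cos_sqrt_coeff n * s ^ n)"
proof (induction k arbitrary: s)
 case 0
 have "summable (\<lambda>n. inverse (fact n) * (4 * pi\<^sup>2 * \<bar>s\<bar>) ^ n)"
  using summable_exp[of "4 * pi\<^sup>2 * \<bar>s\<bar>"] .
 then show ?case
 proof (rule summable_comparison_test'[where N = 0])
  fix n :: nat
  have "(fact n :: real) \<le> fact (2 * n)" by (rule fact_mono) simp
  then have "(4 * pi\<^sup>2 * \<bar>s\<bar>) ^ n / fact (2 * n) \<le> (4 * pi\<^sup>2 * \<bar>s\<bar>) ^ n / fact n"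
   by (intro divide_left_mono) auto
  then show "norm ((diffs ^^ 0) cos_sqrt_coeff n * s ^ n) \<le> inverse (fact n) * (4 * pi\<^sup>2 * \<bar>s\<bar>) ^ n"
   by (simp add: cos_sqrt_coeff_def abs_mult power_abs power_mult_distrib field_simps)
 qed
next
 case (Suc k)
 show ?case using termdiff_converges_all[OF Suc] by simp
qed

lemma cos_sqrt_deriv [derivative_intros]:
 assumes "(f has_field_derivative f') (at x)"
 shows "((\<lambda>x. cos_sqrt k (f x)) has_field_derivative cos_sqrt (Suc k) (f x) * f') (at x)"
proof -
 have "(cos_sqrt k has_field_derivative cos_sqrt (Suc k) s) (at s)" for s
  using termdiffs_strong_converges_everywhere[OF summable_cos_sqrt, of k s] by (simp add: cos_sqrt_def[abs_def])
 then show ?thesis using assms by (rule DERIV_chain2)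
qed

lemma cos_sqrt_0: "cos_sqrt 0 (u\<^sup>2) = cos (2 * pi * u)"
proof -
 have "(\<lambda>n. cos_sqrt_coeff n * (u\<^sup>2) ^ n) = (\<lambda>n. (-1) ^ n / fact (2 * n) * (2 * pi * u) ^ (2 * n))"
 proof
  fix n
  have "(2 * pi * u) ^ (2 * n) = (4 * pi\<^sup>2 * u\<^sup>2) ^ n" by (simp add: power_mult power_mult_distrib)
  moreover have "(- (4 * pi\<^sup>2)) ^ n = (-1) ^ n * (4 * pi\<^sup>2) ^ n" by (rule power_minus)
  ultimately show "cos_sqrt_coeff n * (u\<^sup>2) ^ n = (-1) ^ n / fact (2 * n) * (2 * pi * u) ^ (2 * n)"
   by (simp add: cos_sqrt_coeff_def power_mult_distrib)
 qed
 then show ?thesis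
  using cos_paired[of "2 * pi * u"] by (simp add: cos_sqrt_def sums_iff)
qed

lemma cos_sqrt_1: "u * cos_sqrt 1 (u\<^sup>2) = - pi * sin (2 * pi * u)"
proof -
 have "((\<lambda>u. cos_sqrt 0 (u\<^sup>2)) has_field_derivative cos_sqrt (Suc 0) (u\<^sup>2) * (2 * u)) (at u)"
  by (auto intro!: derivative_eq_intros)
 moreover have "((\<lambda>u. cos_sqrt 0 (u\<^sup>2)) has_field_derivative - sin (2 * pi * u) * (2 * pi)) (at u)"
  unfolding cos_sqrt_0 by (auto intro!: derivative_eq_intros)
 ultimately have "cos_sqrt (Suc 0) (u\<^sup>2) * (2 * u) = - sin (2 * pi * u) * (2 * pi)"
  by (rule DERIV_unique)
 moreover have "cos_sqrt (Suc 0) (u\<^sup>2) * (2 * u) = 2 * (u * cos_sqrt 1 (u\<^sup>2))" by simp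
 moreover have "- sin (2 * pi * u) * (2 * pi) = 2 * (- pi * sin (2 * pi * u))" by simp
 ultimately show ?thesis by linarith
qed

text \<open>Differentiating \<open>u * cos_sqrt 1 (u\<^sup>2) = - pi * sin (2 * pi * u)\<close>
  gives the case \<open>k = 0\<close> with \<open>s = u\<^sup>2\<close>. The equation expresses
  \<open>s\<close> times the derivative of order \<open>k + 2\<close> through lower ones, which is
  the source of the decay.\<close>

lemma cos_sqrt_ode:
 assumes "0 < s"
 shows "4 * s * cos_sqrt (k + 2) s + (4 * real k + 2) * cos_sqrt (k + 1) s + 4 * pi\<^sup>2 * cos_sqrt k s = 0"
 using assms
proof (induction k arbitrary: s)
 case 0
 define u where "u = sqrt s"
 have u: "u\<^sup>2 = s" using 0 by (simp add: u_def)
 have "((\<lambda>u. u * cos_sqrt 1 (u\<^sup>2)) has_field_derivative cos_sqrt 1 (u\<^sup>2) + u * (cos_sqrt (Suc 1) (u\<^sup>2) * (2 * u))) (at u)"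
  by (auto intro!: derivative_eq_intros)
 moreover have "((\<lambda>u. u * cos_sqrt 1 (u\<^sup>2)) has_field_derivative - pi * (cos (2 * pi * u) * (2 * pi))) (at u)"
  unfolding cos_sqrt_1 by (auto intro!: derivative_eq_intros)
 ultimately have "cos_sqrt 1 (u\<^sup>2) + u * (cos_sqrt (Suc 1) (u\<^sup>2) * (2 * u)) = - pi * (cos (2 * pi * u) * (2 * pi))"
  by (rule DERIV_unique)
 moreover have "u * (cos_sqrt (Suc 1) (u\<^sup>2) * (2 * u)) = 2 * s * cos_sqrt 2 s"
  unfolding u[symmetric] Suc_1 by (simp add: power2_eq_square)
 moreover have "- pi * (cos (2 * pi * u) * (2 * pi)) = - (2 * (pi\<^sup>2 * cos_sqrt 0 s))"
  unfolding u[symmetric] cos_sqrt_0 by (simp add: power2_eq_square)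
 ultimately have "cos_sqrt 1 s + 2 * s * cos_sqrt 2 s = - (2 * (pi\<^sup>2 * cos_sqrt 0 s))"
  unfolding u by linarith
 moreover have "4 * s * cos_sqrt (0 + 2) s + (4 * real 0 + 2) * cos_sqrt (0 + 1) s + 4 * pi\<^sup>2 * cos_sqrt 0 s =
  2 * (cos_sqrt 1 s + 2 * s * cos_sqrt 2 s) + 2 * (2 * (pi\<^sup>2 * cos_sqrt 0 s))"
  unfolding add_0 by simp
 ultimately show ?case by (simp only:)
next
 case (Suc k)
 let ?H = "\<lambda>s. 4 * s * cos_sqrt (k + 2) s + (4 * real k + 2) * cos_sqrt (k + 1) s + 4 * pi\<^sup>2 * cos_sqrt k s"
 let ?H' = "(4 * cos_sqrt (k + 2) s + 4 * s * cos_sqrt (Suc (k + 2)) s) + (4 * real k + 2) * cos_sqrt (Suc (k + 1)) s + 4 * pi\<^sup>2 * cos_sqrt (Suc k) s"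
 have "(?H has_field_derivative ?H') (at s)"
  by (auto intro!: derivative_eq_intros)
 \<comment> \<open>By the induction hypothesis \<open>?H\<close> vanishes on the open half-line,
   hence so does its derivative; comparing the two derivatives is the equation for
   \<open>Suc k\<close>.\<close>
 moreover have "(?H has_field_derivative 0) (at s)"
 proof (rule has_field_derivative_transform_within_open[of "\<lambda>_. 0" 0 s "{0<..}"])
  show "0 = ?H t" if "t \<in> {0<..}" for t using Suc.IH[of t] that by simp
 qed (use Suc.prems in auto)
 ultimately have "?H' = 0" by (rule DERIV_unique)
 then show ?case by (simp add: algebra_simps)
qed

text \<open>Boundedness of cosine and sine starts a two-step induction. Solving the differential
  equation for its highest term divides by \<open>s\<close>, which is two powers of
  \<open>sqrt s\<close> for two orders of differentiation.\<close>

lemma cos_sqrt_decay_large: "\<exists>C\<ge>0. \<forall>s\<ge>1. sqrt s ^ k * \<bar>cos_sqrt k s\<bar> \<le> C"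
proof (induction k rule: induct_nat_012)
 case 0
 have "\<bar>cos_sqrt 0 s\<bar> \<le> 1" if "1 \<le> s" for s using cos_sqrt_0[of "sqrt s"] that by simp
 then show ?case by (intro exI[of _ 1]) auto
next
 case 1
 have "sqrt s * \<bar>cos_sqrt 1 s\<bar> \<le> pi" if "1 \<le> s" for s
 proof -
  have "sqrt s * \<bar>cos_sqrt 1 s\<bar> = \<bar>- pi * sin (2 * pi * sqrt s)\<bar>"
   unfolding cos_sqrt_1[symmetric] using that by (simp add: abs_mult)
  also have "\<dots> \<le> pi * 1" unfolding abs_mult by (intro mult_mono) auto
  finally show ?thesis by simp
 qed
 then show ?case by (intro exI[of _ pi]) auto
next
 case (ge2 k)
 then obtain C D where C: "0 \<le> C" "\<And>s. 1 \<le> s \<Longrightarrow> sqrt s ^ k * \<bar>cos_sqrt k s\<bar> \<le> C"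
  and D: "0 \<le> D" "\<And>s. 1 \<le> s \<Longrightarrow> sqrt s ^ Suc k * \<bar>cos_sqrt (Suc k) s\<bar> \<le> D"
  by blast
 have "sqrt s ^ Suc (Suc k) * \<bar>cos_sqrt (Suc (Suc k)) s\<bar> \<le> (4 * real k + 2) * D + 4 * pi\<^sup>2 * C" if s: "1 \<le> s" for s
 proof -
  have ode: "4 * s * cos_sqrt (Suc (Suc k)) s = - ((4 * real k + 2) * cos_sqrt (Suc k) s + 4 * pi\<^sup>2 * cos_sqrt k s)"
   using cos_sqrt_ode[of s k] s by (simp add: algebra_simps)
  have "s * \<bar>cos_sqrt (Suc (Suc k)) s\<bar> \<le> 4 * s * \<bar>cos_sqrt (Suc (Suc k)) s\<bar>"
   using s by (intro mult_right_mono) auto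
  also have "\<dots> = \<bar>4 * s * cos_sqrt (Suc (Suc k)) s\<bar>" using s by (simp add: abs_mult)
  also have "\<dots> = \<bar>(4 * real k + 2) * cos_sqrt (Suc k) s + 4 * pi\<^sup>2 * cos_sqrt k s\<bar>"
   unfolding ode by (rule abs_minus_cancel)
  also have "\<dots> \<le> \<bar>(4 * real k + 2) * cos_sqrt (Suc k) s\<bar> + \<bar>4 * pi\<^sup>2 * cos_sqrt k s\<bar>"
   by (rule abs_triangle_ineq)
  also have "\<dots> = (4 * real k + 2) * \<bar>cos_sqrt (Suc k) s\<bar> + 4 * pi\<^sup>2 * \<bar>cos_sqrt k s\<bar>"
   by (simp add: abs_mult)
  finally have "sqrt s ^ k * (s * \<bar>cos_sqrt (Suc (Suc k)) s\<bar>) \<le> sqrt s ^ k * ((4 * real k + 2) * \<bar>cos_sqrt (Suc k) s\<bar> + 4 * pi\<^sup>2 * \<bar>cos_sqrt k s\<bar>)"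
   using s by (intro mult_left_mono) auto
  also have "\<dots> = (4 * real k + 2) * (sqrt s ^ k * \<bar>cos_sqrt (Suc k) s\<bar>) + 4 * pi\<^sup>2 * (sqrt s ^ k * \<bar>cos_sqrt k s\<bar>)"
   by (simp add: algebra_simps)
  also have "\<dots> \<le> (4 * real k + 2) * D + 4 * pi\<^sup>2 * C"
  proof (intro add_mono mult_left_mono)
   have "1 * (sqrt s ^ k * \<bar>cos_sqrt (Suc k) s\<bar>) \<le> sqrt s * (sqrt s ^ k * \<bar>cos_sqrt (Suc k) s\<bar>)"
    using s by (intro mult_right_mono) auto
   then show "sqrt s ^ k * \<bar>cos_sqrt (Suc k) s\<bar> \<le> D" using D(2)[OF s] by (simp add: mult_ac)
  qed (use C(2)[OF s] in auto)
  finally have F: "sqrt s ^ k * (s * \<bar>cos_sqrt (Suc (Suc k)) s\<bar>) \<le> (4 * real k + 2) * D + 4 * pi\<^sup>2 * C" .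
  have "sqrt s ^ Suc (Suc k) = sqrt s ^ k * (sqrt s * sqrt s)" by (simp only: power_Suc mult_ac)
  also have "sqrt s * sqrt s = s" using s by simp
  finally show ?thesis using F by (simp only: mult.assoc)
 qed
 then show ?case using C(1) D(1) by (intro exI[of _ "(4 * real k + 2) * D + 4 * pi\<^sup>2 * C"]) auto
qed

lemma cos_sqrt_continuous: "continuous_on A (cos_sqrt k)"
proof -
 have "(cos_sqrt k has_field_derivative cos_sqrt (Suc k) s * 1) (at s)" for s
  by (rule cos_sqrt_deriv) (rule DERIV_ident)
 then show ?thesis by (intro continuous_at_imp_continuous_on ballI) (rule DERIV_isCont)
qed

text \<open>On \<open>{0..1}\<close> the weight \<open>sqrt s\<close> is of no help, but
  \<open>cos_sqrt k\<close> is continuous and hence bounded there; the weight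
  \<open>sqrt (1 + s)\<close> joins both ranges.\<close>

lemma cos_sqrt_decay: "\<exists>C\<ge>0. \<forall>s\<ge>0. \<bar>cos_sqrt k s\<bar> \<le> C / sqrt (1 + s) ^ k"
proof -
 obtain C where C: "0 \<le> C" "\<And>s. 1 \<le> s \<Longrightarrow> sqrt s ^ k * \<bar>cos_sqrt k s\<bar> \<le> C"
  using cos_sqrt_decay_large by blast
 have "compact (cos_sqrt k ` {0..1})" by (intro compact_continuous_image cos_sqrt_continuous) auto
 then obtain D where "\<forall>y\<in>cos_sqrt k ` {0..1}. norm y \<le> D"
  using compact_imp_bounded[of "cos_sqrt k ` {0..1}"] unfolding bounded_iff by blast
 then have D: "\<And>s. s \<in> {0..1} \<Longrightarrow> \<bar>cos_sqrt k s\<bar> \<le> D" by auto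
 have D0: "0 \<le> D" using D[of 0] by simp
 have "sqrt (1 + s) ^ k * \<bar>cos_sqrt k s\<bar> \<le> sqrt 2 ^ k * (C + D)" if s: "0 \<le> s" for s
 proof (cases "s \<le> 1")
  case True
  have "sqrt (1 + s) ^ k * \<bar>cos_sqrt k s\<bar> \<le> sqrt 2 ^ k * D"
   using True s D[of s] by (intro mult_mono power_mono) auto
  also have "\<dots> \<le> sqrt 2 ^ k * (C + D)" using C(1) by (intro mult_left_mono) auto
  finally show ?thesis .
 next
  case False
  have "sqrt (1 + s) \<le> sqrt 2 * sqrt s" unfolding real_sqrt_mult[symmetric] using False by simp
  from power_mono[OF this, of k] have "sqrt (1 + s) ^ k * \<bar>cos_sqrt k s\<bar> \<le> (sqrt 2 ^ k * sqrt s ^ k) * \<bar>cos_sqrt k s\<bar>"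
   using s by (intro mult_right_mono) (auto simp: power_mult_distrib)
  also have "\<dots> = sqrt 2 ^ k * (sqrt s ^ k * \<bar>cos_sqrt k s\<bar>)" by simp
  also have "\<dots> \<le> sqrt 2 ^ k * (C + D)"
   using C(2)[of s] False D0 by (intro mult_left_mono) auto
  finally show ?thesis .
 qed
 note F = this
 have "\<bar>cos_sqrt k s\<bar> \<le> sqrt 2 ^ k * (C + D) / sqrt (1 + s) ^ k" if "0 \<le> s" for s
 proof -
  have "0 < sqrt (1 + s) ^ k" using that by simp
  from pos_le_divide_eq[OF this] F[OF that] show ?thesis by (simp only: mult.commute)
 qed
 then show ?thesis using C(1) D0 by (intro exI[of _ "sqrt 2 ^ k * (C + D)"]) auto
qed

text \<open>Functions of a parameter \<open>a\<close> and of \<open>z\<close> that decay like \<open>(1 + a\<^sup>2 + |z|\<^sup>2)\<^bsup>-k/2\<^esup>\<close> together with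
 all their \<open>z\<close>-derivatives.\<close>

inductive symbol_class :: "nat \<Rightarrow> (real \<Rightarrow> 'd::finite cfun) \<Rightarrow> bool" where
 base: "symbol_class k (\<lambda>a z. of_real (cos_sqrt k (a\<^sup>2 + z \<bullet> z)))"
| coord: "symbol_class (Suc k) f \<Longrightarrow> symbol_class k (\<lambda>a z. coord j z * f a z)"
| param: "symbol_class (Suc k) f \<Longrightarrow> symbol_class k (\<lambda>a z. of_real a * f a z)"
| add: "symbol_class k f \<Longrightarrow> symbol_class k h \<Longrightarrow> symbol_class k (\<lambda>a z. f a z + h a z)"
| cmult: "symbol_class k f \<Longrightarrow> symbol_class k (\<lambda>a z. c * f a z)"
| weaken: "symbol_class (Suc k) f \<Longrightarrow> symbol_class k f"

lemma symbol_class_bound: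
 "symbol_class k f \<Longrightarrow> \<exists>C\<ge>0. \<forall>a z. norm (f a z) \<le> C / sqrt (1 + (a\<^sup>2 + z \<bullet> z)) ^ k"
proof (induction rule: symbol_class.induct)
 case (base k)
 obtain C where "0 \<le> C" "\<And>s. 0 \<le> s \<Longrightarrow> \<bar>cos_sqrt k s\<bar> \<le> C / sqrt (1 + s) ^ k"
  using cos_sqrt_decay by blast
 then show ?case by (intro exI[of _ C]) auto
next
 case (coord k f j)
 then obtain C where C: "0 \<le> C" "\<And>a z. norm (f a z) \<le> C / sqrt (1 + (a\<^sup>2 + z \<bullet> z)) ^ Suc k" by blast
 have "norm (coord j z * f a z) \<le> C / sqrt (1 + (a\<^sup>2 + z \<bullet> z)) ^ k" for a z
 proof -
  let ?r = "sqrt (1 + (a\<^sup>2 + z \<bullet> z))"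
  have r: "0 < ?r" by (simp add: add_pos_nonneg)
  have "norm (coord j z) \<le> norm z" using component_le_norm_cart[of z j] by (simp add: coord_def)
  also have "norm z \<le> ?r" by (rule real_le_rsqrt) (simp add: power2_norm_eq_inner)
  finally have "norm (coord j z * f a z) \<le> ?r * (C / ?r ^ Suc k)"
   unfolding norm_mult by (intro mult_mono C) auto
  then show ?thesis using r by simp
 qed
 then show ?case using C(1) by blast
next
 case (param k f)
 then obtain C where C: "0 \<le> C" "\<And>a z. norm (f a z) \<le> C / sqrt (1 + (a\<^sup>2 + z \<bullet> z)) ^ Suc k" by blast
 have "norm (of_real a * f a z) \<le> C / sqrt (1 + (a\<^sup>2 + z \<bullet> z)) ^ k" for a z
 proof -
  let ?r = "sqrt (1 + (a\<^sup>2 + z \<bullet> z))"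
  have r: "0 < ?r" by (simp add: add_pos_nonneg)
  have "\<bar>a\<bar> \<le> ?r" by (rule real_le_rsqrt) simp
  then have "norm (of_real a * f a z) \<le> ?r * (C / ?r ^ Suc k)"
   unfolding norm_mult by (intro mult_mono C) auto
  then show ?thesis using r by simp
 qed
 then show ?case using C(1) by blast
next
 case (add k f h)
 then obtain C D where C: "0 \<le> C" "\<And>a z. norm (f a z) \<le> C / sqrt (1 + (a\<^sup>2 + z \<bullet> z)) ^ k"
  and D: "0 \<le> D" "\<And>a z. norm (h a z) \<le> D / sqrt (1 + (a\<^sup>2 + z \<bullet> z)) ^ k" by blast
 have "norm (f a z + h a z) \<le> (C + D) / sqrt (1 + (a\<^sup>2 + z \<bullet> z)) ^ k" for a z
  using norm_triangle_mono[OF C(2)[of a z] D(2)[of a z]] by (simp add: add_divide_distrib)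
 then show ?case using C(1) D(1) by (intro exI[of _ "C + D"]) auto
next
 case (cmult k f c)
 then obtain C where C: "0 \<le> C" "\<And>a z. norm (f a z) \<le> C / sqrt (1 + (a\<^sup>2 + z \<bullet> z)) ^ k" by blast
 have "norm (c * f a z) \<le> (norm c * C) / sqrt (1 + (a\<^sup>2 + z \<bullet> z)) ^ k" for a z
  using mult_left_mono[OF C(2)[of a z], of "norm c"] by (simp add: norm_mult)
 then show ?case using C(1) by (intro exI[of _ "norm c * C"]) auto
next
 case (weaken k f)
 then obtain C where C: "0 \<le> C" "\<And>a z. norm (f a z) \<le> C / sqrt (1 + (a\<^sup>2 + z \<bullet> z)) ^ Suc k" by blast
 have "C / sqrt (1 + (a\<^sup>2 + z \<bullet> z)) ^ Suc k \<le> C / sqrt (1 + (a\<^sup>2 + z \<bullet> z)) ^ k" for a and z :: "real ^ 'a"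
  using C(1) by (intro divide_left_mono power_increasing mult_pos_pos zero_less_power) (auto simp: add_pos_nonneg)
 then show ?case using C order_trans by blast
qed

text \<open>A derivative of \<open>cos_sqrt k (a\<^sup>2 + z \<bullet> z)\<close> is twice a
  coordinate times the same function of order \<open>k + 1\<close>: the order gained pays for the
  coordinate. Hence differentiation keeps the order, and one \<open>f'\<close> serves for all
  \<open>a\<close>.\<close>

lemma symbol_class_partial_deriv:
 "symbol_class k f \<Longrightarrow> (\<forall>a z. f a differentiable (at z)) \<and> (\<forall>j. \<exists>f'. symbol_class k f' \<and> (\<forall>a. partial_deriv j (f a) = f' a))"
proof (induction rule: symbol_class.induct)
 case (base k)
 have d: "((\<lambda>z. complex_of_real (cos_sqrt k (a\<^sup>2 + z \<bullet> z))) has_derivative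
   (\<lambda>h. of_real (cos_sqrt (Suc k) (a\<^sup>2 + z \<bullet> z) * (2 * (z \<bullet> h))))) (at z)" for a and z :: "real ^ 'a"
 proof -
  have 1: "((\<lambda>z. a\<^sup>2 + z \<bullet> z) has_derivative (\<lambda>h. 2 * (z \<bullet> h))) (at z)"
   by (auto intro!: derivative_eq_intros simp: inner_commute)
  have 2: "(cos_sqrt k has_derivative (*) (cos_sqrt (Suc k) s)) (at s)" for s
   using cos_sqrt_deriv[OF DERIV_ident, of k s] by (simp add: has_field_derivative_def)
  from has_derivative_of_real[OF has_derivative_compose[OF 1 2]] show ?thesis .
 qed
 show ?case
 proof (intro conjI allI)
  show "(\<lambda>z. complex_of_real (cos_sqrt k (a\<^sup>2 + z \<bullet> z))) differentiable (at z)" for a and z :: "real ^ 'a"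
   using differentiableI[OF d] .
  fix j :: 'a
  have "partial_deriv j (\<lambda>z. complex_of_real (cos_sqrt k (a\<^sup>2 + z \<bullet> z))) = (\<lambda>z. 2 * (coord j z * of_real (cos_sqrt (Suc k) (a\<^sup>2 + z \<bullet> z))))" for a
   by (rule ext, subst partial_deriv_eq[OF d]) (simp add: coord_def inner_axis)
  then show "\<exists>f'. symbol_class k f' \<and> (\<forall>a. partial_deriv j (\<lambda>z. complex_of_real (cos_sqrt k (a\<^sup>2 + z \<bullet> z))) = f' a)"
   using symbol_class.cmult[OF symbol_class.coord[OF symbol_class.base, of k j], of 2] by blast
 qed
next
 case (coord k f i)
 have f: "f a differentiable (at z)" for a z using coord by blast
 have c: "coord i differentiable (at z)" for z by (rule smooth_differentiable[OF smooth_coord])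
 show ?case
 proof (intro conjI allI)
  show "(\<lambda>z. coord i z * f a z) differentiable (at z)" for a z
   by (intro differentiable_mult f c)
  fix j
  obtain f' where f': "symbol_class (Suc k) f'" "\<And>a. partial_deriv j (f a) = f' a" using coord by blast
  have "partial_deriv j (\<lambda>z. coord i z * f a z) = (\<lambda>z. (if j = i then 1 else 0) * f a z + coord i z * f' a z)" for a
   by (rule ext, subst partial_deriv_mult[OF c f]) (simp add: partial_deriv_coord f')
  moreover have "symbol_class k (\<lambda>a z. (if j = i then 1 else 0) * f a z + coord i z * f' a z)"
   by (intro symbol_class.add symbol_class.cmult symbol_class.coord symbol_class.weaken[OF coord.hyps] f')
  ultimately show "\<exists>f'. symbol_class k f' \<and> (\<forall>a. partial_deriv j (\<lambda>z. coord i z * f a z) = f' a)" by blast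
 qed
next
 case (param k f)
 have f: "f a differentiable (at z)" for a z using param by blast
 show ?case
 proof (intro conjI allI)
  show "(\<lambda>z. of_real a * f a z) differentiable (at z)" for a z by (intro differentiable_mult f) simp
  fix j
  obtain f' where f': "symbol_class (Suc k) f'" "\<And>a. partial_deriv j (f a) = f' a" using param by blast
  have "partial_deriv j (\<lambda>z. of_real a * f a z) = (\<lambda>z. of_real a * f' a z)" for a
   by (rule ext, subst partial_deriv_mult[OF differentiable_const f]) (simp add: partial_deriv_const f')
  then show "\<exists>f'. symbol_class k f' \<and> (\<forall>a. partial_deriv j (\<lambda>z. of_real a * f a z) = f' a)"
   using symbol_class.param[OF f'(1)] by blast
 qed
next
 case (add k f h)
 have f: "f a differentiable (at z)" and h: "h a differentiable (at z)" for a z using add by blast+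
 show ?case
 proof (intro conjI allI)
  show "(\<lambda>z. f a z + h a z) differentiable (at z)" for a z by (intro differentiable_add f h)
  fix j
  obtain f' h' where f': "symbol_class k f'" "\<And>a. partial_deriv j (f a) = f' a"
   and h': "symbol_class k h'" "\<And>a. partial_deriv j (h a) = h' a" using add by metis
  have "partial_deriv j (\<lambda>z. f a z + h a z) = (\<lambda>z. f' a z + h' a z)" for a
   by (rule ext, subst partial_deriv_add[OF f h]) (simp add: f' h')
  then show "\<exists>f'. symbol_class k f' \<and> (\<forall>a. partial_deriv j (\<lambda>z. f a z + h a z) = f' a)"
   using symbol_class.add[OF f'(1) h'(1)] by blast
 qed
next
 case (cmult k f c)
 have f: "f a differentiable (at z)" for a z using cmult by blast
 show ?case
 proof (intro conjI allI)
  show "(\<lambda>z. c * f a z) differentiable (at z)" for a z by (intro differentiable_mult f) simp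
  fix j
  obtain f' where f': "symbol_class k f'" "\<And>a. partial_deriv j (f a) = f' a" using cmult by blast
  have "partial_deriv j (\<lambda>z. c * f a z) = (\<lambda>z. c * f' a z)" for a
   by (rule ext, subst partial_deriv_mult[OF differentiable_const f]) (simp add: partial_deriv_const f')
  then show "\<exists>f'. symbol_class k f' \<and> (\<forall>a. partial_deriv j (\<lambda>z. c * f a z) = f' a)"
   using symbol_class.cmult[OF f'(1)] by blast
 qed
next
 case (weaken k f)
 then show ?case using symbol_class.weaken by blast
qed

lemma symbol_class_smooth: "symbol_class k f \<Longrightarrow> smooth (f a)"
 by (rule smooth_coinduct[of "\<lambda>h. \<exists>f. symbol_class k f \<and> h = f a"])
   (use symbol_class_partial_deriv in blast)+

lemma symbol_class_partial_derivs: "symbol_class k f \<Longrightarrow> \<exists>f'. symbol_class k f' \<and> (\<forall>a. partial_derivs js (f a) = f' a)"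
proof (induction js)
 case (Cons j js)
 then obtain f' where f': "symbol_class k f'" "\<And>a. partial_derivs js (f a) = f' a" by blast
 then show ?case using symbol_class_partial_deriv[OF f'(1)] by simp
qed auto

text \<open>Uniformity in \<open>a\<close> is the point: \<open>a\<close> will be
  \<open>t * m\<close> and \<open>z\<close> will be \<open>t *\<^sub>R \<xi>\<close>, so that
  \<open>t\<close> enters the bounds for the symbol only through the dilation.\<close>

lemma symbol_class_deriv_bound:
 fixes f :: "real \<Rightarrow> 'd::finite cfun"
 assumes "symbol_class 0 f"
 shows "\<exists>C\<ge>0. \<forall>a z. deriv_bound K (f a) z C"
proof -
 have "\<exists>C\<ge>0. \<forall>a z. norm (partial_derivs js (f a) z) \<le> C" for js
 proof -
  obtain f' where f': "symbol_class 0 f'" "\<And>a. partial_derivs js (f a) = f' a"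
   using symbol_class_partial_derivs[OF assms] by blast
  show ?thesis using symbol_class_bound[OF f'(1)] f'(2) by simp
 qed
 then obtain C where C: "\<And>js. 0 \<le> C js" "\<And>js a z. norm (partial_derivs js (f a) z) \<le> C js" by metis
 have "C js \<le> (\<Sum>js | length js \<le> K. C js)" if "length js \<le> K" for js
  using that C(1) by (intro member_le_sum finite_lists_length) auto
 then have "deriv_bound K (f a) z (\<Sum>js | length js \<le> K. C js)" for a z
  unfolding deriv_bound_def using C(2) order_trans by blast
 then show ?thesis using C(1) by (meson sum_nonneg)
qed

section \<open>The exponential of a matrix whose square is scalar\<close>

lemma mat_mult_entry: "(mat c ** A) $ i $ j = c * A $ i $ j" for A :: "complex ^ 'n ^ 'n::finite"
proof -
 have "(\<Sum>k\<in>UNIV. (if i = k then c else 0) * A $ k $ j) = (\<Sum>k\<in>UNIV. if k = i then c * A $ k $ j else 0)"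
  by (rule sum.cong) auto
 then show ?thesis by (simp add: matrix_matrix_mult_def mat_def)
qed

lemma mult_mat_entry: "(A ** mat c) $ i $ j = c * A $ i $ j" for A :: "complex ^ 'n ^ 'n::finite"
proof -
 have "(\<Sum>k\<in>UNIV. A $ i $ k * (if k = j then c else 0)) = (\<Sum>k\<in>UNIV. if k = j then c * A $ i $ k else 0)"
  by (rule sum.cong) auto
 then show ?thesis by (simp add: matrix_matrix_mult_def mat_def)
qed

lemma mat_mult_mat: "mat a ** mat b = (mat (a * b) :: complex ^ 'n ^ 'n::finite)"
 by (simp add: vec_eq_iff mat_mult_entry) (simp add: mat_def)

definition dirac_hamiltonian :: "('d::finite option \<Rightarrow> complex ^ 'n ^ 'n::finite) \<Rightarrow> real \<Rightarrow> real ^ 'd \<Rightarrow> complex ^ 'n ^ 'n" where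
 "dirac_hamiltonian \<alpha> a z = a *\<^sub>R \<alpha> None + (\<Sum>j\<in>UNIV. (z $ j) *\<^sub>R \<alpha> (Some j))"

lemma dirac_hamiltonian_entry:
 "dirac_hamiltonian \<alpha> a z $ k $ l = of_real a * \<alpha> None $ k $ l + (\<Sum>j\<in>UNIV. coord j z * \<alpha> (Some j) $ k $ l)"
 by (simp add: dirac_hamiltonian_def coord_def scaleR_conv_of_real[where 'a = complex])

text \<open>The double sum of products is symmetrised in its two indices, which turns each product
  into half an anticommutator; only the diagonal survives.\<close>

lemma dirac_hamiltonian_square:
 fixes \<alpha> :: "'d::finite option \<Rightarrow> complex ^ 'n ^ 'n::finite"
 assumes \<alpha>: "dirac_matrices \<alpha>"
 shows "dirac_hamiltonian \<alpha> a z ** dirac_hamiltonian \<alpha> a z = mat (of_real (a\<^sup>2 + z \<bullet> z))"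
proof -
 \<comment> \<open>Mass and momentum as one family over \<open>'d option\<close>, so that the mass
   term is not a special case.\<close>
 define y where "y i = (case i of None \<Rightarrow> complex_of_real a | Some j \<Rightarrow> of_real (z $ j))" for i
 have H: "dirac_hamiltonian \<alpha> a z $ k $ l = (\<Sum>i\<in>UNIV. y i * \<alpha> i $ k $ l)" for k l
  by (simp add: dirac_hamiltonian_entry y_def UNIV_option_conv sum.reindex coord_def)
 have yy: "(\<Sum>i\<in>UNIV. y i * y i) = of_real (a\<^sup>2 + z \<bullet> z)"
  by (simp add: y_def UNIV_option_conv sum.reindex inner_vec_def power2_eq_square)
 have "(dirac_hamiltonian \<alpha> a z ** dirac_hamiltonian \<alpha> a z) $ r $ c = mat (of_real (a\<^sup>2 + z \<bullet> z)) $ r $ c" for r c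
 proof -
  let ?P = "\<lambda>i k. (\<alpha> i ** \<alpha> k) $ r $ c"
  have "(dirac_hamiltonian \<alpha> a z ** dirac_hamiltonian \<alpha> a z) $ r $ c =
   (\<Sum>m\<in>UNIV. \<Sum>i\<in>UNIV. \<Sum>k\<in>UNIV. (y i * \<alpha> i $ r $ m) * (y k * \<alpha> k $ m $ c))"
   by (simp add: matrix_matrix_mult_def H sum_product)
  also have "\<dots> = (\<Sum>i\<in>UNIV. \<Sum>k\<in>UNIV. \<Sum>m\<in>UNIV. (y i * \<alpha> i $ r $ m) * (y k * \<alpha> k $ m $ c))"
   by (subst sum.swap, intro sum.cong refl, rule sum.swap)
  also have "\<dots> = (\<Sum>i\<in>UNIV. \<Sum>k\<in>UNIV. y i * y k * ?P i k)"
   by (intro sum.cong refl) (simp add: matrix_matrix_mult_def sum_distrib_left mult_ac)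
  finally have eq: "(dirac_hamiltonian \<alpha> a z ** dirac_hamiltonian \<alpha> a z) $ r $ c = (\<Sum>i\<in>UNIV. \<Sum>k\<in>UNIV. y i * y k * ?P i k)" .
  have sw: "(\<Sum>i\<in>UNIV. \<Sum>k\<in>UNIV. y i * y k * ?P i k) = (\<Sum>i\<in>UNIV. \<Sum>k\<in>UNIV. y i * y k * ?P k i)"
   by (subst sum.swap) (intro sum.cong refl, simp)
  have "2 * (\<Sum>i\<in>UNIV. \<Sum>k\<in>UNIV. y i * y k * ?P i k) =
   (\<Sum>i\<in>UNIV. \<Sum>k\<in>UNIV. y i * y k * ?P i k) + (\<Sum>i\<in>UNIV. \<Sum>k\<in>UNIV. y i * y k * ?P k i)"
   unfolding sw[symmetric] by (rule mult_2)
  also have "\<dots> = (\<Sum>i\<in>UNIV. \<Sum>k\<in>UNIV. y i * y k * (?P i k + ?P k i))"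
   by (simp only: sum.distrib distrib_left)
  also have "\<dots> = (\<Sum>i\<in>UNIV. \<Sum>k\<in>UNIV. if k = i then y i * y i * (if r = c then 2 else 0) else 0)"
  proof (intro sum.cong refl)
   fix i k
   have "?P i k + ?P k i = (mat (if i = k then 2 else 0) :: complex ^ 'n ^ 'n) $ r $ c"
    using \<alpha> unfolding dirac_matrices_def by (metis vector_add_component)
   then show "y i * y k * (?P i k + ?P k i) = (if k = i then y i * y i * (if r = c then 2 else 0) else 0)"
    by (auto simp: mat_def)
  qed
  also have "\<dots> = (\<Sum>i\<in>UNIV. y i * y i) * (if r = c then 2 else 0)"
   by (simp add: sum_distrib_right)
  also have "\<dots> = 2 * (mat (of_real (a\<^sup>2 + z \<bullet> z)) :: complex ^ 'n ^ 'n) $ r $ c"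
   unfolding yy by (simp add: mat_def)
  finally show ?thesis unfolding eq by (simp only: mult_cancel_left) simp
 qed
 then show ?thesis by (simp add: vec_eq_iff)
qed

lemma matrix_power_entry:
 fixes A :: "complex ^ 'n ^ 'n::finite"
 assumes A: "A ** A = mat w"
 shows "(((**) A ^^ k) (mat 1)) $ i $ j = (if even k then w ^ (k div 2) * (if i = j then 1 else 0) else w ^ ((k - 1) div 2) * A $ i $ j)"
proof -
 have even: "((**) A ^^ (2 * n)) (mat 1) = mat (w ^ n)" for n
 proof (induction n)
  case (Suc n)
  have "((**) A ^^ (2 * Suc n)) (mat 1) = A ** (A ** mat (w ^ n))" using Suc by simp
  also have "\<dots> = mat w ** mat (w ^ n)" by (simp add: matrix_mul_assoc A)
  also have "\<dots> = mat (w ^ Suc n)" by (simp add: mat_mult_mat)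
  finally show ?case .
 qed simp
 show ?thesis
 proof (cases "even k")
  case True
  then obtain n where "k = 2 * n" by blast
  then show ?thesis using even[of n] by (simp add: mat_def)
 next
  case False
  then obtain n where n: "k = Suc (2 * n)" by (metis oddE Suc_eq_plus1)
  then show ?thesis using even[of n] by (simp add: mult_mat_entry)
 qed
qed

lemma cos_sqrt_sums_0: "(\<lambda>n. (- (4 * pi\<^sup>2) * s) ^ n / fact (2 * n)) sums cos_sqrt 0 s"
proof -
 have "(- (4 * pi\<^sup>2) * s) ^ n / fact (2 * n) = (diffs ^^ 0) cos_sqrt_coeff n * s ^ n" for n
  unfolding cos_sqrt_coeff_def power_mult_distrib by simp
 then show ?thesis
  unfolding cos_sqrt_def[of 0 s] using summable_sums[OF summable_cos_sqrt[of 0 s]] by (simp only:)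
qed

text \<open>The odd part of the exponential series is, up to a factor, the derivative of the cosine
  series: shifting the index in \<open>cos_sqrt_coeff\<close> brings out
  \<open>- (4 * pi\<^sup>2)\<close>, and \<open>real (Suc n) / fact (2 * Suc n)\<close> equals
  \<open>1 / (2 * fact (Suc (2 * n)))\<close>.\<close>

lemma cos_sqrt_sums_1: "(\<lambda>n. (- (4 * pi\<^sup>2) * s) ^ n / fact (Suc (2 * n))) sums (- 1 / (2 * pi\<^sup>2) * cos_sqrt 1 s)"
proof -
 have "(\<lambda>n. - 1 / (2 * pi\<^sup>2) * ((diffs ^^ 1) cos_sqrt_coeff n * s ^ n)) sums (- 1 / (2 * pi\<^sup>2) * cos_sqrt 1 s)"
  unfolding cos_sqrt_def[of 1 s] by (intro sums_mult summable_sums summable_cos_sqrt)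
 moreover have "- 1 / (2 * pi\<^sup>2) * ((diffs ^^ 1) cos_sqrt_coeff n * s ^ n) = (- (4 * pi\<^sup>2) * s) ^ n / fact (Suc (2 * n))" for n
 proof -
  have c: "N * (- (4 * pi\<^sup>2) * X / (2 * N * F)) = - (2 * pi\<^sup>2) * (X / F)" if "N \<noteq> 0" for N X F :: real
   using that by (simp add: divide_simps)
  have "(fact (2 * Suc n) :: real) = 2 * real (Suc n) * fact (Suc (2 * n))" by (simp add: algebra_simps)
  then have "cos_sqrt_coeff (Suc n) = - (4 * pi\<^sup>2) * (- (4 * pi\<^sup>2)) ^ n / (2 * real (Suc n) * fact (Suc (2 * n)))"
   unfolding cos_sqrt_coeff_def by simp
  then have "real (Suc n) * cos_sqrt_coeff (Suc n) = - (2 * pi\<^sup>2) * ((- (4 * pi\<^sup>2)) ^ n / fact (Suc (2 * n)))"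
   using c[of "real (Suc n)" "(- (4 * pi\<^sup>2)) ^ n" "fact (Suc (2 * n))"] by (simp del: of_nat_Suc fact_Suc)
  then have "- 1 / (2 * pi\<^sup>2) * (real (Suc n) * cos_sqrt_coeff (Suc n)) = (- (4 * pi\<^sup>2)) ^ n / fact (Suc (2 * n))"
   by (simp del: of_nat_Suc fact_Suc)
  then have "- 1 / (2 * pi\<^sup>2) * (real (Suc n) * cos_sqrt_coeff (Suc n)) * s ^ n = (- (4 * pi\<^sup>2) * s) ^ n / fact (Suc (2 * n))"
   unfolding power_mult_distrib by (simp only: times_divide_eq_left)
  moreover have "(diffs ^^ 1) cos_sqrt_coeff n = real (Suc n) * cos_sqrt_coeff (Suc n)"
   by (simp add: diffs_def del: of_nat_Suc)
  ultimately show ?thesis by (simp only: mult.assoc)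
 qed
 ultimately show ?thesis by simp
qed

text \<open>Powers of \<open>A\<close> alternate between scalar matrices and scalar multiples of
  \<open>A\<close>; the two subseries are the cosine and the sine quotient, here
  \<open>cos_sqrt 0\<close> and a multiple of \<open>cos_sqrt 1\<close>.\<close>

lemma mat_exp_entry:
 fixes A :: "complex ^ 'n ^ 'n::finite"
 assumes A: "A ** A = mat (of_real (- (4 * pi\<^sup>2) * s))"
 shows "mat_exp A $ i $ j = of_real (cos_sqrt 0 s) * (if i = j then 1 else 0) + of_real (- 1 / (2 * pi\<^sup>2) * cos_sqrt 1 s) * A $ i $ j"
proof -
 define X :: "complex ^ 'n ^ 'n" where "X = (\<chi> i j. of_real (cos_sqrt 0 s) * (if i = j then 1 else 0) + of_real (- 1 / (2 * pi\<^sup>2) * cos_sqrt 1 s) * A $ i $ j)"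
 let ?f = "\<lambda>k. (1 / fact k) *\<^sub>R (((**) A ^^ k) (mat 1))"
 let ?w = "- (4 * pi\<^sup>2) * s"
 let ?e = "\<lambda>n. ?w ^ n / fact (2 * n)" and ?o = "\<lambda>n. ?w ^ n / fact (Suc (2 * n))"
 have ev: "(\<lambda>n. if even n then ?e (n div 2) else 0) sums (0 + cos_sqrt 0 s)"
  using sums_if[OF sums_zero cos_sqrt_sums_0] by simp
 have od: "(\<lambda>n. if even n then 0 else ?o ((n - 1) div 2)) sums (- 1 / (2 * pi\<^sup>2) * cos_sqrt 1 s + 0)"
  using sums_if[OF cos_sqrt_sums_1 sums_zero] by simp
 have ent: "(\<lambda>k. ?f k $ i $ j) sums X $ i $ j" for i j
 proof -
  have "(\<lambda>k. of_real (if even k then ?e (k div 2) else 0) * (if i = j then 1 else 0) + of_real (if even k then 0 else ?o ((k - 1) div 2)) * A $ i $ j) sums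
   (of_real (0 + cos_sqrt 0 s) * (if i = j then 1 else 0) + of_real (- 1 / (2 * pi\<^sup>2) * cos_sqrt 1 s + 0) * A $ i $ j)"
   by (intro sums_add sums_mult2 sums_of_real ev od)
  moreover have "?f k $ i $ j = of_real (if even k then ?e (k div 2) else 0) * (if i = j then 1 else 0) + of_real (if even k then 0 else ?o ((k - 1) div 2)) * A $ i $ j" for k
  proof (cases "even k")
   case True
   then show ?thesis by (simp add: matrix_power_entry[OF A] scaleR_conv_of_real[where 'a = complex])
  next
   case False
   then have "Suc (2 * ((k - 1) div 2)) = k" by (metis oddE Suc_eq_plus1 add_diff_cancel_right' nonzero_mult_div_cancel_left zero_neq_numeral)
   then show ?thesis using False by (simp add: matrix_power_entry[OF A] scaleR_conv_of_real[where 'a = complex] del: fact_Suc)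
  qed
  ultimately show ?thesis by (simp add: X_def)
 qed
 have "?f sums X"
  unfolding sums_def
 proof (intro vec_tendstoI)
  show "(\<lambda>n. (\<Sum>k<n. ?f k) $ i $ j) \<longlonglongrightarrow> X $ i $ j" for i j
   using ent[of i j] unfolding sums_def by simp
 qed
 then have "mat_exp A = X" unfolding mat_exp_def by (simp add: sums_iff)
 then show ?thesis by (simp add: X_def)
qed

lemma symbol_class_sum:
 assumes "finite I" "\<And>i. i \<in> I \<Longrightarrow> symbol_class k (f i)"
 shows "symbol_class k (\<lambda>a z. \<Sum>i\<in>I. f i a z)"
 using assms
proof (induction I rule: finite_induct)
 case empty
 show ?case using symbol_class.cmult[OF symbol_class.base[of k], of 0] by simp
next
 case (insert i I)
 then show ?case using symbol_class.add[of k "f i" "\<lambda>a z. \<Sum>i\<in>I. f i a z"] by simp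
qed

text \<open>Time is absorbed into mass and momentum, so that \<open>t\<close> occurs only as
  \<open>t * m\<close> and \<open>t *\<^sub>R \<xi>\<close>. The square of
  \<open>- 2 * pi * \<i>\<close> times the Hamiltonian is scalar, as \<open>mat_exp_entry\<close>
  requires.\<close>

lemma dirac_symbol_eq:
 assumes \<alpha>: "dirac_matrices \<alpha>"
 shows "dirac_symbol \<alpha> m t \<xi> $ k $ l = of_real (cos_sqrt 0 ((t * m)\<^sup>2 + (t *\<^sub>R \<xi>) \<bullet> (t *\<^sub>R \<xi>))) * (if k = l then 1 else 0) +
  of_real (- 1 / (2 * pi\<^sup>2) * cos_sqrt 1 ((t * m)\<^sup>2 + (t *\<^sub>R \<xi>) \<bullet> (t *\<^sub>R \<xi>))) * ((- 2 * pi * \<i>) * dirac_hamiltonian \<alpha> (t * m) (t *\<^sub>R \<xi>) $ k $ l)"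
proof -
 let ?H = "dirac_hamiltonian \<alpha> (t * m) (t *\<^sub>R \<xi>)" and ?s = "(t * m)\<^sup>2 + (t *\<^sub>R \<xi>) \<bullet> (t *\<^sub>R \<xi>)"
 have A: "mat (- 2 * pi * \<i> * t) ** (m *\<^sub>R \<alpha> None + (\<Sum>j\<in>UNIV. (\<xi> $ j) *\<^sub>R \<alpha> (Some j))) = mat (- 2 * pi * \<i>) ** ?H"
 proof -
  have "?H = t *\<^sub>R (m *\<^sub>R \<alpha> None + (\<Sum>j\<in>UNIV. (\<xi> $ j) *\<^sub>R \<alpha> (Some j)))"
   by (simp add: dirac_hamiltonian_def scaleR_right_distrib scaleR_sum_right)
  then show ?thesis
   by (simp add: vec_eq_iff mat_mult_entry scaleR_conv_of_real[where 'a = complex])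
 qed
 have "(mat (- 2 * pi * \<i>) ** ?H) ** (mat (- 2 * pi * \<i>) ** ?H) = mat (of_real (- (4 * pi\<^sup>2) * ?s))"
 proof -
  have "(mat (- 2 * pi * \<i>) ** ?H) ** (mat (- 2 * pi * \<i>) ** ?H) = mat (- 2 * pi * \<i>) ** (mat (- 2 * pi * \<i>) ** (?H ** ?H))"
  proof -
   have comm: "?H ** mat (- 2 * pi * \<i>) = mat (- 2 * pi * \<i>) ** ?H"
    by (simp only: vec_eq_iff mat_mult_entry mult_mat_entry) simp
   have "(mat (- 2 * pi * \<i>) ** ?H) ** (mat (- 2 * pi * \<i>) ** ?H) = mat (- 2 * pi * \<i>) ** ((?H ** mat (- 2 * pi * \<i>)) ** ?H)"
    by (simp only: matrix_mul_assoc)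
   then show ?thesis unfolding comm by (simp only: matrix_mul_assoc)
  qed
  also have "\<dots> = mat ((- 2 * pi * \<i>) * ((- 2 * pi * \<i>) * of_real ?s))"
   unfolding dirac_hamiltonian_square[OF \<alpha>] mat_mult_mat ..
  also have "(- 2 * pi * \<i>) * ((- 2 * pi * \<i>) * of_real ?s) = of_real (- (4 * pi\<^sup>2) * ?s)"
  proof -
   have e: "(- 2 * pi * \<i>) * ((- 2 * pi * \<i>) * x) = - (4 * (of_real pi)\<^sup>2) * x" for x
    by (simp add: power2_eq_square)
   have r: "complex_of_real (- (4 * pi\<^sup>2) * x) = - (4 * (of_real pi)\<^sup>2) * of_real x" for x
    by simp
   show ?thesis unfolding e r ..
  qed
  finally show ?thesis .
 qed
 from mat_exp_entry[OF this, of k l] show ?thesis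
  unfolding dirac_symbol_def A by (simp add: mat_mult_entry)
qed

text \<open>The entries are of order 0 in \<open>symbol_class\<close>: the one order of decay of
  \<open>cos_sqrt 1\<close> is spent on the factor \<open>a\<close> or \<open>coord j\<close> from
  the Hamiltonian. Each derivative of a function of \<open>t *\<^sub>R \<xi>\<close> brings out a
  factor \<open>t\<close>.\<close>

lemma dirac_symbol_deriv_bound:
 fixes \<alpha> :: "'d::finite option \<Rightarrow> complex ^ 'n ^ 'n::finite"
 assumes \<alpha>: "dirac_matrices \<alpha>"
 shows "smooth (\<lambda>\<xi>. dirac_symbol \<alpha> m t \<xi> $ k $ l)"
  and "\<exists>C\<ge>0. \<forall>t \<xi>. deriv_bound K (\<lambda>\<xi>. dirac_symbol \<alpha> m t \<xi> $ k $ l) \<xi> (C * (1 + \<bar>t\<bar>) ^ K)"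
proof -
 define f where "f a z = (if k = l then 1 else 0) * complex_of_real (cos_sqrt 0 (a\<^sup>2 + z \<bullet> z)) +
  (\<i> / pi) * (\<alpha> None $ k $ l * (of_real a * of_real (cos_sqrt (Suc 0) (a\<^sup>2 + z \<bullet> z))) + (\<Sum>j\<in>UNIV. \<alpha> (Some j) $ k $ l * (coord j z * of_real (cos_sqrt (Suc 0) (a\<^sup>2 + z \<bullet> z)))))" for a and z :: "real ^ 'd"
 have f: "symbol_class 0 f"
  unfolding f_def[abs_def]
  by (intro symbol_class.add symbol_class.cmult symbol_class.base symbol_class_sum symbol_class.coord symbol_class.param) auto
 have eq: "(\<lambda>\<xi>. dirac_symbol \<alpha> m t \<xi> $ k $ l) = (\<lambda>\<xi>. f (t * m) (t *\<^sub>R \<xi> + 0))" for t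
 proof
  fix \<xi>
  have c: "complex_of_real (- 1 / (2 * pi\<^sup>2) * x) * ((- 2 * pi * \<i>) * h) = (\<i> / pi) * (h * of_real x)" for x h
   by (simp add: power2_eq_square)
  have d: "(of_real a * A + (\<Sum>j\<in>UNIV. coord j z * B j)) * F = A * (of_real a * F) + (\<Sum>j\<in>UNIV. B j * (coord j z * F))"
   for a A F and B :: "'d \<Rightarrow> complex" and z
   unfolding distrib_right sum_distrib_right by (simp only: mult_ac)
  show "dirac_symbol \<alpha> m t \<xi> $ k $ l = f (t * m) (t *\<^sub>R \<xi> + 0)"
   unfolding dirac_symbol_eq[OF \<alpha>] c dirac_hamiltonian_entry f_def add_0_right One_nat_def d
   by (simp only: mult.commute[of _ "if k = l then 1 else 0"])
 qed
 show "smooth (\<lambda>\<xi>. dirac_symbol \<alpha> m t \<xi> $ k $ l)"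
  unfolding eq by (intro smooth_affine symbol_class_smooth[OF f])
 obtain C where C: "0 \<le> C" "\<And>a z. deriv_bound K (f a) z C" using symbol_class_deriv_bound[OF f] by blast
 have "deriv_bound K (\<lambda>\<xi>. dirac_symbol \<alpha> m t \<xi> $ k $ l) \<xi> (C * (1 + \<bar>t\<bar>) ^ K)" for t \<xi>
  unfolding eq mult.commute[of C] by (rule deriv_bound_affine[OF symbol_class_smooth[OF f] C(2)]) auto
 then show "\<exists>C\<ge>0. \<forall>t \<xi>. deriv_bound K (\<lambda>\<xi>. dirac_symbol \<alpha> m t \<xi> $ k $ l) \<xi> (C * (1 + \<bar>t\<bar>) ^ K)"
  using C(1) by blast
qed

subsection \<open>Fourier multipliers in phase space\<close>

lemma integral_reflect:
 fixes f :: "'a::euclidean_space \<Rightarrow> complex"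
 assumes "f \<in> \<B>"
 shows "(\<integral>\<^sub>Lx. f (- x)) = (\<integral>\<^sub>Lx. f x)"
 using integral_lborel_affine[OF assms, of "-1" 0] by simp

lemma inv_fourier_multiplication_formula:
 fixes f h :: "'d::finite cfun"
 assumes f: "integrable lborel f" and h: "integrable lborel h"
 shows "(\<integral>\<^sub>Lz. inv_fourier f z * h z) = (\<integral>\<^sub>Lz. f z * inv_fourier h z)"
proof -
 have [measurable]: "f \<in> \<B>" "h \<in> \<B>"
  using f h by (auto dest: borel_measurable_integrable)
 have [measurable]: "fourier f \<in> \<B>" by (rule fourier_measurable[OF f])
 have h': "integrable lborel (\<lambda>z. h (- z))" using integrable_lborel_affine[OF h, of "-1" 0] by simp
 have r: "fourier (\<lambda>z. h (- z)) x = fourier h (- x)" for x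
  unfolding fourier_eq
  using integral_reflect[of "\<lambda>z. expi (- (- x)) z * h z"] by (simp add: expi_minus)
 have "(\<integral>\<^sub>Lz. inv_fourier f z * h z) = (\<integral>\<^sub>Lz. fourier f (- z) * h (- (- z)))"
  by (simp add: inv_fourier_eq)
 also have "\<dots> = (\<integral>\<^sub>Lz. fourier f z * h (- z))"
  by (rule integral_reflect[of "\<lambda>z. fourier f z * h (- z)"]) measurable
 also have "\<dots> = (\<integral>\<^sub>Lz. f z * fourier (\<lambda>z. h (- z)) z)"
  by (rule fourier_multiplication_formula[OF f h'])
 finally show ?thesis by (simp add: r inv_fourier_eq)
qed

lemma fourier_translate:
 assumes [measurable]: "h \<in> \<B>"
 shows "fourier (\<lambda>z. h (z + - x)) \<zeta> = expi (- \<zeta>) x * fourier h \<zeta>"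
proof -
 have "fourier (\<lambda>z. h (z + - x)) \<zeta> = (\<integral>\<^sub>Lz. expi (- \<zeta>) (x + z) * h (x + z + - x))"
  unfolding fourier_eq by (rule integral_lborel_translate[symmetric]) measurable
 also have "\<dots> = (\<integral>\<^sub>Lz. expi (- \<zeta>) x * (expi (- \<zeta>) z * h z))"
  by (intro Bochner_Integration.integral_cong refl) (simp add: expi_add)
 finally show ?thesis unfolding fourier_eq by (simp only: integral_mult_right_zero)
qed

lemma fourier_time_freq_shift:
 assumes "h \<in> \<B>"
 shows "fourier (time_freq_shift x \<xi> h) \<zeta> = expi (- (\<zeta> - \<xi>)) x * fourier h (\<zeta> - \<xi>)"
 unfolding time_freq_shift_eq fourier_modulation fourier_translate[OF assms] ..

text \<open>The symbol is centred at the input frequency \<open>\<xi>\<close>, with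
  \<open>\<xi> + \<eta>\<close> as output frequency. The shift by \<open>\<xi>\<close> falls on
  \<open>\<nu>\<close> alone, so bounds on \<open>\<nu>\<close> that hold everywhere give bounds
  uniform in \<open>\<xi>\<close>.\<close>

definition multiplier_kernel ::
  "('d::finite cfun) \<Rightarrow> ('d cfun) \<Rightarrow> real ^ 'd \<Rightarrow> real ^ 'd \<Rightarrow> 'd cfun" where
 "multiplier_kernel g \<nu> \<xi> \<eta> = (\<lambda>\<zeta>. \<nu> (\<zeta> + \<xi>) * (fourier g \<zeta> * cnj (fourier g (\<zeta> + - \<eta>))))"

definition multiplier_op :: "('d::finite cfun) \<Rightarrow> ('d cfun) \<Rightarrow> 'd cfun" where
 "multiplier_op \<nu> \<phi> = inv_fourier (\<lambda>\<zeta>. \<nu> \<zeta> * fourier \<phi> \<zeta>)"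

lemma multiplier_schwartz:
 assumes "smooth \<nu>" "\<And>k. \<exists>B. \<forall>\<zeta>. deriv_bound k \<nu> \<zeta> B"
 shows "schwartz_map (\<lambda>\<phi> \<zeta>. \<nu> \<zeta> * \<phi> \<zeta>)"
proof (rule schwartz_map_mult[OF assms(1)])
 fix k
 obtain B where "\<forall>\<zeta>. deriv_bound k \<nu> \<zeta> B" using assms(2) by blast
 then show "\<exists>A n. \<forall>x. deriv_bound k \<nu> x (A * (1 + norm x) ^ n)"
  by (intro exI[of _ B] exI[of _ 0]) simp
qed

lemma multiplier_op_schwartz:
 assumes "smooth \<nu>" "\<And>k. \<exists>B. \<forall>\<zeta>. deriv_bound k \<nu> \<zeta> B"
 shows "schwartz_map (multiplier_op \<nu>)"
 unfolding multiplier_op_def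
 by (intro schwartz_map_compose[OF schwartz_map_inv_fourier] schwartz_map_compose[OF multiplier_schwartz[OF assms] schwartz_map_fourier])

text \<open>\<open>C\<close> is chosen before \<open>\<nu>\<close> and the bound is linear in
  \<open>B\<close>, so the growth of \<open>\<nu>\<close> in \<open>t\<close> passes to the kernel
  unchanged. Decay in \<open>\<eta>\<close> is the small overlap of \<open>fourier g\<close> with
  its translate by \<open>\<eta>\<close>.\<close>

lemma multiplier_kernel_bound:
 fixes g :: "'d::finite cfun"
 assumes g: "g \<in> schwartz"
 shows "\<exists>C\<ge>0. \<forall>\<nu> B. smooth \<nu> \<longrightarrow> (\<forall>\<zeta>. deriv_bound k \<nu> \<zeta> B) \<longrightarrow>
  (\<forall>\<xi> \<eta>. decay_bound k M (C * B / (1 + norm \<eta>) ^ N) (multiplier_kernel g \<nu> \<xi> \<eta>))"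
proof -
 have Fg: "fourier g \<in> schwartz" by (rule schwartz_map_schwartz[OF schwartz_map_fourier g])
 obtain A1 where A1: "decay_bound k (M + N) A1 (fourier g)" using schwartz_decay[OF Fg] by blast
 obtain A2 where A2: "decay_bound k N A2 (\<lambda>\<zeta>. cnj (fourier g \<zeta>))" using schwartz_decay[OF schwartz_cnj[OF Fg]] by blast
 have s: "smooth (fourier g)" "smooth (\<lambda>\<zeta>. cnj (fourier g \<zeta>))" by (intro schwartz_smooth Fg schwartz_cnj)+
 have "decay_bound k M (2 ^ k * (2 ^ k * A1 * A2) * B / (1 + norm \<eta>) ^ N) (multiplier_kernel g \<nu> \<xi> \<eta>)"
  if \<nu>: "smooth \<nu>" "\<And>\<zeta>. deriv_bound k \<nu> \<zeta> B" for \<nu> B \<xi> \<eta>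
  unfolding decay_bound_def
 proof
  fix \<zeta>
  have 1: "deriv_bound k (\<lambda>\<zeta>. \<nu> (\<zeta> + \<xi>)) \<zeta> B" using \<nu>(2) deriv_bound_translate[OF \<nu>(1)] by blast
  have 2: "deriv_bound k (\<lambda>\<zeta>. fourier g \<zeta> * cnj (fourier g (\<zeta> + - \<eta>))) \<zeta> (2 ^ k * A1 * A2 / (1 + norm \<eta>) ^ N / (1 + norm \<zeta>) ^ M)"
   using decay_bound_mult_translate[OF s A1 A2, of \<eta>] unfolding decay_bound_def by blast
  have 3: "smooth (\<lambda>\<zeta>. fourier g \<zeta> * cnj (fourier g (\<zeta> + - \<eta>)))"
   by (intro smooth_mult s smooth_translate[OF s(2)])
  from deriv_bound_mult[OF smooth_translate[OF \<nu>(1)] 3 1 2]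
  show "deriv_bound k (multiplier_kernel g \<nu> \<xi> \<eta>) \<zeta> (2 ^ k * (2 ^ k * A1 * A2) * B / (1 + norm \<eta>) ^ N / (1 + norm \<zeta>) ^ M)"
   unfolding multiplier_kernel_def by (simp add: mult_ac)
 qed
 moreover have "0 \<le> 2 ^ k * (2 ^ k * A1 * A2)" using decay_bound_nonneg[OF A1] decay_bound_nonneg[OF A2] by simp
 ultimately show ?thesis by blast
qed

lemma multiplier_kernel_schwartz:
 fixes g :: "'d::finite cfun"
 assumes g: "g \<in> schwartz" and \<nu>: "smooth \<nu>" "\<And>k. \<exists>B. \<forall>\<zeta>. deriv_bound k \<nu> \<zeta> B"
 shows "multiplier_kernel g \<nu> \<xi> \<eta> \<in> schwartz"
proof -
 have Fg: "fourier g \<in> schwartz" by (rule schwartz_map_schwartz[OF schwartz_map_fourier g])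
 have "schwartz_map (\<lambda>\<phi> \<zeta>. \<nu> (\<zeta> + \<xi>) * \<phi> \<zeta>)"
 proof (rule multiplier_schwartz)
  show "smooth (\<lambda>\<zeta>. \<nu> (\<zeta> + \<xi>))" by (rule smooth_translate[OF \<nu>(1)])
  show "\<exists>B. \<forall>\<zeta>. deriv_bound k (\<lambda>\<zeta>. \<nu> (\<zeta> + \<xi>)) \<zeta> B" for k
   using \<nu>(2)[of k] unfolding deriv_bound_translate[OF \<nu>(1)] by blast
 qed
 from schwartz_map_schwartz[OF this schwartz_mult[OF Fg schwartz_cnj[OF schwartz_translate[OF Fg]]]]
 show ?thesis unfolding multiplier_kernel_def .
qed

text \<open>The matrix coefficient of the multiplier between two atoms, evaluated on the frequency
  side by the multiplication formula. The positions combine to a character at \<open>y - x\<close>,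
  so for each \<open>\<eta>\<close> the coefficient is a convolution kernel up to a phase in
  \<open>y\<close>.\<close>

lemma gabor_coeff_multiplier:
 fixes g :: "'d::finite cfun"
 assumes g: "g \<in> schwartz" and \<nu>: "smooth \<nu>" "\<And>k. \<exists>B. \<forall>\<zeta>. deriv_bound k \<nu> \<zeta> B"
 shows "gabor_coeff g (multiplier_op \<nu> (time_freq_shift x \<xi> g)) (y, \<xi> + \<eta>) =
  expi (- \<eta>) y * inv_fourier (multiplier_kernel g \<nu> \<xi> \<eta>) (y - x)"
proof -
 let ?E = "time_freq_shift x \<xi> g" and ?E' = "time_freq_shift y (\<xi> + \<eta>) g"
 have gm: "g \<in> \<B>" by (intro smooth_borel schwartz_smooth g)
 have E: "?E \<in> schwartz" "?E' \<in> schwartz" by (intro time_freq_shift_schwartz g)+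
 have FE: "(\<lambda>\<zeta>. \<nu> \<zeta> * fourier ?E \<zeta>) \<in> schwartz"
  using schwartz_map_schwartz[OF schwartz_map_compose[OF multiplier_schwartz[OF \<nu>] schwartz_map_fourier] E(1)] .
 have "gabor_coeff g (multiplier_op \<nu> ?E) (y, \<xi> + \<eta>) = (\<integral>\<^sub>Lz. multiplier_op \<nu> ?E z * cnj (?E' z))"
  unfolding gabor_coeff_def fourier_eq time_freq_shift_eq
  by (intro Bochner_Integration.integral_cong refl) (simp add: cnj_expi mult_ac)
 also have "\<dots> = (\<integral>\<^sub>L\<zeta>. \<nu> \<zeta> * fourier ?E \<zeta> * inv_fourier (\<lambda>z. cnj (?E' z)) \<zeta>)"
  unfolding multiplier_op_def
  by (intro inv_fourier_multiplication_formula schwartz_integrable FE schwartz_cnj E)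
 also have "(\<lambda>\<zeta>. inv_fourier (\<lambda>z. cnj (?E' z)) \<zeta>) = (\<lambda>\<zeta>. cnj (fourier ?E' \<zeta>))"
  unfolding inv_fourier_eq fourier_eq
  by (rule ext, subst Bochner_Integration.integral_cnj[symmetric]) (simp add: cnj_expi)
 also have "(\<integral>\<^sub>L\<zeta>. \<nu> \<zeta> * fourier ?E \<zeta> * cnj (fourier ?E' \<zeta>)) =
   (\<integral>\<^sub>L\<zeta>. \<nu> (\<xi> + \<zeta>) * fourier ?E (\<xi> + \<zeta>) * cnj (fourier ?E' (\<xi> + \<zeta>)))"
 proof (rule integral_lborel_translate[symmetric])
  have [measurable]: "(\<lambda>\<zeta>. \<nu> \<zeta> * fourier ?E \<zeta>) \<in> \<B>" "fourier ?E' \<in> \<B>"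
   by (intro smooth_borel schwartz_smooth FE schwartz_map_schwartz[OF schwartz_map_fourier] E)+
  show "(\<lambda>\<zeta>. \<nu> \<zeta> * fourier ?E \<zeta> * cnj (fourier ?E' \<zeta>)) \<in> \<B>" by measurable
 qed
 also have "\<dots> = (\<integral>\<^sub>L\<zeta>. expi (- \<eta>) y * (expi \<zeta> (y - x) * multiplier_kernel g \<nu> \<xi> \<eta> \<zeta>))"
 proof (intro Bochner_Integration.integral_cong refl)
  fix \<zeta>
  have 1: "fourier ?E (\<xi> + \<zeta>) = expi (- \<zeta>) x * fourier g \<zeta>"
   unfolding fourier_time_freq_shift[OF gm] by simp
  have 2: "cnj (fourier ?E' (\<xi> + \<zeta>)) = expi (\<zeta> - \<eta>) y * cnj (fourier g (\<zeta> + - \<eta>))"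
  proof -
   have "\<xi> + \<zeta> - (\<xi> + \<eta>) = \<zeta> + - \<eta>" by simp
   then show ?thesis unfolding fourier_time_freq_shift[OF gm] by (simp only: complex_cnj_mult cnj_expi minus_minus) simp
  qed
  have 3: "expi (\<zeta> - \<eta>) y * expi (- \<zeta>) x = expi (- \<eta>) y * expi \<zeta> (y - x)"
   using expi_add(1)[of \<zeta> "- \<eta>" y] expi_add(2)[of \<zeta> y "- x"] by (simp add: expi_minus[of \<zeta> x])
  have "\<nu> (\<xi> + \<zeta>) * fourier ?E (\<xi> + \<zeta>) * cnj (fourier ?E' (\<xi> + \<zeta>)) =
   (expi (\<zeta> - \<eta>) y * expi (- \<zeta>) x) * (\<nu> (\<xi> + \<zeta>) * (fourier g \<zeta> * cnj (fourier g (\<zeta> + - \<eta>))))"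
   unfolding 1 2 by (simp only: mult_ac)
  then show "\<nu> (\<xi> + \<zeta>) * fourier ?E (\<xi> + \<zeta>) * cnj (fourier ?E' (\<xi> + \<zeta>)) = expi (- \<eta>) y * (expi \<zeta> (y - x) * multiplier_kernel g \<nu> \<xi> \<eta> \<zeta>)"
   unfolding 3 multiplier_kernel_def by (simp only: add.commute[of \<xi>] mult.assoc)
 qed
 also have "\<dots> = expi (- \<eta>) y * inv_fourier (multiplier_kernel g \<nu> \<xi> \<eta>) (y - x)"
 proof -
  have e: "inv_fourier h z = (\<integral>\<^sub>L\<zeta>. expi \<zeta> z * h \<zeta>)" for h :: "'d cfun" and z
   by (simp add: inv_fourier_def expi_def)
  show ?thesis unfolding e by (rule integral_mult_right_zero)
 qed
 finally show ?thesis .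
qed

section \<open>Convolutions arising from the multiplier\<close>

definition conv_op :: "('d::finite cfun) \<Rightarrow> ('d cfun) \<Rightarrow> 'd cfun" where
 "conv_op Q f x = (\<integral>\<^sub>Ly. inv_fourier Q (x - y) * f y)"

lemma cnj_inv_fourier: "cnj (inv_fourier Q z) = inv_fourier (\<lambda>\<zeta>. cnj (Q \<zeta>)) (- z)"
 unfolding inv_fourier_eq fourier_eq
 by (subst Bochner_Integration.integral_cnj[symmetric]) (simp add: cnj_expi)

text \<open>The reproducing formula for the image of an atom, integrated in \<open>y\<close> at
  fixed \<open>\<eta>\<close>. The norm stays outside the integral in \<open>y\<close>, so that the
  cancellations of the convolution remain available for the \<open>L^p\<close> bounds; only the
  integral in \<open>\<eta>\<close> is estimated absolutely.\<close>

lemma tempered_multiplier_le: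
 fixes g :: "'d::finite cfun"
 assumes v: "tempered_form N C v" and g: "g \<in> schwartz"
  and c: "\<And>f x. f \<in> schwartz \<Longrightarrow> inv_fourier (fourier f) x = c * f (x :: real ^ 'd)"
  and k: "k = c * of_real (\<integral>\<^sub>Ly. (norm (g y))\<^sup>2)" "k \<noteq> 0"
  and \<nu>: "smooth \<nu>" "\<And>k. \<exists>B. \<forall>\<zeta>. deriv_bound k \<nu> \<zeta> B"
 shows "ennreal (norm (v (multiplier_op \<nu> (time_freq_shift x \<xi> g)))) \<le> ennreal (1 / norm k) *
  (\<integral>\<^sub>+\<eta>. ennreal (norm (conv_op (\<lambda>\<zeta>. cnj (multiplier_kernel g \<nu> \<xi> \<eta> \<zeta>)) (\<lambda>y. expi \<eta> y * v (time_freq_shift y (\<xi> + \<eta>) g)) x)))"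
proof -
 let ?\<phi> = "multiplier_op \<nu> (time_freq_shift x \<xi> g)"
 let ?c = "\<lambda>\<eta>. conv_op (\<lambda>\<zeta>. cnj (multiplier_kernel g \<nu> \<xi> \<eta> \<zeta>)) (\<lambda>y. expi \<eta> y * v (time_freq_shift y (\<xi> + \<eta>) g)) x"
 let ?a = "gabor_coeff g ?\<phi>" and ?W = "\<lambda>w. v (gabor_atom g w)"
 have \<phi>: "?\<phi> \<in> schwartz"
  by (rule schwartz_map_schwartz[OF multiplier_op_schwartz[OF \<nu>] time_freq_shift_schwartz[OF g]])
 note gabor_coeff_measurable[OF g \<phi>, measurable] tempered_gabor_measurable[OF v g, measurable]
 obtain G where G: "\<And>w. norm (?W w) \<le> G * (1 + norm w) ^ (2 * N)"
  using tempered_gabor_growth[OF v g] by blast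
 have "integrable lborel (\<lambda>w. ?a w * cnj (?W w))"
  by (rule integrable_gabor_coeff_mult[OF g \<phi>, of _ G "2 * N"]) (simp_all add: G)
 then have "integrable lborel (\<lambda>w. cnj (?a w * cnj (?W w)))" by (simp only: complex_integrable_cnj)
 then have int: "integrable (lborel \<Otimes>\<^sub>M lborel) (\<lambda>(y, \<eta>). cnj (?a (y, \<eta>)) * ?W (y, \<eta>))"
  by (simp add: lborel_prod split_beta')
 let ?I = "\<lambda>\<eta>. \<integral>\<^sub>Ly. cnj (?a (y, \<eta>)) * ?W (y, \<eta>)"
 have [measurable]: "?I \<in> \<B>"
 proof -
  have [measurable]: "(\<lambda>w. cnj (?a w) * ?W w) \<in> borel_measurable (borel \<Otimes>\<^sub>M borel)"
   unfolding borel_prod by measurable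
  show ?thesis by measurable
 qed
 have "cnj k * v ?\<phi> = (\<integral>\<^sub>Lw. cnj (?a w) * ?W w)"
  unfolding k by (rule tempered_form_reproducing[OF v g \<phi> c, symmetric])
 also have "\<dots> = (\<integral>\<^sub>L\<eta>. ?I \<eta>)"
  using lborel_pair.integral_snd[OF int] by (simp add: lborel_prod split_beta')
 finally have eq: "cnj k * v ?\<phi> = (\<integral>\<^sub>L\<eta>. ?I \<eta>)" .
 have "ennreal (norm k) * ennreal (norm (v ?\<phi>)) = ennreal (norm (\<integral>\<^sub>L\<eta>. ?I \<eta>))"
  unfolding eq[symmetric] by (simp add: norm_mult ennreal_mult)
 also have "\<dots> \<le> (\<integral>\<^sub>+\<eta>. ennreal (norm (?I \<eta>)))"
 proof (cases "integrable lborel ?I")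
  case True
  then show ?thesis by (rule integral_norm_bound_ennreal)
 qed (simp add: not_integrable_integral_eq)
 also have "\<dots> = (\<integral>\<^sub>+\<eta>. ennreal (norm (?I (\<xi> + \<eta>))))"
  by (rule nn_integral_lborel_translate[symmetric]) measurable
 also have "\<dots> = (\<integral>\<^sub>+\<eta>. ennreal (norm (?c \<eta>)))"
 proof (intro nn_integral_cong)
  fix \<eta>
  have "?I (\<xi> + \<eta>) = ?c \<eta>"
   unfolding conv_op_def gabor_coeff_multiplier[OF g \<nu>]
   by (intro Bochner_Integration.integral_cong refl) (simp add: cnj_expi cnj_inv_fourier mult_ac)
  then show "ennreal (norm (?I (\<xi> + \<eta>))) = ennreal (norm (?c \<eta>))"
   by simp
 qed
 finally have main: "ennreal (norm k) * ennreal (norm (v ?\<phi>)) \<le>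
  (\<integral>\<^sub>+\<eta>. ennreal (norm (?c \<eta>)))" .
 have "ennreal (norm (v ?\<phi>)) = ennreal (1 / norm k) * (ennreal (norm k) * ennreal (norm (v ?\<phi>)))"
  using k(2) by (simp add: ennreal_mult[symmetric])
 also have "\<dots> \<le> ennreal (1 / norm k) * (\<integral>\<^sub>+\<eta>. ennreal (norm (?c \<eta>)))"
  by (intro mult_left_mono main) simp
 finally show ?thesis .
qed

text \<open>The crude bound, with \<open>C\<close> depending on \<open>\<nu>\<close> in an
  unspecified way: rapid decay of the kernel in both variables, enough for the weighted estimates at
  fixed \<open>t\<close>.\<close>

lemma inv_fourier_multiplier_kernel_bound:
 fixes g :: "'d::finite cfun"
 assumes g: "g \<in> schwartz" and \<nu>: "smooth \<nu>" "\<And>k. \<exists>B. \<forall>\<zeta>. deriv_bound k \<nu> \<zeta> B"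
 shows "\<exists>C\<ge>0. \<forall>\<xi> \<eta> y. norm (inv_fourier (\<lambda>\<zeta>. cnj (multiplier_kernel g \<nu> \<xi> \<eta> \<zeta>)) y) \<le>
  C * (1 / (1 + norm y) ^ N * (1 / (1 + norm \<eta>) ^ N))"
proof -
 obtain M D where D: "0 \<le> D" "\<And>\<phi> B. \<phi> \<in> schwartz \<Longrightarrow> decay_bound M M B \<phi> \<Longrightarrow> decay_bound N N (D * B) (inv_fourier \<phi> :: 'd cfun)"
  using schwartz_mapD[OF schwartz_map_inv_fourier] by metis
 obtain B where B: "\<And>\<zeta>. deriv_bound M \<nu> \<zeta> B" using \<nu>(2) by blast
 obtain C where C: "0 \<le> C" "\<And>\<xi> \<eta>. decay_bound M M (C * B / (1 + norm \<eta>) ^ N) (multiplier_kernel g \<nu> \<xi> \<eta>)"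
  using multiplier_kernel_bound[OF g, of M M N] \<nu>(1) B by blast
 have "norm (inv_fourier (\<lambda>\<zeta>. cnj (multiplier_kernel g \<nu> \<xi> \<eta> \<zeta>)) y) \<le> D * (C * B) * (1 / (1 + norm y) ^ N * (1 / (1 + norm \<eta>) ^ N))" for \<xi> \<eta> y
 proof -
  have "multiplier_kernel g \<nu> \<xi> \<eta> \<in> schwartz" by (rule multiplier_kernel_schwartz[OF g \<nu>])
  from decay_bound_norm[OF D(2)[OF this C(2)], of "- y"]
  have "norm (cnj (inv_fourier (multiplier_kernel g \<nu> \<xi> \<eta>) (- y))) \<le> D * (C * B / (1 + norm \<eta>) ^ N) / (1 + norm y) ^ N"
   by simp
  then show ?thesis unfolding cnj_inv_fourier by (simp add: mult.commute[of "(1 + norm \<eta>) ^ N"])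
 qed
 moreover have "0 \<le> D * (C * B)" using D(1) C(1) deriv_bound_nonneg[OF B] by simp
 ultimately show ?thesis by blast
qed

lemma nn_integral_norm_square_decay:
 fixes f :: "'d::finite cfun"
 assumes f: "\<And>x. norm (f x) \<le> B / (1 + norm x) ^ CARD('d)"
 shows "(\<integral>\<^sub>+x. ennreal ((norm (f x))\<^sup>2)) \<le> ennreal (B\<^sup>2 * bracket_integral TYPE('d))"
proof -
 have i: "integrable lborel (\<lambda>x::real ^ 'd. B\<^sup>2 * (1 / (1 + norm x) ^ (2 * CARD('d))))"
  by (intro integrable_mult_right integrable_inverse_one_plus_norm) simp
 have "(\<integral>\<^sub>+x. ennreal ((norm (f x))\<^sup>2)) \<le> (\<integral>\<^sub>+(x::real ^ 'd). ennreal (B\<^sup>2 * (1 / (1 + norm x) ^ (2 * CARD('d)))))"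
 proof (intro nn_integral_mono ennreal_leI)
  fix x
  have "(norm (f x))\<^sup>2 \<le> (B / (1 + norm x) ^ CARD('d))\<^sup>2" by (intro power_mono f) simp
  also have "\<dots> = B\<^sup>2 * (1 / (1 + norm x) ^ (2 * CARD('d)))"
   by (simp add: power_divide power_mult[symmetric] mult.commute)
  finally show "(norm (f x))\<^sup>2 \<le> B\<^sup>2 * (1 / (1 + norm x) ^ (2 * CARD('d)))" .
 qed
 also have "\<dots> = ennreal (\<integral>\<^sub>L(x::real ^ 'd). B\<^sup>2 * (1 / (1 + norm x) ^ (2 * CARD('d))))"
  by (rule nn_integral_eq_integral[OF i]) simp
 also have "(\<integral>\<^sub>L(x::real ^ 'd). B\<^sup>2 * (1 / (1 + norm x) ^ (2 * CARD('d)))) = B\<^sup>2 * bracket_integral TYPE('d)"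
  unfolding bracket_integral_def by (rule integral_mult_right_zero)
 finally show ?thesis .
qed

text \<open>Cauchy--Schwarz against the weight \<open>(1 + |y|/R)\<^bsup>-2d\<^esup>\<close> and the Plancherel inequality for \<open>Q\<close> and
 \<open>\<partial>\<^sub>j\<^sup>d Q\<close>: this is where the factor \<open>R\<^bsup>d/2\<^esup>\<close> comes from.\<close>

lemma inv_fourier_L1_bound:
 assumes C0: "0 \<le> C0" and pl: "\<And>f::'d::finite cfun. integrable lborel f \<Longrightarrow>
  (\<integral>\<^sub>+\<xi>. ennreal ((norm (fourier f \<xi>))\<^sup>2)) \<le> ennreal C0 * (\<integral>\<^sub>+x. ennreal ((norm (f x))\<^sup>2))"
 shows "\<exists>C>0. \<forall>Q::'d cfun\<in>schwartz. \<forall>b>0. \<forall>R\<ge>1.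
  decay_bound 0 CARD('d) b Q \<longrightarrow> decay_bound CARD('d) CARD('d) (b * R ^ CARD('d)) Q \<longrightarrow>
  (\<integral>\<^sub>+y. ennreal (norm (inv_fourier Q y))) \<le> ennreal (C * sqrt (R ^ CARD('d)) * b)"
proof -
 let ?d = "CARD('d)"
 let ?I = "bracket_integral TYPE('d)"
 define C1 where "C1 = (2 * real ?d) ^ (2 * ?d) * (2 * C0 * ?I + 2 * real ?d * (real ?d * (C0 * ?I)))"
 have C1: "0 \<le> C1" unfolding C1_def by (intro mult_nonneg_nonneg add_nonneg_nonneg C0 bracket_integral_nonneg[of "TYPE('d)"]) auto
 have main: "(\<integral>\<^sub>+y. ennreal (norm (inv_fourier Q y))) \<le> ennreal ((1 + ?I + C1) * sqrt (R ^ ?d) * b)"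
  if Q: "Q \<in> schwartz" and b: "0 < b" and R: "1 \<le> R" and d0: "decay_bound 0 ?d b Q" and dd: "decay_bound ?d ?d (b * R ^ ?d) Q"
  for Q :: "'d cfun" and b R
 proof -
  define K where "K = inv_fourier Q"
  let ?k = "\<lambda>j y. (\<bar>y $ j\<bar> / R) ^ (2 * ?d) * (norm (K y))\<^sup>2"
  have Ks: "K \<in> schwartz" unfolding K_def by (rule schwartz_map_schwartz[OF schwartz_map_inv_fourier Q])
  have FQ: "fourier Q \<in> schwartz" by (rule schwartz_map_schwartz[OF schwartz_map_fourier Q])
  have [measurable]: "K \<in> \<B>" "fourier Q \<in> \<B>"
   by (intro smooth_borel schwartz_smooth Ks FQ)+
  have K2: "(\<integral>\<^sub>+y. ennreal ((norm (K y))\<^sup>2)) \<le> ennreal (C0 * ?I * b\<^sup>2)"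
  proof -
   have "(\<integral>\<^sub>+y. ennreal ((norm (K y))\<^sup>2)) = (\<integral>\<^sub>+y. ennreal ((norm (fourier Q y))\<^sup>2))"
    unfolding K_def inv_fourier_eq by (rule nn_integral_reflect[of "\<lambda>y. ennreal ((norm (fourier Q y))\<^sup>2)"]) measurable
   also have "\<dots> \<le> ennreal C0 * (\<integral>\<^sub>+x. ennreal ((norm (Q x))\<^sup>2))"
    by (rule pl[OF schwartz_integrable[OF Q]])
   also have "\<dots> \<le> ennreal C0 * ennreal (b\<^sup>2 * ?I)"
    by (intro mult_left_mono nn_integral_norm_square_decay decay_bound_norm[OF d0]) simp
   also have "\<dots> = ennreal (C0 * ?I * b\<^sup>2)" 
    using C0 bracket_integral_nonneg[of "TYPE('d)"] by (subst ennreal_mult[symmetric]) (auto simp: mult_ac)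
   finally show ?thesis .
  qed
  \<comment> \<open>The factor \<open>R ^ (2 * ?d)\<close> from the squared bound on the derivatives
    of order \<open>?d\<close> cancels against the scaling of \<open>y\<close>, so these weighted
    integrals obey the same bound as the unweighted one.\<close>
  have Kj: "(\<integral>\<^sub>+y. ennreal (?k j y)) \<le> ennreal (C0 * ?I * b\<^sup>2)" for j
  proof -
   let ?D = "partial_derivs (replicate ?d j) Q"
   have D: "?D \<in> schwartz" by (rule schwartz_map_schwartz[OF schwartz_map_partial_derivs Q])
   have [measurable]: "fourier ?D \<in> \<B>"
    by (intro smooth_borel schwartz_smooth schwartz_map_schwartz[OF schwartz_map_fourier D])
   have "(\<integral>\<^sub>+y. ennreal (?k j y)) = (\<integral>\<^sub>+y. ennreal ((\<bar>y $ j\<bar> / R) ^ (2 * ?d) * (norm (fourier Q y))\<^sup>2))"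
    unfolding K_def inv_fourier_eq
    using nn_integral_reflect[of "\<lambda>y. ennreal ((\<bar>y $ j\<bar> / R) ^ (2 * ?d) * (norm (fourier Q y))\<^sup>2)"] by simp
   also have "\<dots> \<le> (\<integral>\<^sub>+y. ennreal ((1 / R ^ (2 * ?d)) * (norm (fourier ?D y))\<^sup>2))"
   proof (intro nn_integral_mono ennreal_leI)
    fix y
    have "\<bar>y $ j\<bar> ^ ?d \<le> (2 * pi * \<bar>y $ j\<bar>) ^ ?d"
    proof (rule power_mono)
     show "\<bar>y $ j\<bar> \<le> 2 * pi * \<bar>y $ j\<bar>"
      using mult_right_mono[of 1 "2 * pi" "\<bar>y $ j\<bar>"] pi_gt3 by simp
    qed simp
    then have "\<bar>y $ j\<bar> ^ ?d * norm (fourier Q y) \<le> (2 * pi * \<bar>y $ j\<bar>) ^ ?d * norm (fourier Q y)" by (intro mult_right_mono) auto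
    also have "\<dots> = norm (fourier ?D y)"
     by (simp add: fourier_partial_derivs_replicate[OF Q] norm_mult norm_power coord_def)
    finally have "(\<bar>y $ j\<bar> ^ ?d * norm (fourier Q y))\<^sup>2 \<le> (norm (fourier ?D y))\<^sup>2" by (intro power_mono) auto
    then have "(1 / R ^ (2 * ?d)) * (\<bar>y $ j\<bar> ^ ?d * norm (fourier Q y))\<^sup>2 \<le> (1 / R ^ (2 * ?d)) * (norm (fourier ?D y))\<^sup>2"
     using R by (intro mult_left_mono) auto
    moreover have "(\<bar>y $ j\<bar> / R) ^ (2 * ?d) * (norm (fourier Q y))\<^sup>2 = (1 / R ^ (2 * ?d)) * (\<bar>y $ j\<bar> ^ ?d * norm (fourier Q y))\<^sup>2"
     by (simp add: power_divide power_mult_distrib power_mult[symmetric] mult.commute[of ?d 2])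
    ultimately show "(\<bar>y $ j\<bar> / R) ^ (2 * ?d) * (norm (fourier Q y))\<^sup>2 \<le> (1 / R ^ (2 * ?d)) * (norm (fourier ?D y))\<^sup>2" by linarith
   qed
   also have "\<dots> = ennreal (1 / R ^ (2 * ?d)) * (\<integral>\<^sub>+y. ennreal ((norm (fourier ?D y))\<^sup>2))"
    using R by (subst nn_integral_cmult[symmetric]) (auto simp: ennreal_mult[symmetric])
   also have "\<dots> \<le> ennreal (1 / R ^ (2 * ?d)) * (ennreal C0 * (\<integral>\<^sub>+x. ennreal ((norm (?D x))\<^sup>2)))"
    by (intro mult_left_mono pl schwartz_integrable D) simp
   also have "\<dots> \<le> ennreal (1 / R ^ (2 * ?d)) * (ennreal C0 * ennreal ((b * R ^ ?d)\<^sup>2 * ?I))"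
   proof (intro mult_left_mono nn_integral_norm_square_decay)
    show "norm (?D x) \<le> b * R ^ ?d / (1 + norm x) ^ ?d" for x
     using dd deriv_boundD[of ?d Q x _ "replicate ?d j"] unfolding decay_bound_def by simp
   qed auto
   also have "\<dots> = ennreal (1 / R ^ (2 * ?d) * (C0 * ((b * R ^ ?d)\<^sup>2 * ?I)))"
   proof -
    have "0 \<le> (b * R ^ ?d)\<^sup>2 * ?I" using bracket_integral_nonneg[of "TYPE('d)"] by simp
    then show ?thesis using C0 R by (simp only: ennreal_mult mult_nonneg_nonneg divide_nonneg_nonneg zero_le_power zero_le_one order_trans[OF zero_le_one R])
   qed
   also have "1 / R ^ (2 * ?d) * (C0 * ((b * R ^ ?d)\<^sup>2 * ?I)) = C0 * ?I * b\<^sup>2"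
    using R by (simp add: power_mult_distrib power_mult[symmetric] mult.commute[of ?d 2])
   finally show ?thesis .
  qed
  define w where "w y = (1 + norm y / R) ^ (2 * ?d)" for y :: "real ^ 'd"
  have w1: "1 \<le> w y" for y unfolding w_def using R by (intro one_le_power) simp
  have [measurable]: "w \<in> \<B>" unfolding w_def by measurable
  have wint: "(\<integral>\<^sub>+y. ennreal (1 / w y)) = ennreal (R ^ ?d * ?I)"
  proof -
   have "(\<integral>\<^sub>+y. ennreal (1 / w y)) = ennreal (\<bar>R\<bar> ^ ?d) * (\<integral>\<^sub>+y. ennreal (1 / w (0 + R *\<^sub>R y)))"
    using R by (subst nn_integral_lborel_affine[of _ R 0]) auto
   also have "(\<lambda>y. ennreal (1 / w (0 + R *\<^sub>R y))) = (\<lambda>y::real ^ 'd. ennreal (1 / (1 + norm y) ^ (2 * ?d)))"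
    using R by (simp add: w_def)
   also have "(\<integral>\<^sub>+(y::real ^ 'd). ennreal (1 / (1 + norm y) ^ (2 * ?d))) = ennreal ?I"
    unfolding bracket_integral_def
    by (rule nn_integral_eq_integral) (auto intro!: integrable_inverse_one_plus_norm)
   finally show ?thesis using R bracket_integral_nonneg[of "TYPE('d)"] by (simp add: ennreal_mult[symmetric])
  qed
  have wK: "(\<integral>\<^sub>+y. ennreal (w y * (norm (K y))\<^sup>2)) \<le> ennreal (C1 * b\<^sup>2)"
  proof -
   have "w y * (norm (K y))\<^sup>2 \<le> (2 * real ?d) ^ (2 * ?d) * (2 * (norm (K y))\<^sup>2 + 2 * real ?d * (\<Sum>j\<in>UNIV. ?k j y))" for y
   proof -
    let ?s = "\<lambda>j. (\<bar>y $ j\<bar> / R) ^ ?d"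
    have "(1 + norm ((1 / R) *\<^sub>R y)) ^ ?d \<le> (2 * real ?d) ^ ?d * (1 + (\<Sum>j\<in>UNIV. \<bar>((1 / R) *\<^sub>R y) $ j\<bar> ^ ?d))"
     by (rule power_one_plus_norm_le)
    then have "(1 + norm y / R) ^ ?d \<le> (2 * real ?d) ^ ?d * (1 + (\<Sum>j\<in>UNIV. ?s j))"
     using R by (simp add: abs_mult divide_inverse mult.commute)
    then have "((1 + norm y / R) ^ ?d)\<^sup>2 \<le> ((2 * real ?d) ^ ?d * (1 + (\<Sum>j\<in>UNIV. ?s j)))\<^sup>2"
     using R by (intro power_mono) auto
    then have "w y \<le> (2 * real ?d) ^ (2 * ?d) * (1 + (\<Sum>j\<in>UNIV. ?s j))\<^sup>2"
     unfolding w_def by (simp add: power_mult_distrib power_mult[symmetric] mult.commute[of ?d 2])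
    also have "\<dots> \<le> (2 * real ?d) ^ (2 * ?d) * (2 + 2 * (real ?d * (\<Sum>j\<in>UNIV. (?s j)\<^sup>2)))"
    proof (intro mult_left_mono)
     have "(\<Sum>j\<in>UNIV. ?s j)\<^sup>2 \<le> (\<Sum>j\<in>UNIV. (?s j)\<^sup>2) * real ?d"
      by (rule sum_squared_le_sum_of_squares)
     moreover have "(1 + (\<Sum>j\<in>UNIV. ?s j))\<^sup>2 \<le> 2 + 2 * (\<Sum>j\<in>UNIV. ?s j)\<^sup>2"
      using sum_squares_bound[of 1 "\<Sum>j\<in>UNIV. ?s j"] by (simp add: power2_sum)
     ultimately show "(1 + (\<Sum>j\<in>UNIV. ?s j))\<^sup>2 \<le> 2 + 2 * (real ?d * (\<Sum>j\<in>UNIV. (?s j)\<^sup>2))"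
      by (simp add: mult.commute)
    qed simp
    finally have "w y * (norm (K y))\<^sup>2 \<le> (2 * real ?d) ^ (2 * ?d) * (2 + 2 * (real ?d * (\<Sum>j\<in>UNIV. (?s j)\<^sup>2))) * (norm (K y))\<^sup>2"
     by (intro mult_right_mono) auto
    also have "\<dots> = (2 * real ?d) ^ (2 * ?d) * (2 * (norm (K y))\<^sup>2 + 2 * real ?d * (\<Sum>j\<in>UNIV. ?k j y))"
    proof -
     have "(\<Sum>j\<in>UNIV. ?k j y) = (\<Sum>j\<in>UNIV. (?s j)\<^sup>2) * (norm (K y))\<^sup>2"
      unfolding sum_distrib_right by (simp only: power_mult[symmetric] mult.commute[of ?d 2])
     then show ?thesis by (simp only: distrib_right mult.assoc)
    qed
    finally show ?thesis .
   qed
   then have "(\<integral>\<^sub>+y. ennreal (w y * (norm (K y))\<^sup>2)) \<le>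
    (\<integral>\<^sub>+y. ennreal ((2 * real ?d) ^ (2 * ?d)) * (ennreal 2 * ennreal ((norm (K y))\<^sup>2) + ennreal (2 * real ?d) * (\<Sum>j\<in>UNIV. ennreal (?k j y))))"
   proof (intro nn_integral_mono)
    fix y
    assume *: "\<And>y. w y * (norm (K y))\<^sup>2 \<le> (2 * real ?d) ^ (2 * ?d) * (2 * (norm (K y))\<^sup>2 + 2 * real ?d * (\<Sum>j\<in>UNIV. ?k j y))"
    have n: "0 \<le> (\<Sum>j\<in>UNIV. ?k j y)" using R by (intro sum_nonneg) auto
    have "ennreal (w y * (norm (K y))\<^sup>2) \<le> ennreal ((2 * real ?d) ^ (2 * ?d) * (2 * (norm (K y))\<^sup>2 + 2 * real ?d * (\<Sum>j\<in>UNIV. ?k j y)))"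
     by (rule ennreal_leI[OF *])
    also have "\<dots> = ennreal ((2 * real ?d) ^ (2 * ?d)) * (ennreal 2 * ennreal ((norm (K y))\<^sup>2) + ennreal (2 * real ?d) * (\<Sum>j\<in>UNIV. ennreal (?k j y)))"
    proof (subst sum_ennreal)
     show "0 \<le> ?k j y" for j using R by simp
     have "0 \<le> 2 * real ?d" "0 \<le> 2 * (norm (K y))\<^sup>2" "0 \<le> (2 * real ?d) ^ (2 * ?d)" "0 \<le> (norm (K y))\<^sup>2" "0 \<le> (2::real)" by simp_all
     with n show "ennreal ((2 * real ?d) ^ (2 * ?d) * (2 * (norm (K y))\<^sup>2 + 2 * real ?d * (\<Sum>j\<in>UNIV. ?k j y)))
      = ennreal ((2 * real ?d) ^ (2 * ?d)) * (ennreal 2 * ennreal ((norm (K y))\<^sup>2) + ennreal (2 * real ?d) * ennreal (\<Sum>j\<in>UNIV. ?k j y))"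
      by (simp only: ennreal_mult[symmetric] ennreal_plus[symmetric] mult_nonneg_nonneg add_nonneg_nonneg)
    qed
    finally show "ennreal (w y * (norm (K y))\<^sup>2) \<le> ennreal ((2 * real ?d) ^ (2 * ?d)) * (ennreal 2 * ennreal ((norm (K y))\<^sup>2) + ennreal (2 * real ?d) * (\<Sum>j\<in>UNIV. ennreal (?k j y)))" .
   qed
   also have "\<dots> = ennreal ((2 * real ?d) ^ (2 * ?d)) * (ennreal 2 * (\<integral>\<^sub>+y. ennreal ((norm (K y))\<^sup>2)) + ennreal (2 * real ?d) * (\<Sum>j\<in>UNIV. (\<integral>\<^sub>+y. ennreal (?k j y))))"
   proof -
    have "(\<integral>\<^sub>+y. c1 * (c2 * A y + c3 * (\<Sum>j\<in>UNIV. B j y))) =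
      c1 * (c2 * (\<integral>\<^sub>+y. A y) + c3 * (\<Sum>j\<in>UNIV. (\<integral>\<^sub>+y. B j y)))"
     if [measurable]: "A \<in> \<B>" "\<And>j. B j \<in> \<B>"
     for c1 c2 c3 :: ennreal and A and B :: "'d \<Rightarrow> real ^ 'd \<Rightarrow> ennreal"
     by (simp add: nn_integral_cmult nn_integral_add nn_integral_sum)
    then show ?thesis by this measurable
   qed
   also have "\<dots> \<le> ennreal ((2 * real ?d) ^ (2 * ?d)) * (ennreal 2 * ennreal (C0 * ?I * b\<^sup>2) + ennreal (2 * real ?d) * (\<Sum>j\<in>(UNIV::'d set). ennreal (C0 * ?I * b\<^sup>2)))"
    by (intro mult_left_mono add_mono sum_mono K2 Kj) auto
   also have "\<dots> = ennreal (C1 * b\<^sup>2)"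
   proof -
    have n: "0 \<le> C0 * ?I * b\<^sup>2" using C0 bracket_integral_nonneg[of "TYPE('d)"] by simp
    have "ennreal ((2 * real ?d) ^ (2 * ?d)) * (ennreal 2 * ennreal (C0 * ?I * b\<^sup>2) + ennreal (2 * real ?d) * (\<Sum>j\<in>(UNIV::'d set). ennreal (C0 * ?I * b\<^sup>2)))
     = ennreal ((2 * real ?d) ^ (2 * ?d) * (2 * (C0 * ?I * b\<^sup>2) + 2 * real ?d * (\<Sum>j\<in>(UNIV::'d set). C0 * ?I * b\<^sup>2)))"
    proof (subst sum_ennreal[OF n])
     have "0 \<le> 2 * real ?d" "0 \<le> (2 * real ?d) ^ (2 * ?d)" "0 \<le> (2::real)" "0 \<le> (\<Sum>j\<in>(UNIV::'d set). C0 * ?I * b\<^sup>2)"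
      using n by (auto intro: sum_nonneg simp del: sum_constant)
     with n show "ennreal ((2 * real ?d) ^ (2 * ?d)) * (ennreal 2 * ennreal (C0 * ?I * b\<^sup>2) + ennreal (2 * real ?d) * ennreal (\<Sum>j\<in>(UNIV::'d set). C0 * ?I * b\<^sup>2))
      = ennreal ((2 * real ?d) ^ (2 * ?d) * (2 * (C0 * ?I * b\<^sup>2) + 2 * real ?d * (\<Sum>j\<in>(UNIV::'d set). C0 * ?I * b\<^sup>2)))"
      by (simp only: ennreal_mult[symmetric] ennreal_plus[symmetric] mult_nonneg_nonneg add_nonneg_nonneg)
    qed
    also have "(2 * real ?d) ^ (2 * ?d) * (2 * (C0 * ?I * b\<^sup>2) + 2 * real ?d * (\<Sum>j\<in>(UNIV::'d set). C0 * ?I * b\<^sup>2)) = C1 * b\<^sup>2"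
     by (simp add: C1_def algebra_simps)
    finally show ?thesis .
   qed
   finally show ?thesis .
  qed
  let ?S = "sqrt (R ^ ?d)"
  have S: "0 < ?S" "?S * ?S = R ^ ?d" using R by auto
  \<comment> \<open>The parameter in
    \<open>norm (K y) \<le> l / w y + w y * (norm (K y))\<^sup>2 / l\<close>. This value balances
    \<open>l * R ^ ?d\<close> against \<open>b\<^sup>2 / l\<close>: both become
    \<open>?S * b\<close>.\<close>
  define l where "l = b / ?S"
  have l: "0 < l" using b S by (simp add: l_def)
  have "(\<integral>\<^sub>+y. ennreal (norm (K y))) \<le> (\<integral>\<^sub>+y. ennreal l * ennreal (1 / w y) + ennreal (1 / l) * ennreal (w y * (norm (K y))\<^sup>2))"
  proof (rule nn_integral_mono)
   fix y
   have wp: "0 < w y" using w1[of y] by linarith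
   have "2 * sqrt (l / w y) * sqrt (w y * (norm (K y))\<^sup>2 / l) \<le> (sqrt (l / w y))\<^sup>2 + (sqrt (w y * (norm (K y))\<^sup>2 / l))\<^sup>2"
    by (rule sum_squares_bound)
   moreover have "sqrt (l / w y) * sqrt (w y * (norm (K y))\<^sup>2 / l) = norm (K y)"
    unfolding real_sqrt_mult[symmetric] using l wp by simp
   ultimately have "2 * norm (K y) \<le> l / w y + w y * (norm (K y))\<^sup>2 / l"
    using l wp by (simp add: mult.assoc)
   then have "norm (K y) \<le> l / w y + w y * (norm (K y))\<^sup>2 / l"
    using norm_ge_zero[of "K y"] by linarith
   then have "norm (K y) \<le> l * (1 / w y) + 1 / l * (w y * (norm (K y))\<^sup>2)"
    by simp
   then have "ennreal (norm (K y)) \<le> ennreal (l * (1 / w y) + 1 / l * (w y * (norm (K y))\<^sup>2))" by (rule ennreal_leI)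
   also have "\<dots> = ennreal l * ennreal (1 / w y) + ennreal (1 / l) * ennreal (w y * (norm (K y))\<^sup>2)"
    using l wp by (subst ennreal_plus) (auto simp: ennreal_mult[symmetric])
   finally show "ennreal (norm (K y)) \<le> ennreal l * ennreal (1 / w y) + ennreal (1 / l) * ennreal (w y * (norm (K y))\<^sup>2)" .
  qed
  also have "\<dots> = ennreal l * (\<integral>\<^sub>+y. ennreal (1 / w y)) + ennreal (1 / l) * (\<integral>\<^sub>+y. ennreal (w y * (norm (K y))\<^sup>2))"
   by (simp add: nn_integral_add nn_integral_cmult)
  also have "\<dots> \<le> ennreal l * ennreal (R ^ ?d * ?I) + ennreal (1 / l) * ennreal (C1 * b\<^sup>2)"
   unfolding wint by (intro add_left_mono mult_left_mono wK) simp
  also have "\<dots> = ennreal (l * (R ^ ?d * ?I) + 1 / l * (C1 * b\<^sup>2))"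
   using l R C1 bracket_integral_nonneg[of "TYPE('d)"] by (subst ennreal_plus) (auto simp: ennreal_mult[symmetric])
  also have "\<dots> \<le> ennreal ((1 + ?I + C1) * ?S * b)"
  proof (rule ennreal_leI)
   have "l * (R ^ ?d * ?I) = ?I * ?S * b" 
   proof -
    have "b / s * (s * s * ?I) = ?I * s * b" if "0 < s" for s :: real using that by simp
    from this[OF S(1)] show ?thesis unfolding l_def S(2) .
   qed
   moreover have "1 / l * (C1 * b\<^sup>2) = C1 * ?S * b" 
    unfolding l_def using b by (simp add: power2_eq_square)
   moreover have "0 \<le> 1 * ?S * b" using S b by simp
   ultimately show "l * (R ^ ?d * ?I) + 1 / l * (C1 * b\<^sup>2) \<le> (1 + ?I + C1) * ?S * b"
    by (simp only: distrib_right)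
  qed
  finally show ?thesis unfolding K_def .
 qed
 have "0 < 1 + ?I + C1" using C1 bracket_integral_nonneg[of "TYPE('d)"] by linarith
 then show ?thesis using main by (intro exI[of _ "1 + ?I + C1"]) blast
qed

lemma bounded_support_fun_integrable:
 assumes "bounded_support_fun f"
 shows "integrable lborel f"
proof -
 obtain s R where sR: "\<And>x. norm (f x) \<le> s" "\<And>x. R < norm x \<Longrightarrow> f x = 0" and [measurable]: "f \<in> \<B>"
  using assms unfolding bounded_support_fun_def by blast
 have "integrable lborel (\<lambda>x::'a. indicator (cball 0 R) x *\<^sub>R s)"
  using emeasure_bounded_finite[of "cball (0::'a) R"] by (intro integrable_scaleR_left integrable_real_indicator) auto
 then show ?thesis
 proof (rule Bochner_Integration.integrable_bound)
  show "AE x in lborel. norm (f x) \<le> norm (indicator (cball 0 R) x *\<^sub>R s)"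
   using sR order_trans[OF norm_ge_zero sR(1)] by (intro AE_I2) (auto simp: indicator_def)
 qed simp
qed

subsection \<open>Convolution operators on Lebesgue spaces\<close>

text \<open>Carries bounds from truncated functions to their pointwise limit. For
  \<open>p = top\<close> the countably many exceptional null sets are merged.\<close>

lemma lp_norm_fatou:
 fixes u :: "nat \<Rightarrow> 'a::euclidean_space \<Rightarrow> real"
 assumes u: "\<And>n. u n \<in> \<B>" "\<And>n x. 0 \<le> u n x"
  and lim: "\<And>x. (\<lambda>n. u n x) \<longlonglongrightarrow> v x" and p: "1 \<le> p"
  and L: "\<And>n. lp_norm p (\<lambda>x. ennreal (u n x)) \<le> L"
 shows "lp_norm p (\<lambda>x. ennreal (v x)) \<le> L"
proof (cases "p = top")
 case True
 have [measurable]: "u n \<in> \<B>" for n by (rule u)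
 have [measurable]: "v \<in> \<B>" by (rule borel_measurable_LIMSEQ_real[OF lim]) measurable
 have "AE x in lborel. \<forall>n. ennreal (u n x) \<le> L"
  unfolding AE_all_countable
 proof
  fix n
  have "AE x in lborel. ennreal (u n x) \<le> esssup lborel (\<lambda>x. ennreal (u n x))" by (rule esssup_AE)
  then show "AE x in lborel. ennreal (u n x) \<le> L"
  proof eventually_elim
   case (elim x)
   then show ?case using L[of n] unfolding True lp_norm_top by (rule order_trans)
  qed
 qed
 then have "AE x in lborel. ennreal (v x) \<le> L"
 proof eventually_elim
  case (elim x)
  show ?case by (rule LIMSEQ_le_const2[OF tendsto_ennrealI[OF lim]]) (use elim in auto)
 qed
 then show ?thesis unfolding True lp_norm_top by (intro esssup_I) auto
next
 case False
 let ?P = "enn2real p"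
 have P: "1 \<le> ?P" by (rule enn2real_ge_1[OF p False])
 have [measurable]: "u n \<in> \<B>" for n by (rule u)
 have v0: "0 \<le> v x" for x by (rule LIMSEQ_le_const[OF lim]) (use u in auto)
 have "(\<integral>\<^sub>+x. ennreal_powr (ennreal (v x)) ?P) = (\<integral>\<^sub>+x. liminf (\<lambda>n. ennreal (u n x powr ?P)))"
 proof (intro nn_integral_cong)
  fix x
  have "(\<lambda>n. ennreal (u n x powr ?P)) \<longlonglongrightarrow> ennreal (v x powr ?P)"
   using P u(2) by (intro tendsto_ennrealI tendsto_powr' lim tendsto_const) auto
  then have "liminf (\<lambda>n. ennreal (u n x powr ?P)) = ennreal (v x powr ?P)"
   by (intro lim_imp_Liminf) auto
  then show "ennreal_powr (ennreal (v x)) ?P = liminf (\<lambda>n. ennreal (u n x powr ?P))"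
   using v0 by (simp add: ennreal_powr_ennreal)
 qed
 also have "\<dots> \<le> liminf (\<lambda>n. \<integral>\<^sub>+x. ennreal (u n x powr ?P))"
  by (rule nn_integral_liminf) measurable
 also have "\<dots> \<le> ennreal_powr L ?P"
 proof (rule Liminf_le)
  have "(\<integral>\<^sub>+x. ennreal (u n x powr ?P)) \<le> ennreal_powr L ?P" for n
  proof -
   have "(\<integral>\<^sub>+x. ennreal (u n x powr ?P)) = ennreal_powr (lp_norm p (\<lambda>x. ennreal (u n x))) ?P"
    using P u(2) unfolding lp_norm_finite[OF False] by (simp add: ennreal_powr_powr ennreal_powr_ennreal)
   also have "\<dots> \<le> ennreal_powr L ?P" using P by (intro ennreal_powr_mono L) auto
   finally show ?thesis .
  qed
  then show "\<forall>\<^sub>F n in sequentially. (\<integral>\<^sub>+x. ennreal (u n x powr ?P)) \<le> ennreal_powr L ?P" by simp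
 qed simp
 finally have "(\<integral>\<^sub>+x. ennreal_powr (ennreal (v x)) ?P) \<le> ennreal_powr L ?P" .
 then have "lp_norm p (\<lambda>x. ennreal (v x)) \<le> ennreal_powr (ennreal_powr L ?P) (1 / ?P)"
  unfolding lp_norm_finite[OF False] using P by (intro ennreal_powr_mono) auto
 also have "\<dots> = L" using P by (intro ennreal_powr_inverse) auto
 finally show ?thesis .
qed

lemma conv_op_eq_inv_fourier:
 fixes Q f :: "'d::finite cfun"
 assumes Q: "integrable lborel Q" and f: "integrable lborel f"
 shows "conv_op Q f x = inv_fourier (\<lambda>\<zeta>. Q \<zeta> * fourier f \<zeta>) x"
proof -
 have [measurable]: "Q \<in> \<B>" "f \<in> \<B>"
  using Q f by (auto dest: borel_measurable_integrable)
 have "conv_op Q f x = (\<integral>\<^sub>Ly. (\<integral>\<^sub>L\<zeta>. expi \<zeta> (x - y) * Q \<zeta> * f y))"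
  unfolding conv_op_def inv_fourier_eq fourier_eq by (simp add: expi_commute)
 also have "\<dots> = (\<integral>\<^sub>L\<zeta>. (\<integral>\<^sub>Ly. expi \<zeta> (x - y) * Q \<zeta> * f y))"
 proof (rule Fubini_bound[of "\<lambda>(\<zeta>, y). expi \<zeta> (x - y) * Q \<zeta> * f y", unfolded prod.case])
  show "integrable lborel (\<lambda>\<zeta>. norm (Q \<zeta>))" "integrable lborel (\<lambda>\<zeta>. norm (f \<zeta>))" using Q f by simp_all
  show "(\<lambda>(\<zeta>, y). expi \<zeta> (x - y) * Q \<zeta> * f y) \<in> \<B>"
   unfolding borel_prod[symmetric] by measurable
 qed (simp add: norm_mult)
 also have "\<dots> = (\<integral>\<^sub>L\<zeta>. expi x \<zeta> * (Q \<zeta> * (\<integral>\<^sub>Ly. expi (- \<zeta>) y * f y)))"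
 proof (intro Bochner_Integration.integral_cong refl)
  fix \<zeta>
  have "(\<integral>\<^sub>Ly. expi \<zeta> (x - y) * Q \<zeta> * f y) = (\<integral>\<^sub>Ly. expi x \<zeta> * (Q \<zeta> * (expi (- \<zeta>) y * f y)))"
  proof (intro Bochner_Integration.integral_cong refl)
   fix y
   have "expi \<zeta> (x - y) = expi x \<zeta> * expi (- \<zeta>) y"
    using expi_add(2)[of \<zeta> x "- y"] by (simp add: expi_minus expi_commute[of \<zeta> x])
   then show "expi \<zeta> (x - y) * Q \<zeta> * f y = expi x \<zeta> * (Q \<zeta> * (expi (- \<zeta>) y * f y))" by (simp add: mult_ac)
  qed
  then show "(\<integral>\<^sub>Ly. expi \<zeta> (x - y) * Q \<zeta> * f y) = expi x \<zeta> * (Q \<zeta> * (\<integral>\<^sub>Ly. expi (- \<zeta>) y * f y))"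
   by (simp only: integral_mult_right_zero)
 qed
 finally show ?thesis unfolding inv_fourier_eq fourier_eq by simp
qed

text \<open>Division by \<open>C0 * b\<close> makes the operator a contraction on
  \<open>L^2\<close>: the Plancherel inequality is used for the transform and for its inverse, each
  time at the cost of \<open>C0\<close>, and the symbol contributes \<open>b\<^sup>2\<close>. The
  other two bounds are both the \<open>L^1\<close> norm of the kernel.\<close>

lemma interpolation_operator_conv_op:
 fixes Q :: "'d::finite cfun"
 assumes C0: "0 < C0" and pl: "\<And>f::'d cfun. integrable lborel f \<Longrightarrow>
  (\<integral>\<^sub>+\<xi>. ennreal ((norm (fourier f \<xi>))\<^sup>2)) \<le> ennreal C0 * (\<integral>\<^sub>+x. ennreal ((norm (f x))\<^sup>2))"
  and Q: "Q \<in> schwartz" and b: "0 < b" "\<And>\<zeta>. norm (Q \<zeta>) \<le> b"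
  and a: "0 < a" "(\<integral>\<^sub>+y. ennreal (norm (inv_fourier Q y))) \<le> ennreal a"
 shows "interpolation_operator (\<lambda>f x. conv_op Q f x / of_real (C0 * b)) (a / (C0 * b))"
proof -
 define K where "K = inv_fourier Q"
 have K: "K \<in> schwartz" unfolding K_def by (rule schwartz_map_schwartz[OF schwartz_map_inv_fourier Q])
 obtain BK where "decay_bound 0 0 BK K" using schwartz_decay[OF K] by blast
 from decay_bound_norm[OF this] have BK: "norm (K x) \<le> BK" for x by simp
 have [measurable]: "K \<in> \<B>" "Q \<in> \<B>"
  by (intro smooth_borel schwartz_smooth K Q)+
 let ?c = "C0 * b"
 have c: "0 < ?c" using C0 b by simp
 have Kint: "integrable lborel (\<lambda>y. K (x - y) * f y)" if f: "bounded_support_fun f" for f x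
 proof (rule Bochner_Integration.integrable_bound)
  have [measurable]: "f \<in> \<B>" using f by (simp add: bounded_support_fun_def)
  show "integrable lborel (\<lambda>y. BK * norm (f y))"
   using bounded_support_fun_integrable[OF f] by simp
  show "AE y in lborel. norm (K (x - y) * f y) \<le> norm (BK * norm (f y))"
   using BK order_trans[OF norm_ge_zero BK] by (intro AE_I2) (auto simp: norm_mult abs_mult intro!: mult_right_mono)
  show "(\<lambda>y. K (x - y) * f y) \<in> borel_measurable lborel" by measurable
 qed
 have le: "ennreal (norm (conv_op Q f x)) \<le> (\<integral>\<^sub>+y. ennreal (norm (K (x - y))) * ennreal (norm (f y)))"
  if "bounded_support_fun f" for f x
  using integral_norm_bound_ennreal[OF Kint[OF that, of x]]
  unfolding conv_op_def K_def by (simp add: norm_mult ennreal_mult)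
 have meas: "conv_op Q f \<in> \<B>" if "bounded_support_fun f" for f
 proof -
  have [measurable]: "f \<in> \<B>" using that by (simp add: bounded_support_fun_def)
  show ?thesis unfolding conv_op_def[abs_def] K_def[symmetric] by measurable
 qed
 have scale: "ennreal (norm (z / of_real ?c)) = ennreal (1 / ?c) * ennreal (norm z)" for z :: complex
  using c C0 b(1) by (simp add: norm_divide norm_mult ennreal_mult[symmetric])
 show ?thesis
 proof
  show "0 < a / ?c" using a c by simp
  show "conv_op Q (\<lambda>x. f x + h x) x / of_real ?c = conv_op Q f x / of_real ?c + conv_op Q h x / of_real ?c"
   if "bounded_support_fun f" "bounded_support_fun h" for f h x
   using Kint[OF that(1)] Kint[OF that(2)]
   unfolding conv_op_def K_def[symmetric] by (simp add: distrib_left add_divide_distrib)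
  show "(\<lambda>x. conv_op Q f x / of_real ?c) \<in> \<B>" if f: "bounded_support_fun f" for f
  proof -
   note meas[OF f, measurable]
   show ?thesis by measurable
  qed
  show "(\<integral>\<^sub>+x. ennreal (norm (conv_op Q f x / of_real ?c))) \<le> ennreal (a / ?c) * (\<integral>\<^sub>+x. ennreal (norm (f x)))"
   if f: "bounded_support_fun f" for f
  proof -
   have [measurable]: "f \<in> \<B>" using f by (simp add: bounded_support_fun_def)
   note meas[OF f, measurable]
   have "(\<integral>\<^sub>+x. ennreal (norm (conv_op Q f x / of_real ?c))) = ennreal (1 / ?c) * (\<integral>\<^sub>+x. ennreal (norm (conv_op Q f x)))"
    unfolding scale by (rule nn_integral_cmult) measurable
   also have "(\<integral>\<^sub>+x. ennreal (norm (conv_op Q f x))) \<le>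
     (\<integral>\<^sub>+x. (\<integral>\<^sub>+y. ennreal (norm (K (x - y))) * ennreal (norm (f y))))"
    by (intro nn_integral_mono le f)
   also have "\<dots> = (\<integral>\<^sub>+y. (\<integral>\<^sub>+x. ennreal (norm (K (x - y))) * ennreal (norm (f y))))"
    by (rule lborel_pair.Fubini'[symmetric]) measurable
   also have "\<dots> = (\<integral>\<^sub>+y. (\<integral>\<^sub>+x. ennreal (norm (K x))) * ennreal (norm (f y)))"
   proof (intro nn_integral_cong)
    fix y
    have "(\<integral>\<^sub>+x. ennreal (norm (K (- y + x)))) = (\<integral>\<^sub>+x. ennreal (norm (K x)))"
     by (rule nn_integral_lborel_translate) measurable
    then show "(\<integral>\<^sub>+x. ennreal (norm (K (x - y))) * ennreal (norm (f y))) = (\<integral>\<^sub>+x. ennreal (norm (K x))) * ennreal (norm (f y))"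
     by (subst nn_integral_multc) auto
   qed
   also have "\<dots> = (\<integral>\<^sub>+x. ennreal (norm (K x))) * (\<integral>\<^sub>+x. ennreal (norm (f x)))"
    by (rule nn_integral_cmult) measurable
   also have "\<dots> \<le> ennreal a * (\<integral>\<^sub>+x. ennreal (norm (f x)))"
    using a(2) unfolding K_def by (rule mult_right_mono) simp
   also have "ennreal (1 / ?c) * (ennreal a * (\<integral>\<^sub>+x. ennreal (norm (f x)))) = ennreal (a / ?c) * (\<integral>\<^sub>+x. ennreal (norm (f x)))"
    using a c by (simp add: mult.assoc[symmetric] ennreal_mult[symmetric])
   finally show ?thesis by (simp add: mult_left_mono)
  qed
  show "(\<integral>\<^sub>+x. ennreal ((norm (conv_op Q f x / of_real ?c))\<^sup>2)) \<le> (\<integral>\<^sub>+x. ennreal ((norm (f x))\<^sup>2))"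
   if f: "bounded_support_fun f" for f
  proof -
   have [measurable]: "f \<in> \<B>" using f by (simp add: bounded_support_fun_def)
   note fi = bounded_support_fun_integrable[OF f]
   have [measurable]: "fourier f \<in> \<B>" by (rule fourier_measurable[OF fi])
   let ?h = "\<lambda>\<zeta>. Q \<zeta> * fourier f \<zeta>"
   have h: "integrable lborel ?h"
   proof (rule Bochner_Integration.integrable_bound)
    show "integrable lborel (\<lambda>\<zeta>. (\<integral>\<^sub>Lx. norm (f x)) * norm (Q \<zeta>))" using schwartz_integrable[OF Q] by simp
    have "norm (fourier f \<zeta>) * norm (Q \<zeta>) \<le> (\<integral>\<^sub>Lx. norm (f x)) * norm (Q \<zeta>)" for \<zeta>
     by (intro mult_right_mono norm_fourier_le) simp
    then show "AE \<zeta> in lborel. norm (?h \<zeta>) \<le> norm ((\<integral>\<^sub>Lx. norm (f x)) * norm (Q \<zeta>))"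
     by (intro AE_I2) (simp add: norm_mult abs_mult mult.commute)
    show "?h \<in> borel_measurable lborel" by measurable
   qed
   have [measurable]: "fourier ?h \<in> \<B>" by (rule fourier_measurable[OF h])
   have "(\<integral>\<^sub>+x. ennreal ((norm (conv_op Q f x / of_real ?c))\<^sup>2)) = (\<integral>\<^sub>+x. ennreal ((norm (fourier ?h (- x) / of_real ?c))\<^sup>2))"
    unfolding conv_op_eq_inv_fourier[OF schwartz_integrable[OF Q] fi] inv_fourier_eq ..
   also have "\<dots> = (\<integral>\<^sub>+x. ennreal ((norm (fourier ?h x / of_real ?c))\<^sup>2))"
    by (rule nn_integral_reflect[of "\<lambda>x. ennreal ((norm (fourier ?h x / of_real ?c))\<^sup>2)"]) measurable
   also have "\<dots> = (\<integral>\<^sub>+x. ennreal (1 / ?c\<^sup>2) * ennreal ((norm (fourier ?h x))\<^sup>2))"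
    by (simp add: norm_divide power_divide ennreal_mult[symmetric] norm_mult power_mult_distrib)
   also have "\<dots> = ennreal (1 / ?c\<^sup>2) * (\<integral>\<^sub>+x. ennreal ((norm (fourier ?h x))\<^sup>2))"
    by (rule nn_integral_cmult) measurable
   also have "\<dots> \<le> ennreal (1 / ?c\<^sup>2) * (ennreal C0 * (\<integral>\<^sub>+x. ennreal ((norm (?h x))\<^sup>2)))"
    by (intro mult_left_mono pl h) simp
   also have "\<dots> \<le> ennreal (1 / ?c\<^sup>2) * (ennreal C0 * (\<integral>\<^sub>+x. ennreal (b\<^sup>2) * ennreal ((norm (fourier f x))\<^sup>2)))"
   proof (intro mult_left_mono nn_integral_mono)
    fix x
    have "(norm (?h x))\<^sup>2 \<le> (b * norm (fourier f x))\<^sup>2"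
     unfolding norm_mult by (intro power_mono mult_right_mono b mult_nonneg_nonneg) auto
    then show "ennreal ((norm (?h x))\<^sup>2) \<le> ennreal (b\<^sup>2) * ennreal ((norm (fourier f x))\<^sup>2)"
     unfolding power_mult_distrib by (simp add: ennreal_mult[symmetric])
   qed auto
   also have "\<dots> = ennreal (1 / ?c\<^sup>2) * (ennreal C0 * (ennreal (b\<^sup>2) * (\<integral>\<^sub>+x. ennreal ((norm (fourier f x))\<^sup>2))))"
    by (subst nn_integral_cmult) auto
   also have "\<dots> \<le> ennreal (1 / ?c\<^sup>2) * (ennreal C0 * (ennreal (b\<^sup>2) * (ennreal C0 * (\<integral>\<^sub>+x. ennreal ((norm (f x))\<^sup>2)))))"
    by (intro mult_left_mono pl fi) auto
   also have "\<dots> = ennreal (1 / ?c\<^sup>2 * (C0 * (b\<^sup>2 * C0))) * (\<integral>\<^sub>+x. ennreal ((norm (f x))\<^sup>2))"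
   proof -
    have "ennreal (1 / ?c\<^sup>2 * (C0 * (b\<^sup>2 * C0))) = ennreal (1 / ?c\<^sup>2) * (ennreal C0 * (ennreal (b\<^sup>2) * ennreal C0))"
     using C0 by (subst ennreal_mult, simp, simp, subst ennreal_mult, simp, simp, subst ennreal_mult, simp_all)
    then show ?thesis by (simp only: mult_ac)
   qed
   also have "1 / ?c\<^sup>2 * (C0 * (b\<^sup>2 * C0)) = 1" using C0 b(1) by (simp add: power2_eq_square)
   finally show ?thesis by simp
  qed
  show "norm (conv_op Q f x / of_real ?c) \<le> a / ?c * s"
   if f: "bounded_support_fun f" and s: "\<And>x. norm (f x) \<le> s" for f s x
  proof -
   have s0: "0 \<le> s" by (rule order_trans[OF norm_ge_zero s])
   have "ennreal (norm (conv_op Q f x)) \<le> (\<integral>\<^sub>+y. ennreal (norm (K (x - y))) * ennreal s)"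
    by (rule order_trans[OF le[OF f]]) (intro nn_integral_mono mult_left_mono ennreal_leI s zero_le)
   also have "\<dots> = (\<integral>\<^sub>+y. ennreal (norm (K (x - y)))) * ennreal s"
    by (rule nn_integral_multc) measurable
   also have "(\<integral>\<^sub>+y. ennreal (norm (K (x - y)))) = (\<integral>\<^sub>+y. ennreal (norm (K y)))"
    using nn_integral_lborel_affine[of "\<lambda>y. ennreal (norm (K y))" "-1" x] by simp
   also have "\<dots> * ennreal s \<le> ennreal a * ennreal s" using a(2) unfolding K_def by (rule mult_right_mono) simp
   also have "\<dots> = ennreal (a * s)" using a(1) s0 by (simp add: ennreal_mult)
   finally have "norm (conv_op Q f x) \<le> a * s" using a(1) s0 by (simp add: ennreal_le_iff)
   then have "norm (conv_op Q f x) / ?c \<le> a * s / ?c" using c by (intro divide_right_mono) auto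
   then show ?thesis using c C0 b(1) by (simp add: norm_divide norm_mult)
  qed
 qed
qed

text \<open>The functions of interest are short-time Fourier transforms of distributions, which grow
  polynomially and may lie outside the test class. They are truncated to balls; rapid decay of the
  kernel makes the convolutions converge pointwise, and \<open>lp_norm_fatou\<close> passes the
  bound to the limit.\<close>

lemma lp_norm_conv_op:
 fixes Q :: "'d::finite cfun"
 assumes C0: "0 < C0" and pl: "\<And>f::'d cfun. integrable lborel f \<Longrightarrow>
  (\<integral>\<^sub>+\<xi>. ennreal ((norm (fourier f \<xi>))\<^sup>2)) \<le> ennreal C0 * (\<integral>\<^sub>+x. ennreal ((norm (f x))\<^sup>2))"
  and Q: "Q \<in> schwartz" and b: "0 < b" "\<And>\<zeta>. norm (Q \<zeta>) \<le> b"
  and a: "0 < a" "(\<integral>\<^sub>+y. ennreal (norm (inv_fourier Q y))) \<le> ennreal a"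
  and p: "1 \<le> p" and f: "f \<in> \<B>" "\<And>y. norm (f y) \<le> D * (1 + norm y) ^ N"
 shows "lp_norm p (\<lambda>x. ennreal (norm (conv_op Q f x))) \<le>
  ennreal (C0 * b * (interpolation_constant p * (a / (C0 * b)) powr \<bar>1 - 2 * enn2real (1 / p)\<bar>)) * lp_norm p (\<lambda>x. ennreal (norm (f x)))"
proof -
 interpret interpolation_operator "\<lambda>f x. conv_op Q f x / of_real (C0 * b)" "a / (C0 * b)"
  by (rule interpolation_operator_conv_op[OF C0 pl Q b a])
 let ?c = "C0 * b" and ?A = "interpolation_constant p * (a / (C0 * b)) powr \<bar>1 - 2 * enn2real (1 / p)\<bar>"
 have c: "0 < ?c" using C0 b by simp
 note f(1)[measurable]
 have K: "inv_fourier Q \<in> schwartz" by (rule schwartz_map_schwartz[OF schwartz_map_inv_fourier Q])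
 have [measurable]: "inv_fourier Q \<in> \<B>" by (intro smooth_borel schwartz_smooth K)
 define F where "F n y = (if norm y \<le> real n then f y else 0)" for n y
 have D0: "0 \<le> D" using order_trans[OF norm_ge_zero f(2)[of 0]] by simp
 have Fb: "bounded_support_fun (F n)" for n
  unfolding bounded_support_fun_def
 proof (intro conjI exI allI impI)
  show "F n \<in> \<B>" unfolding F_def by measurable
  show "norm (F n y) \<le> D * (1 + real n) ^ N" for y
  proof (cases "norm y \<le> real n")
   case True
   have "D * (1 + norm y) ^ N \<le> D * (1 + real n) ^ N" using True D0 by (intro mult_left_mono power_mono) auto
   then show ?thesis using f(2)[of y] True by (simp add: F_def)
  qed (use D0 in \<open>simp add: F_def\<close>)
  show "F n y = 0" if "real n < norm y" for y using that by (simp add: F_def)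
 qed
 have Fm [measurable]: "F n \<in> \<B>" for n using Fb by (simp add: bounded_support_fun_def)
 obtain BK where "decay_bound 0 (N + 2 * CARD('d)) BK (inv_fourier Q)" using schwartz_decay[OF K] by blast
 from decay_bound_norm[OF this] have BK: "norm (inv_fourier Q z) \<le> BK / (1 + norm z) ^ (N + 2 * CARD('d))" for z .
 have lim: "(\<lambda>n. conv_op Q (F n) x) \<longlonglongrightarrow> conv_op Q f x" for x
  unfolding conv_op_def
 proof (rule integral_dominated_convergence)
  \<comment> \<open>Peetre's inequality trades the growth of \<open>f\<close> in \<open>y\<close>
    for growth in the fixed \<open>x\<close> and \<open>N\<close> powers of the decay of the
    kernel.\<close>
  let ?w = "\<lambda>y::real ^ 'd. D * BK * (1 + norm x) ^ N * (1 / (1 + norm (x + (-1) *\<^sub>R y)) ^ (2 * CARD('d)))"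
  show "integrable lborel ?w"
   by (intro integrable_mult_right integrable_lborel_affine integrable_inverse_one_plus_norm) auto
  show "AE y in lborel. norm (inv_fourier Q (x - y) * F n y) \<le> ?w y" for n
  proof (rule AE_I2)
   fix y
   let ?z = "1 + norm (x - y)"
   have z: "0 < ?z" using norm_ge_zero[of "x - y"] by linarith
   have "norm (F n y) \<le> D * (1 + norm y) ^ N" using f(2)[of y] D0 by (simp add: F_def)
   also have "\<dots> \<le> D * ((1 + norm x) * ?z) ^ N"
    using one_plus_norm_shift[of y "- x"] D0 by (intro mult_left_mono power_mono) (auto simp: norm_minus_commute)
   finally have "norm (inv_fourier Q (x - y)) * norm (F n y) \<le> BK / ?z ^ (N + 2 * CARD('d)) * (D * ((1 + norm x) * ?z) ^ N)"
    by (intro mult_mono BK order_trans[OF norm_ge_zero BK]) auto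
   also have "\<dots> = ?w y"
   proof -
    have "BK / z ^ (N + k) * (D * (a * z) ^ N) = D * BK * a ^ N * (1 / z ^ k)" if "0 < z" for z a :: real and k
     using that by (simp add: power_add power_mult_distrib)
    from this[OF z] show ?thesis by simp
   qed
   finally show "norm (inv_fourier Q (x - y) * F n y) \<le> ?w y" by (simp add: norm_mult)
  qed
  show "AE y in lborel. (\<lambda>n. inv_fourier Q (x - y) * F n y) \<longlonglongrightarrow> inv_fourier Q (x - y) * f y"
  proof (intro AE_I2 tendsto_intros)
   fix y
   have "\<forall>\<^sub>F n in sequentially. F n y = f y"
    using eventually_ge_at_top[of "nat \<lceil>norm y\<rceil>"]
   proof eventually_elim
    case (elim n)
    then have "norm y \<le> real n" by linarith
    then show ?case by (simp add: F_def)
   qed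
   then show "(\<lambda>n. F n y) \<longlonglongrightarrow> f y" by (rule tendsto_eventually)
  qed
 qed measurable
 show ?thesis
 proof (rule lp_norm_fatou[OF _ _ tendsto_norm[OF lim] p])
  have cm [measurable]: "conv_op Q (F n) \<in> \<B>" for n
   unfolding conv_op_def[abs_def] by measurable
  show "(\<lambda>x. norm (conv_op Q (F n) x)) \<in> \<B>" for n by measurable
  show "lp_norm p (\<lambda>x. ennreal (norm (conv_op Q (F n) x))) \<le> ennreal (?c * ?A) * lp_norm p (\<lambda>x. ennreal (norm (f x)))" for n
  proof -
   have "lp_norm p (\<lambda>x. ennreal (norm (conv_op Q (F n) x))) = lp_norm p (\<lambda>x. ennreal ?c * ennreal (norm (conv_op Q (F n) x / of_real ?c)))"
    using c C0 b(1) by (intro arg_cong[where f = "lp_norm p"] ext) (simp add: norm_divide norm_mult ennreal_mult[symmetric])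
   also have "\<dots> \<le> ennreal ?c * lp_norm p (\<lambda>x. ennreal (norm (conv_op Q (F n) x / of_real ?c)))"
    by (rule lp_norm_cmult_le) (use p in measurable)
   also have "\<dots> \<le> ennreal ?c * (ennreal ?A * lp_norm p (\<lambda>x. ennreal (norm (F n x))))"
    by (intro mult_left_mono lp_norm_bound Fb p) simp
   also have "\<dots> \<le> ennreal ?c * (ennreal ?A * lp_norm p (\<lambda>x. ennreal (norm (f x))))"
    by (intro mult_left_mono lp_norm_mono p) (auto simp: F_def)
   also have "\<dots> = ennreal (?c * ?A) * lp_norm p (\<lambda>x. ennreal (norm (f x)))"
   proof -
    have "ennreal b' * (ennreal a' * L) = ennreal (b' * a') * L" if "0 \<le> b'" "0 \<le> a'" for a' b' :: real and L
     using that by (simp add: ennreal_mult mult.assoc)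
    then show ?thesis using c interpolation_constant_nonneg[of p] by simp
   qed
   finally show ?thesis .
  qed
 qed simp
qed

subsection \<open>Boundedness of Fourier multipliers on the Gabor transform\<close>

lemma ennreal_mult_mult: "0 \<le> a \<Longrightarrow> 0 \<le> b \<Longrightarrow> ennreal a * (ennreal b * c) = ennreal (a * b) * c"
 by (simp add: ennreal_mult mult.assoc)

lemma multiplier_op_add:
 assumes "smooth \<nu>" "\<And>k. \<exists>B. \<forall>\<zeta>. deriv_bound k \<nu> \<zeta> B" "\<phi> \<in> schwartz" "\<psi> \<in> schwartz"
 shows "multiplier_op \<nu> (\<lambda>x. \<phi> x + \<psi> x) = (\<lambda>x. multiplier_op \<nu> \<phi> x + multiplier_op \<nu> \<psi> x)"
proof -
 have F: "fourier (\<lambda>x. f x + h x) \<xi> = fourier f \<xi> + fourier h \<xi>" if "f \<in> schwartz" "h \<in> schwartz" for f h :: "'a cfun" and \<xi>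
  using integrable_expi_mult[OF schwartz_integrable[OF that(1)]] integrable_expi_mult[OF schwartz_integrable[OF that(2)]]
  unfolding fourier_eq by (simp add: distrib_left)
 have "(\<lambda>\<zeta>. \<nu> \<zeta> * fourier \<phi> \<zeta>) \<in> schwartz" "(\<lambda>\<zeta>. \<nu> \<zeta> * fourier \<psi> \<zeta>) \<in> schwartz"
  using schwartz_map_schwartz[OF schwartz_map_compose[OF multiplier_schwartz[OF assms(1,2)] schwartz_map_fourier]] assms(3,4) by auto
 from F[OF this] F[OF assms(3,4)] show ?thesis
  unfolding multiplier_op_def inv_fourier_eq by (simp add: distrib_left)
qed

lemma multiplier_op_cmult: "multiplier_op \<nu> (\<lambda>x. c * \<phi> x) = (\<lambda>x. c * multiplier_op \<nu> \<phi> x)"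
proof -
 have F: "fourier (\<lambda>x. c * f x) \<xi> = c * fourier f \<xi>" for f :: "'a cfun" and \<xi>
  unfolding fourier_eq by (simp add: mult.left_commute[of _ c])
 show ?thesis
  unfolding multiplier_op_def inv_fourier_eq F mult.left_commute[of _ c] ..
qed

lemma tempered_form_multiplier:
 assumes v: "tempered_form N C v" and \<nu>: "smooth \<nu>" "\<And>k. \<exists>B. \<forall>\<zeta>. deriv_bound k \<nu> \<zeta> B"
 shows "\<exists>N C. tempered_form N C (\<lambda>\<phi>. v (multiplier_op \<nu> \<phi>))"
proof -
 note L = multiplier_op_schwartz[OF \<nu>]
 obtain M D where D: "0 \<le> D" "\<And>\<phi> B. \<phi> \<in> schwartz \<Longrightarrow> decay_bound M M B \<phi> \<Longrightarrow> decay_bound N N (D * B) (multiplier_op \<nu> \<phi>)"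
  using schwartz_mapD[OF L] by metis
 have "tempered_form M (C * D) (\<lambda>\<phi>. v (multiplier_op \<nu> \<phi>))"
  unfolding tempered_form_def
 proof (intro conjI ballI allI impI)
  show "0 \<le> C * D" using D tempered_form_nonneg[OF v] by simp
 next
  fix \<phi> \<psi> :: "'a cfun" assume "\<phi> \<in> schwartz" "\<psi> \<in> schwartz"
  then show "v (multiplier_op \<nu> (\<lambda>x. \<phi> x + \<psi> x)) = v (multiplier_op \<nu> \<phi>) + v (multiplier_op \<nu> \<psi>)"
   by (simp add: multiplier_op_add[OF \<nu>] tempered_form_add[OF v] schwartz_map_schwartz[OF L])
 next
  fix c and \<phi> :: "'a cfun" assume "\<phi> \<in> schwartz"
  then show "v (multiplier_op \<nu> (\<lambda>x. c * \<phi> x)) = cnj c * v (multiplier_op \<nu> \<phi>)"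
   by (simp add: multiplier_op_cmult tempered_form_cmult[OF v] schwartz_map_schwartz[OF L])
 next
  fix \<phi> :: "'a cfun" and B assume "\<phi> \<in> schwartz" "decay_bound M M B \<phi>"
  then show "norm (v (multiplier_op \<nu> \<phi>)) \<le> C * D * B"
   using tempered_form_bound[OF v schwartz_map_schwartz[OF L] D(2)] by (simp add: mult.assoc)
 qed
 then show ?thesis by blast
qed

lemma tempered_form_sum_forms:
 assumes "finite I" "\<And>i. i \<in> I \<Longrightarrow> \<exists>N C. tempered_form N C (v i)"
 shows "\<exists>N C. tempered_form N C (\<lambda>\<phi>. \<Sum>i\<in>I. v i \<phi>)"
 using assms
proof (induction I rule: finite_induct)
 case empty
 have "tempered_form 0 0 (\<lambda>\<phi>::'b cfun. 0)" by (simp add: tempered_form_def)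
 then show ?case by auto
next
 case (insert i I)
 obtain N C N' C' where *: "tempered_form N C (v i)" "tempered_form N' C' (\<lambda>\<phi>. \<Sum>i\<in>I. v i \<phi>)"
  using insert.IH insert.prems by (metis insertCI)
 let ?M = "max N N'"
 have 1: "tempered_form ?M C (v i)" "tempered_form ?M C' (\<lambda>\<phi>. \<Sum>i\<in>I. v i \<phi>)"
  by (rule tempered_form_mono[OF *(1)], simp, simp) (rule tempered_form_mono[OF *(2)], simp, simp)
 have "tempered_form ?M (C + C') (\<lambda>\<phi>. v i \<phi> + (\<Sum>i\<in>I. v i \<phi>))"
  unfolding tempered_form_def
 proof (intro conjI ballI allI impI)
  show "0 \<le> C + C'" using 1[THEN tempered_form_nonneg] by simp
 next
  fix \<phi> :: "'b cfun" and B assume "\<phi> \<in> schwartz" "decay_bound ?M ?M B \<phi>"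
  then show "norm (v i \<phi> + (\<Sum>i\<in>I. v i \<phi>)) \<le> (C + C') * B"
   unfolding distrib_right by (intro norm_triangle_mono 1[THEN tempered_form_bound])
 qed (use 1 in \<open>auto simp: tempered_form_def distrib_left\<close>)
 then show ?case using insert.hyps by auto
qed

lemma norm_conv_op_le:
 assumes [measurable]: "inv_fourier Q \<in> \<B>" "f \<in> \<B>"
 shows "ennreal (norm (conv_op Q f x)) \<le> (\<integral>\<^sub>+y. ennreal (norm (inv_fourier Q (- y))) * ennreal (norm (f (x + y))))"
proof (cases "integrable lborel (\<lambda>y. inv_fourier Q (x - y) * f y)")
 case True
 have "ennreal (norm (conv_op Q f x)) \<le> (\<integral>\<^sub>+y. ennreal (norm (inv_fourier Q (x - y) * f y)))"
  unfolding conv_op_def by (rule integral_norm_bound_ennreal[OF True])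
 also have "\<dots> = (\<integral>\<^sub>+y. ennreal (norm (inv_fourier Q (x - (x + y)) * f (x + y))))"
  by (rule nn_integral_lborel_translate[symmetric]) measurable
 finally show ?thesis by (simp add: norm_mult ennreal_mult)
qed (simp add: conv_op_def not_integrable_integral_eq)

text \<open>Absolute values are taken inside both integrals and the crude kernel bound is inserted.
  The resulting domination by a convolution on phase space is symmetric in time and frequency up to
  the order of integration, so it serves modulation and amalgam norms alike.\<close>

lemma phase_space_bound:
 fixes g :: "'d::finite cfun"
 assumes g: "g \<in> schwartz" "g \<noteq> (\<lambda>x. 0)" and \<nu>: "smooth \<nu>" "\<And>k. \<exists>B. \<forall>\<zeta>. deriv_bound k \<nu> \<zeta> B"
 shows "\<exists>C\<ge>0. \<forall>N C' v x \<xi>. tempered_form N C' v \<longrightarrow>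
  ennreal (norm (v (multiplier_op \<nu> (time_freq_shift x \<xi> g)))) \<le> ennreal C * (\<integral>\<^sub>+\<eta>. (\<integral>\<^sub>+y. decay_weight K y *
   (decay_weight K \<eta> * ennreal (norm (v (time_freq_shift (x + y) (\<xi> + \<eta>) g))))))"
proof -
 from fourier_inversion[OF g] obtain c where c_inv: "c \<noteq> 0 \<and> (\<forall>f::'d cfun\<in>schwartz. \<forall>x. inv_fourier (fourier f) x = c * f x)" ..
 note c = conjunct1[OF c_inv] and inv = conjunct2[OF c_inv]
 define k where "k = c * of_real (\<integral>\<^sub>Ly. (norm (g y))\<^sup>2)"
 have k: "k \<noteq> 0" 
 proof -
  have "(\<integral>\<^sub>Ly. (norm (g y))\<^sup>2) \<noteq> 0" using schwartz_integral_norm_square_eq_0[OF g(1)] g(2) by blast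
  then show ?thesis using c by (simp add: k_def)
 qed
 obtain C where C: "0 \<le> C" "\<And>\<xi> \<eta> y. norm (inv_fourier (\<lambda>\<zeta>. cnj (multiplier_kernel g \<nu> \<xi> \<eta> \<zeta>)) y) \<le>
  C * (1 / (1 + norm y) ^ K * (1 / (1 + norm \<eta>) ^ K))"
  using inv_fourier_multiplier_kernel_bound[OF g(1) \<nu>, of K] by blast
 have "ennreal (norm (v (multiplier_op \<nu> (time_freq_shift x \<xi> g)))) \<le> ennreal (1 / norm k * C) * (\<integral>\<^sub>+\<eta>. (\<integral>\<^sub>+y. decay_weight K y *
   (decay_weight K \<eta> * ennreal (norm (v (time_freq_shift (x + y) (\<xi> + \<eta>) g))))))"
  (is "_ \<le> _ * (\<integral>\<^sub>+\<eta>. (\<integral>\<^sub>+y. ?F \<eta> y))")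
  if v: "tempered_form N C' v" for N C' v x \<xi>
 proof -
  let ?Q = "\<lambda>\<eta> \<zeta>. cnj (multiplier_kernel g \<nu> \<xi> \<eta> \<zeta>)"
  let ?W = "\<lambda>w. v (gabor_atom g w)"
  note tempered_gabor_measurable[OF v g(1), measurable]
  have Fm: "(\<lambda>z. ?F (fst z) (snd z)) \<in> borel_measurable (lborel \<Otimes>\<^sub>M lborel)"
  proof -
   have "(\<lambda>z. decay_weight K (snd z) * (decay_weight K (fst z) * ennreal (norm (?W (x + snd z, \<xi> + fst z))))) \<in> borel_measurable (lborel \<Otimes>\<^sub>M lborel)"
    by measurable
   then show ?thesis by simp
  qed
  have le: "ennreal (norm (conv_op (?Q \<eta>) (\<lambda>y. expi \<eta> y * v (time_freq_shift y (\<xi> + \<eta>) g)) x)) \<le> ennreal C * (\<integral>\<^sub>+y. ?F \<eta> y)" for \<eta>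
  proof -
   have "inv_fourier (?Q \<eta>) \<in> schwartz"
    by (intro schwartz_map_schwartz[OF schwartz_map_inv_fourier] schwartz_cnj multiplier_kernel_schwartz[OF g(1) \<nu>])
   then have Qm: "inv_fourier (?Q \<eta>) \<in> \<B>" by (intro smooth_borel schwartz_smooth)
   have "(\<lambda>y. expi \<eta> y * ?W (y, \<xi> + \<eta>)) \<in> \<B>" by measurable
   then have fm: "(\<lambda>y. expi \<eta> y * v (time_freq_shift y (\<xi> + \<eta>) g)) \<in> \<B>" by simp
   have "ennreal (norm (conv_op (?Q \<eta>) (\<lambda>y. expi \<eta> y * v (time_freq_shift y (\<xi> + \<eta>) g)) x)) \<le>
     (\<integral>\<^sub>+y. ennreal (norm (inv_fourier (?Q \<eta>) (- y))) * ennreal (norm (expi \<eta> (x + y) * v (time_freq_shift (x + y) (\<xi> + \<eta>) g))))"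
    by (rule norm_conv_op_le[OF Qm fm])
   also have "\<dots> \<le> (\<integral>\<^sub>+y. ennreal C * ?F \<eta> y)"
   proof (rule nn_integral_mono)
    fix y
    have "ennreal (norm (inv_fourier (?Q \<eta>) (- y))) \<le> ennreal (C * (1 / (1 + norm y) ^ K * (1 / (1 + norm \<eta>) ^ K)))"
     using C(2)[of \<xi> \<eta> "- y"] by (intro ennreal_leI) simp
    also have "\<dots> = ennreal C * (decay_weight K y * decay_weight K \<eta>)"
     using C(1) by (subst ennreal_mult, simp, simp, subst ennreal_mult, simp_all)
    finally show "ennreal (norm (inv_fourier (?Q \<eta>) (- y))) * ennreal (norm (expi \<eta> (x + y) * v (time_freq_shift (x + y) (\<xi> + \<eta>) g))) \<le> ennreal C * ?F \<eta> y"
     using mult_right_mono by (fastforce simp: norm_mult mult.assoc)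
   qed
   also have "\<dots> = ennreal C * (\<integral>\<^sub>+y. ?F \<eta> y)"
    using measurable_compose[OF measurable_Pair1' Fm, of \<eta>] by (intro nn_integral_cmult) simp
   finally show ?thesis .
  qed
  have "ennreal (norm (v (multiplier_op \<nu> (time_freq_shift x \<xi> g)))) \<le> ennreal (1 / norm k) *
   (\<integral>\<^sub>+\<eta>. ennreal (norm (conv_op (?Q \<eta>) (\<lambda>y. expi \<eta> y * v (time_freq_shift y (\<xi> + \<eta>) g)) x)))"
   by (rule tempered_multiplier_le[OF v g(1) inv[rule_format] k_def k \<nu>])
  also have "\<dots> \<le> ennreal (1 / norm k) * (\<integral>\<^sub>+\<eta>. ennreal C * (\<integral>\<^sub>+y. ?F \<eta> y))"
   by (intro mult_left_mono nn_integral_mono le) simp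
  also have "(\<integral>\<^sub>+\<eta>. ennreal C * (\<integral>\<^sub>+y. ?F \<eta> y)) = ennreal C * (\<integral>\<^sub>+\<eta>. (\<integral>\<^sub>+y. ?F \<eta> y))"
   using lborel.borel_measurable_nn_integral_fst[OF Fm] by (intro nn_integral_cmult) simp
  also have "ennreal (1 / norm k) * \<dots> = ennreal (1 / norm k * C) * (\<integral>\<^sub>+\<eta>. (\<integral>\<^sub>+y. ?F \<eta> y))"
   by (rule ennreal_mult_mult) (simp_all add: C(1))
  finally show ?thesis by (simp add: mult_left_mono)
 qed
 moreover have "0 \<le> 1 / norm k * C" using C(1) by simp
 ultimately show ?thesis by blast
qed

lemma decay_bound_cnj: "smooth f \<Longrightarrow> decay_bound k N B (\<lambda>x. cnj (f x)) \<longleftrightarrow> decay_bound k N B f"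
 by (simp add: decay_bound_def deriv_bound_cnj)

text \<open>The derivatives of order \<open>d\<close> of the multiplier grow like \<open>(1 + |t|)\<^bsup>d\<^esup>\<close>, so that the kernel has
 \<open>L\<^sup>1\<close> norm of order \<open>(1 + |t|)\<^bsup>d/2\<^esup>\<close>; interpolation with \<open>L\<^sup>2\<close> gives the exponent for general \<open>p\<close>.\<close>

lemma lp_norm_tempered_multiplier:
 fixes g :: "'d::finite cfun" and \<nu> :: "real \<Rightarrow> 'd cfun"
 assumes g: "g \<in> schwartz" "g \<noteq> (\<lambda>x. 0)" and p: "1 \<le> p"
  and \<nu>: "\<And>t. smooth (\<nu> t)" "\<And>k. \<exists>B\<ge>0. \<forall>t \<zeta>. deriv_bound k (\<nu> t) \<zeta> (B * (1 + \<bar>t\<bar>) ^ k)"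
 shows "\<exists>C\<ge>0. \<forall>t N C' v \<xi>. tempered_form N C' v \<longrightarrow>
  lp_norm p (\<lambda>x. ennreal (norm (v (multiplier_op (\<nu> t) (time_freq_shift x \<xi> g))))) \<le>
   ennreal (C * (1 + \<bar>t\<bar>) powr (real CARD('d) * \<bar>1 / 2 - enn2real (1 / p)\<bar>)) *
   (\<integral>\<^sub>+\<eta>. decay_weight K \<eta> * lp_norm p (\<lambda>x. ennreal (norm (v (time_freq_shift x (\<xi> + \<eta>) g)))))"
proof -
 let ?d = "CARD('d)"
 define \<theta> where "\<theta> = \<bar>1 - 2 * enn2real (1 / p)\<bar>"
 from fourier_inversion[OF g] obtain c where c_inv: "c \<noteq> 0 \<and> (\<forall>f::'d cfun\<in>schwartz. \<forall>x. inv_fourier (fourier f) x = c * f x)" ..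
 note c = conjunct1[OF c_inv] and inv = conjunct2[OF c_inv]
 define k where "k = c * of_real (\<integral>\<^sub>Ly. (norm (g y))\<^sup>2)"
 have k: "k \<noteq> 0" 
 proof -
  have "(\<integral>\<^sub>Ly. (norm (g y))\<^sup>2) \<noteq> 0" using schwartz_integral_norm_square_eq_0[OF g(1)] g(2) by blast
  then show ?thesis using c by (simp add: k_def)
 qed
 from plancherel_inequality[OF g] obtain P where P': "0 \<le> P \<and> (\<forall>f::'d cfun. integrable lborel f \<longrightarrow>
  (\<integral>\<^sub>+\<xi>. ennreal ((norm (fourier f \<xi>))\<^sup>2)) \<le> ennreal P * (\<integral>\<^sub>+x. ennreal ((norm (f x))\<^sup>2)))" ..
 note P = conjunct1[OF P'] conjunct2[OF P']
 \<comment> \<open>The \<open>+ 1\<close> makes the constant positive, since the normalisation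
   divides by it.\<close>
 define C0 where "C0 = P + 1"
 have C0: "0 < C0" using P(1) by (simp add: C0_def)
 have pl: "(\<integral>\<^sub>+\<xi>. ennreal ((norm (fourier f \<xi>))\<^sup>2)) \<le> ennreal C0 * (\<integral>\<^sub>+x. ennreal ((norm (f x))\<^sup>2))"
  if "integrable lborel f" for f :: "'d cfun"
  by (rule order_trans[OF P(2)[rule_format, OF that]]) (intro mult_right_mono ennreal_leI, simp_all add: C0_def)
 from inv_fourier_L1_bound[OF less_imp_le[OF C0] pl] obtain C1 where C1': "0 < C1 \<and> (\<forall>Q::'d cfun\<in>schwartz. \<forall>b>0. \<forall>R\<ge>1. decay_bound 0 ?d b Q \<longrightarrow> decay_bound ?d ?d (b * R ^ ?d) Q \<longrightarrow>
   (\<integral>\<^sub>+y. ennreal (norm (inv_fourier Q y))) \<le> ennreal (C1 * sqrt (R ^ ?d) * b))" ..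
 note C1 = conjunct1[OF C1'] conjunct2[OF C1']
 obtain B0 where B0: "0 \<le> B0" "\<And>t \<zeta>. deriv_bound 0 (\<nu> t) \<zeta> B0" using \<nu>(2)[of 0] by auto
 obtain Bd where Bd: "0 \<le> Bd" "\<And>t \<zeta>. deriv_bound ?d (\<nu> t) \<zeta> (Bd * (1 + \<bar>t\<bar>) ^ ?d)" using \<nu>(2)[of ?d] by auto
 from multiplier_kernel_bound[OF g(1), of 0 ?d K] obtain K0 where K0': "0 \<le> K0 \<and> (\<forall>\<nu> B. smooth \<nu> \<longrightarrow> (\<forall>\<zeta>. deriv_bound 0 \<nu> \<zeta> B) \<longrightarrow>
  (\<forall>\<xi> \<eta>. decay_bound 0 ?d (K0 * B / (1 + norm \<eta>) ^ K) (multiplier_kernel g \<nu> \<xi> \<eta>)))" ..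
 note K0 = conjunct1[OF K0'] conjunct2[OF K0']
 from multiplier_kernel_bound[OF g(1), of ?d ?d K] obtain Kd where Kd': "0 \<le> Kd \<and> (\<forall>\<nu> B. smooth \<nu> \<longrightarrow> (\<forall>\<zeta>. deriv_bound ?d \<nu> \<zeta> B) \<longrightarrow>
  (\<forall>\<xi> \<eta>. decay_bound ?d ?d (Kd * B / (1 + norm \<eta>) ^ K) (multiplier_kernel g \<nu> \<xi> \<eta>)))" ..
 note Kd = conjunct1[OF Kd'] conjunct2[OF Kd']
 \<comment> \<open>One number for the bounds of order 0 and of order \<open>?d\<close>, and at least
   1 so that it can be divided by.\<close>
 define b0 where "b0 = 1 + K0 * B0 + Kd * Bd"
 have b0: "1 \<le> b0" "K0 * B0 \<le> b0" "Kd * Bd \<le> b0" unfolding b0_def using K0(1) B0(1) Kd(1) Bd(1) by simp_all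
 define A where "A = C0 * b0 * (interpolation_constant p * (C1 / C0) powr \<theta>)"
 have A: "0 \<le> A" unfolding A_def using C0 b0(1) interpolation_constant_nonneg[of p] by simp
 have "lp_norm p (\<lambda>x. ennreal (norm (v (multiplier_op (\<nu> t) (time_freq_shift x \<xi> g))))) \<le>
   ennreal (1 / norm k * A * (1 + \<bar>t\<bar>) powr (real ?d * \<bar>1 / 2 - enn2real (1 / p)\<bar>)) *
   (\<integral>\<^sub>+\<eta>. decay_weight K \<eta> * lp_norm p (\<lambda>x. ennreal (norm (v (time_freq_shift x (\<xi> + \<eta>) g)))))"
  if v: "tempered_form N C' v" for t N C' v \<xi>
 proof -
  define R where "R = 1 + \<bar>t\<bar>"
  let ?V = "\<lambda>\<eta>. decay_weight K \<eta> * lp_norm p (\<lambda>x. ennreal (norm (v (time_freq_shift x (\<xi> + \<eta>) g))))"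
   and ?U = "\<lambda>x. v (multiplier_op (\<nu> t) (time_freq_shift x \<xi> g))"
  have R: "1 \<le> R" by (simp add: R_def)
  let ?S = "R powr (real ?d * \<bar>1 / 2 - enn2real (1 / p)\<bar>)"
  let ?Q = "\<lambda>\<eta> \<zeta>. cnj (multiplier_kernel g (\<nu> t) \<xi> \<eta> \<zeta>)"
  let ?f = "\<lambda>\<eta> y. expi \<eta> y * v (time_freq_shift y (\<xi> + \<eta>) g)"
  let ?W = "\<lambda>w. v (gabor_atom g w)"
  have \<nu>t: "smooth (\<nu> t)" "\<And>k. \<exists>B. \<forall>\<zeta>. deriv_bound k (\<nu> t) \<zeta> B" using \<nu>(1) \<nu>(2) by blast+
  note tempered_gabor_measurable[OF v g(1), measurable]
  have [measurable]: "\<nu> t \<in> \<B>" "fourier g \<in> \<B>"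
   by (intro smooth_borel \<nu>t(1)) (intro fourier_measurable schwartz_integrable g(1))
  have Sm: "0 \<le> ?S" by simp
  have term_le: "lp_norm p (\<lambda>x. ennreal (norm (conv_op (?Q \<eta>) (?f \<eta>) x))) \<le>
   ennreal (A * ?S) * ?V \<eta>" for \<eta>
  proof -
   let ?e = "1 / (1 + norm \<eta>) ^ K"
   have e: "0 < ?e" by (simp add: add_pos_nonneg)
   let ?b = "b0 * ?e"
   have b: "0 < ?b" using b0(1) e by (intro mult_pos_pos) auto
   have ks: "multiplier_kernel g (\<nu> t) \<xi> \<eta> \<in> schwartz" by (rule multiplier_kernel_schwartz[OF g(1) \<nu>t])
   have Qs: "?Q \<eta> \<in> schwartz" by (rule schwartz_cnj[OF ks])
   have d0: "decay_bound 0 ?d ?b (?Q \<eta>)"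
    unfolding decay_bound_cnj[OF schwartz_smooth[OF ks]]
   proof (rule decay_bound_mono[OF K0(2)[rule_format, OF \<nu>t(1) B0(2)]])
    show "K0 * B0 / (1 + norm \<eta>) ^ K \<le> ?b" using mult_right_mono[OF b0(2), of ?e] e by simp
   qed simp_all
   have dd: "decay_bound ?d ?d (?b * R ^ ?d) (?Q \<eta>)"
    unfolding decay_bound_cnj[OF schwartz_smooth[OF ks]]
   proof (rule decay_bound_mono[OF Kd(2)[rule_format, OF \<nu>t(1) Bd(2)]])
    have "Kd * Bd * (?e * R ^ ?d) \<le> b0 * (?e * R ^ ?d)"
     using b0(3) e R by (intro mult_right_mono) auto
    then show "Kd * (Bd * (1 + \<bar>t\<bar>) ^ ?d) / (1 + norm \<eta>) ^ K \<le> ?b * R ^ ?d"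
     unfolding R_def by (simp add: mult_ac)
   qed simp_all
   have Qb: "norm (?Q \<eta> \<zeta>) \<le> ?b" for \<zeta>
   proof -
    have "norm (?Q \<eta> \<zeta>) \<le> ?b / (1 + norm \<zeta>) ^ ?d" by (rule decay_bound_norm[OF d0])
    also have "\<dots> \<le> ?b / 1" using b by (intro divide_left_mono one_le_power) auto
    finally show ?thesis by simp
   qed
   let ?a = "C1 * sqrt (R ^ ?d) * ?b"
   have a: "0 < ?a" by (rule mult_pos_pos[OF _ b]) (use C1(1) R in simp)
   obtain D where D: "0 \<le> D" "\<And>w. norm (?W w) \<le> D * (1 + norm w) ^ (2 * N)"
    using tempered_gabor_growth[OF v g(1)] by blast
   have "(\<lambda>y. expi \<eta> y * ?W (y, \<xi> + \<eta>)) \<in> \<B>" by measurable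
   then have fm: "?f \<eta> \<in> \<B>" by simp
   have fb: "norm (?f \<eta> y) \<le> D * (1 + norm (\<xi> + \<eta>)) ^ (2 * N) * (1 + norm y) ^ (2 * N)" for y
   proof -
    have "norm (y, \<xi> + \<eta>) \<le> norm y + norm (\<xi> + \<eta>)" by (rule norm_Pair_le)
    moreover have "0 \<le> norm (\<xi> + \<eta>) * norm y" by simp
    moreover have "(1 + norm (\<xi> + \<eta>)) * (1 + norm y) = 1 + norm y + norm (\<xi> + \<eta>) + norm (\<xi> + \<eta>) * norm y" by (simp add: algebra_simps)
    ultimately have "1 + norm (y, \<xi> + \<eta>) \<le> (1 + norm (\<xi> + \<eta>)) * (1 + norm y)" by linarith
    then have "(1 + norm (y, \<xi> + \<eta>)) ^ (2 * N) \<le> ((1 + norm (\<xi> + \<eta>)) * (1 + norm y)) ^ (2 * N)"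
     by (intro power_mono) auto
    then have "D * (1 + norm (y, \<xi> + \<eta>)) ^ (2 * N) \<le> D * ((1 + norm (\<xi> + \<eta>)) * (1 + norm y)) ^ (2 * N)"
     using D(1) by (rule mult_left_mono)
    with D(2)[of "(y, \<xi> + \<eta>)"] show ?thesis by (simp add: norm_mult power_mult_distrib mult.assoc)
   qed
   have "lp_norm p (\<lambda>x. ennreal (norm (conv_op (?Q \<eta>) (?f \<eta>) x))) \<le>
    ennreal (C0 * ?b * (interpolation_constant p * (?a / (C0 * ?b)) powr \<bar>1 - 2 * enn2real (1 / p)\<bar>)) * lp_norm p (\<lambda>x. ennreal (norm (?f \<eta> x)))"
    by (rule lp_norm_conv_op[OF C0 pl Qs b Qb a C1(2)[rule_format, OF Qs b R d0 dd] p fm fb])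
   also have "C0 * ?b * (interpolation_constant p * (?a / (C0 * ?b)) powr \<bar>1 - 2 * enn2real (1 / p)\<bar>) = A * ?S * ?e"
   proof -
    \<comment> \<open>\<open>?b\<close> cancels in the quotient of the \<open>L^1\<close> and
      \<open>L^2\<close> bounds, so the power \<open>\<theta>\<close> falls only on
      \<open>C1 / C0\<close> and \<open>sqrt (R ^ ?d)\<close>; the decay in \<open>\<eta>\<close>
      survives in the prefactor.\<close>
    have "?a / (C0 * ?b) = (C1 / C0) * sqrt (R ^ ?d)" using b b0(1) by auto
    then have "(?a / (C0 * ?b)) powr \<theta> = (C1 / C0) powr \<theta> * sqrt (R ^ ?d) powr \<theta>"
     using C1(1) C0 R by (simp only: powr_mult divide_nonneg_nonneg less_imp_le real_sqrt_ge_zero zero_le_power order_trans[OF zero_le_one])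
    also have "sqrt (R ^ ?d) powr \<theta> = ?S"
    proof -
     have "sqrt (R ^ ?d) = R powr (real ?d * (1 / 2))"
      using R by (simp add: powr_half_sqrt[symmetric] powr_realpow[symmetric] powr_powr)
     moreover have "real ?d * (1 / 2) * \<theta> = real ?d * \<bar>1 / 2 - enn2real (1 / p)\<bar>"
      unfolding \<theta>_def by (simp add: abs_if)
     ultimately show ?thesis by (simp only: powr_powr)
    qed
    finally have 1: "(?a / (C0 * ?b)) powr \<theta> = (C1 / C0) powr \<theta> * ?S" .
    show ?thesis unfolding \<theta>_def[symmetric] 1 A_def by (simp only: mult_ac)
   qed
   also have "ennreal (A * ?S * ?e) = ennreal (A * ?S) * ennreal ?e" using A by (intro ennreal_mult) auto
   finally show ?thesis by (simp add: norm_mult mult.assoc)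
  qed
  \<comment> \<open>Joint measurability in position and \<open>\<eta>\<close>, read off from the
    iterated integral that defines the convolution.\<close>
  have conv_m: "(\<lambda>z. ennreal (norm (conv_op (?Q (snd z)) (?f (snd z)) (fst z)))) \<in> borel_measurable (lborel \<Otimes>\<^sub>M lborel)"
  proof -
   have "(\<lambda>z. \<integral>\<^sub>Ly. (\<integral>\<^sub>L\<zeta>. expi (fst z - y) \<zeta> * cnj (\<nu> t (\<zeta> + \<xi>) * (fourier g \<zeta> * cnj (fourier g (\<zeta> + - snd z))))) *
     (expi (snd z) y * ?W (y, \<xi> + snd z))) \<in> borel_measurable (lborel \<Otimes>\<^sub>M lborel)"
    by measurable
   moreover have "inv_fourier f x = (\<integral>\<^sub>L\<zeta>. expi x \<zeta> * f \<zeta>)" for f and x :: "real ^ 'd"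
    by (simp add: inv_fourier_eq fourier_eq)
   ultimately show ?thesis unfolding conv_op_def multiplier_kernel_def by simp
  qed
  have Nm: "(\<lambda>\<eta>. ennreal (A * ?S) * ?V \<eta>) \<in> \<B>"
   and Nm': "(\<lambda>\<eta>. ?V \<eta>) \<in> \<B>"
  proof -
   have "continuous_on UNIV (\<lambda>w. norm (?W w))" by (intro continuous_on_norm continuous_on_tempered_gabor[OF v g(1)])
   from lp_norm_measurable_parameter[OF this, of p]
   have [measurable]: "(\<lambda>\<xi>. lp_norm p (\<lambda>x. ennreal (norm (v (time_freq_shift x \<xi> g))))) \<in> \<B>" by simp
   show "(\<lambda>\<eta>. ennreal (A * ?S) * ?V \<eta>) \<in> \<B>"
    "(\<lambda>\<eta>. ?V \<eta>) \<in> \<B>"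
    by measurable
  qed
  let ?I = "\<lambda>x. \<integral>\<^sub>+\<eta>. ennreal (norm (conv_op (?Q \<eta>) (?f \<eta>) x))"
  have Im: "?I \<in> \<B>"
   using lborel.borel_measurable_nn_integral_fst[OF conv_m] by simp
  obtain N2 C2 where v2: "tempered_form N2 C2 (\<lambda>\<phi>. v (multiplier_op (\<nu> t) \<phi>))"
   using tempered_form_multiplier[OF v \<nu>t] by blast
  have "continuous_on UNIV (\<lambda>x. v (multiplier_op (\<nu> t) (gabor_atom g (x, \<xi>))))"
   by (rule continuous_on_compose2[OF continuous_on_tempered_gabor[OF v2 g(1)]]) (auto intro!: continuous_intros)
  then have vm: "(\<lambda>x. ?U x) \<in> \<B>"
   by (simp add: borel_measurable_continuous_onI)
  have "lp_norm p (\<lambda>x. ennreal (norm (?U x))) \<le> lp_norm p (\<lambda>x. ennreal (1 / norm k) * ?I x)"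
  proof (rule lp_norm_mono[OF _ _ p])
   show "(\<lambda>x. ennreal (norm (?U x))) \<in> \<B>"
    using vm by measurable
   show "(\<lambda>x. ennreal (1 / norm k) * ?I x) \<in> \<B>" using Im by measurable
   show "ennreal (norm (?U x)) \<le> ennreal (1 / norm k) * ?I x" for x
    by (rule tempered_multiplier_le[OF v g(1) inv[rule_format] k_def k \<nu>t])
  qed
  also have "\<dots> \<le> ennreal (1 / norm k) * lp_norm p ?I" by (rule lp_norm_cmult_le[OF Im p])
  also have "lp_norm p ?I \<le> (\<integral>\<^sub>+\<eta>. ennreal (A * ?S) * ?V \<eta>)"
   using minkowski_integral[OF sigma_finite_lborel conv_m _ p, simplified, OF Nm term_le] .
  also have "\<dots> = ennreal (A * ?S) * (\<integral>\<^sub>+\<eta>. ?V \<eta>)"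
   using Nm' by (intro nn_integral_cmult) simp
  also have "ennreal (1 / norm k) * \<dots> = ennreal (1 / norm k * A * ?S) * (\<integral>\<^sub>+\<eta>. ?V \<eta>)"
   (is "_ * (_ * ?L) = _")
   unfolding mult.assoc[of "1 / norm k"] by (rule ennreal_mult_mult) (simp_all add: A)
  finally show ?thesis unfolding R_def by (simp add: mult_left_mono)
 qed
 moreover have "0 \<le> 1 / norm k * A" using A by simp
 ultimately show ?thesis by blast
qed

subsection \<open>Mixed norm estimates\<close>

lemma continuous_on_mult_bracket:
 fixes W :: "'a::euclidean_space \<times> 'a \<Rightarrow> real"
 assumes "continuous_on UNIV W"
 shows "continuous_on UNIV (\<lambda>z. W z * japanese_bracket (fst z) powr r)"
proof -
 have "japanese_bracket z \<noteq> 0" for z :: 'a using japanese_bracket_ge_1[of z] by linarith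
 then show ?thesis by (intro continuous_intros assms) auto
qed

text \<open>The only form in which the operator enters the weighted estimates; from here on these
  concern continuous functions on phase space.\<close>

abbreviation phase_space_dominated :: "nat \<Rightarrow> real \<Rightarrow> ('a::euclidean_space \<times> 'a \<Rightarrow> real) \<Rightarrow> ('a \<times> 'a \<Rightarrow> real) \<Rightarrow> bool" where
 "phase_space_dominated K C S W \<equiv> \<forall>x \<xi>. ennreal (S (x, \<xi>)) \<le> ennreal C * (\<integral>\<^sub>+\<eta>. (\<integral>\<^sub>+y. decay_weight K y * (decay_weight K \<eta> * ennreal (W (x + y, \<xi> + \<eta>)))))"

abbreviation mixed_norm :: "ennreal \<Rightarrow> ennreal \<Rightarrow> real \<Rightarrow> real \<Rightarrow> ('a::euclidean_space \<times> 'a \<Rightarrow> real) \<Rightarrow> ennreal" where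
 "mixed_norm p q r s W \<equiv> lp_norm q (\<lambda>\<xi>. lp_norm p (\<lambda>x. ennreal (W (x, \<xi>) * japanese_bracket x powr r)) * ennreal (japanese_bracket \<xi> powr s))"

text \<open>The convolution in \<open>x\<close> is absorbed by
  \<open>lp_norm_convolution_weight\<close>, while the integral in \<open>\<eta>\<close> is kept,
  since the outer norm has to see it as a convolution in frequency. \<open>D\<close> is chosen
  before \<open>p\<close>, the functions and \<open>C\<close>.\<close>

lemma lp_norm_phase_space_bound:
 assumes K: "2 * real DIM('a) + \<bar>r\<bar> \<le> real K"
 shows "\<exists>D\<ge>0. \<forall>p S W C \<xi>. 1 \<le> p \<longrightarrow> continuous_on UNIV S \<longrightarrow> continuous_on UNIV (W :: 'a::euclidean_space \<times> 'a \<Rightarrow> real) \<longrightarrow> 0 \<le> C \<longrightarrow>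
  phase_space_dominated K C S W \<longrightarrow>
  lp_norm p (\<lambda>x. ennreal (S (x, \<xi>) * japanese_bracket x powr r)) \<le>
   ennreal (D * C) * (\<integral>\<^sub>+\<eta>. decay_weight K \<eta> * lp_norm p (\<lambda>x. ennreal (W (x, \<xi> + \<eta>) * japanese_bracket x powr r)))"
proof -
 let ?w = "\<lambda>x::'a. ennreal (japanese_bracket x powr r)" and ?k = "\<lambda>y::'a. decay_weight K y"
 from lp_norm_convolution_weight[OF K] obtain D where D': "0 \<le> D \<and> (\<forall>p B. 1 \<le> p \<longrightarrow> (B :: 'a \<Rightarrow> ennreal) \<in> \<B> \<longrightarrow>
  lp_norm p (\<lambda>x. (\<integral>\<^sub>+y. ?k y * B (x + y)) * ?w x) \<le> ennreal D * lp_norm p (\<lambda>x. B x * ?w x))" ..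
 note D = conjunct1[OF D'] conjunct2[OF D', rule_format]
 have "lp_norm p (\<lambda>x. ennreal (S (x, \<xi>) * japanese_bracket x powr r)) \<le>
   ennreal (D * C) * (\<integral>\<^sub>+\<eta>. ?k \<eta> * lp_norm p (\<lambda>x. ennreal (W (x, \<xi> + \<eta>) * japanese_bracket x powr r)))"
  if p: "1 \<le> p" and S: "continuous_on UNIV S" and W: "continuous_on UNIV W" and C: "0 \<le> C"
   and le: "\<And>x \<xi>. ennreal (S (x, \<xi>)) \<le> ennreal C * (\<integral>\<^sub>+\<eta>. (\<integral>\<^sub>+y. ?k y * (?k \<eta> * ennreal (W (x + y, \<xi> + \<eta>)))))"
  for p and S W :: "'a \<times> 'a \<Rightarrow> real" and C \<xi>
 proof -
  have [measurable]: "S \<in> \<B>" "W \<in> \<B>"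
   using S W by (auto intro: borel_measurable_continuous_onI)
  define N where "N = (\<lambda>\<xi>. lp_norm p (\<lambda>x. ennreal (W (x, \<xi>) * japanese_bracket x powr r)))"
  have [measurable]: "N \<in> \<B>"
   using lp_norm_measurable_parameter[OF continuous_on_mult_bracket[OF W, of r], of p] unfolding N_def by simp
  define B where "B x \<eta> = ?k \<eta> * ((\<integral>\<^sub>+y. ?k y * ennreal (W (x + y, \<xi> + \<eta>))) * ?w x)" for x \<eta>
  have Bm: "(\<lambda>z. B (fst z) (snd z)) \<in> borel_measurable (lborel \<Otimes>\<^sub>M lborel)" unfolding B_def by measurable
  have pt: "ennreal (S (x, \<xi>) * japanese_bracket x powr r) \<le> ennreal C * (\<integral>\<^sub>+\<eta>. B x \<eta>)" for x
  proof -
   have "ennreal (S (x, \<xi>) * japanese_bracket x powr r) = ennreal (S (x, \<xi>)) * ?w x" by (simp add: ennreal_mult'')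
   also have "\<dots> \<le> ennreal C * (\<integral>\<^sub>+\<eta>. (\<integral>\<^sub>+y. ?k y * (?k \<eta> * ennreal (W (x + y, \<xi> + \<eta>))))) * ?w x"
    by (intro mult_right_mono le) simp
   also have "(\<integral>\<^sub>+\<eta>. (\<integral>\<^sub>+y. ?k y * (?k \<eta> * ennreal (W (x + y, \<xi> + \<eta>))))) =
     (\<integral>\<^sub>+\<eta>. ?k \<eta> * (\<integral>\<^sub>+y. ?k y * ennreal (W (x + y, \<xi> + \<eta>))))"
    by (intro nn_integral_cong, subst nn_integral_cmult[symmetric]) (auto simp: mult.left_commute)
   also have "ennreal C * \<dots> * ?w x = ennreal C * (\<integral>\<^sub>+\<eta>. B x \<eta>)"
    unfolding B_def mult.assoc by (subst nn_integral_multc[symmetric]) (simp_all add: mult.assoc)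
   finally show ?thesis .
  qed
  have "lp_norm p (\<lambda>x. ennreal (S (x, \<xi>) * japanese_bracket x powr r)) \<le> lp_norm p (\<lambda>x. ennreal C * (\<integral>\<^sub>+\<eta>. B x \<eta>))"
  proof (rule lp_norm_mono[OF _ _ p pt])
   show "(\<lambda>x. ennreal C * (\<integral>\<^sub>+\<eta>. B x \<eta>)) \<in> \<B>" unfolding B_def by measurable
  qed measurable
  also have "\<dots> \<le> ennreal C * lp_norm p (\<lambda>x. \<integral>\<^sub>+\<eta>. B x \<eta>)"
   by (rule lp_norm_cmult_le[OF _ p]) (unfold B_def, measurable)
  also have "lp_norm p (\<lambda>x. \<integral>\<^sub>+\<eta>. B x \<eta>) \<le> (\<integral>\<^sub>+\<eta>. ennreal D * (?k \<eta> * N (\<xi> + \<eta>)))"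
  proof -
   have "lp_norm p (\<lambda>x. B x \<eta>) \<le> ennreal D * (?k \<eta> * N (\<xi> + \<eta>))" for \<eta>
   proof -
    have "lp_norm p (\<lambda>x. B x \<eta>) \<le> ?k \<eta> * lp_norm p (\<lambda>x. (\<integral>\<^sub>+y. ?k y * ennreal (W (x + y, \<xi> + \<eta>))) * ?w x)"
     unfolding B_def by (rule lp_norm_cmult_le[OF _ p]) measurable
    also have "\<dots> \<le> ?k \<eta> * (ennreal D * lp_norm p (\<lambda>x. ennreal (W (x, \<xi> + \<eta>)) * ?w x))"
     by (intro mult_left_mono D(2)[OF p, of "\<lambda>x. ennreal (W (x, \<xi> + \<eta>))"]) simp_all
    finally show ?thesis by (simp add: N_def ennreal_mult'' mult.left_commute)
   qed
   then show ?thesis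
    using minkowski_integral[OF sigma_finite_lborel Bm _ p, of "\<lambda>\<eta>. ennreal D * (?k \<eta> * N (\<xi> + \<eta>))"] by simp
  qed
  also have "\<dots> = ennreal D * (\<integral>\<^sub>+\<eta>. ?k \<eta> * N (\<xi> + \<eta>))" by (rule nn_integral_cmult) measurable
  also have "ennreal C * \<dots> = ennreal (D * C) * (\<integral>\<^sub>+\<eta>. ?k \<eta> * N (\<xi> + \<eta>))"
   unfolding ennreal_mult_mult[OF C D(1)] by (simp only: mult.commute)
  finally show ?thesis unfolding N_def by (simp add: mult_left_mono)
 qed
 with D(1) show ?thesis by blast
qed

text \<open>Stated for arbitrary \<open>M\<close> and \<open>N\<close>, so that it finishes both the
  weighted case and the case \<open>r = 0\<close>, where the inner bound comes from
  interpolation.\<close>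

lemma lp_norm_outer_bound:
 assumes K: "2 * real DIM('a) + \<bar>s\<bar> \<le> real K"
 shows "\<exists>D\<ge>0. \<forall>q M N C. 1 \<le> q \<longrightarrow> M \<in> \<B> \<longrightarrow> (N :: 'a::euclidean_space \<Rightarrow> ennreal) \<in> \<B> \<longrightarrow> 0 \<le> C \<longrightarrow>
  (\<forall>\<xi>. M \<xi> \<le> ennreal C * (\<integral>\<^sub>+\<eta>. decay_weight K \<eta> * N (\<xi> + \<eta>))) \<longrightarrow>
  lp_norm q (\<lambda>\<xi>. M \<xi> * ennreal (japanese_bracket \<xi> powr s)) \<le> ennreal (D * C) * lp_norm q (\<lambda>\<xi>. N \<xi> * ennreal (japanese_bracket \<xi> powr s))"
proof -
 let ?w = "\<lambda>x::'a. ennreal (japanese_bracket x powr s)" and ?k = "\<lambda>y::'a. decay_weight K y"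
 from lp_norm_convolution_weight[OF K] obtain D where D': "0 \<le> D \<and> (\<forall>p B. 1 \<le> p \<longrightarrow> (B :: 'a \<Rightarrow> ennreal) \<in> \<B> \<longrightarrow>
  lp_norm p (\<lambda>x. (\<integral>\<^sub>+y. ?k y * B (x + y)) * ?w x) \<le> ennreal D * lp_norm p (\<lambda>x. B x * ?w x))" ..
 note D = conjunct1[OF D'] conjunct2[OF D', rule_format]
 have "lp_norm q (\<lambda>\<xi>. M \<xi> * ?w \<xi>) \<le> ennreal (D * C) * lp_norm q (\<lambda>\<xi>. N \<xi> * ?w \<xi>)"
  if q: "1 \<le> q" and [measurable]: "M \<in> \<B>" "N \<in> \<B>" and C: "0 \<le> C"
   and le: "\<And>\<xi>. M \<xi> \<le> ennreal C * (\<integral>\<^sub>+\<eta>. ?k \<eta> * N (\<xi> + \<eta>))" for q C and M N :: "'a \<Rightarrow> ennreal"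
 proof -
  have "lp_norm q (\<lambda>\<xi>. M \<xi> * ?w \<xi>) \<le> lp_norm q (\<lambda>\<xi>. ennreal C * ((\<integral>\<^sub>+\<eta>. ?k \<eta> * N (\<xi> + \<eta>)) * ?w \<xi>))"
  proof (rule lp_norm_mono[OF _ _ q])
   show "M \<xi> * ?w \<xi> \<le> ennreal C * ((\<integral>\<^sub>+\<eta>. ?k \<eta> * N (\<xi> + \<eta>)) * ?w \<xi>)" for \<xi>
    unfolding mult.assoc[symmetric] by (intro mult_right_mono le) simp
  qed measurable
  also have "\<dots> \<le> ennreal C * lp_norm q (\<lambda>\<xi>. (\<integral>\<^sub>+\<eta>. ?k \<eta> * N (\<xi> + \<eta>)) * ?w \<xi>)"
   by (rule lp_norm_cmult_le[OF _ q]) measurable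
  also have "\<dots> \<le> ennreal C * (ennreal D * lp_norm q (\<lambda>\<xi>. N \<xi> * ?w \<xi>))"
   by (intro mult_left_mono D(2) q) simp_all
  also have "\<dots> = ennreal (D * C) * lp_norm q (\<lambda>\<xi>. N \<xi> * ?w \<xi>)"
   unfolding ennreal_mult_mult[OF C D(1)] by (simp only: mult.commute)
  finally show ?thesis .
 qed
 with D(1) show ?thesis by blast
qed

lemma mixed_norm_bound:
 fixes r s :: real
 shows "\<exists>K D. 0 \<le> D \<and> (\<forall>p q S W C. 1 \<le> p \<longrightarrow> 1 \<le> q \<longrightarrow> continuous_on UNIV S \<longrightarrow> continuous_on UNIV (W :: 'a::euclidean_space \<times> 'a \<Rightarrow> real) \<longrightarrow> 0 \<le> C \<longrightarrow>
  phase_space_dominated K C S W \<longrightarrow>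
  mixed_norm p q r s S \<le>
   ennreal (D * C) * mixed_norm p q r s W)"
proof -
 \<comment> \<open>Large enough for both weights. \<open>K\<close> is fixed before the kernel bounds
   of that order are requested, hence the order of quantifiers in the statement.\<close>
 define K where "K = nat \<lceil>2 * real DIM('a) + \<bar>r\<bar> + \<bar>s\<bar>\<rceil>"
 have K: "2 * real DIM('a) + \<bar>r\<bar> \<le> real K" "2 * real DIM('a) + \<bar>s\<bar> \<le> real K" unfolding K_def by linarith+
 let ?N = "\<lambda>p W \<xi>. lp_norm p (\<lambda>x::'a. ennreal (W (x, \<xi>::'a) * japanese_bracket x powr r))"
 from lp_norm_phase_space_bound[OF K(1)] obtain D1 where D1: "0 \<le> D1 \<and> (\<forall>p S W C \<xi>. 1 \<le> p \<longrightarrow> continuous_on UNIV S \<longrightarrow> continuous_on UNIV W \<longrightarrow> 0 \<le> C \<longrightarrow>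
  phase_space_dominated K C S W \<longrightarrow> ?N p S \<xi> \<le> ennreal (D1 * C) * (\<integral>\<^sub>+\<eta>. decay_weight K \<eta> * ?N p W (\<xi> + \<eta>)))" ..
 from lp_norm_outer_bound[OF K(2)] obtain D2 where D2: "0 \<le> D2 \<and> (\<forall>q M N C. 1 \<le> q \<longrightarrow> M \<in> \<B> \<longrightarrow> (N :: 'a \<Rightarrow> ennreal) \<in> \<B> \<longrightarrow> 0 \<le> C \<longrightarrow>
  (\<forall>\<xi>. M \<xi> \<le> ennreal C * (\<integral>\<^sub>+\<eta>. decay_weight K \<eta> * N (\<xi> + \<eta>))) \<longrightarrow>
  lp_norm q (\<lambda>\<xi>. M \<xi> * ennreal (japanese_bracket \<xi> powr s)) \<le> ennreal (D2 * C) * lp_norm q (\<lambda>\<xi>. N \<xi> * ennreal (japanese_bracket \<xi> powr s)))" ..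
 have "lp_norm q (\<lambda>\<xi>. ?N p S \<xi> * ennreal (japanese_bracket \<xi> powr s)) \<le>
   ennreal (D2 * D1 * C) * lp_norm q (\<lambda>\<xi>. ?N p W \<xi> * ennreal (japanese_bracket \<xi> powr s))"
  if p: "1 \<le> p" "1 \<le> q" and S: "continuous_on UNIV S" "continuous_on UNIV W" and C: "0 \<le> C" and le: "phase_space_dominated K C S W" for p q S W C
 proof -
  note m = lp_norm_measurable_parameter[OF continuous_on_mult_bracket, where r1 = r, simplified]
  have "0 \<le> D1 * C" using D1 C by simp
  moreover have "\<forall>\<xi>. ?N p S \<xi> \<le> ennreal (D1 * C) * (\<integral>\<^sub>+\<eta>. decay_weight K \<eta> * ?N p W (\<xi> + \<eta>))"
   using conjunct2[OF D1, rule_format, OF p(1) S C] le by blast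
  ultimately show ?thesis
   using conjunct2[OF D2, rule_format, OF p(2) m[OF S(1)] m[OF S(2)], of "D1 * C"] by (simp only: mult.assoc simp_thms)
 qed
 moreover have "0 \<le> D2 * D1" using D1 D2 by simp
 ultimately show ?thesis by blast
qed

subsection \<open>The Dirac evolution\<close>

text \<open>Conjugated because the pairing is conjugate-linear: a symbol entry acts on a
  distribution by multiplying the test functions by its conjugate.\<close>

definition dirac_multiplier :: "('d::finite option \<Rightarrow> complex ^ 'n ^ 'n::finite) \<Rightarrow> real \<Rightarrow> 'n \<Rightarrow> 'n \<Rightarrow> real \<Rightarrow> 'd cfun" where
 "dirac_multiplier \<alpha> m k l t \<xi> = cnj (dirac_symbol \<alpha> m t \<xi> $ k $ l)"

lemma dirac_multiplier_smooth:
 assumes \<alpha>: "dirac_matrices \<alpha>"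
 shows "smooth (dirac_multiplier \<alpha> m k l t)"
  and "\<exists>B\<ge>0. \<forall>t \<zeta>. deriv_bound K (dirac_multiplier \<alpha> m k l t) \<zeta> (B * (1 + \<bar>t\<bar>) ^ K)"
  and "\<exists>B. \<forall>\<zeta>. deriv_bound K (dirac_multiplier \<alpha> m k l t) \<zeta> B"
proof -
 show "smooth (dirac_multiplier \<alpha> m k l t)"
  unfolding dirac_multiplier_def[abs_def] by (intro smooth_cnj dirac_symbol_deriv_bound[OF \<alpha>])
 show *: "\<exists>B\<ge>0. \<forall>t \<zeta>. deriv_bound K (dirac_multiplier \<alpha> m k l t) \<zeta> (B * (1 + \<bar>t\<bar>) ^ K)"
  using dirac_symbol_deriv_bound(2)[OF \<alpha>, of K m k l]
  unfolding dirac_multiplier_def[abs_def] by (simp add: deriv_bound_cnj dirac_symbol_deriv_bound(1)[OF \<alpha>])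
 show "\<exists>B. \<forall>\<zeta>. deriv_bound K (dirac_multiplier \<alpha> m k l t) \<zeta> B" using * by blast
qed

lemma dirac_solution_component:
 "dirac_solution \<alpha> m u t \<phi> $ k = (\<Sum>l\<in>UNIV. u (multiplier_op (dirac_multiplier \<alpha> m k l t) \<phi>) $ l)"
 by (simp add: dirac_solution_def fourier_multiplier_def dist_inv_fourier_def dist_mult_def dist_fourier_def
   multiplier_op_def dirac_multiplier_def)

lemma temperate_dirac_solution:
 assumes \<alpha>: "dirac_matrices \<alpha>" and u: "u \<in> temperate"
 shows "dirac_solution \<alpha> m u t \<in> temperate"
proof (rule temperateI)
 fix k
 obtain N C where "\<And>l. tempered_form N C (\<lambda>\<phi>. u \<phi> $ l)" using temperate_components[OF u] by blast
 then have "\<exists>N C. tempered_form N C (\<lambda>\<phi>. u (multiplier_op (dirac_multiplier \<alpha> m k l t) \<phi>) $ l)" for l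
  by (rule tempered_form_multiplier) (rule dirac_multiplier_smooth[OF \<alpha>])+
 then show "\<exists>N C. tempered_form N C (\<lambda>\<phi>. dirac_solution \<alpha> m u t \<phi> $ k)"
  unfolding dirac_solution_component by (intro tempered_form_sum_forms) auto
qed

lemma norm_stft_dirac_solution_le:
 "ennreal (norm (stft g (dirac_solution \<alpha> m u t) x \<xi>)) \<le>
  (\<Sum>k\<in>UNIV. \<Sum>l\<in>UNIV. ennreal (norm (u (multiplier_op (dirac_multiplier \<alpha> m k l t) (time_freq_shift x \<xi> g)) $ l)))"
proof -
 have "norm (stft g (dirac_solution \<alpha> m u t) x \<xi>) \<le> (\<Sum>k\<in>UNIV. norm (stft g (dirac_solution \<alpha> m u t) x \<xi> $ k))"
  unfolding norm_vec_def by (rule L2_set_le_sum) simp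
 also have "\<dots> \<le> (\<Sum>k\<in>UNIV. \<Sum>l\<in>UNIV. norm (u (multiplier_op (dirac_multiplier \<alpha> m k l t) (time_freq_shift x \<xi> g)) $ l))"
  unfolding stft_def dirac_solution_component by (intro sum_mono norm_sum)
 finally show ?thesis by (simp add: sum_nonneg sum_ennreal ennreal_leI)
qed

lemma continuous_on_stft:
 assumes u: "u \<in> temperate" and g: "g \<in> schwartz"
 shows "continuous_on UNIV (\<lambda>z. norm (stft g u (fst z) (snd z)))"
proof -
 obtain N C where "\<And>l. tempered_form N C (\<lambda>\<phi>. u \<phi> $ l)" using temperate_components[OF u] by blast
 then have "continuous_on UNIV (\<lambda>z. \<chi> l. u (gabor_atom g z) $ l)"
  by (intro continuous_on_vec_lambda continuous_on_tempered_gabor[OF _ g])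
 then show ?thesis unfolding stft_def by (intro continuous_on_norm) simp
qed

lemma norm_component_le_stft: "norm (u (time_freq_shift x \<xi> g) $ l) \<le> norm (stft g u x \<xi>)"
 unfolding stft_def by (rule Finite_Cartesian_Product.norm_nth_le)

text \<open>Matrix entries are estimated one by one. Each component of \<open>u\<close> is dominated
  by the full vector norm, so the sum of the constants of the entries serves for the vector.\<close>

lemma dirac_phase_space_bound:
 fixes g :: "'d::finite cfun" and \<alpha> :: "'d option \<Rightarrow> complex ^ 'n ^ 'n::finite"
 assumes \<alpha>: "dirac_matrices \<alpha>" and g: "g \<in> schwartz" "g \<noteq> (\<lambda>x. 0)"
 shows "\<exists>C\<ge>0. \<forall>u\<in>temperate. \<forall>x \<xi>. ennreal (norm (stft g (dirac_solution \<alpha> m u t) x \<xi>)) \<le>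
  ennreal C * (\<integral>\<^sub>+\<eta>. (\<integral>\<^sub>+y. decay_weight K y * (decay_weight K \<eta> * ennreal (norm (stft g u (x + y) (\<xi> + \<eta>))))))"
proof -
 let ?Y = "\<lambda>V x \<xi>. \<integral>\<^sub>+\<eta>. (\<integral>\<^sub>+y. decay_weight K y * (decay_weight K \<eta> * ennreal (norm (V (x + y) (\<xi> + \<eta>)))))"
 \<comment> \<open>A name for the property, so that constants for all pairs \<open>k\<close>,
   \<open>l\<close> can be chosen simultaneously.\<close>
 define Pr where "Pr k l C \<longleftrightarrow> 0 \<le> C \<and> (\<forall>N C' v x \<xi>. tempered_form N C' v \<longrightarrow>
  ennreal (norm (v (multiplier_op (dirac_multiplier \<alpha> m k l t) (time_freq_shift x \<xi> g)))) \<le> ennreal C * ?Y (\<lambda>x \<xi>. v (time_freq_shift x \<xi> g)) x \<xi>)" for k l C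
 have "\<exists>C. Pr k l C" for k l
  unfolding Pr_def by (rule phase_space_bound[OF g]) (rule dirac_multiplier_smooth[OF \<alpha>])+
 then obtain c where c: "\<And>k l. Pr k l (c k l)" by metis
 have "ennreal (norm (stft g (dirac_solution \<alpha> m u t) x \<xi>)) \<le> ennreal (\<Sum>k\<in>UNIV. \<Sum>l\<in>UNIV. c k l) * ?Y (stft g u) x \<xi>"
  if u: "u \<in> temperate" for u x \<xi>
 proof -
  obtain N C where NC: "\<And>l. tempered_form N C (\<lambda>\<phi>. u \<phi> $ l)" using temperate_components[OF u] by blast
  have "ennreal (norm (u (multiplier_op (dirac_multiplier \<alpha> m k l t) (time_freq_shift x \<xi> g)) $ l)) \<le> ennreal (c k l) * ?Y (stft g u) x \<xi>" for k l
  proof -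
   have "ennreal (norm (u (multiplier_op (dirac_multiplier \<alpha> m k l t) (time_freq_shift x \<xi> g)) $ l)) \<le> ennreal (c k l) * ?Y (\<lambda>x \<xi>. u (time_freq_shift x \<xi> g) $ l) x \<xi>"
    using c[of k l] NC[of l] unfolding Pr_def by blast
   also have "\<dots> \<le> ennreal (c k l) * ?Y (stft g u) x \<xi>"
    by (intro mult_left_mono nn_integral_mono ennreal_leI norm_component_le_stft) auto
   finally show ?thesis .
  qed
  then have "ennreal (norm (stft g (dirac_solution \<alpha> m u t) x \<xi>)) \<le> (\<Sum>k\<in>UNIV. \<Sum>l\<in>UNIV. ennreal (c k l) * ?Y (stft g u) x \<xi>)"
   by (intro order_trans[OF norm_stft_dirac_solution_le] sum_mono)
  also have "\<dots> = ennreal (\<Sum>k\<in>UNIV. \<Sum>l\<in>UNIV. c k l) * ?Y (stft g u) x \<xi>"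
   using c unfolding Pr_def by (simp add: sum_distrib_right[symmetric] sum_ennreal sum_nonneg)
  finally show ?thesis .
 qed
 moreover have "0 \<le> (\<Sum>k\<in>UNIV. \<Sum>l\<in>UNIV. c k l)" using c unfolding Pr_def by (simp add: sum_nonneg)
 ultimately show ?thesis by blast
qed

text \<open>Entrywise again, now in \<open>L^p\<close> at fixed frequency, where the sum over
  entries passes through the triangle inequality and the constants of the entries share the same
  power of \<open>1 + \<bar>t\<bar>\<close>.\<close>

lemma dirac_lp_norm_bound:
 fixes g :: "'d::finite cfun" and \<alpha> :: "'d option \<Rightarrow> complex ^ 'n ^ 'n::finite"
 assumes \<alpha>: "dirac_matrices \<alpha>" and g: "g \<in> schwartz" "g \<noteq> (\<lambda>x. 0)" and p: "1 \<le> p"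
 shows "\<exists>C\<ge>0. \<forall>t. \<forall>u\<in>temperate. \<forall>\<xi>. lp_norm p (\<lambda>x. ennreal (norm (stft g (dirac_solution \<alpha> m u t) x \<xi>))) \<le>
  ennreal (C * (1 + \<bar>t\<bar>) powr (real CARD('d) * \<bar>1 / 2 - enn2real (1 / p)\<bar>)) *
   (\<integral>\<^sub>+\<eta>. decay_weight K \<eta> * lp_norm p (\<lambda>x. ennreal (norm (stft g u x (\<xi> + \<eta>)))))"
proof -
 let ?S = "\<lambda>t. (1 + \<bar>t\<bar>) powr (real CARD('d) * \<bar>1 / 2 - enn2real (1 / p)\<bar>)"
 let ?Y = "\<lambda>V \<xi>. \<integral>\<^sub>+\<eta>. decay_weight K \<eta> * lp_norm p (\<lambda>x. ennreal (norm (V x (\<xi> + \<eta>))))"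
 define Pr where "Pr k l C \<longleftrightarrow> 0 \<le> C \<and> (\<forall>t N C' v \<xi>. tempered_form N C' v \<longrightarrow>
  lp_norm p (\<lambda>x. ennreal (norm (v (multiplier_op (dirac_multiplier \<alpha> m k l t) (time_freq_shift x \<xi> g))))) \<le>
  ennreal (C * ?S t) * ?Y (\<lambda>x \<xi>. v (time_freq_shift x \<xi> g)) \<xi>)" for k l C
 have "\<exists>C. Pr k l C" for k l
  unfolding Pr_def by (rule lp_norm_tempered_multiplier[OF g p]) (rule dirac_multiplier_smooth[OF \<alpha>])+
 then obtain c where c: "\<And>k l. Pr k l (c k l)" by metis
 then have c0: "0 \<le> c k l" for k l unfolding Pr_def by blast
 have "lp_norm p (\<lambda>x. ennreal (norm (stft g (dirac_solution \<alpha> m u t) x \<xi>))) \<le> ennreal ((\<Sum>k\<in>UNIV. \<Sum>l\<in>UNIV. c k l) * ?S t) * ?Y (stft g u) \<xi>"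
  if u: "u \<in> temperate" for t u \<xi>
 proof -
  obtain N C where NC: "\<And>l. tempered_form N C (\<lambda>\<phi>. u \<phi> $ l)" using temperate_components[OF u] by blast
  have sec: "(\<lambda>x. h (x, \<xi>')) \<in> \<B>" if "continuous_on UNIV h"
   for h :: "(real ^ 'd) \<times> (real ^ 'd) \<Rightarrow> 'z::topological_space" and \<xi>'
   by (intro borel_measurable_continuous_onI continuous_on_compose2[OF that]) (auto intro!: continuous_intros)
  let ?X = "\<lambda>k l x. ennreal (norm (u (multiplier_op (dirac_multiplier \<alpha> m k l t) (time_freq_shift x \<xi> g)) $ l))"
  have Xm [measurable]: "?X k l \<in> \<B>" for k l
  proof -
   obtain N' C' where "tempered_form N' C' (\<lambda>\<phi>. u (multiplier_op (dirac_multiplier \<alpha> m k l t) \<phi>) $ l)"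
    using tempered_form_multiplier[OF NC[of l] dirac_multiplier_smooth(1,3)[OF \<alpha>]] by blast
   from sec[OF continuous_on_tempered_gabor[OF this g(1)], of \<xi>]
   have "(\<lambda>x. u (multiplier_op (dirac_multiplier \<alpha> m k l t) (time_freq_shift x \<xi> g)) $ l) \<in> \<B>" by simp
   then show ?thesis by measurable
  qed
  have um: "(\<lambda>x. ennreal (norm (u (time_freq_shift x \<xi>' g) $ l))) \<in> \<B>" for l \<xi>'
  proof -
   have "(\<lambda>x. u (time_freq_shift x \<xi>' g) $ l) \<in> \<B>"
    using sec[OF continuous_on_tempered_gabor[OF NC g(1)], of \<xi>' l] by simp
   then show ?thesis by measurable
  qed
  have Sm: "(\<lambda>x. ennreal (norm (stft g u' x \<xi>'))) \<in> \<B>" if "u' \<in> temperate" for u' :: "('d, 'n) vdist" and \<xi>'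
  proof -
   have "(\<lambda>x. norm (stft g u' x \<xi>')) \<in> \<B>"
    using sec[OF continuous_on_stft[OF that g(1)], of \<xi>'] by simp
   then show ?thesis by measurable
  qed
  have X: "lp_norm p (?X k l) \<le> ennreal (c k l * ?S t) * ?Y (stft g u) \<xi>" for k l
  proof -
   have "lp_norm p (?X k l) \<le> ennreal (c k l * ?S t) * ?Y (\<lambda>x \<xi>. u (time_freq_shift x \<xi> g) $ l) \<xi>"
    using c[of k l] NC[of l] unfolding Pr_def by blast
   also have "\<dots> \<le> ennreal (c k l * ?S t) * ?Y (stft g u) \<xi>"
    by (intro mult_left_mono nn_integral_mono lp_norm_mono[OF um Sm[OF u] p] ennreal_leI norm_component_le_stft) auto
   finally show ?thesis .
  qed
  have "lp_norm p (\<lambda>x. ennreal (norm (stft g (dirac_solution \<alpha> m u t) x \<xi>))) \<le> lp_norm p (\<lambda>x. \<Sum>k\<in>UNIV. \<Sum>l\<in>UNIV. ?X k l x)"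
   by (rule lp_norm_mono[OF Sm[OF temperate_dirac_solution[OF \<alpha> u]] _ p norm_stft_dirac_solution_le]) measurable
  also have "\<dots> \<le> (\<Sum>k\<in>UNIV. lp_norm p (\<lambda>x. \<Sum>l\<in>UNIV. ?X k l x))"
   by (rule lp_norm_sum_le[OF _ p]) measurable
  also have "\<dots> \<le> (\<Sum>k\<in>UNIV. \<Sum>l\<in>UNIV. lp_norm p (?X k l))"
   by (intro sum_mono lp_norm_sum_le[OF Xm p])
  also have "\<dots> \<le> (\<Sum>k\<in>UNIV. \<Sum>l\<in>UNIV. ennreal (c k l * ?S t) * ?Y (stft g u) \<xi>)"
   by (intro sum_mono X)
  also have "\<dots> = ennreal (\<Sum>k\<in>UNIV. \<Sum>l\<in>UNIV. c k l * ?S t) * ?Y (stft g u) \<xi>"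
   using c0 by (simp add: sum_distrib_right[symmetric] sum_ennreal sum_nonneg del: sum_distrib_right)
  also have "(\<Sum>k\<in>UNIV. \<Sum>l\<in>UNIV. c k l * ?S t) = (\<Sum>k\<in>UNIV. \<Sum>l\<in>UNIV. c k l) * ?S t"
   by (simp only: sum_distrib_right)
  finally show ?thesis .
 qed
 moreover have "0 \<le> (\<Sum>k\<in>UNIV. \<Sum>l\<in>UNIV. c k l)" using c0 by (simp add: sum_nonneg)
 ultimately show ?thesis by blast
qed

text \<open>Fubini brings the domination into the shape required when time and frequency exchange
  their roles.\<close>

lemma swap_phase_space_integral:
 fixes W :: "'a::euclidean_space \<times> 'a \<Rightarrow> real"
 assumes "continuous_on UNIV W"
 shows "(\<integral>\<^sub>+\<eta>. (\<integral>\<^sub>+y. decay_weight K y * (decay_weight K \<eta> * ennreal (W (x + y, \<xi> + \<eta>))))) =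
  (\<integral>\<^sub>+y. (\<integral>\<^sub>+\<eta>. decay_weight K \<eta> * (decay_weight K y * ennreal (W (x + y, \<xi> + \<eta>)))))"
proof -
 have [measurable]: "W \<in> \<B>" by (rule borel_measurable_continuous_onI[OF assms])
 have "(\<integral>\<^sub>+\<eta>. (\<integral>\<^sub>+y. decay_weight K y * (decay_weight K \<eta> * ennreal (W (x + y, \<xi> + \<eta>))))) =
  (\<integral>\<^sub>+y. (\<integral>\<^sub>+\<eta>. decay_weight K y * (decay_weight K \<eta> * ennreal (W (x + y, \<xi> + \<eta>)))))"
  by (rule lborel_pair.Fubini') measurable
 also have "\<dots> = (\<integral>\<^sub>+y. (\<integral>\<^sub>+\<eta>. decay_weight K \<eta> * (decay_weight K y * ennreal (W (x + y, \<xi> + \<eta>)))))"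
  by (intro nn_integral_cong mult.left_commute)
 finally show ?thesis .
qed

text \<open>The amalgam norm is the mixed norm of the same transform with its two variables
  exchanged, so both parts are instances of \<open>mixed_norm_bound\<close>. The constant is
  enlarged by 1 to be positive.\<close>

lemma dirac_modulation_bound:
 fixes g :: "'d::finite cfun" and \<alpha> :: "'d option \<Rightarrow> complex ^ 'n ^ 'n::finite"
 assumes \<alpha>: "dirac_matrices \<alpha>" and g: "g \<in> schwartz" "g \<noteq> (\<lambda>x. 0)" and p: "1 \<le> p" "1 \<le> q"
 shows "\<exists>C>0. \<forall>u\<in>temperate. modulation_norm g p q r s (dirac_solution \<alpha> m u t) \<le> ennreal C * modulation_norm g p q r s u"
  and "\<exists>C>0. \<forall>u\<in>temperate. amalgam_norm g p q r s (dirac_solution \<alpha> m u t) \<le> ennreal C * amalgam_norm g p q r s u"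
proof -
 from mixed_norm_bound[where 'a = "real ^ 'd", of r s] obtain K where "\<exists>D. 0 \<le> D \<and> (\<forall>p q S W C. 1 \<le> p \<longrightarrow> 1 \<le> q \<longrightarrow> continuous_on UNIV S \<longrightarrow> continuous_on UNIV (W :: (real ^ 'd) \<times> (real ^ 'd) \<Rightarrow> real) \<longrightarrow> 0 \<le> C \<longrightarrow>
  phase_space_dominated K C S W \<longrightarrow>
  mixed_norm p q r s S \<le>
   ennreal (D * C) * mixed_norm p q r s W)" ..
 then obtain D where D: "0 \<le> D \<and> (\<forall>p q S W C. 1 \<le> p \<longrightarrow> 1 \<le> q \<longrightarrow> continuous_on UNIV S \<longrightarrow> continuous_on UNIV (W :: (real ^ 'd) \<times> (real ^ 'd) \<Rightarrow> real) \<longrightarrow> 0 \<le> C \<longrightarrow>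
  phase_space_dominated K C S W \<longrightarrow>
  mixed_norm p q r s S \<le>
   ennreal (D * C) * mixed_norm p q r s W)" ..
 note D1 = conjunct2[OF D, rule_format, OF p]
 from dirac_phase_space_bound[OF \<alpha> g, of m t K] obtain C where C: "0 \<le> C \<and> (\<forall>u\<in>temperate. \<forall>x \<xi>. ennreal (norm (stft g (dirac_solution \<alpha> m u t) x \<xi>)) \<le>
  ennreal C * (\<integral>\<^sub>+\<eta>. (\<integral>\<^sub>+y. decay_weight K y * (decay_weight K \<eta> * ennreal (norm (stft g u (x + y) (\<xi> + \<eta>)))))))" ..
 have le: "ennreal (D * C) * z \<le> ennreal (D * C + 1) * z" for z by (intro mult_right_mono ennreal_leI) auto
 have pos: "0 < D * C + 1" using D C by (simp add: add_nonneg_pos)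
 have cont: "continuous_on UNIV (\<lambda>z. norm (stft g u (fst z) (snd z)))" "continuous_on UNIV (\<lambda>z. norm (stft g u (snd z) (fst z)))"
  if "u \<in> temperate" for u :: "('d, 'n) vdist"
 proof -
  show "continuous_on UNIV (\<lambda>z. norm (stft g u (fst z) (snd z)))" by (rule continuous_on_stft[OF that g(1)])
  have "continuous_on UNIV (\<lambda>z::(real ^ 'd) \<times> (real ^ 'd). (snd z, fst z))" by (intro continuous_intros)
  from continuous_on_compose2[OF continuous_on_stft[OF that g(1)] this]
  show "continuous_on UNIV (\<lambda>z. norm (stft g u (snd z) (fst z)))" by simp
 qed
 have "modulation_norm g p q r s (dirac_solution \<alpha> m u t) \<le> ennreal (D * C + 1) * modulation_norm g p q r s u" if u: "u \<in> temperate" for u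
  using order_trans[OF D1[OF cont(1)[OF temperate_dirac_solution[OF \<alpha> u]] cont(1)[OF u] conjunct1[OF C]] le] conjunct2[OF C] u
  unfolding modulation_norm_def by simp
 with pos show "\<exists>C>0. \<forall>u\<in>temperate. modulation_norm g p q r s (dirac_solution \<alpha> m u t) \<le> ennreal C * modulation_norm g p q r s u" by blast
 have "amalgam_norm g p q r s (dirac_solution \<alpha> m u t) \<le> ennreal (D * C + 1) * amalgam_norm g p q r s u" if u: "u \<in> temperate" for u
 proof -
  have "ennreal (norm (stft g (dirac_solution \<alpha> m u t) x \<xi>)) \<le>
   ennreal C * (\<integral>\<^sub>+y. (\<integral>\<^sub>+\<eta>. decay_weight K \<eta> * (decay_weight K y * ennreal (norm (stft g u (x + y) (\<xi> + \<eta>))))))" for x \<xi>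
   by (rule order_trans[OF conjunct2[OF C, rule_format, OF u, of x \<xi>]])
    (unfold swap_phase_space_integral[OF cont(1)[OF u], of K x \<xi>, unfolded fst_conv snd_conv], rule order_refl)
  then show ?thesis
   using order_trans[OF D1[OF cont(2)[OF temperate_dirac_solution[OF \<alpha> u]] cont(2)[OF u] conjunct1[OF C]] le]
   unfolding amalgam_norm_def by simp
 qed
 with pos show "\<exists>C>0. \<forall>u\<in>temperate. amalgam_norm g p q r s (dirac_solution \<alpha> m u t) \<le> ennreal C * amalgam_norm g p q r s u" by blast
qed

text \<open>For \<open>r = 0\<close> the inner norm is unweighted and the interpolated bound at
  fixed frequency applies; the integral in \<open>\<eta>\<close> that it leaves is a convolution
  with a rapidly decaying kernel, absorbed by the outer weighted norm without further growth in
  \<open>t\<close>.\<close>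

lemma dirac_modulation_growth:
 fixes g :: "'d::finite cfun" and \<alpha> :: "'d option \<Rightarrow> complex ^ 'n ^ 'n::finite"
 assumes \<alpha>: "dirac_matrices \<alpha>" and g: "g \<in> schwartz" "g \<noteq> (\<lambda>x. 0)" and p: "1 \<le> p" "1 \<le> q"
 shows "\<exists>C>0. \<forall>t. \<forall>u\<in>temperate. modulation_norm g p q 0 s (dirac_solution \<alpha> m u t) \<le>
  ennreal (C * (1 + \<bar>t\<bar>) powr (real CARD('d) * \<bar>1 / 2 - enn2real (1 / p)\<bar>)) * modulation_norm g p q 0 s u"
proof -
 let ?S = "\<lambda>t. (1 + \<bar>t\<bar>) powr (real CARD('d) * \<bar>1 / 2 - enn2real (1 / p)\<bar>)"
 define K where "K = nat \<lceil>2 * real DIM(real ^ 'd) + \<bar>s\<bar>\<rceil>"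
 have K: "2 * real DIM(real ^ 'd) + \<bar>s\<bar> \<le> real K" unfolding K_def by linarith
 from lp_norm_outer_bound[OF K] obtain D where D: "0 \<le> D \<and> (\<forall>q M N C. 1 \<le> q \<longrightarrow> M \<in> \<B> \<longrightarrow> (N :: real ^ 'd \<Rightarrow> ennreal) \<in> \<B> \<longrightarrow> 0 \<le> C \<longrightarrow>
  (\<forall>\<xi>. M \<xi> \<le> ennreal C * (\<integral>\<^sub>+\<eta>. decay_weight K \<eta> * N (\<xi> + \<eta>))) \<longrightarrow>
  lp_norm q (\<lambda>\<xi>. M \<xi> * ennreal (japanese_bracket \<xi> powr s)) \<le> ennreal (D * C) * lp_norm q (\<lambda>\<xi>. N \<xi> * ennreal (japanese_bracket \<xi> powr s)))" ..
 from dirac_lp_norm_bound[OF \<alpha> g p(1), of m K] obtain C where C: "0 \<le> C \<and> (\<forall>t. \<forall>u\<in>temperate. \<forall>\<xi>. lp_norm p (\<lambda>x. ennreal (norm (stft g (dirac_solution \<alpha> m u t) x \<xi>))) \<le>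
  ennreal (C * ?S t) * (\<integral>\<^sub>+\<eta>. decay_weight K \<eta> * lp_norm p (\<lambda>x. ennreal (norm (stft g u x (\<xi> + \<eta>))))))" ..
 have meas: "(\<lambda>\<xi>. lp_norm p (\<lambda>x. ennreal (norm (stft g u x \<xi>)))) \<in> \<B>" if "u \<in> temperate" for u :: "('d, 'n) vdist"
  using lp_norm_measurable_parameter[OF continuous_on_stft[OF that g(1)], of p] by simp
 have nrm: "modulation_norm g p q 0 s u = lp_norm q (\<lambda>\<xi>. lp_norm p (\<lambda>x. ennreal (norm (stft g u x \<xi>))) * ennreal (japanese_bracket \<xi> powr s))" for u :: "('d, 'n) vdist"
 proof -
  have "japanese_bracket x powr 0 = 1" for x :: "real ^ 'd" using japanese_bracket_ge_1[of x] by simp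
  then show ?thesis unfolding modulation_norm_def by simp
 qed
 have "modulation_norm g p q 0 s (dirac_solution \<alpha> m u t) \<le> ennreal ((D * C + 1) * ?S t) * modulation_norm g p q 0 s u" if u: "u \<in> temperate" for u t
 proof -
  have "0 \<le> C * ?S t" using C by simp
  from conjunct2[OF D, rule_format, OF p(2) meas[OF temperate_dirac_solution[OF \<alpha> u]] meas[OF u] this] conjunct2[OF C] u
  have "modulation_norm g p q 0 s (dirac_solution \<alpha> m u t) \<le> ennreal (D * (C * ?S t)) * modulation_norm g p q 0 s u"
   unfolding nrm by blast
  also have "\<dots> \<le> ennreal ((D * C + 1) * ?S t) * modulation_norm g p q 0 s u"
   by (intro mult_right_mono ennreal_leI) (simp_all add: distrib_right mult.assoc)
  finally show ?thesis .
 qed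
 moreover have "0 < D * C + 1" using D C by (simp add: add_nonneg_pos)
 ultimately show ?thesis by blast
qed

theorem theorem1p1:
  fixes \<alpha> :: "'d::finite option \<Rightarrow> complex ^ 'n ^ 'n::finite"
    and m :: real and p q :: ennreal and r s :: real
    and g :: "real ^ 'd \<Rightarrow> complex"
  assumes "0 \<le> m"
    and "dirac_matrices \<alpha>"
    and "1 \<le> p" and "1 \<le> q"
    and "g \<in> schwartz" and "g \<noteq> (\<lambda>x. 0)"
  shows "(\<forall>t. \<exists>C>0. \<forall>\<psi>0 \<in> modulation_space g p q r s.
            dirac_solution \<alpha> m \<psi>0 t \<in> modulation_space g p q r s \<and>
            modulation_norm g p q r s (dirac_solution \<alpha> m \<psi>0 t)
              \<le> ennreal C * modulation_norm g p q r s \<psi>0)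
       \<and> (\<forall>t. \<exists>C>0. \<forall>\<psi>0 \<in> amalgam_space g p q r s.
            dirac_solution \<alpha> m \<psi>0 t \<in> amalgam_space g p q r s \<and>
            amalgam_norm g p q r s (dirac_solution \<alpha> m \<psi>0 t)
              \<le> ennreal C * amalgam_norm g p q r s \<psi>0)
       \<and> (\<exists>C'>0. \<exists>C :: real \<Rightarrow> real.
            (\<forall>t. 0 < C t
               \<and> C t \<le> C' * (1 + \<bar>t\<bar>) powr (real CARD('d) * \<bar>1 / 2 - enn2real (1 / p)\<bar>))
            \<and> (\<forall>t. \<forall>\<psi>0 \<in> modulation_space g p q 0 s.
                 dirac_solution \<alpha> m \<psi>0 t \<in> modulation_space g p q 0 s \<and>
                 modulation_norm g p q 0 s (dirac_solution \<alpha> m \<psi>0 t)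
                   \<le> ennreal (C t) * modulation_norm g p q 0 s \<psi>0))"
proof (intro conjI allI)
  note \<alpha> = assms(2) and bounds = assms(2,5,6,3,4)
  \<comment> \<open>Turns a norm bound into membership: a real multiple of a finite norm is
    finite.\<close>
  have fin: "a < \<infinity>" if "a \<le> ennreal C * b" "b < \<infinity>" for a b C
    by (rule le_less_trans[OF that(1)]) (simp add: ennreal_mult_less_top that(2)[simplified])
  fix t
  from dirac_modulation_bound(1)[OF bounds, of r s m t] obtain C where "0 < C \<and> (\<forall>u\<in>temperate. modulation_norm g p q r s (dirac_solution \<alpha> m u t) \<le> ennreal C * modulation_norm g p q r s u)" ..
  then show "\<exists>C>0. \<forall>\<psi>0 \<in> modulation_space g p q r s. dirac_solution \<alpha> m \<psi>0 t \<in> modulation_space g p q r s \<and>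
      modulation_norm g p q r s (dirac_solution \<alpha> m \<psi>0 t) \<le> ennreal C * modulation_norm g p q r s \<psi>0"
    using temperate_dirac_solution[OF \<alpha>] fin unfolding modulation_space_def by (intro exI[of _ C]) blast
  from dirac_modulation_bound(2)[OF bounds, of r s m t] obtain C where "0 < C \<and> (\<forall>u\<in>temperate. amalgam_norm g p q r s (dirac_solution \<alpha> m u t) \<le> ennreal C * amalgam_norm g p q r s u)" ..
  then show "\<exists>C>0. \<forall>\<psi>0 \<in> amalgam_space g p q r s. dirac_solution \<alpha> m \<psi>0 t \<in> amalgam_space g p q r s \<and>
      amalgam_norm g p q r s (dirac_solution \<alpha> m \<psi>0 t) \<le> ennreal C * amalgam_norm g p q r s \<psi>0"
    using temperate_dirac_solution[OF \<alpha>] fin unfolding amalgam_space_def by (intro exI[of _ C]) blast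
next
  note \<alpha> = assms(2) and bounds = assms(2,5,6,3,4)
  let ?S = "\<lambda>t. (1 + \<bar>t\<bar>) powr (real CARD('d) * \<bar>1 / 2 - enn2real (1 / p)\<bar>)"
  have fin: "a < \<infinity>" if "a \<le> ennreal C * b" "b < \<infinity>" for a b C
    by (rule le_less_trans[OF that(1)]) (simp add: ennreal_mult_less_top that(2)[simplified])
  from dirac_modulation_growth[OF bounds, of s m] obtain C where C: "0 < C \<and> (\<forall>t. \<forall>u\<in>temperate. modulation_norm g p q 0 s (dirac_solution \<alpha> m u t) \<le> ennreal (C * ?S t) * modulation_norm g p q 0 s u)" ..
  show "\<exists>C'>0. \<exists>C :: real \<Rightarrow> real. (\<forall>t. 0 < C t \<and> C t \<le> C' * ?S t) \<and> (\<forall>t. \<forall>\<psi>0 \<in> modulation_space g p q 0 s.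
      dirac_solution \<alpha> m \<psi>0 t \<in> modulation_space g p q 0 s \<and>
      modulation_norm g p q 0 s (dirac_solution \<alpha> m \<psi>0 t) \<le> ennreal (C t) * modulation_norm g p q 0 s \<psi>0)"
  \<comment> \<open>The constant at time \<open>t\<close> is the upper bound itself, so the required
    inequality between them is an equality.\<close>
  proof (intro exI[of _ C] exI[of _ "\<lambda>t. C * ?S t"] conjI allI ballI)
    show "0 < C" using C by blast
    show "0 < C * ?S t" for t
    proof -
      have "0 < 1 + \<bar>t\<bar>" by simp
      with C show ?thesis by simp
    qed
    fix t and \<psi>0 :: "('d, 'n) vdist" assume "\<psi>0 \<in> modulation_space g p q 0 s"
    then have u: "\<psi>0 \<in> temperate" "modulation_norm g p q 0 s \<psi>0 < \<infinity>" by (simp_all add: modulation_space_def)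
    show le: "modulation_norm g p q 0 s (dirac_solution \<alpha> m \<psi>0 t) \<le> ennreal (C * ?S t) * modulation_norm g p q 0 s \<psi>0"
      using conjunct2[OF C] u(1) by blast
    show "dirac_solution \<alpha> m \<psi>0 t \<in> modulation_space g p q 0 s"
      using temperate_dirac_solution[OF \<alpha> u(1)] fin[OF le u(2)] unfolding modulation_space_def by blast
  qed simp
qed

end
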